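(* Let $n\geq 3$ and let $S_n$ act on $V=W^*\oplus W\cong\mathbb{C}^{2n}$ by the doubled permutation representation. (1) The Drinfeld orbifold algebra maps $\kappa=\kappa^L+\kappa^C$ whose linear part $\kappa^L$ is supported only on the identity (that is, the Lie orbifold algebra maps) are precisely the maps with $\kappa^L=\kappa^L_1$ and $\kappa^C=\kappa^C_1+\kappa^C_{\mathrm{ref}}$, where the $17$ complex parameters $a_1,\dots,a_7,b_1,\dots,b_7,\alpha,\beta,c$ satisfy the $22$ homogeneous quadratic equations $\gamma_1=\cdots=\gamma_{22}=0$ listed in the context. The corresponding quotient algebras $\mathcal{H}_\kappa$ are Lie orbifold algebras. (2) The Drinfeld orbifold algebra maps $\kappa=\kappa^L+\kappa^C$ whose linear part $\kappa^L$ is supported only off the identity are precisely the maps with $\kappa^L=\kappa^L_{\mathrm{ref}}$ and $\kappa^C=\kappa^C_1+\kappa^C_{\mathrm{ref}}+\kappa^C_{\mathrm{3\text{-}cyc}}$, where the seven complex parameters $a,a^\perp,b,b^\perp,\alpha,\beta,c$ satisfy the four homogeneous quadratic equations $$\alpha a+\beta\big(a+(n-2)a^\perp\big)=0,\qquad \alpha a^\perp+\beta\big(2a+(n-3)a^\perp\big)=0,$$ $$\alpha b+\beta\big(b+(n-2)b^\perp\big)=0,\qquad \alpha b^\perp+\beta\big(2b+(n-3)b^\perp\big)=0.$$ The corresponding quotient algebras $\mathcal{H}_\kappa$ are Drinfeld orbifold algebras. In particular, these families give the only degree-one deformations $\mathcal{H}_\kappa$ of $S(V)\#S_n$ whose parameter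 maps (Drinfeld orbifold algebra maps with $\kappa^L\neq 0$) have linear part supported only on or only off the identity.
   Context: General definitions. Let $G$ be a finite group acting linearly on a finite-dimensional complex vector space $V$; write ${}^{g}v$ for the action and $V^g$ for the fixed space of $g$. For a $\mathbb{C}$-algebra $R$ with $G$-action by automorphisms, $R\#G$ is $R\otimes\mathbb{C}G$ with product $(r\otimes g)(s\otimes h)=r({}^{g}s)\otimes gh$. A 2-cochain is $\kappa=\sum_{g\in G}\kappa_g g$ with linear components $\kappa_g:\bigwedge^2V\to S(V)$ (written as skew-symmetric bilinear maps $\kappa_g(u,v)$; $\kappa(u,v)=\sum_g\kappa_g(u,v)\otimes g$); it is linear if every $\kappa_g$ maps into $V$, and constant if every $\kappa_g$ maps into $\mathbb{C}$. It is supported only on (resp. only off) $X\subseteq G$ if $\kappa_g=0$ for all $g\notin X$ (resp. $g\in X$). It is $G$-invariant if ${}^{h}(\kappa_g(u,v))=\kappa_{hgh^{-1}}({}^{h}u,{}^{h}v)$ for all $g,h,u,v$. For a linear 2-cochain $\kappa^L$ and a constant 2-cochain $\kappa^C$, the map $\kappa=\kappa^L+\kappa^C$ is a Drinfeld orbifold algebra map if for all $g\in G$, $v_1,v_2,v_3\in V$ (with $\mathrm{Alt}_3$ the alternating group on three letters): (0) $\mathrm{im}\,\kappa^L_g\subseteq V^g$; (i) $\kappa^L$ and $\kappa^C$ are $G$-invariant; (ii) $\sum_{\sigma\in\mathrm{Alt}_3}\kappa^L_g(v_{\sigma(2)},v_{\sigma(3)})({}^{g}v_{\sigma(1)}-v_{\sigma(1)})=0$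 in $S(V)$; (iii) $\sum_{\sigma\in\mathrm{Alt}_3}\sum_{xy=g}\kappa^L_x\big(v_{\sigma(1)}+{}^{y}v_{\sigma(1)},\kappa^L_y(v_{\sigma(2)},v_{\sigma(3)})\big)=2\sum_{\sigma\in\mathrm{Alt}_3}\kappa^C_g(v_{\sigma(2)},v_{\sigma(3)})({}^{g}v_{\sigma(1)}-v_{\sigma(1)})$; (iv) $\sum_{\sigma\in\mathrm{Alt}_3}\sum_{xy=g}\kappa^C_x\big(v_{\sigma(1)}+{}^{y}v_{\sigma(1)},\kappa^L_y(v_{\sigma(2)},v_{\sigma(3)})\big)=0$. It is a Lie orbifold algebra map if moreover $\kappa^L$ is supported only on the identity. $\mathcal{H}_\kappa=T(V)\#G/\langle vw-wv-\kappa^L(v,w)-\kappa^C(v,w)\mid v,w\in V\rangle$ is a Drinfeld orbifold algebra if its associated graded algebra (elements of $V$ in degree one, of $G$ in degree zero) is isomorphic to $S(V)\#G$; it is a Lie orbifold algebra if moreover $\kappa$ is a Lie orbifold algebra map. The representation. $W\cong\mathbb{C}^n$ has basis $y_1,\dots,y_n$, $W^*$ has dual basis $x_1,\dots,x_n$, and ${}^{\sigma}y_i=y_{\sigma(i)}$, ${}^{\sigma}x_i=x_{\sigma(i)}$. For $v=x$ or $y$ let $v_{[n]}=\sum_i v_i$, $v_{r,s}=v_r+v_s$, $v_{r,s}^\perp=v_{[n]}-v_{r,s}$. The maps (skew-symmetric bilinear; $1\le i\ne j\le n$ unless stated). $\kappa^L_1$ (supported on the identity): $\kappa^L_1(x_i,x_j)=a_1(x_i-x_j)+b_1(y_i-y_j)$;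 $\kappa^L_1(y_i,y_j)=a_2(x_i-x_j)+b_2(y_i-y_j)$; $\kappa^L_1(x_i,y_i)=a_3x_i+a_4x_{[n]}+b_3y_i+b_4y_{[n]}$; $\kappa^L_1(x_i,y_j)=a_5x_i+a_6x_j+a_7x_{[n]}+b_5y_i+b_6y_j+b_7y_{[n]}$. $\kappa^C_1$ (supported on the identity): $\kappa^C_1(x_i,x_j)=\kappa^C_1(y_i,y_j)=0$, $\kappa^C_1(x_i,y_i)=\alpha$, $\kappa^C_1(x_i,y_j)=\beta$. $\kappa^L_{\mathrm{ref}}$, $\kappa^C_{\mathrm{ref}}$ (supported on transpositions $g=(rs)$): for all $i,j$, $\kappa^*_g(x_i,x_j)=\kappa^*_g(y_i,y_j)=0$ for $*=L,C$. Put $u_g=ax_{r,s}+a^\perp x_{r,s}^\perp+by_{r,s}+b^\perp y_{r,s}^\perp$. Then $\kappa^L_g(x_i,y_j)$ is $u_g$ if $i=j\in\{r,s\}$, is $-u_g$ if $\{i,j\}=\{r,s\}$, and is $0$ otherwise; $\kappa^C_g(x_i,y_j)$ is respectively $c$, $-c$, $0$ in these cases. $\kappa^C_{\mathrm{3\text{-}cyc}}$ (supported on 3-cycles): for $g=(i\,j\,k)$, $\kappa^C_g$ is zero on a pair of basis vectors unless their indices are two distinct elements of $\{i,j,k\}$, and $\kappa^C_g(x_i,x_j)=\kappa^C_g(x_j,x_k)=\kappa^C_g(x_k,x_i)=(b^\perp-b)^2$; $\kappa^C_g(y_i,y_j)=\kappa^C_g(y_j,y_k)=\kappa^C_g(y_k,y_i)=(a^\perp-a)^2$;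 $\kappa^C_g(x_i,y_j)=\kappa^C_g(y_j,x_k)=\kappa^C_g(x_k,y_i)=\kappa^C_g(y_i,x_j)=\kappa^C_g(x_j,y_k)=\kappa^C_g(y_k,x_i)=-(a^\perp-a)(b^\perp-b)$. The 22 polynomials. $\gamma_1=a_1(a_5+a_6+na_7)-b_1a_2-b_5a_6+a_5(b_5+b_6+nb_7)+b_7(a_3-a_5-a_6)$; $\gamma_2=b_1(a_5+a_6+na_7)-b_1b_2+b_1a_5+b_5(b_5-a_1+nb_7)+b_7(b_3-b_5-b_6)$; $\gamma_3=c(b_6-a_1)$; $\gamma_4=-a_2(b_6+b_5+nb_7)-a_2a_1-a_2b_6+a_6(a_6+b_2+na_7)+a_7(a_3-a_6-a_5)$; $\gamma_5=-b_2(b_6+b_5+nb_7)-a_2b_1-a_6b_5+b_6(a_6+a_5+na_7)+a_7(b_3-b_6-b_5)$; $\gamma_6=c(b_2+a_5)$; $\gamma_7=\alpha(a_1-b_6+b_4-b_7)-\beta(a_1-b_3+b_5-(n-1)(b_4-b_7))$; $\gamma_8=a_7(b_3-b_5)-a_4b_6+(b_4-b_7)(a_4+(n-1)a_7+a_6)$; $\gamma_9=a_1(a_3+na_4)+a_5(b_3+nb_4)+b_4(a_3-a_5-a_6)-a_2b_1-b_5a_6$; $\gamma_{10}=-a_1(a_5+a_6+na_7)-a_5(b_5+nb_7)-b_7(a_3-a_5-a_6)+a_2b_1+b_3a_6-a_3b_6$; $\gamma_{11}=b_7(b_3-b_5)-b_4b_6+(b_4-b_7)(a_1+b_4+(n-1)b_7+b_6)-b_1(a_4-a_7)$;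 $\gamma_{12}=b_1(a_5-b_2+a_3+na_4)-b_5(a_1+b_6-b_3-nb_4)+b_4(b_3-b_5-b_6)$; $\gamma_{13}=b_1(-b_2+a_5+a_3+na_7)+b_5(b_5+nb_7)+b_7(b_3-b_5-b_6)-a_1(b_3-b_6)$; $\gamma_{14}=c(2a_1-b_3+b_5-b_6)$; $\gamma_{15}=\alpha(-b_2-a_5+a_4-a_7)+\beta(b_2+a_3-a_6+(n-1)(a_4-a_7))$; $\gamma_{16}=a_7(a_3-a_6)-a_4a_5+(a_4-a_7)(-b_2+a_4+(n-1)a_7+a_5)+a_2(b_4-b_7)$; $\gamma_{17}=-a_2(a_1+b_6+b_3+nb_4)+a_6(b_2-a_5+a_3+na_4)+a_4(a_3-a_5-a_6)$; $\gamma_{18}=a_2(a_1+b_6+b_3+nb_7)-a_6(a_6+na_7)-a_7(a_3-a_5-a_6)-b_2(a_3-a_5)$; $\gamma_{19}=b_7(a_3-a_6)-b_4a_5+(a_4-a_7)(b_4+(n-1)b_7+b_5)$; $\gamma_{20}=-b_2(b_3+nb_4)+b_6(a_3+na_4)+a_4(b_3-b_5-b_6)-a_2b_1-a_6b_5$; $\gamma_{21}=b_2(b_5+b_6+nb_7)-b_6(a_6+na_7)-a_7(b_3-b_5-b_6)+a_2b_1+a_3b_5-b_3a_5$; $\gamma_{22}=c(2b_2+a_3+a_5-a_6)$. *)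

theory Defs
  imports
    "HOL-Analysis.Cartesian_Space"
    "HOL-Library.Poly_Mapping"
    "HOL-Algebra.Bij"
    "HOL-Algebra.QuotRing"
    "HOL-Algebra.Module"
    "HOL-Algebra.Sym_Groups"
begin

section \<open>Tensor and symmetric algebras of a coordinate space\<close>

text \<open>
  A finite-dimensional complex vector space is rendered as \<open>complex ^ 'b\<close> with \<open>'b\<close> finite.
  Its tensor algebra is the free algebra on the coordinate basis, i.e. the monoid algebra of the
  free monoid of words in \<open>'b\<close>; its symmetric algebra is the polynomial ring in the variables
  \<open>'b\<close>. In both cases the product is the convolution product of \<^theory>\<open>HOL-Library.Poly_Mapping\<close>.
\<close>

datatype 'a free_mon = Word (letters: "'a list")

instantiation free_mon :: (type) monoid_add
begin

definition zero_free_mon :: "'a free_mon" where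
  "0 = Word []"

definition plus_free_mon :: "'a free_mon \<Rightarrow> 'a free_mon \<Rightarrow> 'a free_mon" where
  "u + w = Word (letters u @ letters w)"

instance
  by standard (simp_all add: zero_free_mon_def plus_free_mon_def)

end

type_synonym 'b tensor_alg = "'b free_mon \<Rightarrow>\<^sub>0 complex"
type_synonym 'b sym_alg = "('b \<Rightarrow>\<^sub>0 nat) \<Rightarrow>\<^sub>0 complex"

definition const_pm :: "complex \<Rightarrow> ('m::monoid_add \<Rightarrow>\<^sub>0 complex)" where
  "const_pm c = Poly_Mapping.single 0 c"

definition scale_pm :: "complex \<Rightarrow> ('m::monoid_add \<Rightarrow>\<^sub>0 complex) \<Rightarrow> ('m \<Rightarrow>\<^sub>0 complex)" where
  "scale_pm c p = const_pm c * p"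

definition tens_emb :: "complex ^ 'b::finite \<Rightarrow> 'b tensor_alg" where
  "tens_emb v = (\<Sum>b\<in>UNIV. Poly_Mapping.single (Word [b]) (v $ b))"

definition sym_emb :: "complex ^ 'b::finite \<Rightarrow> 'b sym_alg" where
  "sym_emb v = (\<Sum>b\<in>UNIV. Poly_Mapping.single (Poly_Mapping.single b 1) (v $ b))"

text \<open>The algebra endomorphisms induced by a linear endomorphism \<open>f\<close> of \<open>V\<close>.\<close>

definition tens_map :: "(complex ^ 'b::finite \<Rightarrow> complex ^ 'b) \<Rightarrow> 'b tensor_alg \<Rightarrow> 'b tensor_alg" where
  "tens_map f t = (\<Sum>w\<in>Poly_Mapping.keys t. const_pm (Poly_Mapping.lookup t w) *
     prod_list (map (\<lambda>b. tens_emb (f (axis b 1))) (letters w)))"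

definition sym_map :: "(complex ^ 'b::finite \<Rightarrow> complex ^ 'b) \<Rightarrow> 'b sym_alg \<Rightarrow> 'b sym_alg" where
  "sym_map f p = (\<Sum>m\<in>Poly_Mapping.keys p. const_pm (Poly_Mapping.lookup p m) *
     (\<Prod>b\<in>UNIV. sym_emb (f (axis b 1)) ^ Poly_Mapping.lookup m b))"

definition word_deg :: "'b free_mon \<Rightarrow> nat" where
  "word_deg w = length (letters w)"

definition mon_deg :: "('b::finite \<Rightarrow>\<^sub>0 nat) \<Rightarrow> nat" where
  "mon_deg m = (\<Sum>b\<in>UNIV. Poly_Mapping.lookup m b)"


section \<open>Algebras: skew group algebra, quotient, associated graded algebra\<close>

text \<open>
  Complex algebras are records of type \<^typ>\<open>(complex, 'x) module\<close>, a ring together with a scalar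
  multiplication. An element \<open>f\<close> of the skew group algebra stands for the sum of all
  \<open>f g \<otimes> g\<close> with \<open>g\<close> in \<open>G\<close>, and is 0 outside the carrier of \<open>G\<close>.
\<close>

definition skew_algebra ::
  "'g monoid \<Rightarrow> (complex \<Rightarrow> 'r \<Rightarrow> 'r) \<Rightarrow> ('g \<Rightarrow> 'r \<Rightarrow> 'r) \<Rightarrow> (complex, 'g \<Rightarrow> 'r::ring_1) module" where
  "skew_algebra G sc act =
    \<lparr>carrier = {f. \<forall>g. g \<notin> carrier G \<longrightarrow> f g = 0},
     monoid.mult = (\<lambda>f h k. if k \<in> carrier G
               then \<Sum>g\<in>carrier G. f g * act g (h (inv\<^bsub>G\<^esub> g \<otimes>\<^bsub>G\<^esub> k)) else 0),
     one = (\<lambda>g. if g = \<one>\<^bsub>G\<^esub> then 1 else 0),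
     zero = (\<lambda>g. 0),
     add = (\<lambda>f h g. f g + h g),
     smult = (\<lambda>c f g. sc c (f g))\<rparr>"

definition quot_algebra :: "(complex, 'x) module \<Rightarrow> 'x set \<Rightarrow> (complex, 'x set) module" where
  "quot_algebra A I = ring.extend (A Quot I)
     (module.fields (\<lambda>c X. \<Union>x\<in>X. I +>\<^bsub>A\<^esub> (c \<odot>\<^bsub>A\<^esub> x)))"

text \<open>
  For an increasing filtration \<open>F 0 \<subseteq> F 1 \<subseteq> \<dots>\<close> of \<open>A\<close>, the degree \<open>m\<close> part of the associated
  graded algebra is \<open>F m / F (m - 1)\<close>, with \<open>F (-1) = {0}\<close>. An element is a finitely supported
  family of cosets, and \<open>filt_prev A F m\<close> is the zero coset in degree \<open>m\<close>. The product is computed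
  on arbitrary coset representatives.
\<close>

definition filt_prev :: "(complex, 'x) module \<Rightarrow> (nat \<Rightarrow> 'x set) \<Rightarrow> nat \<Rightarrow> 'x set" where
  "filt_prev A F m = (if m = 0 then {\<zero>\<^bsub>A\<^esub>} else F (m - 1))"

definition gr_algebra ::
  "(complex, 'x) module \<Rightarrow> (nat \<Rightarrow> 'x set) \<Rightarrow> (complex, nat \<Rightarrow> 'x set) module" where
  "gr_algebra A F =
    \<lparr>carrier = {f. (\<forall>m. \<exists>x\<in>F m. f m = filt_prev A F m +>\<^bsub>A\<^esub> x)
                 \<and> finite {m. f m \<noteq> filt_prev A F m}},
     monoid.mult = (\<lambda>f h m. filt_prev A F m +>\<^bsub>A\<^esub>
               (\<Oplus>\<^bsub>A\<^esub>i\<in>{..m}. (SOME x. x \<in> f i) \<otimes>\<^bsub>A\<^esub> (SOME y. y \<in> h (m - i)))),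
     one = (\<lambda>m. if m = 0 then filt_prev A F 0 +>\<^bsub>A\<^esub> \<one>\<^bsub>A\<^esub> else filt_prev A F m),
     zero = (\<lambda>m. filt_prev A F m),
     add = (\<lambda>f h m. f m <+>\<^bsub>A\<^esub> h m),
     smult = (\<lambda>c f m. \<Union>x\<in>f m. filt_prev A F m +>\<^bsub>A\<^esub> (c \<odot>\<^bsub>A\<^esub> x))\<rparr>"

definition gr_part :: "(complex, 'x) module \<Rightarrow> (nat \<Rightarrow> 'x set) \<Rightarrow> nat \<Rightarrow> (nat \<Rightarrow> 'x set) set" where
  "gr_part A F m = {f \<in> carrier (gr_algebra A F). \<forall>k. k \<noteq> m \<longrightarrow> f k = filt_prev A F k}"

definition graded_algebra_isomorphic ::
  "(complex, 'x) module \<Rightarrow> (nat \<Rightarrow> 'x set) \<Rightarrow> (complex, 'y) module \<Rightarrow> (nat \<Rightarrow> 'y set) \<Rightarrow> bool" where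
  "graded_algebra_isomorphic A D B E \<longleftrightarrow>
    (\<exists>\<phi> \<in> ring_iso A B.
       (\<forall>c. \<forall>x\<in>carrier A. \<phi> (c \<odot>\<^bsub>A\<^esub> x) = c \<odot>\<^bsub>B\<^esub> \<phi> x) \<and> (\<forall>m. \<phi> ` D m = E m))"


section \<open>Cochains and Drinfeld orbifold algebra maps\<close>

text \<open>
  A representation of \<open>G\<close> is a map \<open>\<rho> :: 'g \<Rightarrow> complex ^ 'b \<Rightarrow> complex ^ 'b\<close>. Linear cochains take
  values in \<open>V\<close> and constant cochains in the complex numbers; \<open>\<kappa> g u v\<close> is the value of the
  component \<open>\<kappa>\<^sub>g\<close>. Components outside the carrier of \<open>G\<close> are 0 by convention, so that equality of
  cochains is equality of functions.
\<close>

type_synonym ('g, 'b) lin_cochain = "'g \<Rightarrow> complex ^ 'b \<Rightarrow> complex ^ 'b \<Rightarrow> complex ^ 'b"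
type_synonym ('g, 'b) const_cochain = "'g \<Rightarrow> complex ^ 'b \<Rightarrow> complex ^ 'b \<Rightarrow> complex"

definition skew_bilinear ::
  "(complex \<Rightarrow> 'c \<Rightarrow> 'c) \<Rightarrow> (complex ^ 'b::finite \<Rightarrow> complex ^ 'b \<Rightarrow> 'c::ab_group_add) \<Rightarrow> bool" where
  "skew_bilinear sc B \<longleftrightarrow>
     (\<forall>u. Vector_Spaces.linear (*s) sc (B u)) \<and>
     (\<forall>v. Vector_Spaces.linear (*s) sc (\<lambda>u. B u v)) \<and>
     (\<forall>u v. B u v = - B v u)"

definition cochain ::
  "'g monoid \<Rightarrow> (complex \<Rightarrow> 'c \<Rightarrow> 'c) \<Rightarrow>
   ('g \<Rightarrow> complex ^ 'b::finite \<Rightarrow> complex ^ 'b \<Rightarrow> 'c::ab_group_add) \<Rightarrow> bool" where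
  "cochain G sc \<kappa> \<longleftrightarrow>
     (\<forall>g\<in>carrier G. skew_bilinear sc (\<kappa> g)) \<and> (\<forall>g. g \<notin> carrier G \<longrightarrow> \<kappa> g = (\<lambda>u v. 0))"

definition supported_only_on :: "('g \<Rightarrow> 'v \<Rightarrow> 'v \<Rightarrow> 'c::zero) \<Rightarrow> 'g set \<Rightarrow> bool" where
  "supported_only_on \<kappa> X \<longleftrightarrow> (\<forall>g. g \<notin> X \<longrightarrow> \<kappa> g = (\<lambda>u v. 0))"

definition supported_only_off :: "('g \<Rightarrow> 'v \<Rightarrow> 'v \<Rightarrow> 'c::zero) \<Rightarrow> 'g set \<Rightarrow> bool" where
  "supported_only_off \<kappa> X \<longleftrightarrow> (\<forall>g\<in>X. \<kappa> g = (\<lambda>u v. 0))"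

abbreviation Alt3 :: "(nat \<Rightarrow> nat) set" where
  "Alt3 \<equiv> carrier (alt_group 3)"

definition drinfeld_orbifold_map ::
  "'g monoid \<Rightarrow> ('g \<Rightarrow> complex ^ 'b \<Rightarrow> complex ^ 'b) \<Rightarrow>
   ('g, 'b::finite) lin_cochain \<Rightarrow> ('g, 'b) const_cochain \<Rightarrow> bool" where
  "drinfeld_orbifold_map G \<rho> \<kappa>L \<kappa>C \<longleftrightarrow>
     cochain G (*s) \<kappa>L \<and> cochain G (*) \<kappa>C \<and>
     \<comment> \<open>(0)\<close>
     (\<forall>g\<in>carrier G. \<forall>u v. \<rho> g (\<kappa>L g u v) = \<kappa>L g u v) \<and>
     \<comment> \<open>(i)\<close>
     (\<forall>g\<in>carrier G. \<forall>h\<in>carrier G. \<forall>u v.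
        \<rho> h (\<kappa>L g u v) = \<kappa>L (h \<otimes>\<^bsub>G\<^esub> g \<otimes>\<^bsub>G\<^esub> inv\<^bsub>G\<^esub> h) (\<rho> h u) (\<rho> h v) \<and>
        \<kappa>C g u v = \<kappa>C (h \<otimes>\<^bsub>G\<^esub> g \<otimes>\<^bsub>G\<^esub> inv\<^bsub>G\<^esub> h) (\<rho> h u) (\<rho> h v)) \<and>
     (\<forall>g\<in>carrier G. \<forall>v :: nat \<Rightarrow> complex ^ 'b.
        \<comment> \<open>(ii), in the symmetric algebra\<close>
        (\<Sum>\<sigma>\<in>Alt3. sym_emb (\<kappa>L g (v (\<sigma> 2)) (v (\<sigma> 3))) * sym_emb (\<rho> g (v (\<sigma> 1)) - v (\<sigma> 1))) = 0 \<and>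
        \<comment> \<open>(iii)\<close>
        (\<Sum>\<sigma>\<in>Alt3. \<Sum>(x, y)\<in>{(x, y). x \<in> carrier G \<and> y \<in> carrier G \<and> x \<otimes>\<^bsub>G\<^esub> y = g}.
           \<kappa>L x (v (\<sigma> 1) + \<rho> y (v (\<sigma> 1))) (\<kappa>L y (v (\<sigma> 2)) (v (\<sigma> 3))))
        = 2 *s (\<Sum>\<sigma>\<in>Alt3. \<kappa>C g (v (\<sigma> 2)) (v (\<sigma> 3)) *s (\<rho> g (v (\<sigma> 1)) - v (\<sigma> 1))) \<and>
        \<comment> \<open>(iv)\<close>
        (\<Sum>\<sigma>\<in>Alt3. \<Sum>(x, y)\<in>{(x, y). x \<in> carrier G \<and> y \<in> carrier G \<and> x \<otimes>\<^bsub>G\<^esub> y = g}.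
           \<kappa>C x (v (\<sigma> 1) + \<rho> y (v (\<sigma> 1))) (\<kappa>L y (v (\<sigma> 2)) (v (\<sigma> 3)))) = 0)"

definition lie_orbifold_map ::
  "'g monoid \<Rightarrow> ('g \<Rightarrow> complex ^ 'b \<Rightarrow> complex ^ 'b) \<Rightarrow>
   ('g, 'b::finite) lin_cochain \<Rightarrow> ('g, 'b) const_cochain \<Rightarrow> bool" where
  "lie_orbifold_map G \<rho> \<kappa>L \<kappa>C \<longleftrightarrow>
     drinfeld_orbifold_map G \<rho> \<kappa>L \<kappa>C \<and> supported_only_on \<kappa>L {\<one>\<^bsub>G\<^esub>}"


section \<open>The quotient algebras\<close>

definition tensor_skew ::
  "'g monoid \<Rightarrow> ('g \<Rightarrow> complex ^ 'b::finite \<Rightarrow> complex ^ 'b) \<Rightarrow>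
   (complex, 'g \<Rightarrow> 'b tensor_alg) module" where
  "tensor_skew G \<rho> = skew_algebra G scale_pm (\<lambda>g. tens_map (\<rho> g))"

definition sym_skew ::
  "'g monoid \<Rightarrow> ('g \<Rightarrow> complex ^ 'b::finite \<Rightarrow> complex ^ 'b) \<Rightarrow>
   (complex, 'g \<Rightarrow> 'b sym_alg) module" where
  "sym_skew G \<rho> = skew_algebra G scale_pm (\<lambda>g. sym_map (\<rho> g))"

text \<open>The component at \<open>g\<close> of \<open>vw - wv - \<kappa>\<^sup>L(v,w) - \<kappa>\<^sup>C(v,w)\<close>, where \<open>vw - wv\<close> sits at the identity.\<close>

definition relator ::
  "'g monoid \<Rightarrow> ('g, 'b::finite) lin_cochain \<Rightarrow> ('g, 'b) const_cochain \<Rightarrow>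
   complex ^ 'b \<Rightarrow> complex ^ 'b \<Rightarrow> 'g \<Rightarrow> 'b tensor_alg" where
  "relator G \<kappa>L \<kappa>C v w = (\<lambda>g.
     (if g = \<one>\<^bsub>G\<^esub> then tens_emb v * tens_emb w - tens_emb w * tens_emb v else 0)
     - tens_emb (\<kappa>L g v w) - const_pm (\<kappa>C g v w))"

definition H_ideal ::
  "'g monoid \<Rightarrow> ('g \<Rightarrow> complex ^ 'b \<Rightarrow> complex ^ 'b) \<Rightarrow>
   ('g, 'b::finite) lin_cochain \<Rightarrow> ('g, 'b) const_cochain \<Rightarrow> ('g \<Rightarrow> 'b tensor_alg) set" where
  "H_ideal G \<rho> \<kappa>L \<kappa>C = Idl\<^bsub>tensor_skew G \<rho>\<^esub> {relator G \<kappa>L \<kappa>C v w | v w. True}"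

definition H_algebra ::
  "'g monoid \<Rightarrow> ('g \<Rightarrow> complex ^ 'b \<Rightarrow> complex ^ 'b) \<Rightarrow>
   ('g, 'b::finite) lin_cochain \<Rightarrow> ('g, 'b) const_cochain \<Rightarrow>
   (complex, ('g \<Rightarrow> 'b tensor_alg) set) module" where
  "H_algebra G \<rho> \<kappa>L \<kappa>C = quot_algebra (tensor_skew G \<rho>) (H_ideal G \<rho> \<kappa>L \<kappa>C)"

text \<open>The filtration with \<open>V\<close> in degree one and \<open>G\<close> in degree zero.\<close>

definition H_filtration ::
  "'g monoid \<Rightarrow> ('g \<Rightarrow> complex ^ 'b \<Rightarrow> complex ^ 'b) \<Rightarrow>
   ('g, 'b::finite) lin_cochain \<Rightarrow> ('g, 'b) const_cochain \<Rightarrow>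
   nat \<Rightarrow> ('g \<Rightarrow> 'b tensor_alg) set set" where
  "H_filtration G \<rho> \<kappa>L \<kappa>C m =
     {H_ideal G \<rho> \<kappa>L \<kappa>C +>\<^bsub>tensor_skew G \<rho>\<^esub> f | f. f \<in> carrier (tensor_skew G \<rho>) \<and>
        (\<forall>g. \<forall>w\<in>Poly_Mapping.keys (f g). word_deg w \<le> m)}"

definition sym_skew_part ::
  "'g monoid \<Rightarrow> ('g \<Rightarrow> complex ^ 'b::finite \<Rightarrow> complex ^ 'b) \<Rightarrow> nat \<Rightarrow> ('g \<Rightarrow> 'b sym_alg) set" where
  "sym_skew_part G \<rho> m =
     {f \<in> carrier (sym_skew G \<rho>). \<forall>g. \<forall>p\<in>Poly_Mapping.keys (f g). mon_deg p = m}"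

definition drinfeld_orbifold_algebra ::
  "'g monoid \<Rightarrow> ('g \<Rightarrow> complex ^ 'b \<Rightarrow> complex ^ 'b) \<Rightarrow>
   ('g, 'b::finite) lin_cochain \<Rightarrow> ('g, 'b) const_cochain \<Rightarrow> bool" where
  "drinfeld_orbifold_algebra G \<rho> \<kappa>L \<kappa>C \<longleftrightarrow>
     graded_algebra_isomorphic
       (gr_algebra (H_algebra G \<rho> \<kappa>L \<kappa>C) (H_filtration G \<rho> \<kappa>L \<kappa>C))
       (gr_part (H_algebra G \<rho> \<kappa>L \<kappa>C) (H_filtration G \<rho> \<kappa>L \<kappa>C))
       (sym_skew G \<rho>) (sym_skew_part G \<rho>)"

definition lie_orbifold_algebra ::
  "'g monoid \<Rightarrow> ('g \<Rightarrow> complex ^ 'b \<Rightarrow> complex ^ 'b) \<Rightarrow>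
   ('g, 'b::finite) lin_cochain \<Rightarrow> ('g, 'b) const_cochain \<Rightarrow> bool" where
  "lie_orbifold_algebra G \<rho> \<kappa>L \<kappa>C \<longleftrightarrow>
     drinfeld_orbifold_algebra G \<rho> \<kappa>L \<kappa>C \<and> lie_orbifold_map G \<rho> \<kappa>L \<kappa>C"

text \<open>The parameter map is a Drinfeld orbifold algebra map with nonzero linear part.\<close>

definition degree_one_deformation ::
  "'g monoid \<Rightarrow> ('g \<Rightarrow> complex ^ 'b \<Rightarrow> complex ^ 'b) \<Rightarrow>
   ('g, 'b::finite) lin_cochain \<Rightarrow> ('g, 'b) const_cochain \<Rightarrow> bool" where
  "degree_one_deformation G \<rho> \<kappa>L \<kappa>C \<longleftrightarrow>
     drinfeld_orbifold_map G \<rho> \<kappa>L \<kappa>C \<and> \<kappa>L \<noteq> (\<lambda>g u v. 0) \<and>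
     drinfeld_orbifold_algebra G \<rho> \<kappa>L \<kappa>C"


section \<open>The doubled permutation representation\<close>

text \<open>
  The index set \<open>{1,\<dots>,n}\<close> is a finite type \<open>'n\<close> with \<open>n = CARD('n)\<close>. In
  \<open>V = W\<^sup>* \<oplus> W = complex ^ ('n + 'n)\<close> the left summand carries the basis \<open>x\<^sub>i\<close> of \<open>W\<^sup>*\<close> and the
  right one the basis \<open>y\<^sub>i\<close> of \<open>W\<close>.
\<close>

abbreviation Sn :: "('n \<Rightarrow> 'n) monoid" where
  "Sn \<equiv> BijGroup UNIV"

definition xv :: "'n::finite \<Rightarrow> complex ^ ('n + 'n)" where
  "xv i = axis (Inl i) 1"

definition yv :: "'n::finite \<Rightarrow> complex ^ ('n + 'n)" where
  "yv i = axis (Inr i) 1"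

definition doubled_perm ::
  "('n::finite \<Rightarrow> 'n) \<Rightarrow> complex ^ ('n + 'n) \<Rightarrow> complex ^ ('n + 'n)" where
  "doubled_perm \<sigma> v = (\<Sum>i\<in>UNIV. v $ Inl i *s xv (\<sigma> i)) + (\<Sum>i\<in>UNIV. v $ Inr i *s yv (\<sigma> i))"

definition xsum :: "'n::finite set \<Rightarrow> complex ^ ('n + 'n)" where
  "xsum A = (\<Sum>i\<in>A. xv i)"

definition ysum :: "'n::finite set \<Rightarrow> complex ^ ('n + 'n)" where
  "ysum A = (\<Sum>i\<in>A. yv i)"

text \<open>
  The skew-symmetric bilinear map with \<open>(x\<^sub>i, x\<^sub>j) \<mapsto> xx i j\<close>, \<open>(x\<^sub>i, y\<^sub>j) \<mapsto> xy i j\<close> and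
  \<open>(y\<^sub>i, y\<^sub>j) \<mapsto> yy i j\<close>, where \<open>xx\<close> and \<open>yy\<close> are skew-symmetric.
\<close>

definition skew_ext ::
  "(complex \<Rightarrow> 'c \<Rightarrow> 'c) \<Rightarrow> ('n::finite \<Rightarrow> 'n \<Rightarrow> 'c) \<Rightarrow> ('n \<Rightarrow> 'n \<Rightarrow> 'c) \<Rightarrow> ('n \<Rightarrow> 'n \<Rightarrow> 'c) \<Rightarrow>
   complex ^ ('n + 'n) \<Rightarrow> complex ^ ('n + 'n) \<Rightarrow> 'c::ab_group_add" where
  "skew_ext sc xx xy yy u v = (\<Sum>i\<in>UNIV. \<Sum>j\<in>UNIV.
      sc (u $ Inl i * v $ Inl j) (xx i j)
    + sc (u $ Inl i * v $ Inr j - u $ Inr j * v $ Inl i) (xy i j)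
    + sc (u $ Inr i * v $ Inr j) (yy i j))"


section \<open>The families of maps\<close>

definition kappaL1 ::
  "(nat \<Rightarrow> complex) \<Rightarrow> (nat \<Rightarrow> complex) \<Rightarrow> ('n::finite \<Rightarrow> 'n, 'n + 'n) lin_cochain" where
  "kappaL1 a b g = (if g = id then skew_ext (*s)
      (\<lambda>i j. a 1 *s (xv i - xv j) + b 1 *s (yv i - yv j))
      (\<lambda>i j. if i = j
         then a 3 *s xv i + a 4 *s xsum UNIV + b 3 *s yv i + b 4 *s ysum UNIV
         else a 5 *s xv i + a 6 *s xv j + a 7 *s xsum UNIV
            + b 5 *s yv i + b 6 *s yv j + b 7 *s ysum UNIV)
      (\<lambda>i j. a 2 *s (xv i - xv j) + b 2 *s (yv i - yv j))
    else (\<lambda>u v. 0))"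

definition kappaC1 :: "complex \<Rightarrow> complex \<Rightarrow> ('n::finite \<Rightarrow> 'n, 'n + 'n) const_cochain" where
  "kappaC1 \<alpha> \<beta> g = (if g = id
    then skew_ext (*) (\<lambda>i j. 0) (\<lambda>i j. if i = j then \<alpha> else \<beta>) (\<lambda>i j. 0)
    else (\<lambda>u v. 0))"

definition is_transposition :: "('n \<Rightarrow> 'n) \<Rightarrow> bool" where
  "is_transposition g \<longleftrightarrow> (\<exists>r s. r \<noteq> s \<and> g = Transposition.transpose r s)"

definition is_3cycle :: "('n \<Rightarrow> 'n) \<Rightarrow> bool" where
  "is_3cycle g \<longleftrightarrow> (\<exists>i j k. distinct [i, j, k] \<and> g = cycle_of_list [i, j, k])"

text \<open>For a transposition \<open>g = (r s)\<close> this is the set \<open>{r, s}\<close>.\<close>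

definition moved :: "('n \<Rightarrow> 'n) \<Rightarrow> 'n set" where
  "moved g = {i. g i \<noteq> i}"

definition u_ref ::
  "complex \<Rightarrow> complex \<Rightarrow> complex \<Rightarrow> complex \<Rightarrow> ('n::finite \<Rightarrow> 'n) \<Rightarrow> complex ^ ('n + 'n)" where
  "u_ref a a' b b' g =
     a *s xsum (moved g) + a' *s (xsum UNIV - xsum (moved g))
   + b *s ysum (moved g) + b' *s (ysum UNIV - ysum (moved g))"

definition kappaLref ::
  "complex \<Rightarrow> complex \<Rightarrow> complex \<Rightarrow> complex \<Rightarrow> ('n::finite \<Rightarrow> 'n, 'n + 'n) lin_cochain" where
  "kappaLref a a' b b' g = (if is_transposition g then skew_ext (*s)
      (\<lambda>i j. 0)
      (\<lambda>i j. if i = j \<and> i \<in> moved g then u_ref a a' b b' g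
             else if {i, j} = moved g then - u_ref a a' b b' g else 0)
      (\<lambda>i j. 0)
    else (\<lambda>u v. 0))"

definition kappaCref :: "complex \<Rightarrow> ('n::finite \<Rightarrow> 'n, 'n + 'n) const_cochain" where
  "kappaCref c g = (if is_transposition g then skew_ext (*)
      (\<lambda>i j. 0)
      (\<lambda>i j. if i = j \<and> i \<in> moved g then c else if {i, j} = moved g then - c else 0)
      (\<lambda>i j. 0)
    else (\<lambda>u v. 0))"

text \<open>
  For a 3-cycle \<open>g = (i j k)\<close>, \<open>cyc_sign g\<close> is 1 on \<open>(i,j)\<close>, \<open>(j,k)\<close>, \<open>(k,i)\<close>, is -1 on the
  reversed pairs, and 0 otherwise. By skew-symmetry, prescribing the same value for \<open>(x\<^sub>i, y\<^sub>j)\<close> and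
  \<open>(y\<^sub>i, x\<^sub>j)\<close> means prescribing the opposite value for \<open>(x\<^sub>j, y\<^sub>i)\<close>.
\<close>

definition cyc_sign :: "('n \<Rightarrow> 'n) \<Rightarrow> 'n \<Rightarrow> 'n \<Rightarrow> complex" where
  "cyc_sign g i j = (if i = j then 0 else if g i = j then 1 else if g j = i then - 1 else 0)"

definition kappaC3cyc ::
  "complex \<Rightarrow> complex \<Rightarrow> complex \<Rightarrow> complex \<Rightarrow> ('n::finite \<Rightarrow> 'n, 'n + 'n) const_cochain" where
  "kappaC3cyc a a' b b' g = (if is_3cycle g then skew_ext (*)
      (\<lambda>i j. cyc_sign g i j * (b' - b)\<^sup>2)
      (\<lambda>i j. cyc_sign g i j * (- (a' - a) * (b' - b)))
      (\<lambda>i j. cyc_sign g i j * (a' - a)\<^sup>2)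
    else (\<lambda>u v. 0))"

definition gammas ::
  "complex \<Rightarrow> (nat \<Rightarrow> complex) \<Rightarrow> (nat \<Rightarrow> complex) \<Rightarrow> complex \<Rightarrow> complex \<Rightarrow> complex \<Rightarrow> complex list" where
  "gammas n a b \<alpha> \<beta> c = [
     a 1 * (a 5 + a 6 + n * a 7) - b 1 * a 2 - b 5 * a 6 + a 5 * (b 5 + b 6 + n * b 7) + b 7 * (a 3 - a 5 - a 6),
     b 1 * (a 5 + a 6 + n * a 7) - b 1 * b 2 + b 1 * a 5 + b 5 * (b 5 - a 1 + n * b 7) + b 7 * (b 3 - b 5 - b 6),
     c * (b 6 - a 1),
     - a 2 * (b 6 + b 5 + n * b 7) - a 2 * a 1 - a 2 * b 6 + a 6 * (a 6 + b 2 + n * a 7) + a 7 * (a 3 - a 6 - a 5),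
     - b 2 * (b 6 + b 5 + n * b 7) - a 2 * b 1 - a 6 * b 5 + b 6 * (a 6 + a 5 + n * a 7) + a 7 * (b 3 - b 6 - b 5),
     c * (b 2 + a 5),
     \<alpha> * (a 1 - b 6 + b 4 - b 7) - \<beta> * (a 1 - b 3 + b 5 - (n - 1) * (b 4 - b 7)),
     a 7 * (b 3 - b 5) - a 4 * b 6 + (b 4 - b 7) * (a 4 + (n - 1) * a 7 + a 6),
     a 1 * (a 3 + n * a 4) + a 5 * (b 3 + n * b 4) + b 4 * (a 3 - a 5 - a 6) - a 2 * b 1 - b 5 * a 6,
     - a 1 * (a 5 + a 6 + n * a 7) - a 5 * (b 5 + n * b 7) - b 7 * (a 3 - a 5 - a 6) + a 2 * b 1 + b 3 * a 6 - a 3 * b 6,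
     b 7 * (b 3 - b 5) - b 4 * b 6 + (b 4 - b 7) * (a 1 + b 4 + (n - 1) * b 7 + b 6) - b 1 * (a 4 - a 7),
     b 1 * (a 5 - b 2 + a 3 + n * a 4) - b 5 * (a 1 + b 6 - b 3 - n * b 4) + b 4 * (b 3 - b 5 - b 6),
     b 1 * (- b 2 + a 5 + a 3 + n * a 7) + b 5 * (b 5 + n * b 7) + b 7 * (b 3 - b 5 - b 6) - a 1 * (b 3 - b 6),
     c * (2 * a 1 - b 3 + b 5 - b 6),
     \<alpha> * (- b 2 - a 5 + a 4 - a 7) + \<beta> * (b 2 + a 3 - a 6 + (n - 1) * (a 4 - a 7)),
     a 7 * (a 3 - a 6) - a 4 * a 5 + (a 4 - a 7) * (- b 2 + a 4 + (n - 1) * a 7 + a 5) + a 2 * (b 4 - b 7),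
     - a 2 * (a 1 + b 6 + b 3 + n * b 4) + a 6 * (b 2 - a 5 + a 3 + n * a 4) + a 4 * (a 3 - a 5 - a 6),
     a 2 * (a 1 + b 6 + b 3 + n * b 7) - a 6 * (a 6 + n * a 7) - a 7 * (a 3 - a 5 - a 6) - b 2 * (a 3 - a 5),
     b 7 * (a 3 - a 6) - b 4 * a 5 + (a 4 - a 7) * (b 4 + (n - 1) * b 7 + b 5),
     - b 2 * (b 3 + n * b 4) + b 6 * (a 3 + n * a 4) + a 4 * (b 3 - b 5 - b 6) - a 2 * b 1 - a 6 * b 5,
     b 2 * (b 5 + b 6 + n * b 7) - b 6 * (a 6 + n * a 7) - a 7 * (b 3 - b 5 - b 6) + a 2 * b 1 + a 3 * b 5 - b 3 * a 5,
     c * (2 * b 2 + a 3 + a 5 - a 6)]"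

definition lie_family :: "(('n::finite \<Rightarrow> 'n, 'n + 'n) lin_cochain \<times> ('n \<Rightarrow> 'n, 'n + 'n) const_cochain) set" where
  "lie_family =
     {(kappaL1 a b, \<lambda>g u v. kappaC1 \<alpha> \<beta> g u v + kappaCref c g u v) | a b \<alpha> \<beta> c.
        \<forall>\<gamma>\<in>set (gammas (of_nat CARD('n)) a b \<alpha> \<beta> c). \<gamma> = 0}"

definition off_family :: "(('n::finite \<Rightarrow> 'n, 'n + 'n) lin_cochain \<times> ('n \<Rightarrow> 'n, 'n + 'n) const_cochain) set" where
  "off_family =
     {(kappaLref a a' b b',
       \<lambda>g u v. kappaC1 \<alpha> \<beta> g u v + kappaCref c g u v + kappaC3cyc a a' b b' g u v) | a a' b b' \<alpha> \<beta> c.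
        \<alpha> * a + \<beta> * (a + (of_nat CARD('n) - 2) * a') = 0 \<and>
        \<alpha> * a' + \<beta> * (2 * a + (of_nat CARD('n) - 3) * a') = 0 \<and>
        \<alpha> * b + \<beta> * (b + (of_nat CARD('n) - 2) * b') = 0 \<and>
        \<alpha> * b' + \<beta> * (2 * b + (of_nat CARD('n) - 3) * b') = 0}"


section \<open>Consistency checks\<close>

lemma sum_if_const: "(\<Sum>j\<in>A. if P then f j else 0) = (if P then \<Sum>j\<in>A. f j else 0)"
  by simp

lemma sum_if_delta:
  "(\<Sum>j\<in>UNIV. if Q j then if j = i then c else 0 else 0) = (if Q i then c else 0)"
  for i :: "'n::finite"
proof -
  have "(\<Sum>j\<in>UNIV. if Q j then if j = i then c else 0 else 0)
      = (\<Sum>j\<in>UNIV. if j = i then if Q i then c else 0 else 0)"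
    by (rule sum.cong) auto
  then show ?thesis by simp
qed

lemma neg_delta:
  fixes z :: "'c::ab_group_add"
  shows "- (if P then z else 0) = (if P then - z else 0)"
  by simp

lemma delta_times:
  fixes z :: complex
  shows "(if P then 1 else 0) * z = (if P then z else 0)" "z * (if P then 1 else 0) = (if P then z else 0)"
    "(if P then z else 0) * w = (if P then z * w else 0)"
  by simp_all

lemma one_Sn: "\<one>\<^bsub>Sn\<^esub> = id"
  by (auto simp: BijGroup_def)

lemma carrier_Sn: "carrier Sn = {g. bij g}"
  by (auto simp: BijGroup_def Bij_def)

lemma mult_Sn: "bij g \<Longrightarrow> bij h \<Longrightarrow> g \<otimes>\<^bsub>Sn\<^esub> h = g \<circ> h"
  by (auto simp: BijGroup_def Bij_def compose_def)

lemma doubled_perm_basis: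
  "doubled_perm \<sigma> (xv i) = xv (\<sigma> i)" "doubled_perm \<sigma> (yv i) = yv (\<sigma> i)"
  by (simp_all add: doubled_perm_def xv_def yv_def axis_def vec_eq_iff delta_times sum_if_delta cong: if_cong)

lemma doubled_perm_id: "doubled_perm id v = v"
proof -
  have "doubled_perm id v $ k = v $ k" for k
    by (cases k) (simp_all add: doubled_perm_def xv_def yv_def axis_def delta_times
        cong: if_cong)
  then show ?thesis by (simp add: vec_eq_iff)
qed

lemma doubled_perm_linear: "Vector_Spaces.linear (*s) (*s) (doubled_perm \<sigma>)"
  by unfold_locales
    (simp_all add: doubled_perm_def vec_eq_iff algebra_simps sum.distrib sum_distrib_left)

lemma doubled_perm_comp: "doubled_perm \<sigma> (doubled_perm \<tau> v) = doubled_perm (\<sigma> \<circ> \<tau>) v"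
proof -
  interpret L: Vector_Spaces.linear "(*s)" "(*s)" "doubled_perm \<sigma>"
    by (rule doubled_perm_linear)
  show ?thesis
    by (simp add: doubled_perm_def[of \<tau>] L.add L.sum L.scale doubled_perm_basis)
       (simp add: doubled_perm_def)
qed

lemma cycle_of_list_3:
  assumes "distinct [i, j, k]"
  shows "cycle_of_list [i, j, k] i = j" "cycle_of_list [i, j, k] j = k" "cycle_of_list [i, j, k] k = i"
  using assms by (auto simp: Transposition.transpose_def)

lemma moved_transpose: "r \<noteq> s \<Longrightarrow> moved (Transposition.transpose r s) = {r, s}"
  by (auto simp: moved_def Transposition.transpose_def)

lemma skew_ext_const_basis:
  "skew_ext (*) xx xy yy (xv i) (xv j) = xx i j"
  "skew_ext (*) xx xy yy (xv i) (yv j) = xy i j"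
  "skew_ext (*) xx xy yy (yv j) (xv i) = - xy i j"
  "skew_ext (*) xx xy yy (yv i) (yv j) = yy i j"
  by (simp_all add: skew_ext_def xv_def yv_def axis_def delta_times sum_negf neg_delta sum_if_const cong: if_cong)

lemma skew_ext_lin_basis:
  fixes xx xy yy :: "'n::finite \<Rightarrow> 'n \<Rightarrow> complex ^ ('n + 'n)"
  shows "skew_ext (*s) xx xy yy (xv i) (xv j) = xx i j"
    and "skew_ext (*s) xx xy yy (xv i) (yv j) = xy i j"
    and "skew_ext (*s) xx xy yy (yv j) (xv i) = - xy i j"
    and "skew_ext (*s) xx xy yy (yv i) (yv j) = yy i j"
  by (simp_all add: skew_ext_def xv_def yv_def axis_def vec_eq_iff delta_times sum_negf neg_delta sum_if_const cong: if_cong)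

lemma quot_algebra_simps:
  "carrier (quot_algebra A I) = a_rcosets\<^bsub>A\<^esub> I"
  "X \<otimes>\<^bsub>quot_algebra A I\<^esub> Y = rcoset_mult A I X Y"
  "\<one>\<^bsub>quot_algebra A I\<^esub> = I +>\<^bsub>A\<^esub> \<one>\<^bsub>A\<^esub>"
  "\<zero>\<^bsub>quot_algebra A I\<^esub> = I"
  "X \<oplus>\<^bsub>quot_algebra A I\<^esub> Y = X <+>\<^bsub>A\<^esub> Y"
  "c \<odot>\<^bsub>quot_algebra A I\<^esub> X = (\<Union>x\<in>X. I +>\<^bsub>A\<^esub> (c \<odot>\<^bsub>A\<^esub> x))"
  by (simp_all add: quot_algebra_def FactRing_def ring.defs module.defs)

end

theory Submission
  imports Defs
begin

text \<open>
  The statement combines a theorem about quotient algebras, which holds for every representation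
  of a finite group, with a classification of parameter maps, which is particular to the doubled
  permutation representation.

  \<^bold>\<open>Quotient algebras.\<close> For a Drinfeld orbifold algebra map the algebra \<open>H\<close> is of
  Poincare-Birkhoff-Witt type (\<open>drinfeld_orbifold_algebra\<close>). Sorting the letters of a word by means
  of the relations shows that the class of a tensor depends, up to lower degree, only on its leading
  term in \<open>S(V)#G\<close>. The point is that the ideal of relations does not identify different leading
  terms. For this, \<open>normal_form_functional\<close> provides, for every monomial and every group element, a
  linear functional on \<open>T(V)#G\<close> that vanishes on the ideal and that reads off the coefficient of
  this monomial among the tensors of at most its degree. The functional is extended from words of
  length \<open>D\<close> to words of length \<open>D + 1\<close>: the relations prescribe by how much its value jumps when two
  adjacent letters are exchanged, and by \<open>exists_prescribed_swaps\<close> jumps can be prescribed as soon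
  as they are antisymmetric, agree for two exchanges at disjoint places, and agree for the two ways
  to reverse three adjacent letters. The second property comes from the invariance (i), the third
  from (ii), (iii) and (iv): by (ii) the overlap of two relations is a sum of commutators, which
  the relations in lower degree turn into the two sides of (iii) and (iv).

  \<^bold>\<open>Classification.\<close> Let \<open>B\<close> be a skew form and \<open>g \<noteq> 1\<close>. If the cyclic sum of
  \<open>B(y,z) (\<^sup>gx - x)\<close> vanishes for all vectors, then \<open>B = 0\<close> unless \<open>g\<close> is a transposition \<open>(r s)\<close>, and
  then \<open>B\<close> is a multiple of the form \<open>omega r s\<close> (\<open>homogeneous_imp_kappaCref\<close>). Conditions (0) and
  (ii) make the coordinates of \<open>\<kappa>\<^sup>L\<^sub>g\<close> solutions of this equation. The remaining freedom is
  constrained by invariance: since the symmetric group acts transitively on pairs and on triples of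
  distinct indices, an invariant bracket, form or family of vectors is described by the parameters
  of the statement.

  If \<open>\<kappa>\<^sup>L\<close> is supported on the identity, then off the identity (iii) is the equation above for
  \<open>\<kappa>\<^sup>C\<close>, and the rest of (iii) and (iv) says that \<open>\<kappa>\<^sup>L\<^sub>1\<close> satisfies the Jacobi identity and that the
  components of \<open>\<kappa>\<^sup>C\<close> are cocycles for it. Evaluated on triples of basis vectors these are the 22
  quadratic equations (\<open>lie_conditions_iff_gammas\<close>).

  If \<open>\<kappa>\<^sup>L\<close> is supported off the identity, it lives on transpositions, and the left-hand side of
  (iii) lives on products of two transpositions. It vanishes there except on 3-cycles, where it is
  the right-hand side for the form \<open>\<kappa>\<^sup>C\<^bsub>3-cyc\<^esub>\<close> (\<open>kappaLref_quadratic\<close>). Hence the difference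
  between \<open>\<kappa>\<^sup>C\<close> and this form solves the homogeneous equation. In (iv) only the component of \<open>\<kappa>\<^sup>C\<close>
  at the identity contributes, which gives the four remaining equations
  (\<open>constant_condition_iff\<close>).
\<close>

section \<open>Prescribing the change under adjacent transpositions\<close>

text \<open>
  The value sought for a word is the cost of sorting it by insertion, where the exchange of
  adjacent letters \<open>b, c\<close> between a prefix \<open>u\<close> and a suffix \<open>w\<close> costs \<open>\<phi> u b c w\<close>. The costs depend
  on the whole word, so the recursion carries along the prefix in front of the part being sorted.
\<close>

context
  fixes ix :: "'b \<Rightarrow> nat" and \<phi> :: "'b list \<Rightarrow> 'b \<Rightarrow> 'b \<Rightarrow> 'b list \<Rightarrow> complex"
begin

fun ins_cost :: "'b list \<Rightarrow> 'b \<Rightarrow> 'b list \<Rightarrow> complex" where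
  "ins_cost u b [] = 0"
| "ins_cost u b (c # s) = (if ix b \<le> ix c then 0 else \<phi> u b c s + ins_cost (u @ [c]) b s)"

fun sort_cost :: "'b list \<Rightarrow> 'b list \<Rightarrow> complex" where
  "sort_cost u [] = 0"
| "sort_cost u (b # w) = sort_cost (u @ [b]) w + ins_cost u b (sort_key ix w)"

context
  assumes antisym: "\<And>u a b w. \<phi> u a b w = - \<phi> u b a w"
    and far: "\<And>u a b v c d w. \<phi> u a b (v @ c # d # w) - \<phi> u a b (v @ d # c # w)
                = \<phi> (u @ a # b # v) c d w - \<phi> (u @ b # a # v) c d w"
    and braid: "\<And>u x y z w. \<phi> u x y (z # w) + \<phi> (u @ [y]) x z w + \<phi> u y z (x # w)
                = \<phi> (u @ [x]) y z w + \<phi> u x z (y # w) + \<phi> (u @ [z]) x y w"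
begin

text \<open>
  While \<open>c\<close> moves to its place in \<open>s\<close>, each of its steps takes place far to the right of \<open>a\<close> and
  \<open>b\<close>; by the compatibility of distant exchanges the differences of the costs telescope.
\<close>

lemma ins_cost_prefix_swap:
  "ins_cost (u @ a # b # v) c s - ins_cost (u @ b # a # v) c s
     = \<phi> u a b (v @ c # s) - \<phi> u a b (v @ insort_key ix c s)"
proof (induction s arbitrary: v)
  case (Cons d s)
  show ?case
    using Cons[of "v @ [d]"] far[of u a b v c d s] by (auto simp: algebra_simps)
qed simp

lemma sort_cost_prefix_swap:
  "sort_cost (u @ a # b # v) w - sort_cost (u @ b # a # v) w
     = \<phi> u a b (v @ w) - \<phi> u a b (v @ sort_key ix w)"
proof (induction w arbitrary: v)
  case (Cons d w)
  show ?case
    using Cons[of "v @ [d]"] ins_cost_prefix_swap[of u a b v d "sort_key ix w"]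
    by (simp add: complex_eq_iff)
qed simp

text \<open>
  Inserting \<open>b\<close> and \<open>b'\<close> into a sorted list gives the same result in either order. When both letters
  pass the head \<open>c\<close> of the list, the two orders differ by the two ways to reverse \<open>b\<close>, \<open>b'\<close>, \<open>c\<close>.
\<close>

lemma ins_cost_commute:
  assumes "sorted (map ix s)" "ix b' < ix b"
  shows "\<phi> u b b' s = ins_cost (u @ [b]) b' s + ins_cost u b (insort_key ix b' s)
           - ins_cost (u @ [b']) b s - ins_cost u b' (insort_key ix b s)"
  using assms(1)
proof (induction s arbitrary: u)
  case Nil
  show ?case using assms(2) by simp
next
  case (Cons c s)
  show ?case
  proof (cases "ix b' \<le> ix c")
    case True
    then show ?thesis using assms(2) by (simp add: insort_is_Cons)
  next
    case False
    then have lt: "\<not> ix b' \<le> ix c" "\<not> ix b \<le> ix c" using assms(2) by auto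
    have IH: "\<phi> (u @ [c]) b b' s = ins_cost (u @ [c, b]) b' s + ins_cost (u @ [c]) b (insort_key ix b' s)
           - ins_cost (u @ [c, b']) b s - ins_cost (u @ [c]) b' (insort_key ix b s)"
      using Cons.IH[of "u @ [c]"] Cons.prems by simp
    show ?thesis
      using lt IH ins_cost_prefix_swap[of u b c "[]" b' s] ins_cost_prefix_swap[of u b' c "[]" b s]
        braid[of u b b' c s]
      by (simp add: complex_eq_iff)
  qed
qed

lemma sort_cost_swap_front:
  assumes "inj ix"
  shows "sort_cost u (b # b' # w) - sort_cost u (b' # b # w) = \<phi> u b b' w"
proof -
  have main: "sort_cost u (b # b' # w) - sort_cost u (b' # b # w) = \<phi> u b b' w"
    if "ix b' < ix b" for b b'
    using ins_cost_commute[OF sorted_sort_key that, of u w] sort_cost_prefix_swap[of u b b' "[]" w]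
    by (simp add: complex_eq_iff)
  consider "ix b' < ix b" | "ix b < ix b'" | "b = b'"
    using assms by (metis injD linorder_less_linear)
  then show ?thesis
  proof cases
    case 2
    then show ?thesis using main[of b b'] antisym[of u b b' w] by (simp add: algebra_simps)
  next
    case 3
    then show ?thesis using antisym[of u b b w] by simp
  qed (use main in auto)
qed

lemma sort_cost_swap:
  assumes "inj ix"
  shows "sort_cost v (u @ b # b' # w) - sort_cost v (u @ b' # b # w) = \<phi> (v @ u) b b' w"
proof (induction u arbitrary: v)
  case Nil
  then show ?case using sort_cost_swap_front[OF assms] by simp
next
  case (Cons a u)
  have eq: "sort_key ix (u @ b # b' # w) = sort_key ix (u @ b' # b # w)"
    by (rule sort_key_inj_key_eq) (use assms in \<open>auto simp: inj_on_def\<close>)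
  show ?case using Cons[of "v @ [a]"] eq by (simp del: sort_key_simps)
qed

end
end

text \<open>
  The hypotheses are the relations between the adjacent transpositions that generate the symmetric
  group: involutivity, commutation of distant transpositions, and the braid relation. A function
  with prescribed changes is therefore well defined along any chain of exchanges.
\<close>

lemma exists_prescribed_swaps:
  fixes \<phi> :: "'b::finite list \<Rightarrow> 'b \<Rightarrow> 'b \<Rightarrow> 'b list \<Rightarrow> complex"
  assumes "\<And>u a b w. \<phi> u a b w = - \<phi> u b a w"
    and "\<And>u a b v c d w. \<phi> u a b (v @ c # d # w) - \<phi> u a b (v @ d # c # w)
                = \<phi> (u @ a # b # v) c d w - \<phi> (u @ b # a # v) c d w"
    and "\<And>u x y z w. \<phi> u x y (z # w) + \<phi> (u @ [y]) x z w + \<phi> u y z (x # w)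
                = \<phi> (u @ [x]) y z w + \<phi> u x z (y # w) + \<phi> (u @ [z]) x y w"
  shows "\<exists>F. \<forall>u a b w. F (u @ a # b # w) - F (u @ b # a # w) = \<phi> u a b w"
proof -
  obtain ix :: "'b \<Rightarrow> nat" where "inj ix"
    using finite_imp_inj_to_nat_seg[of "UNIV :: 'b set"] by auto
  then have "\<forall>u a b w. sort_cost ix \<phi> [] (u @ a # b # w) - sort_cost ix \<phi> [] (u @ b # a # w) = \<phi> u a b w"
    using sort_cost_swap[OF assms \<open>inj ix\<close>, of "[]"] by simp
  then show ?thesis by blast
qed

section \<open>Linear maps out of monoid algebras\<close>

lemma poly_mapping_eq_sum: "t = (\<Sum>k\<in>Poly_Mapping.keys t. Poly_Mapping.single k (Poly_Mapping.lookup t k))"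
  by (rule poly_mapping_eqI)
     (auto simp: lookup_sum lookup_single when_def in_keys_iff)

lemma poly_mapping_keys_induct [consumes 1, case_names zero add single]:
  fixes t :: "'m \<Rightarrow>\<^sub>0 complex"
  assumes "\<forall>k\<in>Poly_Mapping.keys t. Q k" "P 0" "\<And>x y. P x \<Longrightarrow> P y \<Longrightarrow> P (x + y)"
    "\<And>k c. Q k \<Longrightarrow> P (Poly_Mapping.single k c)"
  shows "P t"
proof -
  have "P (\<Sum>k\<in>A. Poly_Mapping.single k (Poly_Mapping.lookup t k))" if "finite A" "A \<subseteq> Poly_Mapping.keys t" for A
    using that by (induction A) (use assms in auto)
  from this[of "Poly_Mapping.keys t"] show ?thesis using poly_mapping_eq_sum[of t] by simp
qed

lemma lookup_const_mult [simp]: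
  "Poly_Mapping.lookup (const_pm c * p) k = c * Poly_Mapping.lookup p k"
proof -
  have "\<forall>k\<in>Poly_Mapping.keys p. True" by simp
  then show ?thesis
    by (induction p rule: poly_mapping_keys_induct)
       (auto simp: const_pm_def mult_single lookup_single when_def distrib_left lookup_add)
qed

lemma const_pm_central: "const_pm c * p = p * const_pm c"
proof -
  have "\<forall>k\<in>Poly_Mapping.keys p. True" by simp
  then show ?thesis
    by (induction p rule: poly_mapping_keys_induct)
       (auto simp: const_pm_def mult_single distrib_left distrib_right mult.commute)
qed

lemma const_pm_simps [simp]:
  "const_pm 0 = 0" "const_pm 1 = 1" "const_pm (c + d) = const_pm c + const_pm d"
  "const_pm (c * d) = const_pm c * const_pm d" "const_pm (- c) = - const_pm c"
  "const_pm (c - d) = const_pm c - const_pm d"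
  by (simp_all add: const_pm_def single_add mult_single single_uminus single_diff)

lemma const_pm_sum: "const_pm (sum h A) = (\<Sum>a\<in>A. const_pm (h a))"
  by (induction A rule: infinite_finite_induct) simp_all

lemma single_eq_const_mult: "Poly_Mapping.single k c = const_pm c * Poly_Mapping.single k 1"
  by (simp add: const_pm_def mult_single)

text \<open>
  The scalars of the target of a linear extension: a complex algebra is presented by the ring
  homomorphism from the complex numbers to its centre.
\<close>

locale central_scalars =
  fixes \<eta> :: "complex \<Rightarrow> 'r::ring_1"
  assumes \<eta>_add: "\<eta> (c + d) = \<eta> c + \<eta> d" and \<eta>_mult: "\<eta> (c * d) = \<eta> c * \<eta> d"
    and \<eta>_one: "\<eta> 1 = 1" and \<eta>_central: "\<eta> c * x = x * \<eta> c"
begin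

lemma \<eta>_zero: "\<eta> 0 = 0"
  using \<eta>_add[of 0 0] by simp

definition ext :: "('m \<Rightarrow> 'r) \<Rightarrow> ('m \<Rightarrow>\<^sub>0 complex) \<Rightarrow> 'r" where
  "ext \<phi> t = (\<Sum>w\<in>Poly_Mapping.keys t. \<eta> (Poly_Mapping.lookup t w) * \<phi> w)"

lemma ext_superset:
  assumes "finite A" "Poly_Mapping.keys t \<subseteq> A"
  shows "ext \<phi> t = (\<Sum>w\<in>A. \<eta> (Poly_Mapping.lookup t w) * \<phi> w)"
  unfolding ext_def by (rule sum.mono_neutral_left) (use assms in \<open>auto simp: in_keys_iff \<eta>_zero\<close>)

lemma ext_add [simp]: "ext \<phi> (s + t) = ext \<phi> s + ext \<phi> t"
proof -
  have "finite (Poly_Mapping.keys s \<union> Poly_Mapping.keys t)" by simp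
  from ext_superset[OF this] show ?thesis
    using Poly_Mapping.keys_add[of s t]
    by (simp add: lookup_add \<eta>_add distrib_right sum.distrib)
qed

lemma ext_zero [simp]: "ext \<phi> 0 = 0"
  by (simp add: ext_def)

lemma ext_uminus [simp]: "ext \<phi> (- t) = - ext \<phi> t"
  using ext_add[of \<phi> t "- t"] by (simp add: eq_neg_iff_add_eq_0 add.commute)

lemma ext_diff [simp]: "ext \<phi> (s - t) = ext \<phi> s - ext \<phi> t"
  using ext_add[of \<phi> s "- t"] by simp

lemma ext_sum: "ext \<phi> (sum f A) = (\<Sum>a\<in>A. ext \<phi> (f a))"
  by (induction A rule: infinite_finite_induct) auto

lemma ext_single [simp]: "ext \<phi> (Poly_Mapping.single k c) = \<eta> c * \<phi> k"
  by (simp add: ext_def \<eta>_zero)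

lemma ext_scale [simp]: "ext \<phi> (const_pm c * t) = \<eta> c * ext \<phi> t"
proof -
  have "\<forall>k\<in>Poly_Mapping.keys t. True" by simp
  then show ?thesis
    by (induction t rule: poly_mapping_keys_induct)
       (auto simp: const_pm_def mult_single distrib_left \<eta>_mult mult.assoc)
qed

lemma ext_mult:
  assumes "\<And>u w. \<phi> (u + w) = \<phi> u * \<phi> w"
  shows "ext \<phi> (s * t) = ext \<phi> s * ext \<phi> t"
proof -
  have "\<forall>k\<in>Poly_Mapping.keys t. True" "\<forall>k\<in>Poly_Mapping.keys s. True" by simp_all
  then show ?thesis
  proof (induction t rule: poly_mapping_keys_induct)
    case (single k c)
    from single(2) show ?case
    proof (induction s rule: poly_mapping_keys_induct)
      case (single l d)
      have "\<eta> d * \<eta> c * (\<phi> l * \<phi> k) = \<eta> d * (\<eta> c * \<phi> l) * \<phi> k" by (simp add: mult.assoc)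
      also have "\<dots> = \<eta> d * \<phi> l * (\<eta> c * \<phi> k)" by (simp add: \<eta>_central[of c "\<phi> l"] mult.assoc)
      finally show ?case by (simp add: mult_single assms \<eta>_mult)
    qed (auto simp: distrib_right)
  qed (auto simp: distrib_left)
qed

lemma ext_const: "\<phi> 0 = 1 \<Longrightarrow> ext \<phi> (const_pm c) = \<eta> c"
  by (simp add: const_pm_def)

end

lemma poly_mapping_additive_eqI:
  fixes t :: "'m \<Rightarrow>\<^sub>0 complex"
  assumes "\<And>s t. F (s + t) = F s + (F t :: 'r::ring_1)" "\<And>s t. G (s + t) = G s + G t"
    and "\<And>k c. F (Poly_Mapping.single k c) = G (Poly_Mapping.single k c)"
  shows "F t = G t"
proof -
  have "F 0 = 0" "G 0 = 0" using assms(1,2)[of 0 0] by auto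
  moreover have "\<forall>k\<in>Poly_Mapping.keys t. True" by simp
  then show ?thesis
    by (induction t rule: poly_mapping_keys_induct) (use assms calculation in auto)
qed

interpretation cpm: central_scalars "const_pm :: complex \<Rightarrow> ('m::monoid_add \<Rightarrow>\<^sub>0 complex)"
  by unfold_locales (simp_all, rule const_pm_central)

interpretation cid: central_scalars "\<lambda>c. c :: complex"
  by unfold_locales auto

subsection \<open>Degrees\<close>

definition deg_le :: "('m \<Rightarrow> nat) \<Rightarrow> nat \<Rightarrow> ('m \<Rightarrow>\<^sub>0 complex) \<Rightarrow> bool" where
  "deg_le d m t \<longleftrightarrow> (\<forall>w\<in>Poly_Mapping.keys t. d w \<le> m)"

lemma deg_le_iff: "deg_le d m t \<longleftrightarrow> (\<forall>w. m < d w \<longrightarrow> Poly_Mapping.lookup t w = 0)"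
  unfolding deg_le_def by (metis in_keys_iff linorder_not_le)

lemma deg_le_zero [simp]: "deg_le d m 0"
  by (simp add: deg_le_def)

lemma deg_le_add: "deg_le d m s \<Longrightarrow> deg_le d m t \<Longrightarrow> deg_le d m (s + t)"
  using Poly_Mapping.keys_add[of s t] by (auto simp: deg_le_def)

lemma deg_le_uminus: "deg_le d m s \<Longrightarrow> deg_le d m (- s)"
  by (simp add: deg_le_iff)

lemma deg_le_diff: "deg_le d m s \<Longrightarrow> deg_le d m t \<Longrightarrow> deg_le d m (s - t)"
  using deg_le_add[OF _ deg_le_uminus, of d m s t] by simp

lemma deg_le_sum: "(\<And>a. a \<in> A \<Longrightarrow> deg_le d m (f a)) \<Longrightarrow> deg_le d m (sum f A)"
  by (induction A rule: infinite_finite_induct) (simp_all add: deg_le_add)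

lemma deg_le_single: "d w \<le> m \<Longrightarrow> deg_le d m (Poly_Mapping.single w c)"
  by (simp add: deg_le_def)

lemma deg_le_mono: "deg_le d m t \<Longrightarrow> m \<le> m' \<Longrightarrow> deg_le d m' t"
  by (force simp: deg_le_def)

lemma deg_le_mult:
  assumes "\<And>u w. d (u + w) = d u + d w" "deg_le d m s" "deg_le d n t"
  shows "deg_le d (m + n) (s * t)"
  unfolding deg_le_def
proof
  fix w assume "w \<in> Poly_Mapping.keys (s * t)"
  then obtain a b where "a \<in> Poly_Mapping.keys s" "b \<in> Poly_Mapping.keys t" "w = a + b"
    using keys_mult[of s t] by blast
  then show "d w \<le> m + n" using assms by (auto simp: deg_le_def intro: add_mono)
qed

lemma deg_le_const:
  assumes "\<And>u w. d (u + w) = d u + d w"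
  shows "deg_le d m (const_pm c)"
proof -
  have "d 0 = 0" using assms[of 0 0] by simp
  then show ?thesis by (simp add: const_pm_def deg_le_single)
qed

lemma deg_le_scale:
  "deg_le d m t \<Longrightarrow> deg_le d m (const_pm c * t)"
  by (simp add: deg_le_iff)

lemma word_deg_add: "word_deg (u + w) = word_deg u + word_deg w"
  by (simp add: word_deg_def plus_free_mon_def)

lemma mon_deg_add: "mon_deg (u + w) = mon_deg u + mon_deg w"
  by (simp add: mon_deg_def lookup_add sum.distrib)

section \<open>Maps between tensor and symmetric algebras\<close>

abbreviation word :: "'b list \<Rightarrow> 'b tensor_alg" where
  "word u \<equiv> Poly_Mapping.single (Word u) 1"

lemma word_append: "word (u @ w) = word u * word w"
  by (simp add: mult_single plus_free_mon_def)

lemma word_Nil: "word [] = 1"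
  by (simp flip: zero_free_mon_def)

lemma word_Cons: "word (b # w) = word [b] * word w"
  using word_append[of "[b]" w] by simp

lemma tens_emb_axis: "tens_emb (axis b 1) = word [b]"
proof -
  have "tens_emb (axis b 1) = (\<Sum>c\<in>UNIV. if c = b then word [b] else 0)"
    unfolding tens_emb_def by (rule sum.cong) (auto simp: axis_def)
  then show ?thesis by simp
qed

lemma tens_emb_linear [simp]:
  "tens_emb (u + v) = tens_emb u + tens_emb v" "tens_emb (u - v) = tens_emb u - tens_emb v"
  "tens_emb (- v) = - tens_emb v" "tens_emb 0 = 0" "tens_emb (c *s v) = const_pm c * tens_emb v"
  by (simp_all add: tens_emb_def single_add single_diff single_uminus sum.distrib sum_subtractf
      sum_negf sum_distrib_left const_pm_def mult_single)

lemma sym_emb_linear [simp]: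
  "sym_emb (u + v) = sym_emb u + sym_emb v" "sym_emb (u - v) = sym_emb u - sym_emb v"
  "sym_emb (- v) = - sym_emb v" "sym_emb 0 = 0" "sym_emb (c *s v) = const_pm c * sym_emb v"
  by (simp_all add: sym_emb_def single_add single_diff single_uminus sum.distrib sum_subtractf
      sum_negf sum_distrib_left const_pm_def mult_single)

lemma tens_emb_sum: "tens_emb (sum h A) = (\<Sum>a\<in>A. tens_emb (h a))"
  by (induction A rule: infinite_finite_induct) simp_all

lemma tens_emb_expand: "tens_emb v = (\<Sum>b\<in>UNIV. const_pm (v $ b) * word [b])"
  by (simp add: tens_emb_def const_pm_def mult_single)

lemma sym_emb_expand:
  "sym_emb v = (\<Sum>b\<in>UNIV. const_pm (v $ b) * Poly_Mapping.single (Poly_Mapping.single b 1) 1)"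
  by (simp add: sym_emb_def const_pm_def mult_single)

subsection \<open>Functoriality of the tensor algebra\<close>

lemma tens_map_ext:
  "tens_map f = cpm.ext (\<lambda>w. prod_list (map (\<lambda>b. tens_emb (f (axis b 1))) (letters w)))"
  by (rule ext) (simp add: tens_map_def cpm.ext_def)

lemma tens_map_add [simp]: "tens_map f (s + t) = tens_map f s + tens_map f t"
  and tens_map_diff [simp]: "tens_map f (s - t) = tens_map f s - tens_map f t"
  and tens_map_zero [simp]: "tens_map f 0 = 0"
  and tens_map_scale [simp]: "tens_map f (const_pm c * t) = const_pm c * tens_map f t"
  and tens_map_sum: "tens_map f (sum h A) = (\<Sum>a\<in>A. tens_map f (h a))"
  unfolding tens_map_ext by (simp_all add: cpm.ext_sum)

lemma tens_map_mult [simp]: "tens_map f (s * t) = tens_map f s * tens_map f t"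
  unfolding tens_map_ext by (rule cpm.ext_mult) (simp add: plus_free_mon_def)

lemma tens_map_const [simp]: "tens_map f (const_pm c) = const_pm c"
  unfolding tens_map_ext by (rule cpm.ext_const) (simp add: zero_free_mon_def)

lemma tens_map_one [simp]: "tens_map f 1 = 1"
  using tens_map_const[of f 1] by simp

lemma tens_map_word: "tens_map f (word w) = prod_list (map (\<lambda>b. tens_emb (f (axis b 1))) w)"
  by (simp add: tens_map_ext)

lemma tens_map_emb:
  assumes "Vector_Spaces.linear (*s) (*s) f"
  shows "tens_map f (tens_emb v) = tens_emb (f v)"
proof -
  interpret L: Vector_Spaces.linear "(*s)" "(*s)" f by fact
  have "tens_emb (f v) = tens_emb (f (\<Sum>b\<in>UNIV. v $ b *s axis b 1))"
    by (simp add: basis_expansion)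
  also have "\<dots> = (\<Sum>b\<in>UNIV. const_pm (v $ b) * tens_emb (f (axis b 1)))"
    by (simp add: L.sum L.scale tens_emb_sum)
  finally show ?thesis
    by (simp add: tens_emb_expand[of v] tens_map_sum tens_map_word)
qed

lemma tensor_hom_eqI:
  assumes "\<And>s t. F (s + t) = F s + (F t :: 'r::ring_1)" "\<And>s t. G (s + t) = G s + G t"
    and "\<And>s t. F (s * t) = F s * F t" "\<And>s t. G (s * t) = G s * G t"
    and "\<And>c. F (const_pm c) = G (const_pm c)" "F 1 = 1" "G 1 = 1"
    and "\<And>b. F (word [b]) = G (word [b])"
  shows "F t = G t"
proof (rule poly_mapping_additive_eqI)
  fix k :: "'a free_mon" and c
  obtain w where k: "k = Word w" by (cases k)
  have "F (word w) = G (word w)"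
  proof (induction w)
    case (Cons b w)
    then show ?case by (subst (1 2) word_Cons) (simp only: assms(3,4,8))
  qed (simp add: word_Nil assms(6,7))
  then show "F (Poly_Mapping.single k c) = G (Poly_Mapping.single k c)"
    by (subst (1 2) single_eq_const_mult) (simp only: assms(3-5) k)
qed (use assms in auto)

lemma tens_map_comp:
  assumes "Vector_Spaces.linear (*s) (*s) f"
  shows "tens_map f (tens_map g t) = tens_map (\<lambda>v. f (g v)) t"
  by (rule tensor_hom_eqI) (simp_all add: tens_map_word tens_map_emb[OF assms])

lemma tens_map_id: "tens_map (\<lambda>v. v) t = t"
  by (rule tensor_hom_eqI) (simp_all add: tens_map_word tens_emb_axis)

subsection \<open>Functoriality of the symmetric algebra\<close>

lemma sym_map_ext: "sym_map f = cpm.ext (\<lambda>m. \<Prod>b\<in>UNIV. sym_emb (f (axis b 1)) ^ Poly_Mapping.lookup m b)"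
  by (rule ext) (simp add: sym_map_def cpm.ext_def)

lemma sym_map_add [simp]: "sym_map f (s + t) = sym_map f s + sym_map f t"
  and sym_map_zero [simp]: "sym_map f 0 = 0"
  and sym_map_scale [simp]: "sym_map f (const_pm c * t) = const_pm c * sym_map f t"
  and sym_map_sum: "sym_map f (sum h A) = (\<Sum>a\<in>A. sym_map f (h a))"
  unfolding sym_map_ext by (simp_all add: cpm.ext_sum)

lemma sym_map_mult [simp]: "sym_map f (s * t) = sym_map f s * sym_map f t"
  unfolding sym_map_ext by (rule cpm.ext_mult) (simp add: lookup_add power_add prod.distrib)

lemma sym_map_const [simp]: "sym_map f (const_pm c) = const_pm c"
  unfolding sym_map_ext by (rule cpm.ext_const) simp

lemma sym_map_one [simp]: "sym_map f 1 = 1"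
  using sym_map_const[of f 1] by simp

lemma sym_map_var: "sym_map f (Poly_Mapping.single (Poly_Mapping.single b 1) 1) = sym_emb (f (axis b 1))"
proof -
  have "(\<Prod>c\<in>UNIV. sym_emb (f (axis c 1)) ^ Poly_Mapping.lookup (Poly_Mapping.single b 1) c)
      = (\<Prod>c\<in>UNIV. if c = b then sym_emb (f (axis b 1)) else 1)"
    by (rule prod.cong) (auto simp: lookup_single when_def)
  then show ?thesis by (simp add: sym_map_ext)
qed

subsection \<open>The projection of the tensor algebra onto the symmetric algebra\<close>

definition word_mon :: "'b list \<Rightarrow> ('b \<Rightarrow>\<^sub>0 nat)" where
  "word_mon w = sum_list (map (\<lambda>b. Poly_Mapping.single b 1) w)"

lemma word_mon_simps [simp]:
  "word_mon [] = 0" "word_mon (b # w) = Poly_Mapping.single b 1 + word_mon w"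
  "word_mon (u @ w) = word_mon u + word_mon w"
  by (simp_all add: word_mon_def)

lemma mon_deg_single [simp]: "mon_deg (Poly_Mapping.single b k) = k"
proof -
  have "mon_deg (Poly_Mapping.single b k) = (\<Sum>c\<in>UNIV. if c = b then k else 0)"
    unfolding mon_deg_def by (rule sum.cong) (auto simp: lookup_single when_def)
  then show ?thesis by simp
qed

lemma mon_deg_zero [simp]: "mon_deg 0 = 0"
  by (simp add: mon_deg_def)

lemma mon_deg_word_mon [simp]: "mon_deg (word_mon w) = length w"
  by (induction w) (simp_all add: mon_deg_add)

lemma lookup_word_mon: "Poly_Mapping.lookup (word_mon w) b = count_list w b"
  by (induction w) (simp_all add: lookup_add lookup_single when_def)

definition to_sym :: "'b tensor_alg \<Rightarrow> 'b sym_alg" where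
  "to_sym = cpm.ext (\<lambda>w. Poly_Mapping.single (word_mon (letters w)) 1)"

lemma to_sym_add [simp]: "to_sym (s + t) = to_sym s + to_sym t"
  and to_sym_diff [simp]: "to_sym (s - t) = to_sym s - to_sym t"
  and to_sym_zero [simp]: "to_sym 0 = 0"
  and to_sym_scale [simp]: "to_sym (const_pm c * t) = const_pm c * to_sym t"
  and to_sym_sum: "to_sym (sum h A) = (\<Sum>a\<in>A. to_sym (h a))"
  and to_sym_word: "to_sym (word w) = Poly_Mapping.single (word_mon w) 1"
  unfolding to_sym_def by (simp_all add: cpm.ext_sum)

lemma to_sym_mult [simp]: "to_sym (s * t) = to_sym s * to_sym t"
  unfolding to_sym_def by (rule cpm.ext_mult) (simp add: plus_free_mon_def mult_single)

lemma to_sym_const [simp]: "to_sym (const_pm c) = const_pm c"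
  unfolding to_sym_def by (rule cpm.ext_const) (simp add: zero_free_mon_def)

lemma to_sym_one [simp]: "to_sym 1 = 1"
  using to_sym_const[of 1] by simp

lemma to_sym_emb: "to_sym (tens_emb v) = sym_emb v"
  by (simp add: tens_emb_expand sym_emb_expand to_sym_sum to_sym_word)

lemma to_sym_tens_map: "to_sym (tens_map f t) = sym_map f (to_sym t)"
  by (rule tensor_hom_eqI)
     (simp_all add: tens_map_word to_sym_emb to_sym_word sym_map_var[unfolded One_nat_def])

subsection \<open>Degrees of images\<close>

abbreviation tdeg_le :: "nat \<Rightarrow> 'b tensor_alg \<Rightarrow> bool" where
  "tdeg_le \<equiv> deg_le word_deg"

lemma tdeg_le_mult: "tdeg_le m s \<Longrightarrow> tdeg_le n t \<Longrightarrow> tdeg_le (m + n) (s * t)"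
  by (rule deg_le_mult) (simp_all add: word_deg_add)

lemma tdeg_le_const [simp]: "tdeg_le m (const_pm c)"
  by (rule deg_le_const) (simp add: word_deg_add)

lemma tdeg_le_one [simp]: "tdeg_le m 1"
  using tdeg_le_const[of m 1] by simp

lemma tdeg_le_word: "length w \<le> m \<Longrightarrow> tdeg_le m (word w)"
  by (simp add: deg_le_single word_deg_def)

lemma tdeg_le_emb: "tdeg_le 1 (tens_emb v)"
  unfolding tens_emb_expand by (intro deg_le_sum deg_le_scale tdeg_le_word) simp

lemma tdeg_le_prod_emb: "tdeg_le (length w) (prod_list (map (\<lambda>b. tens_emb (f b)) w))"
proof (induction w)
  case (Cons b w)
  show ?case using tdeg_le_mult[OF tdeg_le_emb Cons, of "f b"] by simp
qed simp

lemma tdeg_le_tens_map: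
  assumes "tdeg_le m t" shows "tdeg_le m (tens_map f t)"
  using assms unfolding deg_le_def[of _ _ t]
proof (induction t rule: poly_mapping_keys_induct)
  case (single k c)
  obtain w where k: "k = Word w" by (cases k)
  have "tdeg_le m (tens_map f (word w))"
    unfolding tens_map_word
    by (rule deg_le_mono[OF tdeg_le_prod_emb]) (use single in \<open>simp add: k word_deg_def\<close>)
  then show ?case by (subst single_eq_const_mult) (simp add: k deg_le_scale)
qed (simp_all add: deg_le_add)

lemma deg_le_to_sym:
  assumes "tdeg_le m t" shows "deg_le mon_deg m (to_sym t)"
  using assms unfolding deg_le_def[of _ _ t]
proof (induction t rule: poly_mapping_keys_induct)
  case (single k c)
  then show ?case
    by (subst single_eq_const_mult)
       (auto intro!: deg_le_scale deg_le_single simp: to_sym_def word_deg_def)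
qed (simp_all add: deg_le_add)

section \<open>The cyclic sums in the defining conditions\<close>

lemma Alt3_eq: "Alt3 = {id, cycle_of_list [1, 2, 3], cycle_of_list [1, 3, 2]}"
  (is "_ = {id, ?c, ?d}")
proof -
  have c: "?c = Transposition.transpose 1 2 \<circ> Transposition.transpose 2 (3::nat)"
    and d: "?d = Transposition.transpose 1 3 \<circ> Transposition.transpose 3 (2::nat)"
    by simp_all
  have vals: "?c 1 = 2" "?c 2 = 3" "?c 3 = 1" "?d 1 = 3" "?d 3 = 2" "?d 2 = (1::nat)"
    using cycle_of_list_3[of 1 2 "3::nat"] cycle_of_list_3[of 1 3 "2::nat"] by auto
  have perm: "?c permutes {1..3}" "?d permutes {1..3}"
    unfolding c d by (auto intro!: permutes_compose permutes_swap_id)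
  have ev: "evenperm ?c" "evenperm ?d"
    unfolding c d by (simp_all add: evenperm_comp permutation_swap_id evenperm_swap)
  have id: "id permutes {1..3::nat}" "evenperm (id :: nat \<Rightarrow> nat)"
    by (simp_all add: permutes_id)
  show ?thesis
  proof (intro equalityI subsetI)
    fix p assume "p \<in> Alt3"
    then have p: "p permutes {1..3}" "evenperm p" by (simp_all add: alt_group_carrier)
    have ext: "p = q" if "q permutes {1..3}" "p 1 = q 1" "p 2 = q 2" "p 3 = q 3" for q
    proof
      fix x show "p x = q x"
      proof (cases "x \<in> {1..3}")
        case True
        then have "x = 1 \<or> x = 2 \<or> x = 3" by auto
        then show ?thesis using that by auto
      next
        case False
        then show ?thesis using p(1) that(1) by (simp add: permutes_not_in)
      qed
    qed
    have r: "p 1 \<in> {1,2,3}" "p 2 \<in> {1,2,3}" "p 3 \<in> {1,2,3}"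
      using permutes_in_image[OF p(1), of 1] permutes_in_image[OF p(1), of 2] permutes_in_image[OF p(1), of 3]
      by auto
    have n: "p 1 \<noteq> p 2" "p 1 \<noteq> p 3" "p 2 \<noteq> p 3"
      by (simp_all add: inj_eq[OF permutes_inj[OF p(1)]])
    have odd: "p \<noteq> Transposition.transpose a b" if "a \<noteq> b" for a b
      using p(2) that by (auto simp: evenperm_swap)
    have tr: "Transposition.transpose a b permutes {1..3}" if "a \<in> {1..3}" "b \<in> {1..3}" for a b :: nat
      using that by (rule permutes_swap_id)
    have "p = Transposition.transpose 1 2" if "p 1 = 2 \<and> p 2 = 1 \<and> p 3 = 3"
      by (rule ext[OF tr]) (use that in \<open>simp_all add: transpose_def\<close>)
    moreover have "p = Transposition.transpose 1 3" if "p 1 = 3 \<and> p 2 = 2 \<and> p 3 = 1"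
      by (rule ext[OF tr]) (use that in \<open>simp_all add: transpose_def\<close>)
    moreover have "p = Transposition.transpose 2 3" if "p 1 = 1 \<and> p 2 = 3 \<and> p 3 = 2"
      by (rule ext[OF tr]) (use that in \<open>simp_all add: transpose_def\<close>)
    ultimately have bad: "\<not> (p 1 = 2 \<and> p 2 = 1 \<and> p 3 = 3)" "\<not> (p 1 = 3 \<and> p 2 = 2 \<and> p 3 = 1)"
       "\<not> (p 1 = 1 \<and> p 2 = 3 \<and> p 3 = 2)"
      using odd[of 1 2] odd[of 1 3] odd[of 2 3] by (fastforce, fastforce, fastforce)
    consider "p 1 = 1 \<and> p 2 = 2 \<and> p 3 = 3" | "p 1 = 2 \<and> p 2 = 3 \<and> p 3 = 1" | "p 1 = 3 \<and> p 2 = 1 \<and> p 3 = 2"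
      using r n bad unfolding insert_iff empty_iff by metis
    then show "p \<in> {id, ?c, ?d}"
    proof cases
      case 1
      then have "p = id" by (intro ext[OF id(1)]) simp_all
      then show ?thesis by simp
    next
      case 2
      then have "p = ?c" using vals by (intro ext[OF perm(1)]) (simp_all only:)
      then show ?thesis by blast
    next
      case 3
      then have "p = ?d" using vals by (intro ext[OF perm(2)]) (simp_all only:)
      then show ?thesis by blast
    qed
  next
    fix p assume "p \<in> {id, ?c, ?d}"
    then show "p \<in> Alt3" using perm ev id by (auto simp only: alt_group_carrier insert_iff empty_iff)
  qed
qed

lemma sum_Alt3: "(\<Sum>\<sigma>\<in>Alt3. F (\<sigma> 1) (\<sigma> 2) (\<sigma> 3)) = F 1 2 3 + F 2 3 1 + (F 3 1 2 :: 'a::comm_monoid_add)"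
proof -
  let ?c = "cycle_of_list [1, 2, 3::nat]" and ?d = "cycle_of_list [1, 3, 2::nat]"
  have vals: "?c 1 = 2" "?c 2 = 3" "?c 3 = 1" "?d 1 = 3" "?d 3 = 2" "?d 2 = (1::nat)"
    using cycle_of_list_3[of 1 2 "3::nat"] cycle_of_list_3[of 1 3 "2::nat"] by auto
  have "id \<noteq> ?c" "id \<noteq> ?d" "?c \<noteq> ?d"
  proof -
    show "id \<noteq> ?c" using vals(1) by (metis id_apply one_eq_numeral_iff semiring_norm(85))
    show "id \<noteq> ?d" using vals(4) by (metis id_apply one_eq_numeral_iff semiring_norm(86))
    show "?c \<noteq> ?d" using vals(1,4) by (metis numeral_eq_iff semiring_norm(89))
  qed
  then show ?thesis unfolding Alt3_eq using vals
    by (simp del: cycle_of_list.simps add: add.assoc)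
qed

definition cyc :: "('v \<Rightarrow> 'v \<Rightarrow> 'v \<Rightarrow> 'a::comm_monoid_add) \<Rightarrow> 'v \<Rightarrow> 'v \<Rightarrow> 'v \<Rightarrow> 'a" where
  "cyc F x y z = F x y z + F y z x + F z x y"

lemma sum_Alt3_cyc: "(\<Sum>\<sigma>\<in>Alt3. F (v (\<sigma> 1)) (v (\<sigma> 2)) (v (\<sigma> 3))) = cyc F (v 1) (v 2) (v 3)"
  using sum_Alt3[of "\<lambda>i j k. F (v i) (v j) (v k)"] by (simp add: cyc_def)

lemma all_triples_iff: "(\<forall>v :: nat \<Rightarrow> 'v. P (v 1) (v 2) (v 3)) \<longleftrightarrow> (\<forall>x y z. P x y z)"
proof
  assume *: "\<forall>v :: nat \<Rightarrow> 'v. P (v 1) (v 2) (v 3)"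
  show "\<forall>x y z. P x y z"
  proof (intro allI)
    fix x y z
    show "P x y z"
      using *[rule_format, of "\<lambda>i. if i = 1 then x else if i = 2 then y else z"] by simp
  qed
qed simp

lemma drinfeld_orbifold_map_cyc:
  "drinfeld_orbifold_map G \<rho> \<kappa>L \<kappa>C \<longleftrightarrow>
     cochain G (*s) \<kappa>L \<and> cochain G (*) \<kappa>C \<and>
     (\<forall>g\<in>carrier G. \<forall>u v. \<rho> g (\<kappa>L g u v) = \<kappa>L g u v) \<and>
     (\<forall>g\<in>carrier G. \<forall>h\<in>carrier G. \<forall>u v.
        \<rho> h (\<kappa>L g u v) = \<kappa>L (h \<otimes>\<^bsub>G\<^esub> g \<otimes>\<^bsub>G\<^esub> inv\<^bsub>G\<^esub> h) (\<rho> h u) (\<rho> h v) \<and>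
        \<kappa>C g u v = \<kappa>C (h \<otimes>\<^bsub>G\<^esub> g \<otimes>\<^bsub>G\<^esub> inv\<^bsub>G\<^esub> h) (\<rho> h u) (\<rho> h v)) \<and>
     (\<forall>g\<in>carrier G. \<forall>x y z.
        cyc (\<lambda>x y z. sym_emb (\<kappa>L g y z) * sym_emb (\<rho> g x - x)) x y z = 0 \<and>
        cyc (\<lambda>u v w. \<Sum>(x, y)\<in>{(x, y). x \<in> carrier G \<and> y \<in> carrier G \<and> x \<otimes>\<^bsub>G\<^esub> y = g}.
           \<kappa>L x (u + \<rho> y u) (\<kappa>L y v w)) x y z
        = 2 *s cyc (\<lambda>x y z. \<kappa>C g y z *s (\<rho> g x - x)) x y z \<and>
        cyc (\<lambda>u v w. \<Sum>(x, y)\<in>{(x, y). x \<in> carrier G \<and> y \<in> carrier G \<and> x \<otimes>\<^bsub>G\<^esub> y = g}.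
           \<kappa>C x (u + \<rho> y u) (\<kappa>L y v w)) x y z = 0)"
proof -
  have s1: "(\<Sum>\<sigma>\<in>Alt3. sym_emb (\<kappa>L g (v (\<sigma> 2)) (v (\<sigma> 3))) * sym_emb (\<rho> g (v (\<sigma> 1)) - v (\<sigma> 1)))
      = cyc (\<lambda>x y z. sym_emb (\<kappa>L g y z) * sym_emb (\<rho> g x - x)) (v 1) (v 2) (v 3)" for g v
    by (rule sum_Alt3_cyc)
  have s2: "(\<Sum>\<sigma>\<in>Alt3. \<Sum>(x, y)\<in>{(x, y). x \<in> carrier G \<and> y \<in> carrier G \<and> x \<otimes>\<^bsub>G\<^esub> y = g}.
           \<kappa>L x (v (\<sigma> 1) + \<rho> y (v (\<sigma> 1))) (\<kappa>L y (v (\<sigma> 2)) (v (\<sigma> 3))))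
      = cyc (\<lambda>u v w. \<Sum>(x, y)\<in>{(x, y). x \<in> carrier G \<and> y \<in> carrier G \<and> x \<otimes>\<^bsub>G\<^esub> y = g}.
           \<kappa>L x (u + \<rho> y u) (\<kappa>L y v w)) (v 1) (v 2) (v 3)" for g v
    by (rule sum_Alt3_cyc[where F = "\<lambda>u v w. \<Sum>(x, y)\<in>{(x, y). x \<in> carrier G \<and> y \<in> carrier G \<and> x \<otimes>\<^bsub>G\<^esub> y = g}.
           \<kappa>L x (u + \<rho> y u) (\<kappa>L y v w)"])
  have s3: "(\<Sum>\<sigma>\<in>Alt3. \<Sum>(x, y)\<in>{(x, y). x \<in> carrier G \<and> y \<in> carrier G \<and> x \<otimes>\<^bsub>G\<^esub> y = g}.
           \<kappa>C x (v (\<sigma> 1) + \<rho> y (v (\<sigma> 1))) (\<kappa>L y (v (\<sigma> 2)) (v (\<sigma> 3))))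
      = cyc (\<lambda>u v w. \<Sum>(x, y)\<in>{(x, y). x \<in> carrier G \<and> y \<in> carrier G \<and> x \<otimes>\<^bsub>G\<^esub> y = g}.
           \<kappa>C x (u + \<rho> y u) (\<kappa>L y v w)) (v 1) (v 2) (v 3)" for g v
    by (rule sum_Alt3_cyc[where F = "\<lambda>u v w. \<Sum>(x, y)\<in>{(x, y). x \<in> carrier G \<and> y \<in> carrier G \<and> x \<otimes>\<^bsub>G\<^esub> y = g}.
           \<kappa>C x (u + \<rho> y u) (\<kappa>L y v w)"])
  have s4: "(\<Sum>\<sigma>\<in>Alt3. \<kappa>C g (v (\<sigma> 2)) (v (\<sigma> 3)) *s (\<rho> g (v (\<sigma> 1)) - v (\<sigma> 1)))
      = cyc (\<lambda>x y z. \<kappa>C g y z *s (\<rho> g x - x)) (v 1) (v 2) (v 3)" for g v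
    by (rule sum_Alt3_cyc)
  show ?thesis
    unfolding drinfeld_orbifold_map_def s1 s2 s3 s4
    by (subst all_triples_iff[where P = "\<lambda>x y z. cyc (\<lambda>x y z. sym_emb (\<kappa>L _ y z) * sym_emb (\<rho> _ x - x)) x y z = 0 \<and> _ x y z"], rule refl)
qed

lemma sum_pairs_product:
  assumes "group G" "finite (carrier G)" "g \<in> carrier G"
  shows "(\<Sum>(x, y)\<in>{(x, y). x \<in> carrier G \<and> y \<in> carrier G \<and> x \<otimes>\<^bsub>G\<^esub> y = g}. F x y)
       = (\<Sum>y\<in>carrier G. F (g \<otimes>\<^bsub>G\<^esub> inv\<^bsub>G\<^esub> y) y)"
proof -
  interpret group G by fact
  show ?thesis
    by (rule sum.reindex_bij_witness[where i = "\<lambda>y. (g \<otimes>\<^bsub>G\<^esub> inv\<^bsub>G\<^esub> y, y)" and j = snd])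
       (use assms(3) in \<open>auto simp: m_assoc\<close>)
qed

section \<open>Quadratic symmetric tensors\<close>

lemma word_mon_eq_iff: "word_mon u = word_mon w \<longleftrightarrow> mset u = mset w"
proof
  assume "word_mon u = word_mon w"
  then have "count_list u b = count_list w b" for b by (metis lookup_word_mon)
  then show "mset u = mset w" by (simp add: multiset_eq_iff count_mset)
next
  assume "mset u = mset w"
  then have "count_list u b = count_list w b" for b by (metis count_mset)
  then show "word_mon u = word_mon w" by (intro poly_mapping_eqI) (simp add: lookup_word_mon)
qed

lemma scale_middle: "s * (const_pm c * t) = const_pm c * (s * t)"
  by (simp only: mult.assoc[symmetric] const_pm_central[of c s])

lemma scale_mult_scale: "const_pm x * p * (const_pm y * q) = const_pm (x * y) * (p * q)"
  by (subst scale_middle, subst mult.commute[of x y], simp add: mult.assoc)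

text \<open>
  The quadratic part of the symmetric algebra embeds in the tensor square by symmetrisation,
  \<open>uv \<mapsto> u \<otimes> v + v \<otimes> u\<close>. This turns condition (ii), an equation between polynomials, into an equation
  between tensors.
\<close>

lemma symmetric_square_embedding:
  obtains S :: "'b::finite sym_alg \<Rightarrow> 'b tensor_alg"
  where "S 0 = 0" "\<And>p q. S (p + q) = S p + S q"
    and "\<And>u v. S (sym_emb u * sym_emb v) = tens_emb u * tens_emb v + tens_emb v * tens_emb u"
proof
  define \<psi> :: "('b \<Rightarrow>\<^sub>0 nat) \<Rightarrow> 'b tensor_alg"
    where "\<psi> m = (let w = SOME w. word_mon w = m in word w + word (rev w))" for m
  have \<psi>: "\<psi> (Poly_Mapping.single b 1 + Poly_Mapping.single c 1) = word [b] * word [c] + word [c] * word [b]" for b c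
  proof -
    have bc: "Poly_Mapping.single b 1 + Poly_Mapping.single c 1 = word_mon [b, c]" by simp
    define w where "w = (SOME w. word_mon w = word_mon [b, c])"
    have "word_mon w = word_mon [b, c]" unfolding w_def by (rule someI[of _ "[b, c]"]) (rule refl)
    then have "mset w = mset [b, c]" by (simp only: word_mon_eq_iff)
    then have "w = [b, c] \<or> w = [c, b]"
    proof -
      assume *: "mset w = mset [b, c]"
      then have "length w = 2" by (metis length_Cons list.size(3) mset_eq_length numeral_2_eq_2)
      then obtain p q where "w = [p, q]" by (auto simp: numeral_2_eq_2 length_Suc_conv)
      then show ?thesis using * by (auto simp: add_eq_conv_ex)
    qed
    then show ?thesis
      unfolding \<psi>_def bc Let_def w_def[symmetric]
      by (auto simp: add.commute simp flip: word_append)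
  qed
  show "cpm.ext \<psi> 0 = 0" by simp
  show "cpm.ext \<psi> (p + q) = cpm.ext \<psi> p + cpm.ext \<psi> q" for p q by simp
  show "cpm.ext \<psi> (sym_emb u * sym_emb v) = tens_emb u * tens_emb v + tens_emb v * tens_emb u" for u v
  proof -
    have mons: "Poly_Mapping.single m (1::complex) * Poly_Mapping.single m' 1 = Poly_Mapping.single (m + m') 1"
      for m m' :: "'b \<Rightarrow>\<^sub>0 nat" by (simp add: mult_single)
    have s: "sym_emb u * sym_emb v = (\<Sum>b\<in>UNIV. \<Sum>c\<in>UNIV. const_pm (u $ b * v $ c) *
        Poly_Mapping.single (Poly_Mapping.single b 1 + Poly_Mapping.single c 1) 1)"
      by (simp only: sym_emb_expand sum_product scale_mult_scale mons)
    have t1: "tens_emb u * tens_emb v = (\<Sum>b\<in>UNIV. \<Sum>c\<in>UNIV. const_pm (u $ b * v $ c) * (word [b] * word [c]))"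
      by (simp only: tens_emb_expand sum_product scale_mult_scale)
    have t2: "tens_emb v * tens_emb u = (\<Sum>b\<in>UNIV. \<Sum>c\<in>UNIV. const_pm (u $ b * v $ c) * (word [c] * word [b]))"
      by (simp only: tens_emb_expand sum_product scale_mult_scale) (subst sum.swap, simp only: mult.commute)
    show ?thesis
      unfolding s t1 t2
      by (simp only: cpm.ext_sum cpm.ext_scale cpm.ext_single \<psi> const_pm_simps(2) mult_1_left distrib_left sum.distrib)
  qed
qed

section \<open>Functionals that respect the relations\<close>

locale finite_rep = group G for G :: "'g monoid" (structure) +
  fixes \<rho> :: "'g \<Rightarrow> complex ^ 'b::finite \<Rightarrow> complex ^ 'b"
  assumes finite_carrier: "finite (carrier G)"
    and \<rho>_linear: "g \<in> carrier G \<Longrightarrow> Vector_Spaces.linear (*s) (*s) (\<rho> g)"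
    and \<rho>_mult: "g \<in> carrier G \<Longrightarrow> h \<in> carrier G \<Longrightarrow> \<rho> (g \<otimes> h) v = \<rho> g (\<rho> h v)"
    and \<rho>_one: "\<rho> \<one> v = v"
begin

abbreviation T where "T g \<equiv> tens_map (\<rho> g)"

lemma T_mult: "g \<in> carrier G \<Longrightarrow> h \<in> carrier G \<Longrightarrow> T (g \<otimes> h) t = T g (T h t)"
proof -
  assume gh: "g \<in> carrier G" "h \<in> carrier G"
  then have "\<rho> (g \<otimes> h) = (\<lambda>v. \<rho> g (\<rho> h v))" by (intro ext) (rule \<rho>_mult)
  then show ?thesis by (simp add: tens_map_comp \<rho>_linear gh)
qed

lemma T_one: "T \<one> t = t"
  using tens_map_id[of t] by (simp add: \<rho>_one[abs_def])

lemma T_emb: "g \<in> carrier G \<Longrightarrow> T g (tens_emb v) = tens_emb (\<rho> g v)"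
  by (simp add: tens_map_emb \<rho>_linear)

lemma sum_conj:
  assumes "g \<in> carrier G"
  shows "(\<Sum>k\<in>carrier G. F (g \<otimes> k \<otimes> inv g)) = (\<Sum>k\<in>carrier G. F k)"
  by (rule sum.reindex_bij_witness[where i = "\<lambda>k. inv g \<otimes> k \<otimes> g" and j = "\<lambda>k. g \<otimes> k \<otimes> inv g"])
     (use assms in \<open>auto simp: m_assoc\<close>, simp_all flip: m_assoc)

lemma sum_product_fibres:
  "(\<Sum>y\<in>carrier G. \<Sum>x\<in>carrier G. F x y)
   = (\<Sum>p\<in>carrier G. \<Sum>(x, y)\<in>{(x, y). x \<in> carrier G \<and> y \<in> carrier G \<and> x \<otimes> y = p}. F x y)"
proof -
  have "(\<Sum>y\<in>carrier G. \<Sum>x\<in>carrier G. F x y) = (\<Sum>(x, y)\<in>carrier G \<times> carrier G. F x y)"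
    by (subst sum.swap) (simp add: sum.cartesian_product)
  also have "\<dots> = (\<Sum>p\<in>carrier G. \<Sum>(x, y)\<in>{z \<in> carrier G \<times> carrier G. (\<lambda>(x, y). x \<otimes> y) z = p}. F x y)"
    by (rule sum.group[symmetric]) (auto simp: finite_carrier)
  also have "\<dots> = (\<Sum>p\<in>carrier G. \<Sum>(x, y)\<in>{(x, y). x \<in> carrier G \<and> y \<in> carrier G \<and> x \<otimes> y = p}. F x y)"
    by (intro sum.cong) auto
  finally show ?thesis .
qed

end

locale drinfeld_data = finite_rep G \<rho>
  for G :: "'g monoid" (structure) and \<rho> :: "'g \<Rightarrow> complex ^ 'b::finite \<Rightarrow> complex ^ 'b" +
  fixes \<kappa>L :: "('g, 'b) lin_cochain" and \<kappa>C :: "('g, 'b) const_cochain"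
  assumes drinfeld: "drinfeld_orbifold_map G \<rho> \<kappa>L \<kappa>C"
begin

text \<open>
  The relations of the quotient read \<open>vw - wv = \<Sum>g. K g v w \<otimes> g\<close>.
\<close>

definition K :: "'g \<Rightarrow> complex ^ 'b \<Rightarrow> complex ^ 'b \<Rightarrow> 'b tensor_alg" where
  "K g v w = tens_emb (\<kappa>L g v w) + const_pm (\<kappa>C g v w)"

lemma skew_\<kappa>: "g \<in> carrier G \<Longrightarrow> skew_bilinear (*s) (\<kappa>L g)" "g \<in> carrier G \<Longrightarrow> skew_bilinear (*) (\<kappa>C g)"
  using drinfeld by (auto simp: drinfeld_orbifold_map_def cochain_def)

lemma \<kappa>_linear:
  assumes "g \<in> carrier G"
  shows "\<kappa>L g (u + v) w = \<kappa>L g u w + \<kappa>L g v w" "\<kappa>L g (c *s u) w = c *s \<kappa>L g u w"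
    "\<kappa>L g w (u + v) = \<kappa>L g w u + \<kappa>L g w v" "\<kappa>L g w (c *s u) = c *s \<kappa>L g w u"
    "\<kappa>C g (u + v) w = \<kappa>C g u w + \<kappa>C g v w" "\<kappa>C g (c *s u) w = c * \<kappa>C g u w"
    "\<kappa>C g w (u + v) = \<kappa>C g w u + \<kappa>C g w v" "\<kappa>C g w (c *s u) = c * \<kappa>C g w u"
proof -
  have l: "Vector_Spaces.linear (*s) (*s) (\<kappa>L g w)" "Vector_Spaces.linear (*s) (*s) (\<lambda>u. \<kappa>L g u w)"
    "Vector_Spaces.linear (*s) (*) (\<kappa>C g w)" "Vector_Spaces.linear (*s) (*) (\<lambda>u. \<kappa>C g u w)" for w
    using skew_\<kappa>[OF assms] unfolding skew_bilinear_def by blast+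
  note a = Vector_Spaces.linear_iff[THEN iffD1, THEN conjunct2, THEN conjunct2, THEN conjunct1, rule_format]
  note s = Vector_Spaces.linear_iff[THEN iffD1, THEN conjunct2, THEN conjunct2, THEN conjunct2, rule_format]
  show "\<kappa>L g (u + v) w = \<kappa>L g u w + \<kappa>L g v w" by (rule a[OF l(2)])
  show "\<kappa>L g (c *s u) w = c *s \<kappa>L g u w" by (rule s[OF l(2)])
  show "\<kappa>L g w (u + v) = \<kappa>L g w u + \<kappa>L g w v" by (rule a[OF l(1)])
  show "\<kappa>L g w (c *s u) = c *s \<kappa>L g w u" by (rule s[OF l(1)])
  show "\<kappa>C g (u + v) w = \<kappa>C g u w + \<kappa>C g v w" by (rule a[OF l(4)])
  show "\<kappa>C g (c *s u) w = c * \<kappa>C g u w" by (rule s[OF l(4)])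
  show "\<kappa>C g w (u + v) = \<kappa>C g w u + \<kappa>C g w v" by (rule a[OF l(3)])
  show "\<kappa>C g w (c *s u) = c * \<kappa>C g w u" by (rule s[OF l(3)])
qed

lemma K_linear:
  assumes "g \<in> carrier G"
  shows "K g (u + v) w = K g u w + K g v w" "K g (c *s u) w = const_pm c * K g u w"
    "K g w (u + v) = K g w u + K g w v" "K g w (c *s u) = const_pm c * K g w u"
  by (simp_all add: K_def \<kappa>_linear[OF assms] algebra_simps)

lemma K_zero: "g \<in> carrier G \<Longrightarrow> K g 0 w = 0" "g \<in> carrier G \<Longrightarrow> K g w 0 = 0"
  using K_linear(2)[of g 0 0 w] K_linear(4)[of g w 0 0] by simp_all

lemma K_skew: "g \<in> carrier G \<Longrightarrow> K g v w = - K g w v"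
proof -
  assume "g \<in> carrier G"
  then have "\<kappa>L g v w = - \<kappa>L g w v" "\<kappa>C g v w = - \<kappa>C g w v"
    using skew_\<kappa>[of g] unfolding skew_bilinear_def by blast+
  then show ?thesis by (simp add: K_def)
qed

lemma K_invariant:
  assumes "g \<in> carrier G" "h \<in> carrier G"
  shows "T h (K g v w) = K (h \<otimes> g \<otimes> inv h) (\<rho> h v) (\<rho> h w)"
proof -
  have "\<rho> h (\<kappa>L g v w) = \<kappa>L (h \<otimes> g \<otimes> inv h) (\<rho> h v) (\<rho> h w)"
    "\<kappa>C g v w = \<kappa>C (h \<otimes> g \<otimes> inv h) (\<rho> h v) (\<rho> h w)"
    using drinfeld assms unfolding drinfeld_orbifold_map_def by blast+
  then show ?thesis by (simp add: K_def T_emb assms)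
qed

lemma tdeg_le_K: "tdeg_le 1 (K g v w)"
  unfolding K_def by (intro deg_le_add tdeg_le_emb tdeg_le_const)

text \<open>
  The left-hand side is the component at \<open>g\<close> of the Jacobi expression of three vectors, computed
  with the right-hand sides of the relations. Writing \<open>x\<close> and \<open>\<^sup>gx\<close> in terms of their sum and their
  difference, the products with the difference add up to the symmetrised form of (ii) and vanish. What
  remains are commutators, to which the relations apply again.
\<close>

lemma overlap:
  assumes g: "g \<in> carrier G"
  shows "cyc (\<lambda>x y z. tens_emb x * K g y z - K g y z * tens_emb (\<rho> g x)) x y z
       = const_pm (1/2) * cyc (\<lambda>x y z. tens_emb (x + \<rho> g x) * tens_emb (\<kappa>L g y z)
            - tens_emb (\<kappa>L g y z) * tens_emb (x + \<rho> g x)) x y z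
         - tens_emb (cyc (\<lambda>x y z. \<kappa>C g y z *s (\<rho> g x - x)) x y z)"
proof -
  obtain S :: "'b sym_alg \<Rightarrow> 'b tensor_alg" where S: "S 0 = 0" "\<And>p q. S (p + q) = S p + S q"
    "\<And>u v. S (sym_emb u * sym_emb v) = tens_emb u * tens_emb v + tens_emb v * tens_emb u"
    using symmetric_square_embedding by blast
  have "cyc (\<lambda>x y z. sym_emb (\<kappa>L g y z) * sym_emb (\<rho> g x - x)) x y z = 0"
    using drinfeld g unfolding drinfeld_orbifold_map_cyc by blast
  then have "S (cyc (\<lambda>x y z. sym_emb (\<kappa>L g y z) * sym_emb (\<rho> g x - x)) x y z) = 0"
    using S(1) by simp
  then have sym: "cyc (\<lambda>x y z. tens_emb (\<kappa>L g y z) * tens_emb (\<rho> g x - x)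
      + tens_emb (\<rho> g x - x) * tens_emb (\<kappa>L g y z)) x y z = 0"
    unfolding cyc_def by (simp only: S(2,3))
  have half: "const_pm (1/2) * (t + t) = t" for t :: "'b tensor_alg"
  proof -
    have "const_pm (1/2) * (t + t) = const_pm (1/2 + 1/2) * t"
      by (simp only: distrib_left distrib_right const_pm_simps(3))
    then show ?thesis by simp
  qed
  have single_term: "tens_emb x * K g y z - K g y z * tens_emb (\<rho> g x)
     = const_pm (1/2) * (tens_emb (x + \<rho> g x) * tens_emb (\<kappa>L g y z) - tens_emb (\<kappa>L g y z) * tens_emb (x + \<rho> g x))
      - const_pm (1/2) * (tens_emb (\<kappa>L g y z) * tens_emb (\<rho> g x - x) + tens_emb (\<rho> g x - x) * tens_emb (\<kappa>L g y z))
      - tens_emb (\<kappa>C g y z *s (\<rho> g x - x))" for x y z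
  proof -
    let ?x = "tens_emb x" and ?g = "tens_emb (\<rho> g x)" and ?l = "tens_emb (\<kappa>L g y z)" and ?c = "const_pm (\<kappa>C g y z) :: 'b tensor_alg"
    have "const_pm (1/2) * ((?x + ?g) * ?l - ?l * (?x + ?g)) - const_pm (1/2) * (?l * (?g - ?x) + (?g - ?x) * ?l)
        = const_pm (1/2) * ((?x * ?l - ?l * ?g) + (?x * ?l - ?l * ?g))"
      by (simp add: algebra_simps)
    then have "const_pm (1/2) * ((?x + ?g) * ?l - ?l * (?x + ?g)) - const_pm (1/2) * (?l * (?g - ?x) + (?g - ?x) * ?l)
        = ?x * ?l - ?l * ?g" by (simp only: half)
    moreover have "?x * ?c = ?c * ?x" by (rule const_pm_central[symmetric])
    ultimately show ?thesis
      by (simp add: K_def algebra_simps)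
  qed
  show ?thesis
    using arg_cong[OF sym, of "\<lambda>t. const_pm (1/2) * t"]
    unfolding cyc_def single_term by (simp add: algebra_simps)
qed

text \<open>
  A linear functional on \<open>T(V)#G\<close> is a family \<open>N\<close> of functions on words, one for each group element;
  its value on \<open>t \<otimes> h\<close> is \<open>L N h t\<close>. It kills the multiple of a relation by \<open>s\<close> from the left and by
  \<open>t \<otimes> h\<close> from the right if the equation in \<open>kills_upto\<close> holds: moving \<open>g\<close> past \<open>t\<close> applies \<open>g\<close> to \<open>t\<close>
  and leaves the group element \<open>g \<otimes> h\<close>.
\<close>

abbreviation L :: "('g \<Rightarrow> 'b free_mon \<Rightarrow> complex) \<Rightarrow> 'g \<Rightarrow> 'b tensor_alg \<Rightarrow> complex" where
  "L N h \<equiv> cid.ext (N h)"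

definition kills_upto :: "nat \<Rightarrow> ('g \<Rightarrow> 'b free_mon \<Rightarrow> complex) \<Rightarrow> bool" where
  "kills_upto D N \<longleftrightarrow> (\<forall>h\<in>carrier G. \<forall>v w s t m n. tdeg_le m s \<longrightarrow> tdeg_le n t \<longrightarrow> m + n + 2 \<le> D \<longrightarrow>
     L N h (s * (tens_emb v * tens_emb w - tens_emb w * tens_emb v) * t)
     = (\<Sum>g\<in>carrier G. L N (g \<otimes> h) (s * K g v w * T g t)))"

definition word_kills_upto :: "nat \<Rightarrow> ('g \<Rightarrow> 'b free_mon \<Rightarrow> complex) \<Rightarrow> bool" where
  "word_kills_upto D N \<longleftrightarrow> (\<forall>h\<in>carrier G. \<forall>u b c w. length u + length w + 2 \<le> D \<longrightarrow>
     N h (Word (u @ b # c # w)) - N h (Word (u @ c # b # w))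
     = (\<Sum>g\<in>carrier G. L N (g \<otimes> h) (word u * K g (axis b 1) (axis c 1) * T g (word w))))"

text \<open>
  Both sides of the equation are linear in each of \<open>s\<close>, \<open>v\<close>, \<open>w\<close> and \<open>t\<close>.
\<close>

lemma kills_uptoI:
  assumes W: "word_kills_upto D N"
  shows "kills_upto D N"
  unfolding kills_upto_def
proof (intro ballI allI impI)
  fix h v w and s t :: "'b tensor_alg" and m n
  assume h: "h \<in> carrier G" and s: "tdeg_le m s" and t: "tdeg_le n t" and D: "m + n + 2 \<le> D"
  let ?P = "\<lambda>s v w t. L N h (s * (tens_emb v * tens_emb w - tens_emb w * tens_emb v) * t)
     = (\<Sum>g\<in>carrier G. L N (g \<otimes> h) (s * K g v w * T g t))"
  have 1: "?P (word u) (axis b 1) (axis c 1) (word w)" if "length u \<le> m" "length w \<le> n" for u w b c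
  proof -
    have "word u * (tens_emb (axis b 1) * tens_emb (axis c 1) - tens_emb (axis c 1) * tens_emb (axis b 1)) * word w
        = word (u @ b # c # w) - word (u @ c # b # w)"
      by (simp add: tens_emb_axis left_diff_distrib right_diff_distrib mult_single plus_free_mon_def)
    then show ?thesis using W h that D unfolding word_kills_upto_def by simp
  qed
  have 2: "?P (word u) v w (word r)" if "length u \<le> m" "length r \<le> n" for u r v w
  proof -
    have add1: "?P (word u) (a + a') w (word r)" if "?P (word u) a w (word r)" "?P (word u) a' w (word r)" for a a' w
      using that by (simp add: K_linear algebra_simps sum.distrib)
    have scale1: "?P (word u) (c *s a) w (word r)" if "?P (word u) a w (word r)" for c a w
      using that by (simp add: K_linear scale_middle mult.assoc sum_distrib_left flip: right_diff_distrib)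
    have sum1: "?P (word u) (\<Sum>b\<in>A. v $ b *s axis b 1) w (word r)" if "\<And>b. ?P (word u) (axis b 1) w (word r)" "finite A" for A v w
      using that(2)
    proof (induction A)
      case (insert x F)
      show ?case unfolding sum.insert[OF insert.hyps] by (rule add1[OF scale1[OF that(1)] insert.IH])
    qed (simp add: K_zero)
    have add2: "?P (word u) w (a + a') (word r)" if "?P (word u) w a (word r)" "?P (word u) w a' (word r)" for a a' w
      using that by (simp add: K_linear algebra_simps sum.distrib)
    have scale2: "?P (word u) w (c *s a) (word r)" if "?P (word u) w a (word r)" for c a w
      using that by (simp add: K_linear scale_middle mult.assoc sum_distrib_left flip: right_diff_distrib)
    have sum2: "?P (word u) w (\<Sum>b\<in>A. v $ b *s axis b 1) (word r)" if "\<And>b. ?P (word u) w (axis b 1) (word r)" "finite A" for A v w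
      using that(2)
    proof (induction A)
      case (insert x F)
      show ?case unfolding sum.insert[OF insert.hyps] by (rule add2[OF scale2[OF that(1)] insert.IH])
    qed (simp add: K_zero)
    have "?P (word u) (axis b 1) (\<Sum>c\<in>UNIV. w $ c *s axis c 1) (word r)" for b
      by (rule sum2) (simp_all only: 1 that finite)
    then have *: "?P (word u) (axis b 1) w (word r)" for b by (simp only: basis_expansion)
    have "?P (word u) (\<Sum>b\<in>UNIV. v $ b *s axis b 1) w (word r)"
      by (rule sum1) (simp_all only: * finite)
    then show ?thesis by (simp only: basis_expansion)
  qed
  have 3: "?P (word u) v w t" if u: "length u \<le> m" for u
    using t unfolding deg_le_def[of _ _ t]
  proof (induction t rule: poly_mapping_keys_induct)
    case (add x y)
    then show ?case by (simp add: distrib_left sum.distrib)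
  next
    case (single k c)
    moreover obtain r where k: "k = Word r" by (cases k)
    ultimately have "?P (word u) v w (Poly_Mapping.single k 1)" using 2[OF u] by (simp add: word_deg_def)
    then show ?case
      by (subst (1 2) single_eq_const_mult)
         (simp add: scale_middle sum_distrib_left)
  qed simp
  show "?P s v w t"
    using s unfolding deg_le_def[of _ _ s]
  proof (induction s rule: poly_mapping_keys_induct)
    case (add x y)
    then show ?case by (simp add: distrib_right sum.distrib)
  next
    case (single k c)
    moreover obtain r where k: "k = Word r" by (cases k)
    ultimately have "?P (Poly_Mapping.single k 1) v w t" using 3 by (simp add: word_deg_def)
    then show ?case
      by (subst (1 2) single_eq_const_mult)
         (simp add: mult.assoc sum_distrib_left)
  qed simp
qed

lemma L_cong:
  assumes "tdeg_le D t" "\<And>w. word_deg w \<le> D \<Longrightarrow> N h w = N' h w"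
  shows "L N h t = L N' h t"
  unfolding cid.ext_def by (rule sum.cong) (use assms in \<open>auto simp: deg_le_def\<close>)

lemma tdeg_le_insert:
  assumes "length u + length w + 1 \<le> D"
  shows "tdeg_le D (word u * K g v v' * T g (word w))"
proof -
  have "tdeg_le (length u + 1 + length w) (word u * K g v v' * T g (word w))"
    by (intro tdeg_le_mult tdeg_le_tens_map tdeg_le_K tdeg_le_word order_refl)
  then show ?thesis by (rule deg_le_mono) (use assms in simp)
qed

lemma kills_uptoD:
  assumes "kills_upto D N" "h \<in> carrier G" "tdeg_le m s" "tdeg_le n t" "m + n + 2 \<le> D"
  shows "L N h (s * (tens_emb v * tens_emb w - tens_emb w * tens_emb v) * t)
     = (\<Sum>g\<in>carrier G. L N (g \<otimes> h) (s * K g v w * T g t))"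
  using assms unfolding kills_upto_def by blast

text \<open>
  The change that the relations force on the value at \<open>h\<close> when \<open>b\<close> and \<open>c\<close> are exchanged in a word
  of length \<open>D + 1\<close>. The value 0 for words of other lengths is trivially compatible with itself, so that
  all words can be treated at once.
\<close>

definition jump :: "nat \<Rightarrow> ('g \<Rightarrow> 'b free_mon \<Rightarrow> complex) \<Rightarrow> 'g \<Rightarrow> 'b list \<Rightarrow> 'b \<Rightarrow> 'b \<Rightarrow> 'b list \<Rightarrow> complex" where
  "jump D N h u b c w = (if length u + length w + 1 = D
     then \<Sum>g\<in>carrier G. L N (g \<otimes> h) (word u * K g (axis b 1) (axis c 1) * T g (word w)) else 0)"

lemma jump_antisym: "jump D N h u b c w = - jump D N h u c b w"
proof -
  have "L N (g \<otimes> h) (word u * K g (axis b 1) (axis c 1) * T g (word w))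
    = - L N (g \<otimes> h) (word u * K g (axis c 1) (axis b 1) * T g (word w))" if "g \<in> carrier G" for g
    by (subst K_skew[OF that]) simp
  then show ?thesis by (simp add: jump_def sum_negf)
qed

text \<open>
  Applying the relation for one pair and then the relation for the other pair gives, in either
  order, a double sum over the group. By (i) the two sums agree term by term after one summation
  index has been conjugated by the other.
\<close>

lemma jump_far:
  assumes N: "kills_upto D N" and h: "h \<in> carrier G"
  shows "jump D N h u a b (v @ c # d # w) - jump D N h u a b (v @ d # c # w)
       = jump D N h (u @ a # b # v) c d w - jump D N h (u @ b # a # v) c d w"
proof (cases "length u + length v + length w + 3 = D")
  case True
  let ?e = "\<lambda>b. axis b 1 :: complex ^ 'b"
  let ?X = "\<lambda>g. word u * K g (?e a) (?e b) * T g (word v)"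
  have diff1: "word (v @ c # d # w) - word (v @ d # c # w)
      = word v * (tens_emb (?e c) * tens_emb (?e d) - tens_emb (?e d) * tens_emb (?e c)) * word w"
    by (simp add: tens_emb_axis left_diff_distrib right_diff_distrib mult_single plus_free_mon_def)
  have diff2: "word (u @ a # b # v) - word (u @ b # a # v)
      = word u * (tens_emb (?e a) * tens_emb (?e b) - tens_emb (?e b) * tens_emb (?e a)) * word v"
    by (simp add: tens_emb_axis left_diff_distrib right_diff_distrib mult_single plus_free_mon_def)
  have "jump D N h u a b (v @ c # d # w) - jump D N h u a b (v @ d # c # w)
      = (\<Sum>g\<in>carrier G. L N (g \<otimes> h) (word u * K g (?e a) (?e b) * T g (word (v @ c # d # w) - word (v @ d # c # w))))"
    using True by (simp add: jump_def algebra_simps sum_subtractf)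
  also have "\<dots> = (\<Sum>g\<in>carrier G. L N (g \<otimes> h) (?X g * (tens_emb (\<rho> g (?e c)) * tens_emb (\<rho> g (?e d))
      - tens_emb (\<rho> g (?e d)) * tens_emb (\<rho> g (?e c))) * T g (word w)))"
    unfolding diff1 by (rule sum.cong) (simp_all add: T_emb mult.assoc)
  also have "\<dots> = (\<Sum>g\<in>carrier G. \<Sum>k\<in>carrier G. L N (k \<otimes> (g \<otimes> h))
      (?X g * K k (\<rho> g (?e c)) (\<rho> g (?e d)) * T k (T g (word w))))"
  proof (rule sum.cong[OF refl])
    fix g assume g: "g \<in> carrier G"
    have 1: "tdeg_le (length u + 1 + length v) (?X g)"
      by (intro tdeg_le_mult tdeg_le_tens_map tdeg_le_K tdeg_le_word order_refl)
    have 2: "tdeg_le (length w) (T g (word w))"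
      by (intro tdeg_le_tens_map tdeg_le_word order_refl)
    show "L N (g \<otimes> h) (?X g * (tens_emb (\<rho> g (?e c)) * tens_emb (\<rho> g (?e d))
      - tens_emb (\<rho> g (?e d)) * tens_emb (\<rho> g (?e c))) * T g (word w)) = (\<Sum>k\<in>carrier G. L N (k \<otimes> (g \<otimes> h))
      (?X g * K k (\<rho> g (?e c)) (\<rho> g (?e d)) * T k (T g (word w))))"
      by (rule kills_uptoD[OF N _ 1 2]) (use g h True in auto)
  qed
  also have "\<dots> = (\<Sum>g\<in>carrier G. \<Sum>k\<in>carrier G. L N (g \<otimes> (k \<otimes> h))
      (word u * K g (?e a) (?e b) * T g (word v * K k (?e c) (?e d) * T k (word w))))"
  proof (rule sum.cong[OF refl])
    fix g assume g: "g \<in> carrier G"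
    have "(\<Sum>k\<in>carrier G. L N (k \<otimes> (g \<otimes> h)) (?X g * K k (\<rho> g (?e c)) (\<rho> g (?e d)) * T k (T g (word w))))
      = (\<Sum>k\<in>carrier G. L N (g \<otimes> k \<otimes> inv g \<otimes> (g \<otimes> h))
          (?X g * K (g \<otimes> k \<otimes> inv g) (\<rho> g (?e c)) (\<rho> g (?e d)) * T (g \<otimes> k \<otimes> inv g) (T g (word w))))"
      by (rule sum_conj[OF g, symmetric])
    also have "\<dots> = (\<Sum>k\<in>carrier G. L N (g \<otimes> (k \<otimes> h))
      (word u * K g (?e a) (?e b) * T g (word v * K k (?e c) (?e d) * T k (word w))))"
    proof (rule sum.cong[OF refl])
      fix k assume k: "k \<in> carrier G"
      have 1: "g \<otimes> k \<otimes> inv g \<otimes> (g \<otimes> h) = g \<otimes> (k \<otimes> h)"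
        using g k h by (metis inv_closed inv_solve_right m_assoc m_closed)
      have "g \<otimes> k \<otimes> inv g \<otimes> g = g \<otimes> k"
        using g k by (simp add: m_assoc)
      then have 2: "T (g \<otimes> k \<otimes> inv g) (T g (word w)) = T g (T k (word w))"
        using g k by (simp flip: T_mult)
      show "L N (g \<otimes> k \<otimes> inv g \<otimes> (g \<otimes> h))
          (?X g * K (g \<otimes> k \<otimes> inv g) (\<rho> g (?e c)) (\<rho> g (?e d)) * T (g \<otimes> k \<otimes> inv g) (T g (word w)))
        = L N (g \<otimes> (k \<otimes> h)) (word u * K g (?e a) (?e b) * T g (word v * K k (?e c) (?e d) * T k (word w)))"
        unfolding 1 2 by (simp add: K_invariant g k mult.assoc)
    qed
    finally show "(\<Sum>k\<in>carrier G. L N (k \<otimes> (g \<otimes> h)) (?X g * K k (\<rho> g (?e c)) (\<rho> g (?e d)) * T k (T g (word w))))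
      = (\<Sum>k\<in>carrier G. L N (g \<otimes> (k \<otimes> h))
      (word u * K g (?e a) (?e b) * T g (word v * K k (?e c) (?e d) * T k (word w))))" .
  qed
  also have "\<dots> = (\<Sum>k\<in>carrier G. \<Sum>g\<in>carrier G. L N (g \<otimes> (k \<otimes> h))
      (word u * K g (?e a) (?e b) * T g (word v * K k (?e c) (?e d) * T k (word w))))"
    by (rule sum.swap)
  also have "\<dots> = (\<Sum>k\<in>carrier G. L N (k \<otimes> h) (word u * (tens_emb (?e a) * tens_emb (?e b) - tens_emb (?e b) * tens_emb (?e a))
      * (word v * K k (?e c) (?e d) * T k (word w))))"
  proof (rule sum.cong[OF refl])
    fix k assume k: "k \<in> carrier G"
    have "tdeg_le (length v + 1 + length w) (word v * K k (?e c) (?e d) * T k (word w))"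
      by (intro tdeg_le_mult tdeg_le_tens_map tdeg_le_K tdeg_le_word order_refl)
    then show "(\<Sum>g\<in>carrier G. L N (g \<otimes> (k \<otimes> h)) (word u * K g (?e a) (?e b) * T g (word v * K k (?e c) (?e d) * T k (word w))))
      = L N (k \<otimes> h) (word u * (tens_emb (?e a) * tens_emb (?e b) - tens_emb (?e b) * tens_emb (?e a))
      * (word v * K k (?e c) (?e d) * T k (word w)))"
      by (intro kills_uptoD[OF N, symmetric] tdeg_le_word order_refl) (use k h True in auto)
  qed
  also have "\<dots> = (\<Sum>k\<in>carrier G. L N (k \<otimes> h) ((word (u @ a # b # v) - word (u @ b # a # v)) * K k (?e c) (?e d) * T k (word w)))"
    unfolding diff2 by (simp only: mult.assoc)
  also have "\<dots> = jump D N h (u @ a # b # v) c d w - jump D N h (u @ b # a # v) c d w"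
    using True by (simp add: jump_def algebra_simps sum_subtractf)
  finally show ?thesis .
qed (simp add: jump_def)

text \<open>
  The difference of the two sides is the value of the functional on the overlap of the relations. The
  commutators of the overlap have degree at most \<open>D\<close>, so the functional turns them into the sums over
  factorisations \<open>k \<otimes> g = p\<close> that occur in (iii) and (iv).
\<close>

lemma jump_braid:
  assumes N: "kills_upto D N" and h: "h \<in> carrier G"
  shows "jump D N h u x y (z # w) + jump D N h (u @ [y]) x z w + jump D N h u y z (x # w)
       = jump D N h (u @ [x]) y z w + jump D N h u x z (y # w) + jump D N h (u @ [z]) x y w"
proof (cases "length u + length w + 2 = D")
  case True
  let ?e = "\<lambda>b. axis b 1 :: complex ^ 'b"
  let ?x = "?e x" and ?y = "?e y" and ?z = "?e z"
  let ?J = "\<lambda>g. cyc (\<lambda>x y z. tens_emb x * K g y z - K g y z * tens_emb (\<rho> g x)) ?x ?y ?z"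
  let ?M = "\<lambda>k g x y z. K k (x + \<rho> g x) (\<kappa>L g y z)"
  let ?U = "\<lambda>g t. word u * t * T g (word w)"
  have head: "T g (word (b # w)) = tens_emb (\<rho> g (?e b)) * T g (word w)" if "g \<in> carrier G" for g b
    by (subst word_Cons) (simp add: T_emb that flip: tens_emb_axis)
  have tail: "word (u @ [b]) = word u * tens_emb (?e b)" for b
    by (simp add: word_append tens_emb_axis)
  have "jump D N h u x y (z # w) + jump D N h (u @ [y]) x z w + jump D N h u y z (x # w)
      - (jump D N h (u @ [x]) y z w + jump D N h u x z (y # w) + jump D N h (u @ [z]) x y w)
      = - (\<Sum>g\<in>carrier G. L N (g \<otimes> h) (?U g (?J g)))"
  proof -
    have "L N (g \<otimes> h) (word u * K g ?x ?y * T g (word (z # w))) + L N (g \<otimes> h) (word (u @ [y]) * K g ?x ?z * T g (word w))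
       + L N (g \<otimes> h) (word u * K g ?y ?z * T g (word (x # w)))
       - (L N (g \<otimes> h) (word (u @ [x]) * K g ?y ?z * T g (word w)) + L N (g \<otimes> h) (word u * K g ?x ?z * T g (word (y # w)))
       + L N (g \<otimes> h) (word (u @ [z]) * K g ?x ?y * T g (word w)))
       = - L N (g \<otimes> h) (?U g (?J g))" if "g \<in> carrier G" for g
      unfolding head[OF that] tail cyc_def K_skew[OF that, of ?x ?z]
      by (simp add: algebra_simps)
    then have "(\<Sum>g\<in>carrier G. L N (g \<otimes> h) (word u * K g ?x ?y * T g (word (z # w))) + L N (g \<otimes> h) (word (u @ [y]) * K g ?x ?z * T g (word w))
       + L N (g \<otimes> h) (word u * K g ?y ?z * T g (word (x # w)))
       - (L N (g \<otimes> h) (word (u @ [x]) * K g ?y ?z * T g (word w)) + L N (g \<otimes> h) (word u * K g ?x ?z * T g (word (y # w)))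
       + L N (g \<otimes> h) (word (u @ [z]) * K g ?x ?y * T g (word w)))) = (\<Sum>g\<in>carrier G. - L N (g \<otimes> h) (?U g (?J g)))"
      by (rule sum.cong[OF refl])
    then show ?thesis
      using True by (simp add: jump_def sum.distrib sum_subtractf sum_negf)
  qed
  moreover have "(\<Sum>g\<in>carrier G. L N (g \<otimes> h) (?U g (?J g))) = 0"
  proof -
    let ?C = "\<lambda>g. tens_emb (cyc (\<lambda>x y z. \<kappa>C g y z *s (\<rho> g x - x)) ?x ?y ?z)"
    let ?B = "\<lambda>g x y z. tens_emb (x + \<rho> g x) * tens_emb (\<kappa>L g y z) - tens_emb (\<kappa>L g y z) * tens_emb (x + \<rho> g x)"
    have br: "L N (g \<otimes> h) (?U g (?B g x y z)) = (\<Sum>k\<in>carrier G. L N (k \<otimes> g \<otimes> h) (?U (k \<otimes> g) (?M k g x y z)))"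
      if g: "g \<in> carrier G" for g x y z
    proof -
      have "L N (g \<otimes> h) (?U g (?B g x y z)) = (\<Sum>k\<in>carrier G. L N (k \<otimes> (g \<otimes> h)) (word u * ?M k g x y z * T k (T g (word w))))"
        by (intro kills_uptoD[OF N] tdeg_le_word tdeg_le_tens_map order_refl) (use g h True in auto)
      also have "\<dots> = (\<Sum>k\<in>carrier G. L N (k \<otimes> g \<otimes> h) (?U (k \<otimes> g) (?M k g x y z)))"
        by (rule sum.cong) (use g h in \<open>simp_all add: T_mult m_assoc\<close>)
      finally show ?thesis .
    qed
    have "(\<Sum>g\<in>carrier G. L N (g \<otimes> h) (?U g (?J g)))
        = (\<Sum>g\<in>carrier G. 1/2 * L N (g \<otimes> h) (?U g (cyc (?B g) ?x ?y ?z)) - L N (g \<otimes> h) (?U g (?C g)))"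
      by (rule sum.cong[OF refl]) (simp only: overlap right_diff_distrib left_diff_distrib cid.ext_diff scale_middle mult.assoc cid.ext_scale)
    also have "\<dots> = 1/2 * (\<Sum>g\<in>carrier G. L N (g \<otimes> h) (?U g (cyc (?B g) ?x ?y ?z))) - (\<Sum>g\<in>carrier G. L N (g \<otimes> h) (?U g (?C g)))"
      by (simp only: sum_subtractf sum_distrib_left)
    also have "(\<Sum>g\<in>carrier G. L N (g \<otimes> h) (?U g (cyc (?B g) ?x ?y ?z)))
        = (\<Sum>g\<in>carrier G. \<Sum>k\<in>carrier G. L N (k \<otimes> g \<otimes> h) (?U (k \<otimes> g) (cyc (?M k g) ?x ?y ?z)))"
      by (rule sum.cong[OF refl]) (simp only: cyc_def distrib_left distrib_right cid.ext_add br sum.distrib)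
    also have "\<dots> = (\<Sum>p\<in>carrier G. \<Sum>(k, g)\<in>{(k, g). k \<in> carrier G \<and> g \<in> carrier G \<and> k \<otimes> g = p}.
          L N (k \<otimes> g \<otimes> h) (?U (k \<otimes> g) (cyc (?M k g) ?x ?y ?z)))"
      by (rule sum_product_fibres)
    also have "\<dots> = (\<Sum>p\<in>carrier G. \<Sum>(k, g)\<in>{(k, g). k \<in> carrier G \<and> g \<in> carrier G \<and> k \<otimes> g = p}.
          L N (p \<otimes> h) (?U p (cyc (?M k g) ?x ?y ?z)))"
      by (intro sum.cong refl) auto
    also have "\<dots> = (\<Sum>p\<in>carrier G. L N (p \<otimes> h) (?U p (\<Sum>(k, g)\<in>{(k, g). k \<in> carrier G \<and> g \<in> carrier G \<and> k \<otimes> g = p}.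
           cyc (?M k g) ?x ?y ?z)))"
      by (simp add: sum_distrib_left sum_distrib_right cid.ext_sum case_prod_unfold)
    also have "\<dots> = (\<Sum>p\<in>carrier G. 2 * L N (p \<otimes> h) (?U p (?C p)))"
    proof (rule sum.cong[OF refl])
      fix p assume p: "p \<in> carrier G"
      let ?P = "{(k, g). k \<in> carrier G \<and> g \<in> carrier G \<and> k \<otimes> g = p}"
      have c3: "cyc (\<lambda>u v w. \<Sum>(k, g)\<in>?P. \<kappa>L k (u + \<rho> g u) (\<kappa>L g v w)) ?x ?y ?z
        = 2 *s cyc (\<lambda>x y z. \<kappa>C p y z *s (\<rho> p x - x)) ?x ?y ?z"
        and c4: "cyc (\<lambda>u v w. \<Sum>(k, g)\<in>?P. \<kappa>C k (u + \<rho> g u) (\<kappa>L g v w)) ?x ?y ?z = 0"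
        using drinfeld p unfolding drinfeld_orbifold_map_cyc by blast+
      have "(\<Sum>(k, g)\<in>?P. cyc (?M k g) ?x ?y ?z)
         = tens_emb (cyc (\<lambda>u v w. \<Sum>(k, g)\<in>?P. \<kappa>L k (u + \<rho> g u) (\<kappa>L g v w)) ?x ?y ?z)
         + const_pm (cyc (\<lambda>u v w. \<Sum>(k, g)\<in>?P. \<kappa>C k (u + \<rho> g u) (\<kappa>L g v w)) ?x ?y ?z)"
        unfolding cyc_def K_def
        by (simp add: sum.distrib case_prod_unfold tens_emb_sum const_pm_sum algebra_simps)
      also have "\<dots> = const_pm 2 * ?C p" unfolding c3 c4 by simp
      finally show "L N (p \<otimes> h) (?U p (\<Sum>(k, g)\<in>?P. cyc (?M k g) ?x ?y ?z)) = 2 * L N (p \<otimes> h) (?U p (?C p))"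
        by (simp only: scale_middle mult.assoc cid.ext_scale)
    qed
    finally show ?thesis by (simp add: sum_distrib_left)
  qed
  ultimately show ?thesis by simp
qed (auto simp: jump_def)

text \<open>
  Only the exchanges of adjacent letters in words of length \<open>D + 1\<close> impose new conditions, and
  their right-hand sides involve words of length at most \<open>D\<close>.
\<close>

lemma extend_degree:
  assumes W: "word_kills_upto D N"
  obtains N' where "word_kills_upto (Suc D) N'" "\<And>h w. word_deg w \<le> D \<Longrightarrow> N' h w = N h w"
proof -
  note N = kills_uptoI[OF W]
  have "\<exists>F. \<forall>u a b w. F (u @ a # b # w) - F (u @ b # a # w) = jump D N h u a b w" if "h \<in> carrier G" for h
    by (rule exists_prescribed_swaps[OF jump_antisym jump_far[OF N that] jump_braid[OF N that]])
  then obtain F where F: "\<And>h u a b w. h \<in> carrier G \<Longrightarrow> F h (u @ a # b # w) - F h (u @ b # a # w) = jump D N h u a b w"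
    by metis
  define N' where "N' h w = (if word_deg w \<le> D then N h w else F h (letters w))" for h w
  have same: "L N' h t = L N h t" if "tdeg_le D t" for h t
    by (rule L_cong[OF that]) (simp add: N'_def)
  have "word_kills_upto (Suc D) N'"
    unfolding word_kills_upto_def
  proof (intro ballI allI impI)
    fix h b c and u w :: "'b list"
    assume h: "h \<in> carrier G" and D: "length u + length w + 2 \<le> Suc D"
    have "(\<Sum>g\<in>carrier G. L N' (g \<otimes> h) (word u * K g (axis b 1) (axis c 1) * T g (word w)))
        = (\<Sum>g\<in>carrier G. L N (g \<otimes> h) (word u * K g (axis b 1) (axis c 1) * T g (word w)))"
      by (intro sum.cong refl same tdeg_le_insert) (use D in simp)
    moreover have "N' h (Word (u @ b # c # w)) - N' h (Word (u @ c # b # w))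
        = (\<Sum>g\<in>carrier G. L N (g \<otimes> h) (word u * K g (axis b 1) (axis c 1) * T g (word w)))"
    proof (cases "length u + length w + 2 \<le> D")
      case True
      then show ?thesis using W h unfolding word_kills_upto_def by (simp add: N'_def word_deg_def)
    next
      case False
      then show ?thesis using F[OF h, of u b c w] D by (simp add: N'_def word_deg_def jump_def)
    qed
    ultimately show "N' h (Word (u @ b # c # w)) - N' h (Word (u @ c # b # w))
      = (\<Sum>g\<in>carrier G. L N' (g \<otimes> h) (word u * K g (axis b 1) (axis c 1) * T g (word w)))" by simp
  qed
  then show ?thesis using that[of N'] by (simp add: N'_def)
qed

text \<open>
  In the degree of the monomial \<open>m\<close>, the functional that reads off the coefficient of \<open>m\<close> at \<open>k\<close>
  respects the relations, because it is symmetric and vanishes on tensors of lower degree. Each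
  extension to the next degree keeps the values that were chosen before.
\<close>

lemma normal_form_functional:
  obtains N where
    "\<And>h v w s t. h \<in> carrier G \<Longrightarrow> L N h (s * (tens_emb v * tens_emb w - tens_emb w * tens_emb v) * t)
       = (\<Sum>g\<in>carrier G. L N (g \<otimes> h) (s * K g v w * T g t))"
    "\<And>h t. tdeg_le (mon_deg m) t \<Longrightarrow> L N h t = (if h = k then Poly_Mapping.lookup (to_sym t) m else 0)"
proof -
  define N0 where "N0 h w = (if h = k \<and> word_mon (letters w) = m then 1 else 0 :: complex)" for h :: 'g and w :: "'b free_mon"
  let ?d = "mon_deg m"
  have N0: "L N0 h t = (if h = k then Poly_Mapping.lookup (to_sym t) m else 0)" for h t
  proof (rule poly_mapping_additive_eqI[where t = t])
    fix w :: "'b free_mon" and c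
    show "L N0 h (Poly_Mapping.single w c) = (if h = k then Poly_Mapping.lookup (to_sym (Poly_Mapping.single w c)) m else 0)"
      by (subst (2) single_eq_const_mult) (simp add: N0_def to_sym_def lookup_single when_def)
  qed (simp_all add: lookup_add)
  have base: "word_kills_upto ?d N0"
    unfolding word_kills_upto_def
  proof (intro ballI allI impI)
    fix h b c and u w :: "'b list"
    assume D: "length u + length w + 2 \<le> ?d"
    have "L N0 (g \<otimes> h) (word u * K g (axis b 1) (axis c 1) * T g (word w)) = 0" for g
    proof -
      have "tdeg_le (?d - 1) (word u * K g (axis b 1) (axis c 1) * T g (word w))"
        by (rule tdeg_le_insert) (use D in simp)
      from deg_le_to_sym[OF this] have "Poly_Mapping.lookup (to_sym (word u * K g (axis b 1) (axis c 1) * T g (word w))) m = 0"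
        unfolding deg_le_iff using D by auto
      then show ?thesis by (simp only: N0 if_cancel)
    qed
    then show "N0 h (Word (u @ b # c # w)) - N0 h (Word (u @ c # b # w))
      = (\<Sum>g\<in>carrier G. L N0 (g \<otimes> h) (word u * K g (axis b 1) (axis c 1) * T g (word w)))"
      by (simp add: N0_def add_ac)
  qed
  have "\<exists>f. \<forall>n. (word_kills_upto (?d + n) (f n) \<and> (n = 0 \<longrightarrow> f n = N0)) \<and>
      (\<forall>h w. word_deg w \<le> ?d + n \<longrightarrow> f (Suc n) h w = f n h w)"
  proof (rule dependent_nat_choice)
    show "\<exists>N. word_kills_upto (?d + 0) N \<and> (0 = 0 \<longrightarrow> N = N0)" using base by auto
  next
    fix N n assume "word_kills_upto (?d + n) N \<and> (n = 0 \<longrightarrow> N = N0)"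
    then obtain N' where "word_kills_upto (Suc (?d + n)) N'" "\<And>h w. word_deg w \<le> ?d + n \<Longrightarrow> N' h w = N h w"
      using extend_degree by metis
    then show "\<exists>N'. (word_kills_upto (?d + Suc n) N' \<and> (Suc n = 0 \<longrightarrow> N' = N0)) \<and> (\<forall>h w. word_deg w \<le> ?d + n \<longrightarrow> N' h w = N h w)"
      by (intro exI[of _ N']) auto
  qed
  then obtain f where f: "\<And>n. word_kills_upto (?d + n) (f n)" "f 0 = N0"
    "\<And>n h w. word_deg w \<le> ?d + n \<Longrightarrow> f (Suc n) h w = f n h w"
    by blast
  have stable: "f (n + j) h w = f n h w" if "word_deg w \<le> ?d + n" for n j h w
    by (induction j) (use f(3) that in auto)
  \<comment> \<open>By stability the stage given by the length of the word may be used for all words at once.\<close>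
  define N where "N h w = f (word_deg w) h w" for h w
  have N: "N h w = f n h w" if "word_deg w \<le> ?d + n" for h w n
  proof (cases "n \<le> word_deg w")
    case True
    then show ?thesis using stable[OF that, of "word_deg w - n"] by (simp add: N_def)
  next
    case False
    then show ?thesis using stable[of w "word_deg w" "n - word_deg w"] by (simp add: N_def)
  qed
  show ?thesis
  proof (rule that[of N])
    fix h and v w :: "complex ^ 'b" and s t :: "'b tensor_alg"
    assume h: "h \<in> carrier G"
    have fin: "\<exists>m. tdeg_le m t" for t :: "'b tensor_alg"
      unfolding deg_le_def by (rule exI[of _ "Max (word_deg ` Poly_Mapping.keys t)"]) simp
    obtain m n where m: "tdeg_le m s" and n: "tdeg_le n t" using fin by metis
    let ?n = "m + n + 2"
    have eq: "L N h' r = L (f ?n) h' r" if "tdeg_le ?n r" for h' r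
      by (rule L_cong[OF that]) (simp add: N)
    have c: "tdeg_le 2 (tens_emb v * tens_emb w - tens_emb w * tens_emb v)"
      using tdeg_le_mult[OF tdeg_le_emb tdeg_le_emb, of v w] tdeg_le_mult[OF tdeg_le_emb tdeg_le_emb, of w v]
      by (simp add: deg_le_diff numeral_2_eq_2)
    have "L N h (s * (tens_emb v * tens_emb w - tens_emb w * tens_emb v) * t)
       = L (f ?n) h (s * (tens_emb v * tens_emb w - tens_emb w * tens_emb v) * t)"
      by (rule eq, rule deg_le_mono[OF tdeg_le_mult[OF tdeg_le_mult[OF m c] n]]) simp
    also have "\<dots> = (\<Sum>g\<in>carrier G. L (f ?n) (g \<otimes> h) (s * K g v w * T g t))"
      by (rule kills_uptoD[OF kills_uptoI[OF f(1)] h m n]) simp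
    also have "\<dots> = (\<Sum>g\<in>carrier G. L N (g \<otimes> h) (s * K g v w * T g t))"
      by (intro sum.cong refl eq[symmetric],
          rule deg_le_mono[OF tdeg_le_mult[OF tdeg_le_mult[OF m tdeg_le_K] tdeg_le_tens_map[OF n]]]) simp
    finally show "L N h (s * (tens_emb v * tens_emb w - tens_emb w * tens_emb v) * t)
       = (\<Sum>g\<in>carrier G. L N (g \<otimes> h) (s * K g v w * T g t))" .
  next
    fix h and t :: "'b tensor_alg" assume t: "tdeg_le ?d t"
    have "L N h t = L N0 h t"
      by (rule L_cong[OF t]) (use N[of _ 0] f(2) in simp)
    then show "L N h t = (if h = k then Poly_Mapping.lookup (to_sym t) m else 0)" by (simp only: N0)
  qed
qed

end

lemma to_sym_single: "to_sym (Poly_Mapping.single (Word w) c) = Poly_Mapping.single (word_mon w) c"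
  by (subst (1 2) single_eq_const_mult) (simp only: to_sym_scale to_sym_word)

lemma word_mon_surj: "\<exists>w. word_mon w = k" for k :: "'b::finite \<Rightarrow>\<^sub>0 nat"
proof -
  obtain w where "mset w = Abs_multiset (Poly_Mapping.lookup k)" using ex_mset by blast
  then have "count (mset w) = Poly_Mapping.lookup k" by (simp add: count_Abs_multiset)
  then show ?thesis by (intro exI[of _ w] poly_mapping_eqI) (simp add: lookup_word_mon count_mset[symmetric])
qed

section \<open>Skew group algebras\<close>

locale skew_action = group G for G :: "'g monoid" (structure) +
  fixes sc :: "complex \<Rightarrow> 'r::ring_1 \<Rightarrow> 'r" and act :: "'g \<Rightarrow> 'r \<Rightarrow> 'r"
  assumes fin: "finite (carrier G)"
    and act_add: "g \<in> carrier G \<Longrightarrow> act g (x + y) = act g x + act g y"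
    and act_mult: "g \<in> carrier G \<Longrightarrow> act g (x * y) = act g x * act g y"
    and act_one: "g \<in> carrier G \<Longrightarrow> act g 1 = 1"
    and act_comp: "g \<in> carrier G \<Longrightarrow> h \<in> carrier G \<Longrightarrow> act (g \<otimes> h) x = act g (act h x)"
    and act_id: "act \<one> x = x"
begin

abbreviation "R \<equiv> skew_algebra G sc act"

lemma R_simps:
  "f \<in> carrier R \<longleftrightarrow> (\<forall>g. g \<notin> carrier G \<longrightarrow> f g = 0)"
  "k \<in> carrier G \<Longrightarrow> (f \<otimes>\<^bsub>R\<^esub> h) k = (\<Sum>g\<in>carrier G. f g * act g (h (inv g \<otimes> k)))"
  "k \<notin> carrier G \<Longrightarrow> (f \<otimes>\<^bsub>R\<^esub> h) k = 0"
  "\<one>\<^bsub>R\<^esub> = (\<lambda>g. if g = \<one> then 1 else 0)" "\<zero>\<^bsub>R\<^esub> = (\<lambda>g. 0)"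
  "f \<oplus>\<^bsub>R\<^esub> h = (\<lambda>g. f g + h g)" "c \<odot>\<^bsub>R\<^esub> f = (\<lambda>g. sc c (f g))"
  by (simp_all add: skew_algebra_def)

lemma act_zero: "g \<in> carrier G \<Longrightarrow> act g 0 = 0"
  using act_add[of g 0 0] by simp

lemma act_sum: "g \<in> carrier G \<Longrightarrow> act g (sum h A) = (\<Sum>a\<in>A. act g (h a))"
  by (induction A rule: infinite_finite_induct) (simp_all add: act_zero act_add)

lemma sum_translate:
  assumes "a \<in> carrier G"
  shows "(\<Sum>g\<in>carrier G. F g) = (\<Sum>b\<in>carrier G. F (a \<otimes> b))"
  by (rule sum.reindex_bij_witness[where i = "\<lambda>b. a \<otimes> b" and j = "\<lambda>g. inv a \<otimes> g"])
     (use assms in \<open>simp_all flip: m_assoc\<close>)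

lemma mult_assoc_R:
  assumes "f \<in> carrier R" "h \<in> carrier R" "k \<in> carrier R"
  shows "f \<otimes>\<^bsub>R\<^esub> h \<otimes>\<^bsub>R\<^esub> k = f \<otimes>\<^bsub>R\<^esub> (h \<otimes>\<^bsub>R\<^esub> k)"
proof
  fix p
  show "(f \<otimes>\<^bsub>R\<^esub> h \<otimes>\<^bsub>R\<^esub> k) p = (f \<otimes>\<^bsub>R\<^esub> (h \<otimes>\<^bsub>R\<^esub> k)) p"
  proof (cases "p \<in> carrier G")
    case p: True
    have "(f \<otimes>\<^bsub>R\<^esub> h \<otimes>\<^bsub>R\<^esub> k) p
       = (\<Sum>g\<in>carrier G. \<Sum>a\<in>carrier G. f a * act a (h (inv a \<otimes> g)) * act g (k (inv g \<otimes> p)))"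
      by (simp add: R_simps p sum_distrib_right)
    also have "\<dots> = (\<Sum>a\<in>carrier G. \<Sum>g\<in>carrier G. f a * act a (h (inv a \<otimes> g)) * act g (k (inv g \<otimes> p)))"
      by (rule sum.swap)
    also have "\<dots> = (\<Sum>a\<in>carrier G. \<Sum>b\<in>carrier G. f a * act a (h b * act b (k (inv b \<otimes> (inv a \<otimes> p)))))"
    proof (rule sum.cong[OF refl])
      fix a assume a: "a \<in> carrier G"
      have "(\<Sum>g\<in>carrier G. f a * act a (h (inv a \<otimes> g)) * act g (k (inv g \<otimes> p)))
          = (\<Sum>b\<in>carrier G. f a * act a (h (inv a \<otimes> (a \<otimes> b))) * act (a \<otimes> b) (k (inv (a \<otimes> b) \<otimes> p)))"
        by (rule sum_translate[OF a])
      also have "\<dots> = (\<Sum>b\<in>carrier G. f a * act a (h b * act b (k (inv b \<otimes> (inv a \<otimes> p)))))"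
      proof (rule sum.cong[OF refl])
        fix b assume b: "b \<in> carrier G"
        have 1: "inv a \<otimes> (a \<otimes> b) = b" using a b by (simp flip: m_assoc)
        have 2: "inv (a \<otimes> b) \<otimes> p = inv b \<otimes> (inv a \<otimes> p)" using a b p by (simp add: inv_mult_group m_assoc)
        show "f a * act a (h (inv a \<otimes> (a \<otimes> b))) * act (a \<otimes> b) (k (inv (a \<otimes> b) \<otimes> p))
          = f a * act a (h b * act b (k (inv b \<otimes> (inv a \<otimes> p))))"
          unfolding 1 2 by (simp add: act_comp act_mult a b mult.assoc)
      qed
      finally show "(\<Sum>g\<in>carrier G. f a * act a (h (inv a \<otimes> g)) * act g (k (inv g \<otimes> p)))
          = (\<Sum>b\<in>carrier G. f a * act a (h b * act b (k (inv b \<otimes> (inv a \<otimes> p)))))" .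
    qed
    also have "\<dots> = (f \<otimes>\<^bsub>R\<^esub> (h \<otimes>\<^bsub>R\<^esub> k)) p"
      by (simp add: R_simps p act_sum sum_distrib_left)
    finally show ?thesis .
  qed (simp add: R_simps)
qed

lemma sum_single_group:
  assumes "a \<in> carrier G" "\<And>g. g \<in> carrier G \<Longrightarrow> g \<noteq> a \<Longrightarrow> F g = 0"
  shows "(\<Sum>g\<in>carrier G. F g) = (F a :: 'x::comm_monoid_add)"
proof -
  have "(\<Sum>g\<in>carrier G. F g) = (\<Sum>g\<in>{a}. F g)"
    by (rule sum.mono_neutral_right) (use assms fin in auto)
  then show ?thesis by simp
qed

lemma ring_R: "ring R"
proof (rule ringI)
  show "abelian_group R"
  proof (rule abelian_groupI)
    fix f assume f: "f \<in> carrier R"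
    show "\<exists>h\<in>carrier R. h \<oplus>\<^bsub>R\<^esub> f = \<zero>\<^bsub>R\<^esub>"
      by (rule bexI[of _ "\<lambda>g. - f g"]) (use f in \<open>simp_all add: R_simps\<close>)
  qed (simp_all add: R_simps add_ac)
  show "monoid R"
  proof
    fix f h assume "f \<in> carrier R" "h \<in> carrier R"
    show "f \<otimes>\<^bsub>R\<^esub> h \<in> carrier R" by (simp add: R_simps)
  next
    show "\<one>\<^bsub>R\<^esub> \<in> carrier R" by (auto simp: R_simps)
  next
    fix f assume f: "f \<in> carrier R"
    show "\<one>\<^bsub>R\<^esub> \<otimes>\<^bsub>R\<^esub> f = f"
    proof
      fix k show "(\<one>\<^bsub>R\<^esub> \<otimes>\<^bsub>R\<^esub> f) k = f k"
      proof (cases "k \<in> carrier G")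
        case True
        have "(\<one>\<^bsub>R\<^esub> \<otimes>\<^bsub>R\<^esub> f) k = (\<Sum>g\<in>carrier G. (if g = \<one> then 1 else 0) * act g (f (inv g \<otimes> k)))"
          using True by (simp add: R_simps)
        also have "\<dots> = (if \<one> = \<one> then 1 else 0) * act \<one> (f (inv \<one> \<otimes> k))"
          by (rule sum_single_group) simp_all
        finally show ?thesis using True by (simp add: act_id)
      qed (use f in \<open>simp add: R_simps\<close>)
    qed
    show "f \<otimes>\<^bsub>R\<^esub> \<one>\<^bsub>R\<^esub> = f"
    proof
      fix k show "(f \<otimes>\<^bsub>R\<^esub> \<one>\<^bsub>R\<^esub>) k = f k"
      proof (cases "k \<in> carrier G")
        case True
        have "(f \<otimes>\<^bsub>R\<^esub> \<one>\<^bsub>R\<^esub>) k = (\<Sum>g\<in>carrier G. f g * act g (if inv g \<otimes> k = \<one> then 1 else 0))"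
          using True by (simp add: R_simps)
        also have "\<dots> = f k * act k (if inv k \<otimes> k = \<one> then 1 else 0)"
        proof (rule sum_single_group[OF True])
          fix g assume g: "g \<in> carrier G" "g \<noteq> k"
          then have "inv g \<otimes> k \<noteq> \<one>" using True by (metis inv_closed inv_equality inv_inv)
          then show "f g * act g (if inv g \<otimes> k = \<one> then 1 else 0) = 0" using g by (simp add: act_zero)
        qed
        finally show ?thesis using True by (simp add: act_one)
      qed (use f in \<open>simp add: R_simps\<close>)
    qed
  qed (rule mult_assoc_R)
next
  fix f h k assume "f \<in> carrier R" "h \<in> carrier R" "k \<in> carrier R"
  show "(f \<oplus>\<^bsub>R\<^esub> h) \<otimes>\<^bsub>R\<^esub> k = f \<otimes>\<^bsub>R\<^esub> k \<oplus>\<^bsub>R\<^esub> h \<otimes>\<^bsub>R\<^esub> k"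
    by (rule HOL.ext, case_tac "x \<in> carrier G") (simp_all add: R_simps distrib_right sum.distrib)
  show "k \<otimes>\<^bsub>R\<^esub> (f \<oplus>\<^bsub>R\<^esub> h) = k \<otimes>\<^bsub>R\<^esub> f \<oplus>\<^bsub>R\<^esub> k \<otimes>\<^bsub>R\<^esub> h"
    by (rule HOL.ext, case_tac "x \<in> carrier G") (simp_all add: R_simps distrib_left sum.distrib act_add)
qed

text \<open>
  The element \<open>x \<otimes> g\<close> of the skew group algebra.
\<close>

definition pure :: "'g \<Rightarrow> 'r \<Rightarrow> 'g \<Rightarrow> 'r" where
  "pure g x = (\<lambda>k. if k = g then x else 0)"

lemma pure_carrier: "g \<in> carrier G \<Longrightarrow> pure g x \<in> carrier R"
  by (auto simp: R_simps pure_def)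

lemma pure_one_mult:
  assumes "f \<in> carrier R"
  shows "pure \<one> x \<otimes>\<^bsub>R\<^esub> f = (\<lambda>k. x * f k)"
proof
  fix k show "(pure \<one> x \<otimes>\<^bsub>R\<^esub> f) k = x * f k"
  proof (cases "k \<in> carrier G")
    case True
    have "(pure \<one> x \<otimes>\<^bsub>R\<^esub> f) k = (\<Sum>g\<in>carrier G. pure \<one> x g * act g (f (inv g \<otimes> k)))"
      using True by (simp add: R_simps)
    also have "\<dots> = pure \<one> x \<one> * act \<one> (f (inv \<one> \<otimes> k))"
      by (rule sum_single_group) (simp_all add: pure_def)
    finally show ?thesis using True by (simp add: act_id pure_def)
  qed (use assms in \<open>simp add: R_simps\<close>)
qed

lemma mult_pure:
  assumes "h \<in> carrier G" "k \<in> carrier G"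
  shows "(f \<otimes>\<^bsub>R\<^esub> pure h x) k = f (k \<otimes> inv h) * act (k \<otimes> inv h) x"
proof -
  have "(f \<otimes>\<^bsub>R\<^esub> pure h x) k = (\<Sum>g\<in>carrier G. f g * act g (pure h x (inv g \<otimes> k)))"
    using assms by (simp add: R_simps)
  also have "\<dots> = f (k \<otimes> inv h) * act (k \<otimes> inv h) (pure h x (inv (k \<otimes> inv h) \<otimes> k))"
  proof (rule sum_single_group)
    fix g assume g: "g \<in> carrier G" "g \<noteq> k \<otimes> inv h"
    then have "inv g \<otimes> k \<noteq> h" using assms by (metis inv_solve_left inv_solve_right)
    then show "f g * act g (pure h x (inv g \<otimes> k)) = 0" using g by (simp add: pure_def act_zero)
  qed (use assms in simp)
  also have "inv (k \<otimes> inv h) \<otimes> k = h"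
    using assms by (simp add: inv_mult_group m_assoc)
  finally show ?thesis by (simp add: pure_def)
qed

end

context finite_rep
begin

sublocale TS: skew_action G scale_pm "\<lambda>g. tens_map (\<rho> g)"
  by unfold_locales (simp_all add: finite_carrier T_mult T_one)

lemma tensor_skew_eq: "tensor_skew G \<rho> = skew_algebra G scale_pm (\<lambda>g. tens_map (\<rho> g))"
  by (simp add: tensor_skew_def)

lemma to_sym_surj_deg:
  fixes p :: "'b sym_alg"
  assumes "deg_le mon_deg m p"
  shows "\<exists>t. tdeg_le m t \<and> to_sym t = p"
proof -
  show ?thesis
    using assms unfolding deg_le_def[of _ _ p]
  proof (induction p rule: poly_mapping_keys_induct)
    case zero
    then show ?case by (intro exI[of _ 0]) simp
  next
    case (add x y)
    then show ?case by (metis to_sym_add deg_le_add)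
  next
    case (single k c)
    obtain w where "word_mon w = k" using word_mon_surj by blast
    then have "to_sym (Poly_Mapping.single (Word w) c) = Poly_Mapping.single k c" "length w = mon_deg k"
      by (auto simp: to_sym_single)
    moreover have "tdeg_le m (Poly_Mapping.single (Word w) c)"
      using single calculation(2) by (intro deg_le_single) (simp add: word_deg_def)
    ultimately show ?case by blast
  qed
qed

lemma to_sym_surj:
  fixes p :: "'b sym_alg"
  shows "\<exists>t. to_sym t = p"
proof -
  have "deg_le mon_deg (Max (mon_deg ` Poly_Mapping.keys p)) p" by (simp add: deg_le_def)
  then show ?thesis using to_sym_surj_deg by blast
qed

text \<open>
  The symmetric algebra inherits the action from the tensor algebra, because \<open>to_sym\<close> is surjective and
  commutes with the induced maps.
\<close>

sublocale SS: skew_action G scale_pm "\<lambda>g. sym_map (\<rho> g)"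
proof unfold_locales
  fix g h and x :: "'b sym_alg"
  obtain t where t: "to_sym t = x" using to_sym_surj by blast
  show "sym_map (\<rho> \<one>) x = x"
    unfolding t[symmetric] by (simp flip: to_sym_tens_map add: T_one)
  show "sym_map (\<rho> (g \<otimes> h)) x = sym_map (\<rho> g) (sym_map (\<rho> h) x)" if "g \<in> carrier G" "h \<in> carrier G"
    unfolding t[symmetric] using that by (simp flip: to_sym_tens_map add: T_mult)
qed (simp_all add: finite_carrier)

end

section \<open>Leading terms modulo the ideal\<close>

text \<open>
  The homogeneous part of degree \<open>m\<close>.
\<close>

definition hpart :: "nat \<Rightarrow> 'b::finite sym_alg \<Rightarrow> 'b sym_alg" where
  "hpart m = cpm.ext (\<lambda>k. if mon_deg k = m then Poly_Mapping.single k 1 else 0)"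

lemma hpart_add [simp]: "hpart m (p + q) = hpart m p + hpart m q"
  and hpart_diff [simp]: "hpart m (p - q) = hpart m p - hpart m q"
  and hpart_zero [simp]: "hpart m 0 = 0"
  and hpart_scale [simp]: "hpart m (const_pm c * p) = const_pm c * hpart m p"
  and hpart_sum: "hpart m (sum h A) = (\<Sum>a\<in>A. hpart m (h a))"
  by (simp_all add: hpart_def cpm.ext_sum)

lemma lookup_hpart: "Poly_Mapping.lookup (hpart m p) k = (if mon_deg k = m then Poly_Mapping.lookup p k else 0)"
proof -
  have "\<forall>k\<in>Poly_Mapping.keys p. True" by simp
  then show ?thesis
    by (induction p rule: poly_mapping_keys_induct)
       (auto simp: hpart_def lookup_add lookup_single when_def)
qed

lemma hpart_eq_0_if_deg_le:
  assumes "deg_le mon_deg n p" "n < m" shows "hpart m p = 0"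
  by (rule poly_mapping_eqI) (use assms in \<open>simp add: lookup_hpart deg_le_iff\<close>)

lemma deg_le_hpart: "deg_le mon_deg m (hpart m p)"
  by (simp add: deg_le_iff lookup_hpart)

lemma hpart_hpart: "hpart m (hpart n p) = (if m = n then hpart n p else 0)"
  by (rule poly_mapping_eqI) (simp add: lookup_hpart)

lemma hpart_single:
  "hpart m (Poly_Mapping.single k c) = (if mon_deg k = m then Poly_Mapping.single k c else 0)"
  by (rule poly_mapping_eqI) (auto simp: lookup_hpart lookup_single when_def)

lemma hpart_mult: "hpart m (p * r) = (\<Sum>i\<le>m. hpart i p * hpart (m - i) r)"
proof -
  have "\<forall>k\<in>Poly_Mapping.keys p. True" "\<forall>k\<in>Poly_Mapping.keys r. True" by simp_all
  then show ?thesis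
  proof (induction p rule: poly_mapping_keys_induct)
    case (single k c)
    from single(2) show ?case
    proof (induction r rule: poly_mapping_keys_induct)
      case (single l d)
      have "(\<Sum>i\<le>m. hpart i (Poly_Mapping.single k c) * hpart (m - i) (Poly_Mapping.single l d))
         = (\<Sum>i\<le>m. if i = mon_deg k then Poly_Mapping.single k c * hpart (m - mon_deg k) (Poly_Mapping.single l d) else 0)"
        by (rule sum.cong) (auto simp: hpart_single)
      also have "\<dots> = hpart m (Poly_Mapping.single k c * Poly_Mapping.single l d)"
        by (auto simp: mult_single hpart_single mon_deg_add)
      finally show ?case ..
    qed (auto simp: distrib_left sum.distrib)
  qed (auto simp: distrib_right sum.distrib)
qed

lemma hpart_mult_homogeneous: "hpart (i + j) (hpart i p * hpart j r) = hpart i p * hpart j r"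
proof -
  have "(\<Sum>l\<le>i + j. hpart l (hpart i p) * hpart (i + j - l) (hpart j r))
      = (\<Sum>l\<le>i + j. if l = i then hpart i p * hpart j r else 0)"
    by (rule sum.cong) (auto simp: hpart_hpart)
  then show ?thesis by (simp add: hpart_mult)
qed

lemma hpart_sym_map:
  fixes p :: "'b::finite sym_alg"
  shows "hpart m (sym_map f p) = sym_map f (hpart m p)"
proof -
  have v: "hpart 1 (sym_emb v) = sym_emb v" for v :: "complex ^ 'b"
    by (rule poly_mapping_eqI)
       (auto simp: lookup_hpart sym_emb_def lookup_sum lookup_single when_def intro!: sum.neutral simp del: One_nat_def)
  have w: "hpart (length w) (sym_map f (Poly_Mapping.single (word_mon w) 1)) = sym_map f (Poly_Mapping.single (word_mon w) 1)" for w
  proof (induction w)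
    case Nil
    have "hpart 0 (1 :: 'b sym_alg) = 1"
      by (rule poly_mapping_eqI) (auto simp: lookup_hpart lookup_one when_def)
    then show ?case by simp
  next
    case (Cons b w)
    have "Poly_Mapping.single (word_mon (b # w)) (1::complex)
        = Poly_Mapping.single (Poly_Mapping.single b 1) 1 * Poly_Mapping.single (word_mon w) 1"
      by (simp add: mult_single)
    then have "sym_map f (Poly_Mapping.single (word_mon (b # w)) 1)
        = hpart 1 (sym_emb (f (axis b 1))) * hpart (length w) (sym_map f (Poly_Mapping.single (word_mon w) 1))"
      by (simp only: sym_map_mult sym_map_var Cons v)
    then show ?case using hpart_mult_homogeneous[of 1 "length w"] by simp
  qed
  have "\<forall>k\<in>Poly_Mapping.keys p. True" by simp
  then show ?thesis
  proof (induction p rule: poly_mapping_keys_induct)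
    case (single k c)
    obtain w where k: "word_mon w = k" using word_mon_surj by blast
    have "hpart m (sym_map f (Poly_Mapping.single k 1)) = sym_map f (hpart m (Poly_Mapping.single k 1))"
      using w[of w] hpart_hpart[of m "length w" "sym_map f (Poly_Mapping.single k 1)"]
      by (auto simp: hpart_single k[symmetric])
    then show ?case
      by (subst (1 2) single_eq_const_mult) (simp only: sym_map_scale hpart_scale)
  qed simp_all
qed

context skew_action
begin

lemma a_inv_R: "f \<in> carrier R \<Longrightarrow> \<ominus>\<^bsub>R\<^esub> f = (\<lambda>g. - f g)"
proof -
  assume f: "f \<in> carrier R"
  interpret ring R by (rule ring_R)
  show ?thesis by (rule minus_equality) (use f in \<open>simp_all add: R_simps\<close>)
qed

lemma eq_sum_pure: "f \<in> carrier R \<Longrightarrow> f = (\<lambda>k. \<Sum>g\<in>carrier G. pure g (f g) k)"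
  using fin by (auto simp: pure_def R_simps)

end

context drinfeld_data
begin

abbreviation "R \<equiv> TS.R"
abbreviation "I \<equiv> H_ideal G \<rho> \<kappa>L \<kappa>C"

lemma relator_eq:
  "g \<in> carrier G \<Longrightarrow> relator G \<kappa>L \<kappa>C v w g
     = (if g = \<one> then tens_emb v * tens_emb w - tens_emb w * tens_emb v else 0) - K g v w"
  by (simp add: relator_def K_def)

lemma relator_carrier: "relator G \<kappa>L \<kappa>C v w \<in> carrier R"
  using drinfeld by (auto simp: TS.R_simps relator_def drinfeld_orbifold_map_def cochain_def)

lemma ideal_I: "ideal I R"
  unfolding H_ideal_def tensor_skew_eq
  by (rule ring.genideal_ideal[OF TS.ring_R]) (use relator_carrier in auto)

lemma relator_in_I: "relator G \<kappa>L \<kappa>C v w \<in> I"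
proof -
  have "{relator G \<kappa>L \<kappa>C v w | v w. True} \<subseteq> I"
    unfolding H_ideal_def tensor_skew_eq
    by (rule ring.genideal_self[OF TS.ring_R]) (use relator_carrier in auto)
  then show ?thesis by blast
qed

lemma I_carrier: "f \<in> I \<Longrightarrow> f \<in> carrier R"
  using ideal_I by (meson additive_subgroup.a_Hcarr ideal.axioms(1))

lemma I_add: "f \<in> I \<Longrightarrow> h \<in> I \<Longrightarrow> (\<lambda>g. f g + h g) \<in> I"
  using additive_subgroup.a_closed[OF ideal.axioms(1)[OF ideal_I]] by (simp add: TS.R_simps(6))

lemma I_zero: "(\<lambda>g. 0) \<in> I"
  using additive_subgroup.zero_closed[OF ideal.axioms(1)[OF ideal_I]] by (simp add: TS.R_simps(5))

lemma I_scale: "f \<in> I \<Longrightarrow> (\<lambda>g. const_pm c * f g) \<in> I"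
proof -
  assume f: "f \<in> I"
  have "TS.pure \<one> (const_pm c) \<otimes>\<^bsub>R\<^esub> f \<in> I"
    by (rule ideal.I_l_closed[OF ideal_I f]) (simp add: TS.pure_carrier)
  then show ?thesis by (simp add: TS.pure_one_mult I_carrier[OF f])
qed

lemma I_uminus: "f \<in> I \<Longrightarrow> (\<lambda>g. - f g) \<in> I"
  using I_scale[of f "-1"] by simp

text \<open>
  The elements \<open>f\<close> for which the functional vanishes on all products of \<open>f\<close> with factors on both sides
  form an ideal, so it suffices to look at the relators. For these, the components of \<open>s\<close>, of the
  relator and of \<open>t\<close> are summed separately, and (i) carries the relator past the group element of \<open>s\<close>.
\<close>

lemma functional_kills_ideal:
  assumes N: "\<And>h v w s t. h \<in> carrier G \<Longrightarrow> L N h (s * (tens_emb v * tens_emb w - tens_emb w * tens_emb v) * t)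
       = (\<Sum>g\<in>carrier G. L N (g \<otimes> h) (s * K g v w * T g t))"
    and f: "f \<in> I"
  shows "(\<Sum>h\<in>carrier G. L N h (f h)) = 0"
proof -
  interpret R: ring R by (rule TS.ring_R)
  let ?\<nu> = "\<lambda>f. \<Sum>h\<in>carrier G. L N h (f h)"
  define J where "J = {f \<in> carrier R. \<forall>s\<in>carrier R. \<forall>t\<in>carrier R. ?\<nu> (s \<otimes>\<^bsub>R\<^esub> f \<otimes>\<^bsub>R\<^esub> t) = 0}"
  have add: "?\<nu> (f \<oplus>\<^bsub>R\<^esub> h) = ?\<nu> f + ?\<nu> h" for f h
    by (simp add: TS.R_simps(6) sum.distrib)
  have "ideal J R"
  proof (rule idealI[OF TS.ring_R])
    show "subgroup J (add_monoid R)"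
    proof (rule R.add.subgroupI)
      show "J \<subseteq> carrier R" by (auto simp: J_def)
      have "\<zero>\<^bsub>R\<^esub> \<in> J" by (simp add: J_def) (simp add: TS.R_simps(5))
      then show "J \<noteq> {}" by auto
    next
      fix a assume a: "a \<in> J"
      have "?\<nu> (s \<otimes>\<^bsub>R\<^esub> (\<ominus>\<^bsub>R\<^esub> a) \<otimes>\<^bsub>R\<^esub> t) = 0" if st: "s \<in> carrier R" "t \<in> carrier R" for s t
      proof -
        have ac: "a \<in> carrier R" and a0: "?\<nu> (s \<otimes>\<^bsub>R\<^esub> a \<otimes>\<^bsub>R\<^esub> t) = 0" using a st by (auto simp: J_def)
        have "s \<otimes>\<^bsub>R\<^esub> (\<ominus>\<^bsub>R\<^esub> a) \<otimes>\<^bsub>R\<^esub> t = \<ominus>\<^bsub>R\<^esub> (s \<otimes>\<^bsub>R\<^esub> a \<otimes>\<^bsub>R\<^esub> t)"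
          using ac st by (simp add: R.r_minus R.l_minus)
        also have "\<dots> = (\<lambda>g. - (s \<otimes>\<^bsub>R\<^esub> a \<otimes>\<^bsub>R\<^esub> t) g)"
          by (rule TS.a_inv_R) (use ac st in simp)
        finally show ?thesis using a0 by (simp add: sum_negf)
      qed
      then show "\<ominus>\<^bsub>R\<^esub> a \<in> J" using a by (simp add: J_def)
    next
      fix a b assume "a \<in> J" "b \<in> J"
      then show "a \<oplus>\<^bsub>R\<^esub> b \<in> J"
        by (simp add: J_def R.r_distr R.l_distr add)
    qed
  next
    fix a x assume a: "a \<in> J" and x: "x \<in> carrier R"
    then have ac: "a \<in> carrier R" by (simp add: J_def)
    have "s \<otimes>\<^bsub>R\<^esub> (x \<otimes>\<^bsub>R\<^esub> a) \<otimes>\<^bsub>R\<^esub> t = (s \<otimes>\<^bsub>R\<^esub> x) \<otimes>\<^bsub>R\<^esub> a \<otimes>\<^bsub>R\<^esub> t"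
      "s \<otimes>\<^bsub>R\<^esub> (a \<otimes>\<^bsub>R\<^esub> x) \<otimes>\<^bsub>R\<^esub> t = s \<otimes>\<^bsub>R\<^esub> a \<otimes>\<^bsub>R\<^esub> (x \<otimes>\<^bsub>R\<^esub> t)"
      if "s \<in> carrier R" "t \<in> carrier R" for s t
      using that ac x by (simp_all add: R.m_assoc)
    then show "x \<otimes>\<^bsub>R\<^esub> a \<in> J" "a \<otimes>\<^bsub>R\<^esub> x \<in> J"
      using a ac x by (simp_all add: J_def)
  qed
  moreover have "{relator G \<kappa>L \<kappa>C v w | v w. True} \<subseteq> J"
  proof clarify
    fix v w
    let ?r = "relator G \<kappa>L \<kappa>C v w"
    have "?\<nu> (s \<otimes>\<^bsub>R\<^esub> ?r \<otimes>\<^bsub>R\<^esub> t) = 0" if s: "s \<in> carrier R" and t: "t \<in> carrier R" for s t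
    proof -
      let ?F = "\<lambda>g q p. L N p (s g * T g (?r (inv g \<otimes> q)) * T q (t (inv q \<otimes> p)))"
      have "?\<nu> (s \<otimes>\<^bsub>R\<^esub> ?r \<otimes>\<^bsub>R\<^esub> t) = (\<Sum>p\<in>carrier G. \<Sum>q\<in>carrier G. \<Sum>g\<in>carrier G. ?F g q p)"
        by (simp add: TS.R_simps(2) cid.ext_sum sum_distrib_right)
      also have "\<dots> = (\<Sum>g\<in>carrier G. \<Sum>q\<in>carrier G. \<Sum>p\<in>carrier G. ?F g q p)"
      proof -
        have "(\<Sum>p\<in>carrier G. \<Sum>q\<in>carrier G. \<Sum>g\<in>carrier G. ?F g q p)
            = (\<Sum>p\<in>carrier G. \<Sum>g\<in>carrier G. \<Sum>q\<in>carrier G. ?F g q p)"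
          by (intro sum.cong refl sum.swap)
        also have "\<dots> = (\<Sum>g\<in>carrier G. \<Sum>p\<in>carrier G. \<Sum>q\<in>carrier G. ?F g q p)"
          by (rule sum.swap)
        also have "\<dots> = (\<Sum>g\<in>carrier G. \<Sum>q\<in>carrier G. \<Sum>p\<in>carrier G. ?F g q p)"
          by (intro sum.cong refl sum.swap)
        finally show ?thesis .
      qed
      also have "\<dots> = 0"
      proof (rule sum.neutral, rule ballI)
        fix g assume g: "g \<in> carrier G"
        let ?c = "tens_emb (\<rho> g v) * tens_emb (\<rho> g w) - tens_emb (\<rho> g w) * tens_emb (\<rho> g v)"
        let ?H = "\<lambda>y z. L N (z \<otimes> (g \<otimes> y)) (s g * ((if z = \<one> then ?c else 0) - K z (\<rho> g v) (\<rho> g w)) * T z (T g (t y)))"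
        have "(\<Sum>q\<in>carrier G. \<Sum>p\<in>carrier G. ?F g q p) = (\<Sum>x\<in>carrier G. \<Sum>p\<in>carrier G. ?F g (g \<otimes> x) p)"
          by (rule TS.sum_translate[OF g])
        also have "\<dots> = (\<Sum>x\<in>carrier G. \<Sum>y\<in>carrier G. ?F g (g \<otimes> x) (g \<otimes> x \<otimes> y))"
          by (rule sum.cong[OF refl], rule TS.sum_translate) (use g in simp)
        also have "\<dots> = (\<Sum>x\<in>carrier G. \<Sum>y\<in>carrier G. ?H y (g \<otimes> x \<otimes> inv g))"
        proof (intro sum.cong refl)
          fix x y assume x: "x \<in> carrier G" and y: "y \<in> carrier G"
          let ?z = "g \<otimes> x \<otimes> inv g"
          have z: "?z \<in> carrier G" using g x by simp
          have z1: "?z = \<one> \<longleftrightarrow> x = \<one>"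
          proof
            assume "?z = \<one>"
            then have "inv g \<otimes> ?z \<otimes> g = \<one>" using g by simp
            moreover have "inv g \<otimes> ?z \<otimes> g = x" using g x by (simp add: m_assoc) (simp flip: m_assoc)
            ultimately show "x = \<one>" by simp
          qed (use g in simp)
          have a: "inv g \<otimes> (g \<otimes> x) = x" using g x by (simp flip: m_assoc)
          have b: "inv (g \<otimes> x) \<otimes> (g \<otimes> x \<otimes> y) = y" using g x y by (simp add: inv_mult_group m_assoc) (simp flip: m_assoc)
          have zg: "?z \<otimes> g = g \<otimes> x" using g x by (simp add: m_assoc)
          then have c: "?z \<otimes> (g \<otimes> y) = g \<otimes> x \<otimes> y" using z g y by (simp flip: m_assoc)
          have d: "T ?z (T g (t y)) = T (g \<otimes> x) (t y)" using zg z g by (simp flip: T_mult)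
          have e: "T g (?r x) = (if ?z = \<one> then ?c else 0) - K ?z (\<rho> g v) (\<rho> g w)"
            unfolding relator_eq[OF x] z1 by (simp add: T_emb K_invariant g x)
          show "?F g (g \<otimes> x) (g \<otimes> x \<otimes> y) = ?H y ?z"
            unfolding a b c d e ..
        qed
        also have "\<dots> = (\<Sum>y\<in>carrier G. \<Sum>x\<in>carrier G. ?H y (g \<otimes> x \<otimes> inv g))"
          by (rule sum.swap)
        also have "\<dots> = (\<Sum>y\<in>carrier G. \<Sum>z\<in>carrier G. ?H y z)"
          by (rule sum.cong[OF refl], rule sum_conj[OF g])
        also have "\<dots> = 0"
        proof (rule sum.neutral, rule ballI)
          fix y assume y: "y \<in> carrier G"
          have "(\<Sum>z\<in>carrier G. ?H y z)
             = (\<Sum>z\<in>carrier G. (if z = \<one> then L N (z \<otimes> (g \<otimes> y)) (s g * ?c * T z (T g (t y))) else 0)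
                 - L N (z \<otimes> (g \<otimes> y)) (s g * K z (\<rho> g v) (\<rho> g w) * T z (T g (t y))))"
            by (rule sum.cong) (auto simp: right_diff_distrib left_diff_distrib)
          also have "\<dots> = L N (g \<otimes> y) (s g * ?c * T g (t y))
               - (\<Sum>z\<in>carrier G. L N (z \<otimes> (g \<otimes> y)) (s g * K z (\<rho> g v) (\<rho> g w) * T z (T g (t y))))"
            using g y by (simp add: sum_subtractf finite_carrier T_one)
          also have "\<dots> = 0"
            using N[of "g \<otimes> y" "s g" "\<rho> g v" "\<rho> g w" "T g (t y)"] g y by simp
          finally show "(\<Sum>z\<in>carrier G. ?H y z) = 0" .
        qed
        finally show "(\<Sum>q\<in>carrier G. \<Sum>p\<in>carrier G. ?F g q p) = 0" .
      qed
      finally show ?thesis .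
    qed
    then show "?r \<in> J" using relator_carrier by (simp add: J_def)
  qed
  ultimately have "I \<subseteq> J"
    unfolding H_ideal_def tensor_skew_eq by (rule R.genideal_minimal)
  then have "f \<in> J" "f \<in> carrier R" using f I_carrier by auto
  then have "?\<nu> (\<one>\<^bsub>R\<^esub> \<otimes>\<^bsub>R\<^esub> f \<otimes>\<^bsub>R\<^esub> \<one>\<^bsub>R\<^esub>) = 0" unfolding J_def by blast
  then show ?thesis using \<open>f \<in> carrier R\<close> by simp
qed

text \<open>
  The filtration of \<open>T(V)#G\<close> by degree, its predecessor, and the leading term of an element of
  degree at most \<open>m\<close> as an element of \<open>S(V)#G\<close>.
\<close>

definition E :: "nat \<Rightarrow> ('g \<Rightarrow> 'b tensor_alg) set" where
  "E m = {f \<in> carrier R. \<forall>g. tdeg_le m (f g)}"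

definition E_prev :: "nat \<Rightarrow> ('g \<Rightarrow> 'b tensor_alg) set" where
  "E_prev m = (if m = 0 then {\<lambda>g. 0} else E (m - 1))"

definition symb :: "nat \<Rightarrow> ('g \<Rightarrow> 'b tensor_alg) \<Rightarrow> 'g \<Rightarrow> 'b sym_alg" where
  "symb m f = (\<lambda>g. hpart m (to_sym (f g)))"

lemma E_zero: "(\<lambda>g. 0) \<in> E m"
  by (simp add: E_def TS.R_simps)

lemma E_add: "f \<in> E m \<Longrightarrow> h \<in> E m \<Longrightarrow> (\<lambda>g. f g + h g) \<in> E m"
  by (simp add: E_def TS.R_simps deg_le_add)

lemma E_scale: "f \<in> E m \<Longrightarrow> (\<lambda>g. const_pm c * f g) \<in> E m"
  by (simp add: E_def TS.R_simps deg_le_scale)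

lemma E_diff: "f \<in> E m \<Longrightarrow> h \<in> E m \<Longrightarrow> (\<lambda>g. f g - h g) \<in> E m"
  by (simp add: E_def TS.R_simps deg_le_diff)

lemma E_mono: "f \<in> E m \<Longrightarrow> m \<le> n \<Longrightarrow> f \<in> E n"
  unfolding E_def using deg_le_mono by blast

lemma E_prev_sub: "f \<in> E_prev m \<Longrightarrow> f \<in> E m"
  by (auto simp: E_prev_def E_zero intro: E_mono split: if_splits)

lemma E_prev_add: "f \<in> E_prev m \<Longrightarrow> h \<in> E_prev m \<Longrightarrow> (\<lambda>g. f g + h g) \<in> E_prev m"
  by (auto simp: E_prev_def E_add split: if_splits)

lemma E_prev_scale: "f \<in> E_prev m \<Longrightarrow> (\<lambda>g. const_pm c * f g) \<in> E_prev m"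
  by (auto simp: E_prev_def E_scale split: if_splits)

lemma symb_E_prev: "f \<in> E_prev m \<Longrightarrow> symb m f = (\<lambda>g. 0)"
proof (cases "m = 0")
  case False
  assume "f \<in> E_prev m"
  then have "deg_le mon_deg (m - 1) (to_sym (f g))" for g
    using False by (simp add: E_prev_def E_def deg_le_to_sym)
  then have "hpart m (to_sym (f g)) = 0" for g
    by (rule hpart_eq_0_if_deg_le) (use False in simp)
  then show ?thesis by (simp add: symb_def)
qed (simp add: E_prev_def symb_def)

text \<open>
  The elements that become of degree less than \<open>m\<close> modulo the ideal. Among the elements of degree at
  most \<open>m\<close> these are exactly the ones without a leading term in degree \<open>m\<close>.
\<close>

definition lower :: "nat \<Rightarrow> ('g \<Rightarrow> 'b tensor_alg) set" where
  "lower m = {f. \<exists>i\<in>I. \<exists>e\<in>E_prev m. f = (\<lambda>g. i g + e g)}"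

text \<open>
  The functional belonging to a monomial \<open>\<mu>\<close> of degree \<open>m\<close> vanishes on the ideal and reads off the
  coefficient of \<open>\<mu>\<close>; so every such coefficient of an element of the ideal is 0.
\<close>

lemma symb_eq_0_if_lower:
  assumes f: "f \<in> E m" and "f \<in> lower m"
  shows "symb m f = (\<lambda>g. 0)"
proof -
  obtain i e where i: "i \<in> I" and e: "e \<in> E_prev m" and fi: "f = (\<lambda>g. i g + e g)"
    using assms(2) by (auto simp: lower_def)
  have iE: "i \<in> E m" using E_diff[OF f E_prev_sub[OF e]] by (simp add: fi)
  have "hpart m (to_sym (i k)) = 0" for k
  proof (cases "k \<in> carrier G")
    case k: True
    show ?thesis
    proof (rule poly_mapping_eqI)
      fix \<mu> :: "'b \<Rightarrow>\<^sub>0 nat"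
      show "Poly_Mapping.lookup (hpart m (to_sym (i k))) \<mu> = Poly_Mapping.lookup 0 \<mu>"
      proof (cases "mon_deg \<mu> = m")
        case True
        obtain N where N: "\<And>h v w s t. h \<in> carrier G \<Longrightarrow> L N h (s * (tens_emb v * tens_emb w - tens_emb w * tens_emb v) * t)
           = (\<Sum>g\<in>carrier G. L N (g \<otimes> h) (s * K g v w * T g t))"
          and val: "\<And>h t. tdeg_le (mon_deg \<mu>) t \<Longrightarrow> L N h t = (if h = k then Poly_Mapping.lookup (to_sym t) \<mu> else 0)"
          using normal_form_functional[of \<mu> k] by blast
        have "0 = (\<Sum>h\<in>carrier G. L N h (i h))"
          by (rule functional_kills_ideal[OF N i, symmetric])
        also have "\<dots> = (\<Sum>h\<in>carrier G. if h = k then Poly_Mapping.lookup (to_sym (i h)) \<mu> else 0)"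
          using iE True by (intro sum.cong refl val) (auto simp: E_def)
        finally show ?thesis using k finite_carrier True by (simp add: lookup_hpart)
      qed (simp add: lookup_hpart)
    qed
  next
    case False
    then show ?thesis using I_carrier[OF i] by (simp add: TS.R_simps)
  qed
  then show ?thesis using symb_E_prev[OF e] by (simp add: symb_def fi fun_eq_iff)
qed

lemma lower_add: "f \<in> lower m \<Longrightarrow> h \<in> lower m \<Longrightarrow> (\<lambda>g. f g + h g) \<in> lower m"
proof -
  assume "f \<in> lower m" "h \<in> lower m"
  then obtain i e i' e' where "i \<in> I" "e \<in> E_prev m" "f = (\<lambda>g. i g + e g)"
    "i' \<in> I" "e' \<in> E_prev m" "h = (\<lambda>g. i' g + e' g)" by (auto simp: lower_def)
  then show ?thesis unfolding lower_def
    by (intro CollectI bexI[of _ "\<lambda>g. i g + i' g"] bexI[of _ "\<lambda>g. e g + e' g"] I_add E_prev_add)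
       (auto simp: add_ac)
qed

lemma lower_scale: "f \<in> lower m \<Longrightarrow> (\<lambda>g. const_pm c * f g) \<in> lower m"
proof -
  assume "f \<in> lower m"
  then obtain i e where "i \<in> I" "e \<in> E_prev m" "f = (\<lambda>g. i g + e g)" by (auto simp: lower_def)
  then show ?thesis unfolding lower_def
    by (intro CollectI bexI[of _ "\<lambda>g. const_pm c * i g"] bexI[of _ "\<lambda>g. const_pm c * e g"] I_scale E_prev_scale)
       (auto simp: distrib_left)
qed

lemma E_prev_lower: "f \<in> E_prev m \<Longrightarrow> f \<in> lower m"
  unfolding lower_def using I_zero by force

lemma lower_zero: "(\<lambda>g. 0) \<in> lower m"
  by (rule E_prev_lower) (simp add: E_prev_def E_zero)

lemma lower_sum: "finite A \<Longrightarrow> (\<And>a. a \<in> A \<Longrightarrow> f a \<in> lower m) \<Longrightarrow> (\<lambda>g. \<Sum>a\<in>A. f a g) \<in> lower m"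
  by (induction A rule: finite_induct) (auto simp: lower_zero lower_add)

text \<open>
  The difference is a multiple of a relator, up to the terms of lower degree of this relator.
\<close>

lemma swap_lower:
  assumes h: "h \<in> carrier G"
  shows "TS.pure h (word (u @ b # c # w) - word (u @ c # b # w)) \<in> lower (length u + length w + 2)"
proof -
  let ?b = "axis b 1 :: complex ^ 'b" and ?c = "axis c 1 :: complex ^ 'b"
  let ?r = "relator G \<kappa>L \<kappa>C ?b ?c"
  let ?i = "TS.pure \<one> (word u) \<otimes>\<^bsub>R\<^esub> ?r \<otimes>\<^bsub>R\<^esub> TS.pure h (word w)"
  let ?e = "\<lambda>k. if k \<in> carrier G then word u * K (k \<otimes> inv h) ?b ?c * T (k \<otimes> inv h) (word w) else 0"
  have i: "?i \<in> I"
    by (intro ideal.I_r_closed[OF ideal_I] ideal.I_l_closed[OF ideal_I] relator_in_I TS.pure_carrier h one_closed)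
  have e: "?e \<in> E_prev (length u + length w + 2)"
    by (auto simp: E_prev_def E_def TS.R_simps intro!: tdeg_le_insert)
  have "TS.pure h (word (u @ b # c # w) - word (u @ c # b # w)) k = ?i k + ?e k" for k
  proof (cases "k \<in> carrier G")
    case k: True
    have kh: "k \<otimes> inv h \<in> carrier G" "k \<otimes> inv h = \<one> \<longleftrightarrow> k = h"
      using k h by (auto simp: inv_solve_right')
    have "?i k = word u * ?r (k \<otimes> inv h) * T (k \<otimes> inv h) (word w)"
      by (simp add: TS.mult_pure h k TS.pure_one_mult relator_carrier)
    also have "\<dots> = (if k = h then word u * (tens_emb ?b * tens_emb ?c - tens_emb ?c * tens_emb ?b) * word w else 0) - ?e k"
      unfolding relator_eq[OF kh(1)] kh(2)
      using k h by (auto simp: right_diff_distrib left_diff_distrib T_one)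
    finally show ?thesis
      by (auto simp: TS.pure_def tens_emb_axis left_diff_distrib right_diff_distrib mult_single plus_free_mon_def)
  next
    case False
    then show ?thesis using h by (auto simp: TS.pure_def TS.R_simps)
  qed
  then show ?thesis unfolding lower_def
    by (intro CollectI bexI[OF _ i] bexI[OF _ e] HOL.ext)
qed

lemma sort_lower:
  fixes ix :: "'b \<Rightarrow> nat"
  assumes h: "h \<in> carrier G"
  shows "TS.pure h (word w - word (sort_key ix w)) \<in> lower (length w)"
proof -
  have trans: "TS.pure h (x - z) \<in> lower m" if "TS.pure h (x - y) \<in> lower m" "TS.pure h (y - z) \<in> lower m" for x y z m
  proof -
    have "TS.pure h (x - z) = (\<lambda>g. TS.pure h (x - y) g + TS.pure h (y - z) g)"
      by (auto simp: TS.pure_def)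
    then show ?thesis using lower_add[OF that] by simp
  qed
  have refl: "TS.pure h 0 \<in> lower m" for m
    using lower_zero by (simp add: TS.pure_def)
  have ins: "TS.pure h (word (p @ b # w) - word (p @ insort_key ix b w)) \<in> lower (length p + length w + 1)" for p b w
  proof (induction w arbitrary: p)
    case (Cons c w)
    show ?case
    proof (cases "ix b \<le> ix c")
      case False
      then show ?thesis
        using trans[OF swap_lower[OF h, of p b c w]] Cons[of "p @ [c]"] by simp
    qed (simp add: refl)
  qed (simp add: refl)
  have "TS.pure h (word (p @ w) - word (p @ sort_key ix w)) \<in> lower (length p + length w)" for p
  proof (induction w arbitrary: p)
    case (Cons b w)
    show ?case
      using trans[OF _ ins[of p b "sort_key ix w"], of "word (p @ b # w)"] Cons[of "p @ [b]"] by simp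
  qed (simp add: refl)
  from this[of "[]"] show ?thesis by simp
qed

text \<open>
  Words sorted with respect to a fixed order of the letters give a linear section \<open>sect\<close> of the
  projection to the symmetric algebra. By \<open>sort_lower\<close> every tensor agrees with the section of its
  leading term, up to the ideal and lower degree.
\<close>

lemma lower_if_symb_eq_0:
  assumes f: "f \<in> E m" and s: "symb m f = (\<lambda>g. 0)"
  shows "f \<in> lower m"
proof -
  obtain ix :: "'b \<Rightarrow> nat" where ix: "inj ix"
    using finite_imp_inj_to_nat_seg[of "UNIV :: 'b set"] by auto
  \<comment> \<open>Two words with the same monomial have the same sorted form, so the choice does not matter.\<close>
  define sect :: "'b sym_alg \<Rightarrow> 'b tensor_alg"
    where "sect = cpm.ext (\<lambda>\<mu>. word (sort_key ix (SOME w. word_mon w = \<mu>)))"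
  have sect: "sect (Poly_Mapping.single (word_mon w) c) = const_pm c * word (sort_key ix w)" for w c
  proof -
    define w' where "w' = (SOME w'. word_mon w' = word_mon w)"
    have "word_mon w' = word_mon w" unfolding w'_def by (rule someI[of _ w]) (rule refl)
    then have "sort_key ix w' = sort_key ix w"
      unfolding word_mon_eq_iff by (intro sort_key_inj_key_eq) (use ix in \<open>auto simp: inj_on_def\<close>)
    then show ?thesis by (simp add: sect_def w'_def)
  qed
  have main: "TS.pure h (t - sect (hpart m (to_sym t))) \<in> lower m" if h: "h \<in> carrier G" and t: "tdeg_le m t" for h t
    using t unfolding deg_le_def
  proof (induction t rule: poly_mapping_keys_induct)
    case zero
    then show ?case using lower_zero by (simp add: sect_def TS.pure_def)
  next
    case (add x y)
    have "TS.pure h (x + y - sect (hpart m (to_sym (x + y))))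
       = (\<lambda>g. TS.pure h (x - sect (hpart m (to_sym x))) g + TS.pure h (y - sect (hpart m (to_sym y))) g)"
      by (auto simp: TS.pure_def sect_def)
    then show ?case using lower_add[OF add] by simp
  next
    case (single k c)
    obtain w where k: "k = Word w" by (cases k)
    have sy: "to_sym (Poly_Mapping.single k c) = Poly_Mapping.single (word_mon w) c"
      by (simp add: k to_sym_single)
    show ?case
    proof (cases "length w = m")
      case True
      then have "hpart m (to_sym (Poly_Mapping.single k c)) = Poly_Mapping.single (word_mon w) c"
        unfolding sy by (intro poly_mapping_eqI) (auto simp: lookup_hpart lookup_single when_def)
      then have "TS.pure h (Poly_Mapping.single k c - sect (hpart m (to_sym (Poly_Mapping.single k c))))
         = (\<lambda>g. const_pm c * TS.pure h (word w - word (sort_key ix w)) g)"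
        by (subst single_eq_const_mult) (auto simp: TS.pure_def sect k right_diff_distrib)
      then show ?thesis using lower_scale[OF sort_lower[OF h, of w ix]] True by simp
    next
      case False
      then have lt: "length w < m" using single by (simp add: k word_deg_def)
      then have 0: "hpart m (to_sym (Poly_Mapping.single k c)) = 0"
        unfolding sy by (intro hpart_eq_0_if_deg_le[of "length w"] deg_le_single) simp_all
      have "TS.pure h (Poly_Mapping.single k c) \<in> E_prev m"
        using lt h by (auto simp: E_prev_def E_def TS.R_simps TS.pure_def k word_deg_def intro!: deg_le_single)
      then show ?thesis unfolding 0 by (simp add: sect_def E_prev_lower)
    qed
  qed
  have "TS.pure h (f h) \<in> lower m" if h: "h \<in> carrier G" for h
    using main[OF h, of "f h"] f s by (simp add: E_def symb_def fun_eq_iff sect_def)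
  then have "(\<lambda>k. \<Sum>h\<in>carrier G. TS.pure h (f h) k) \<in> lower m"
    by (intro lower_sum finite_carrier)
  then show ?thesis using TS.eq_sum_pure[of f] f by (simp add: E_def)
qed

end

section \<open>The associated graded algebra\<close>

lemma ring_cong:
  fixes A :: "('a, 'm) ring_scheme" and B :: "('a, 'n) ring_scheme"
  assumes "ring A" "carrier B = carrier A" "monoid.mult B = monoid.mult A" "one B = one A"
    "ring.zero B = ring.zero A" "ring.add B = ring.add A"
  shows "ring B"
proof -
  interpret A: ring A by fact
  show ?thesis
  proof (rule ringI)
    show "abelian_group B"
    proof (rule abelian_groupI)
      fix x assume "x \<in> carrier B"
      then show "\<exists>y\<in>carrier B. y \<oplus>\<^bsub>B\<^esub> x = \<zero>\<^bsub>B\<^esub>"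
        using A.l_neg A.a_inv_closed by (auto simp: assms(2-))
    qed (simp_all add: assms(2-) A.a_ac)
    show "monoid B"
      by (rule monoidI) (simp_all add: assms(2-) A.m_assoc)
  qed (simp_all add: assms(2-) A.l_distr A.r_distr)
qed

context drinfeld_data
begin

abbreviation "H \<equiv> H_algebra G \<rho> \<kappa>L \<kappa>C"
abbreviation "F \<equiv> H_filtration G \<rho> \<kappa>L \<kappa>C"
abbreviation "S \<equiv> SS.R"

definition q :: "('g \<Rightarrow> 'b tensor_alg) \<Rightarrow> ('g \<Rightarrow> 'b tensor_alg) set" where
  "q f = I +>\<^bsub>R\<^esub> f"

lemma q_eq: "q f = (\<lambda>i g. i g + f g) ` I"
  by (auto simp: q_def a_r_coset_def' TS.R_simps(6))

lemma q_eq_iff: "q f = q h \<longleftrightarrow> (\<lambda>g. f g - h g) \<in> I"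
proof
  assume "q f = q h"
  moreover have "f \<in> q f" unfolding q_eq using I_zero by force
  ultimately obtain i where "i \<in> I" "f = (\<lambda>g. i g + h g)" unfolding q_eq by auto
  then show "(\<lambda>g. f g - h g) \<in> I" by simp
next
  have sub: "q f \<subseteq> q h" if "(\<lambda>g. f g - h g) \<in> I" for f h
  proof
    fix x assume "x \<in> q f"
    then obtain i where "i \<in> I" "x = (\<lambda>g. i g + f g)" unfolding q_eq by auto
    then show "x \<in> q h" unfolding q_eq
      by (intro image_eqI[OF _ I_add[OF _ that]]) auto
  qed
  assume d: "(\<lambda>g. f g - h g) \<in> I"
  then have "(\<lambda>g. h g - f g) \<in> I" using I_uminus[OF d] by simp
  then show "q f = q h" using sub d by blast
qed

lemma q_self: "f \<in> q f"
  unfolding q_eq using I_zero by force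

lemma H_eq: "H = quot_algebra R I"
  by (simp add: H_algebra_def tensor_skew_eq)

lemma q_ops:
  assumes "f \<in> carrier R" "h \<in> carrier R"
  shows "q f \<otimes>\<^bsub>H\<^esub> q h = q (f \<otimes>\<^bsub>R\<^esub> h)" "q f \<oplus>\<^bsub>H\<^esub> q h = q (f \<oplus>\<^bsub>R\<^esub> h)"
    "\<one>\<^bsub>H\<^esub> = q \<one>\<^bsub>R\<^esub>" "\<zero>\<^bsub>H\<^esub> = q \<zero>\<^bsub>R\<^esub>" "carrier H = q ` carrier R"
proof -
  interpret ideal I R by (rule ideal_I)
  show "q f \<otimes>\<^bsub>H\<^esub> q h = q (f \<otimes>\<^bsub>R\<^esub> h)"
    unfolding H_eq quot_algebra_simps q_def by (rule rcoset_mult_add[OF assms])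
  show "q f \<oplus>\<^bsub>H\<^esub> q h = q (f \<oplus>\<^bsub>R\<^esub> h)"
    unfolding H_eq quot_algebra_simps q_def by (rule a_rcos_sum[OF assms])
  show "\<one>\<^bsub>H\<^esub> = q \<one>\<^bsub>R\<^esub>" by (simp add: H_eq quot_algebra_simps q_def)
  show "\<zero>\<^bsub>H\<^esub> = q \<zero>\<^bsub>R\<^esub>" by (simp add: H_eq quot_algebra_simps q_eq TS.R_simps)
  show "carrier H = q ` carrier R"
    by (auto simp: H_eq quot_algebra_simps q_def A_RCOSETS_def')
qed

lemma q_smult: "f \<in> carrier R \<Longrightarrow> c \<odot>\<^bsub>H\<^esub> q f = q (\<lambda>g. const_pm c * f g)"
proof -
  assume f: "f \<in> carrier R"
  have "q (c \<odot>\<^bsub>R\<^esub> x) = q (\<lambda>g. const_pm c * f g)" if x: "x \<in> q f" for x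
  proof -
    obtain i where i: "i \<in> I" "x = (\<lambda>g. i g + f g)" using x unfolding q_eq by auto
    then show ?thesis unfolding q_eq_iff
      using I_scale[OF i(1), of c] by (simp add: TS.R_simps(7) scale_pm_def distrib_left)
  qed
  then have "(\<Union>x\<in>q f. q (c \<odot>\<^bsub>R\<^esub> x)) = q (\<lambda>g. const_pm c * f g)"
    using q_self by blast
  then show ?thesis unfolding H_eq quot_algebra_simps by (simp add: q_def)
qed

lemma ring_H: "ring H"
proof -
  have "ring (R Quot I)" using ideal.quotient_is_ring[OF ideal_I] .
  then show ?thesis
    by (rule ring_cong) (simp_all add: H_eq quot_algebra_def ring.defs module.defs)
qed

lemma q_sum:
  assumes "\<And>i. i \<le> m \<Longrightarrow> f i \<in> carrier R"
  shows "(\<Oplus>\<^bsub>H\<^esub>i\<in>{..m::nat}. q (f i)) = q (\<lambda>g. \<Sum>i\<le>m. f i g)"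
  using assms
proof (induction m)
  interpret H: ring H by (rule ring_H)
  case 0
  then have "q (f 0) \<in> carrier H" using q_ops(5)[OF 0 0] by auto
  then show ?case by simp
next
  interpret H: ring H by (rule ring_H)
  case (Suc m)
  have c: "q (f i) \<in> carrier H" if "i \<le> Suc m" for i
    using q_ops(5)[OF Suc.prems Suc.prems, OF that that] Suc.prems[OF that] by auto
  have "(\<Oplus>\<^bsub>H\<^esub>i\<in>{..Suc m}. q (f i)) = q (f (Suc m)) \<oplus>\<^bsub>H\<^esub> (\<Oplus>\<^bsub>H\<^esub>i\<in>{..m}. q (f i))"
    using c by (intro H.finsum_Suc) auto
  also have "\<dots> = q (f (Suc m)) \<oplus>\<^bsub>H\<^esub> q (\<lambda>g. \<Sum>i\<le>m. f i g)"
    using Suc by simp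
  also have "\<dots> = q (f (Suc m) \<oplus>\<^bsub>R\<^esub> (\<lambda>g. \<Sum>i\<le>m. f i g))"
    using Suc.prems by (intro q_ops) (simp_all add: TS.R_simps)
  finally show ?case by (simp add: TS.R_simps add.commute)
qed

lemma F_eq: "F m = q ` E m"
  by (auto simp: H_filtration_def tensor_skew_eq q_def E_def deg_le_def)

lemma filt_prev_eq: "filt_prev H F m = q ` E_prev m"
proof (cases "m = 0")
  case True
  have "\<zero>\<^bsub>H\<^esub> = q (\<lambda>g. 0)" using q_ops(4)[of "\<lambda>g. 0" "\<lambda>g. 0"] by (simp add: TS.R_simps)
  then show ?thesis using True by (simp add: filt_prev_def E_prev_def)
qed (simp add: filt_prev_def E_prev_def F_eq)

lemma E_carrier: "f \<in> E m \<Longrightarrow> f \<in> carrier R"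
  by (simp add: E_def)

lemma symb_diff: "symb m (\<lambda>g. f g - h g) = (\<lambda>g. symb m f g - symb m h g)"
  by (simp add: symb_def)

lemma symb_add: "symb m (\<lambda>g. f g + h g) = (\<lambda>g. symb m f g + symb m h g)"
  by (simp add: symb_def)

lemma lower_iff_symb:
  assumes "f \<in> E m" "h \<in> E m"
  shows "(\<lambda>g. f g - h g) \<in> lower m \<longleftrightarrow> symb m f = symb m h"
  using symb_eq_0_if_lower[OF E_diff[OF assms]] lower_if_symb_eq_0[OF E_diff[OF assms]]
  by (auto simp: symb_diff fun_eq_iff)

lemma I_lower: "f \<in> I \<Longrightarrow> f \<in> lower m"
proof -
  assume f: "f \<in> I"
  have "(\<lambda>g. 0) \<in> E_prev m" by (simp add: E_prev_def E_zero)
  then show ?thesis unfolding lower_def using f by (intro CollectI bexI[of _ f] bexI[of _ "\<lambda>g. 0"]) auto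
qed

text \<open>
  For \<open>s\<close> a leading term in degree \<open>m\<close> this is a coset of the filtration of \<open>H\<close>, see \<open>coset_eq_D\<close>;
  thus the degree \<open>m\<close> part of the associated graded algebra is indexed by leading terms.
\<close>

definition D :: "nat \<Rightarrow> ('g \<Rightarrow> 'b sym_alg) \<Rightarrow> ('g \<Rightarrow> 'b tensor_alg) set set" where
  "D m s = {q h | h. h \<in> E m \<and> symb m h = s}"

lemma coset_eq_D:
  assumes f: "f \<in> E m"
  shows "filt_prev H F m +>\<^bsub>H\<^esub> q f = D m (symb m f)"
proof -
  have "filt_prev H F m +>\<^bsub>H\<^esub> q f = {q (\<lambda>g. e g + f g) | e. e \<in> E_prev m}"
  proof -
    have "q e \<oplus>\<^bsub>H\<^esub> q f = q (\<lambda>g. e g + f g)" if "e \<in> E_prev m" for e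
      using q_ops(2)[OF E_carrier[OF E_prev_sub[OF that]] E_carrier[OF f]] by (simp add: TS.R_simps)
    then show ?thesis unfolding a_r_coset_def' filt_prev_eq by auto
  qed
  also have "\<dots> = D m (symb m f)"
  proof (intro equalityI subsetI)
    fix x assume "x \<in> {q (\<lambda>g. e g + f g) | e. e \<in> E_prev m}"
    then obtain e where e: "e \<in> E_prev m" "x = q (\<lambda>g. e g + f g)" by auto
    moreover have "(\<lambda>g. e g + f g) \<in> E m" by (rule E_add[OF E_prev_sub[OF e(1)] f])
    moreover have "symb m (\<lambda>g. e g + f g) = symb m f"
      unfolding symb_add by (simp add: symb_E_prev[OF e(1)])
    ultimately show "x \<in> D m (symb m f)" unfolding D_def by blast
  next
    fix x assume "x \<in> D m (symb m f)"
    then obtain h where h: "h \<in> E m" "symb m h = symb m f" "x = q h" unfolding D_def by blast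
    then have "(\<lambda>g. h g - f g) \<in> lower m" using lower_iff_symb[OF h(1) f] by simp
    then obtain i e where ie: "i \<in> I" "e \<in> E_prev m" "(\<lambda>g. h g - f g) = (\<lambda>g. i g + e g)"
      unfolding lower_def by blast
    have "(\<lambda>g. h g - (e g + f g)) = i"
    proof
      fix g show "h g - (e g + f g) = i g" using fun_cong[OF ie(3), of g] by (simp add: algebra_simps)
    qed
    then have "q h = q (\<lambda>g. e g + f g)" unfolding q_eq_iff using ie(1) by simp
    then show "x \<in> {q (\<lambda>g. e g + f g) | e. e \<in> E_prev m}" using h(3) ie(2) by blast
  qed
  finally show ?thesis .
qed

lemma symb_zero: "symb m (\<lambda>g. 0) = (\<lambda>g. 0)"
  by (simp add: symb_def)

lemma filt_prev_eq_D: "filt_prev H F m = D m (\<lambda>g. 0)"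
proof -
  interpret H: ring H by (rule ring_H)
  have "filt_prev H F m +>\<^bsub>H\<^esub> q (\<lambda>g. 0) = filt_prev H F m"
  proof -
    have z: "q (\<lambda>g. 0) = \<zero>\<^bsub>H\<^esub>" using q_ops(4)[of "\<lambda>g. 0" "\<lambda>g. 0"] by (simp add: TS.R_simps)
    have "filt_prev H F m \<subseteq> carrier H"
      unfolding filt_prev_eq using q_ops(5)[of "\<lambda>g. 0" "\<lambda>g. 0"] E_carrier[OF E_prev_sub] by (auto simp: TS.R_simps(1))
    then show ?thesis unfolding z by (rule H.a_coset_add_zero)
  qed
  then show ?thesis using coset_eq_D[OF E_zero, of m] by (simp add: symb_zero)
qed

lemma symb_surj:
  assumes p: "p \<in> carrier S"
  shows "\<exists>f\<in>E m. symb m f = (\<lambda>g. hpart m (p g))"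
proof -
  have "\<exists>t. tdeg_le m t \<and> to_sym t = hpart m (p g)" for g
    by (rule to_sym_surj_deg[OF deg_le_hpart])
  then obtain t where t: "\<And>g. tdeg_le m (t g)" "\<And>g. to_sym (t g) = hpart m (p g)" by metis
  let ?f = "\<lambda>g. if g \<in> carrier G then t g else 0"
  have "?f \<in> E m" by (simp add: E_def TS.R_simps t)
  moreover have "symb m ?f = (\<lambda>g. hpart m (p g))"
    using p by (auto simp: symb_def t(2) hpart_hpart SS.R_simps)
  ultimately show ?thesis by blast
qed

lemma D_inj:
  assumes "f \<in> E m" "h \<in> E m" "D m (symb m f) = D m (symb m h)"
  shows "symb m f = symb m h"
proof -
  have "q f \<in> D m (symb m f)" using assms(1) unfolding D_def by blast
  then have "q f \<in> D m (symb m h)" using assms(3) by simp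
  then obtain h' where h': "q f = q h'" "h' \<in> E m" "symb m h' = symb m h" unfolding D_def by blast
  then have "(\<lambda>g. f g - h' g) \<in> lower m" by (intro I_lower) (simp add: q_eq_iff)
  then show ?thesis using lower_iff_symb[OF assms(1) h'(2)] h'(3) by simp
qed

lemma symb_mult:
  assumes f: "f \<in> E i" and h: "h \<in> E j"
  shows "f \<otimes>\<^bsub>R\<^esub> h \<in> E (i + j)" "symb (i + j) (f \<otimes>\<^bsub>R\<^esub> h) = symb i f \<otimes>\<^bsub>S\<^esub> symb j h"
proof -
  have d: "tdeg_le (i + j) ((f \<otimes>\<^bsub>R\<^esub> h) k)" for k
  proof (cases "k \<in> carrier G")
    case True
    then show ?thesis unfolding TS.R_simps(2)[OF True]
      using f h by (intro deg_le_sum tdeg_le_mult tdeg_le_tens_map) (auto simp: E_def)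
  qed (simp add: TS.R_simps)
  then show "f \<otimes>\<^bsub>R\<^esub> h \<in> E (i + j)" by (simp add: E_def TS.R_simps)
  have hp: "hpart (i + j) (p * r) = hpart i p * hpart j r"
    if p: "deg_le mon_deg i p" and r: "deg_le mon_deg j r" for p r :: "'b sym_alg"
  proof -
    have "hpart l p * hpart (i + j - l) r = (if l = i then hpart i p * hpart j r else 0)" if "l \<le> i + j" for l
      using hpart_eq_0_if_deg_le[OF p, of l] hpart_eq_0_if_deg_le[OF r, of "i + j - l"] that
      by (cases l i rule: linorder_cases) auto
    then have "hpart (i + j) (p * r) = (\<Sum>l\<le>i + j. if l = i then hpart i p * hpart j r else 0)"
      unfolding hpart_mult by (intro sum.cong) auto
    then show ?thesis by simp
  qed
  show "symb (i + j) (f \<otimes>\<^bsub>R\<^esub> h) = symb i f \<otimes>\<^bsub>S\<^esub> symb j h"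
  proof
    fix k
    show "symb (i + j) (f \<otimes>\<^bsub>R\<^esub> h) k = (symb i f \<otimes>\<^bsub>S\<^esub> symb j h) k"
    proof (cases "k \<in> carrier G")
      case True
      have "hpart (i + j) (to_sym (f g * T g (h (inv g \<otimes> k)))) = hpart i (to_sym (f g)) * sym_map (\<rho> g) (hpart j (to_sym (h (inv g \<otimes> k))))" for g
      proof -
        have fd: "tdeg_le i (f g)" "tdeg_le j (h (inv g \<otimes> k))" using f h by (simp_all add: E_def)
        have "hpart (i + j) (to_sym (f g * T g (h (inv g \<otimes> k)))) = hpart i (to_sym (f g)) * hpart j (to_sym (T g (h (inv g \<otimes> k))))"
          unfolding to_sym_mult by (intro hp deg_le_to_sym tdeg_le_tens_map fd)
        then show ?thesis unfolding to_sym_tens_map hpart_sym_map .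
      qed
      then show ?thesis
        unfolding symb_def TS.R_simps(2)[OF True] SS.R_simps(2)[OF True] to_sym_sum hpart_sum by simp
    qed (simp add: symb_def TS.R_simps SS.R_simps)
  qed
qed

lemma symb_sum: "symb m (\<lambda>g. \<Sum>i\<in>A. f i g) = (\<lambda>g. \<Sum>i\<in>A. symb m (f i) g)"
  by (simp add: symb_def to_sym_sum hpart_sum)

lemma D_add:
  assumes f: "f \<in> E m" and h: "h \<in> E m"
  shows "D m (symb m f) <+>\<^bsub>H\<^esub> D m (symb m h) = D m (\<lambda>g. symb m f g + symb m h g)"
proof (intro equalityI subsetI)
  fix x assume "x \<in> D m (symb m f) <+>\<^bsub>H\<^esub> D m (symb m h)"
  then obtain a b where ab: "a \<in> E m" "symb m a = symb m f" "b \<in> E m" "symb m b = symb m h" "x = q a \<oplus>\<^bsub>H\<^esub> q b"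
    unfolding set_add_def' D_def by blast
  then have "x = q (\<lambda>g. a g + b g)" using q_ops(2)[OF E_carrier[OF ab(1)] E_carrier[OF ab(3)]] by (simp add: TS.R_simps)
  then show "x \<in> D m (\<lambda>g. symb m f g + symb m h g)"
    unfolding D_def using E_add[OF ab(1,3)] symb_add[of m a b] ab(2,4) by auto
next
  fix x assume "x \<in> D m (\<lambda>g. symb m f g + symb m h g)"
  then obtain k where k: "k \<in> E m" "symb m k = (\<lambda>g. symb m f g + symb m h g)" "x = q k" unfolding D_def by blast
  let ?d = "\<lambda>g. k g - h g"
  have d: "?d \<in> E m" "symb m ?d = symb m f"
    using E_diff[OF k(1) h] by (simp_all add: symb_diff k(2))
  have "x = q ?d \<oplus>\<^bsub>H\<^esub> q h"
    using q_ops(2)[OF E_carrier[OF d(1)] E_carrier[OF h]] k(3) by (simp add: TS.R_simps)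
  then show "x \<in> D m (symb m f) <+>\<^bsub>H\<^esub> D m (symb m h)"
    unfolding set_add_def' D_def using d h by blast
qed

lemma D_smult:
  assumes f: "f \<in> E m"
  shows "(\<Union>x\<in>D m (symb m f). filt_prev H F m +>\<^bsub>H\<^esub> (c \<odot>\<^bsub>H\<^esub> x)) = D m (\<lambda>g. const_pm c * symb m f g)"
proof -
  have "filt_prev H F m +>\<^bsub>H\<^esub> (c \<odot>\<^bsub>H\<^esub> x) = D m (\<lambda>g. const_pm c * symb m f g)" if x: "x \<in> D m (symb m f)" for x
  proof -
    obtain h where h: "h \<in> E m" "symb m h = symb m f" "x = q h" using x unfolding D_def by blast
    have "symb m (\<lambda>g. const_pm c * h g) = (\<lambda>g. const_pm c * symb m f g)"
      unfolding h(2)[symmetric] by (simp add: symb_def)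
    then show ?thesis
      unfolding h(3) q_smult[OF E_carrier[OF h(1)]] coset_eq_D[OF E_scale[OF h(1)]] by simp
  qed
  moreover have "q f \<in> D m (symb m f)" using f unfolding D_def by blast
  ultimately show ?thesis by blast
qed

abbreviation "gr \<equiv> gr_algebra H F"

lemma gr_carrier_iff:
  "X \<in> carrier gr \<longleftrightarrow> (\<forall>m. \<exists>f\<in>E m. X m = D m (symb m f)) \<and> finite {m. X m \<noteq> D m (\<lambda>g. 0)}"
proof -
  have "(\<exists>x\<in>F m. X m = filt_prev H F m +>\<^bsub>H\<^esub> x) \<longleftrightarrow> (\<exists>f\<in>E m. X m = D m (symb m f))" for m
  proof -
    have "(\<exists>x\<in>F m. P x) \<longleftrightarrow> (\<exists>f\<in>E m. P (q f))" for P unfolding F_eq by blast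
    then show ?thesis by (simp add: coset_eq_D cong: bex_cong)
  qed
  then show ?thesis by (simp add: gr_algebra_def flip: filt_prev_eq_D)
qed

text \<open>
  The isomorphism from \<open>S(V)#G\<close> to the associated graded algebra.
\<close>

definition \<psi> :: "('g \<Rightarrow> 'b sym_alg) \<Rightarrow> nat \<Rightarrow> ('g \<Rightarrow> 'b tensor_alg) set set" where
  "\<psi> p m = D m (\<lambda>g. hpart m (p g))"

lemma \<psi>_symb:
  assumes "p \<in> carrier S"
  obtains f where "f \<in> E m" "symb m f = (\<lambda>g. hpart m (p g))" "\<psi> p m = D m (symb m f)"
  using symb_surj[OF assms, of m] unfolding \<psi>_def by fastforce

lemma \<psi>_carrier:
  assumes p: "p \<in> carrier S"
  shows "\<psi> p \<in> carrier gr"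
  unfolding gr_carrier_iff
proof (intro conjI allI)
  fix m show "\<exists>f\<in>E m. \<psi> p m = D m (symb m f)" using \<psi>_symb[OF p] by metis
next
  have "{m. \<psi> p m \<noteq> D m (\<lambda>g. 0)} \<subseteq> (\<Union>g\<in>carrier G. mon_deg ` Poly_Mapping.keys (p g))"
  proof
    fix m assume "m \<in> {m. \<psi> p m \<noteq> D m (\<lambda>g. 0)}"
    then have "(\<lambda>g. hpart m (p g)) \<noteq> (\<lambda>g. 0)" unfolding \<psi>_def by auto
    then obtain g k where gk: "Poly_Mapping.lookup (hpart m (p g)) k \<noteq> 0" by (metis poly_mapping_eqI lookup_zero)
    then have "mon_deg k = m" "Poly_Mapping.lookup (p g) k \<noteq> 0" by (auto simp: lookup_hpart split: if_splits)
    moreover have "g \<in> carrier G" using p calculation(2) by (metis SS.R_simps(1) lookup_zero)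
    moreover have "k \<in> Poly_Mapping.keys (p g)" using calculation(2) by (simp add: in_keys_iff)
    ultimately show "m \<in> (\<Union>g\<in>carrier G. mon_deg ` Poly_Mapping.keys (p g))" by blast
  qed
  then show "finite {m. \<psi> p m \<noteq> D m (\<lambda>g. 0)}"
    by (rule finite_subset) (simp add: finite_carrier)
qed

lemma \<psi>_mult:
  assumes p: "p \<in> carrier S" and r: "r \<in> carrier S"
  shows "\<psi> (p \<otimes>\<^bsub>S\<^esub> r) = \<psi> p \<otimes>\<^bsub>gr\<^esub> \<psi> r"
proof
  fix m
  have ex: "\<exists>f. f \<in> E i \<and> symb i f = (\<lambda>g. hpart i (p g)) \<and> (SOME x. x \<in> \<psi> p i) = q f"
    if p: "p \<in> carrier S" for p i
  proof -
    obtain f where "f \<in> E i" "symb i f = (\<lambda>g. hpart i (p g))" "\<psi> p i = D i (symb i f)" by (rule \<psi>_symb[OF p])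
    then have "q f \<in> \<psi> p i" unfolding D_def by blast
    then have "(SOME x. x \<in> \<psi> p i) \<in> \<psi> p i" by (rule someI)
    then show ?thesis unfolding \<psi>_def D_def by auto
  qed
  obtain f where f: "\<And>i. f i \<in> E i" "\<And>i. symb i (f i) = (\<lambda>g. hpart i (p g))" "\<And>i. (SOME x. x \<in> \<psi> p i) = q (f i)"
    using ex[OF p] by metis
  obtain h where h: "\<And>i. h i \<in> E i" "\<And>i. symb i (h i) = (\<lambda>g. hpart i (r g))" "\<And>i. (SOME x. x \<in> \<psi> r i) = q (h i)"
    using ex[OF r] by metis
  let ?s = "\<lambda>g. \<Sum>i\<le>m. (f i \<otimes>\<^bsub>R\<^esub> h (m - i)) g"
  have fh: "f i \<otimes>\<^bsub>R\<^esub> h (m - i) \<in> E m" "symb m (f i \<otimes>\<^bsub>R\<^esub> h (m - i)) = symb i (f i) \<otimes>\<^bsub>S\<^esub> symb (m - i) (h (m - i))"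
    if "i \<le> m" for i
    using symb_mult[OF f(1)[of i] h(1)[of "m - i"]] that by simp_all
  have sE: "?s \<in> E m" using fh(1) by (auto simp: E_def TS.R_simps intro!: deg_le_sum)
  interpret H: ring H by (rule ring_H)
  have fin: "(\<Oplus>\<^bsub>H\<^esub>i\<in>{..m}. q (f i) \<otimes>\<^bsub>H\<^esub> q (h (m - i))) = q ?s"
  proof -
    have "q (f i) \<otimes>\<^bsub>H\<^esub> q (h (m - i)) = q (f i \<otimes>\<^bsub>R\<^esub> h (m - i))" for i
      by (rule q_ops(1)[OF E_carrier[OF f(1)] E_carrier[OF h(1)]])
    then show ?thesis using q_sum[of m "\<lambda>i. f i \<otimes>\<^bsub>R\<^esub> h (m - i)"] E_carrier[OF fh(1)] by simp
  qed
  have sy: "symb m ?s = (\<lambda>g. hpart m ((p \<otimes>\<^bsub>S\<^esub> r) g))"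
  proof
    fix k
    have "symb m ?s k = (\<Sum>i\<le>m. (symb i (f i) \<otimes>\<^bsub>S\<^esub> symb (m - i) (h (m - i))) k)"
      unfolding symb_sum by (rule sum.cong) (simp_all add: fh(2))
    also have "\<dots> = hpart m ((p \<otimes>\<^bsub>S\<^esub> r) k)"
    proof (cases "k \<in> carrier G")
      case True
      have "hpart m ((p \<otimes>\<^bsub>S\<^esub> r) k) = (\<Sum>g\<in>carrier G. \<Sum>i\<le>m. hpart i (p g) * sym_map (\<rho> g) (hpart (m - i) (r (inv g \<otimes> k))))"
        by (simp add: SS.R_simps(2)[OF True] hpart_sum hpart_mult hpart_sym_map)
      then show ?thesis unfolding f(2) h(2) SS.R_simps(2)[OF True] by (simp add: sum.swap[of _ "{..m}"])
    qed (simp add: SS.R_simps)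
    finally show "symb m ?s k = hpart m ((p \<otimes>\<^bsub>S\<^esub> r) k)" .
  qed
  have "(\<psi> p \<otimes>\<^bsub>gr\<^esub> \<psi> r) m = filt_prev H F m +>\<^bsub>H\<^esub> q ?s"
    by (simp add: gr_algebra_def f(3) h(3) fin)
  then show "\<psi> (p \<otimes>\<^bsub>S\<^esub> r) m = (\<psi> p \<otimes>\<^bsub>gr\<^esub> \<psi> r) m"
    unfolding coset_eq_D[OF sE] sy by (simp add: \<psi>_def)
qed

lemma \<psi>_add:
  assumes p: "p \<in> carrier S" and r: "r \<in> carrier S"
  shows "\<psi> (p \<oplus>\<^bsub>S\<^esub> r) = \<psi> p \<oplus>\<^bsub>gr\<^esub> \<psi> r"
proof
  fix m
  obtain f where f: "f \<in> E m" "symb m f = (\<lambda>g. hpart m (p g))" "\<psi> p m = D m (symb m f)" by (rule \<psi>_symb[OF p])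
  obtain h where h: "h \<in> E m" "symb m h = (\<lambda>g. hpart m (r g))" "\<psi> r m = D m (symb m h)" by (rule \<psi>_symb[OF r])
  have "(\<psi> p \<oplus>\<^bsub>gr\<^esub> \<psi> r) m = \<psi> p m <+>\<^bsub>H\<^esub> \<psi> r m" by (simp add: gr_algebra_def)
  also have "\<dots> = \<psi> (p \<oplus>\<^bsub>S\<^esub> r) m"
    unfolding f(3) h(3) D_add[OF f(1) h(1)] by (simp add: f(2) h(2) \<psi>_def SS.R_simps)
  finally show "\<psi> (p \<oplus>\<^bsub>S\<^esub> r) m = (\<psi> p \<oplus>\<^bsub>gr\<^esub> \<psi> r) m" ..
qed

lemma \<psi>_smult:
  assumes p: "p \<in> carrier S"
  shows "\<psi> (c \<odot>\<^bsub>S\<^esub> p) = c \<odot>\<^bsub>gr\<^esub> \<psi> p"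
proof
  fix m
  obtain f where f: "f \<in> E m" "symb m f = (\<lambda>g. hpart m (p g))" "\<psi> p m = D m (symb m f)" by (rule \<psi>_symb[OF p])
  have "(c \<odot>\<^bsub>gr\<^esub> \<psi> p) m = (\<Union>x\<in>\<psi> p m. filt_prev H F m +>\<^bsub>H\<^esub> (c \<odot>\<^bsub>H\<^esub> x))" by (simp add: gr_algebra_def)
  also have "\<dots> = \<psi> (c \<odot>\<^bsub>S\<^esub> p) m"
    unfolding f(3) D_smult[OF f(1)] by (simp add: f(2) \<psi>_def SS.R_simps scale_pm_def)
  finally show "\<psi> (c \<odot>\<^bsub>S\<^esub> p) m = (c \<odot>\<^bsub>gr\<^esub> \<psi> p) m" ..
qed

lemma \<psi>_one: "\<psi> \<one>\<^bsub>S\<^esub> = \<one>\<^bsub>gr\<^esub>"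
proof
  fix m
  have one: "hpart m (1 :: 'b sym_alg) = (if m = 0 then 1 else 0)"
    by (rule poly_mapping_eqI) (auto simp: lookup_hpart lookup_one when_def)
  have E1: "\<one>\<^bsub>R\<^esub> \<in> E 0" by (auto simp: E_def TS.R_simps)
  have s1: "symb 0 \<one>\<^bsub>R\<^esub> = (\<lambda>g. hpart 0 (\<one>\<^bsub>S\<^esub> g))" by (auto simp: symb_def TS.R_simps SS.R_simps)
  show "\<psi> \<one>\<^bsub>S\<^esub> m = \<one>\<^bsub>gr\<^esub> m"
  proof (cases "m = 0")
    case True
    then show ?thesis using coset_eq_D[OF E1] q_ops(3)[OF E_carrier[OF E1] E_carrier[OF E1]]
      by (simp add: gr_algebra_def \<psi>_def s1)
  next
    case False
    then have "\<psi> \<one>\<^bsub>S\<^esub> m = D m (\<lambda>g. 0)" unfolding \<psi>_def SS.R_simps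
      by (intro arg_cong[of _ _ "D m"]) (auto simp: one)
    then show ?thesis using False by (simp add: gr_algebra_def filt_prev_eq_D)
  qed
qed

lemma \<psi>_inj: "inj_on \<psi> (carrier S)"
proof (rule inj_onI, rule HOL.ext, rule poly_mapping_eqI)
  fix p r g and k :: "'b \<Rightarrow>\<^sub>0 nat"
  assume p: "p \<in> carrier S" and r: "r \<in> carrier S" and eq: "\<psi> p = \<psi> r"
  let ?m = "mon_deg k"
  obtain f where f: "f \<in> E ?m" "symb ?m f = (\<lambda>g. hpart ?m (p g))" "\<psi> p ?m = D ?m (symb ?m f)" by (rule \<psi>_symb[OF p])
  obtain h where h: "h \<in> E ?m" "symb ?m h = (\<lambda>g. hpart ?m (r g))" "\<psi> r ?m = D ?m (symb ?m h)" by (rule \<psi>_symb[OF r])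
  have "symb ?m f = symb ?m h" by (rule D_inj[OF f(1) h(1)]) (use f(3) h(3) eq in simp)
  then have "hpart ?m (p g) = hpart ?m (r g)" using f(2) h(2) by (metis (no_types, lifting))
  then show "Poly_Mapping.lookup (p g) k = Poly_Mapping.lookup (r g) k" by (metis lookup_hpart)
qed

lemma \<psi>_surj:
  assumes X: "X \<in> carrier gr"
  shows "\<exists>p\<in>carrier S. \<psi> p = X \<and> (\<forall>m. (\<forall>k. k \<noteq> m \<longrightarrow> X k = D k (\<lambda>g. 0)) \<longrightarrow> p \<in> sym_skew_part G \<rho> m)"
proof -
  from X obtain f where f: "\<And>m. f m \<in> E m" "\<And>m. X m = D m (symb m (f m))" and fin: "finite {m. X m \<noteq> D m (\<lambda>g. 0)}"
    unfolding gr_carrier_iff by metis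
  let ?M = "{m. X m \<noteq> D m (\<lambda>g. 0)}"
  define p where "p g = (\<Sum>m\<in>?M. symb m (f m) g)" for g
  have p: "p \<in> carrier S" using E_carrier[OF f(1)] by (auto simp: SS.R_simps TS.R_simps p_def symb_def)
  have hp: "hpart m (p g) = (if m \<in> ?M then symb m (f m) g else 0)" for m g
  proof -
    have "hpart m (p g) = (\<Sum>l\<in>?M. if l = m then symb m (f m) g else 0)"
      unfolding p_def hpart_sum by (rule sum.cong) (auto simp: symb_def hpart_hpart)
    then show ?thesis using fin by simp
  qed
  have "\<psi> p m = X m" for m
    using f(2)[of m] unfolding \<psi>_def hp by (cases "m \<in> ?M") auto
  moreover have "p \<in> sym_skew_part G \<rho> m" if "\<forall>k. k \<noteq> m \<longrightarrow> X k = D k (\<lambda>g. 0)" for m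
  proof -
    have "mon_deg k = m" if k: "k \<in> Poly_Mapping.keys (p g)" for g k
    proof (rule ccontr)
      assume "mon_deg k \<noteq> m"
      then have "hpart (mon_deg k) (p g) = 0" unfolding hp using \<open>\<forall>k. k \<noteq> m \<longrightarrow> X k = D k (\<lambda>g. 0)\<close> by simp
      then have "Poly_Mapping.lookup (p g) k = 0" using lookup_hpart[of "mon_deg k" "p g" k] by simp
      then show False using k by (simp add: in_keys_iff)
    qed
    then show ?thesis using p by (simp add: sym_skew_part_def sym_skew_def)
  qed
  ultimately show ?thesis using p by (intro bexI[of _ p]) auto
qed

text \<open>
  Since the cosets of the filtration correspond to leading terms (\<open>D_inj\<close>, \<open>symb_surj\<close>), and leading
  terms multiply as in \<open>S(V)#G\<close> (\<open>symb_mult\<close>), the map \<open>\<psi>\<close> is a graded isomorphism.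
\<close>

theorem drinfeld_orbifold_algebra: "drinfeld_orbifold_algebra G \<rho> \<kappa>L \<kappa>C"
proof -
  have bij: "bij_betw \<psi> (carrier S) (carrier gr)"
    unfolding bij_betw_def using \<psi>_inj \<psi>_carrier \<psi>_surj by fast
  have iso: "\<psi> \<in> ring_iso S gr"
    by (rule ring_iso_memI) (simp_all add: \<psi>_carrier \<psi>_mult \<psi>_add \<psi>_one bij)
  let ?\<phi> = "inv_into (carrier S) \<psi>"
  have \<phi>: "?\<phi> (\<psi> p) = p" if "p \<in> carrier S" for p
    by (rule inv_into_f_f[OF \<psi>_inj that])
  have "?\<phi> \<in> ring_iso gr S" by (rule ring_iso_set_sym[OF SS.ring_R iso])
  moreover have "?\<phi> (c \<odot>\<^bsub>gr\<^esub> x) = c \<odot>\<^bsub>S\<^esub> ?\<phi> x" if x: "x \<in> carrier gr" for c x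
  proof -
    obtain p where p: "p \<in> carrier S" "\<psi> p = x" using \<psi>_surj[OF x] by blast
    have "c \<odot>\<^bsub>S\<^esub> p \<in> carrier S" using p(1) by (simp add: SS.R_simps scale_pm_def)
    then show ?thesis using \<phi> \<psi>_smult[OF p(1)] p by metis
  qed
  moreover have "?\<phi> ` gr_part H F m = sym_skew_part G \<rho> m" for m
  proof (intro equalityI subsetI)
    fix y assume "y \<in> ?\<phi> ` gr_part H F m"
    then obtain X where X: "X \<in> carrier gr" "\<forall>k. k \<noteq> m \<longrightarrow> X k = D k (\<lambda>g. 0)" "y = ?\<phi> X"
      unfolding gr_part_def filt_prev_eq_D by blast
    then obtain p where "p \<in> carrier S" "\<psi> p = X" "p \<in> sym_skew_part G \<rho> m" using \<psi>_surj[OF X(1)] by blast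
    then show "y \<in> sym_skew_part G \<rho> m" using X(3) \<phi> by auto
  next
    fix p assume pm: "p \<in> sym_skew_part G \<rho> m"
    then have p: "p \<in> carrier S" by (simp add: sym_skew_part_def sym_skew_def)
    have "hpart k (p g) = 0" if "k \<noteq> m" for k g
    proof (rule poly_mapping_eqI)
      fix l show "Poly_Mapping.lookup (hpart k (p g)) l = Poly_Mapping.lookup 0 l"
        using pm that unfolding lookup_hpart sym_skew_part_def by (auto simp flip: not_in_keys_iff_lookup_eq_zero)
    qed
    then have "\<psi> p \<in> gr_part H F m"
      unfolding gr_part_def filt_prev_eq_D using \<psi>_carrier[OF p] by (simp add: \<psi>_def)
    then show "p \<in> ?\<phi> ` gr_part H F m" using \<phi>[OF p] by force
  qed
  ultimately show ?thesis
    unfolding drinfeld_orbifold_algebra_def graded_algebra_isomorphic_def sym_skew_def by blast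
qed

end

section \<open>The doubled permutation representation\<close>

abbreviation "tr \<equiv> Transposition.transpose"

lemma inv_Sn: "bij g \<Longrightarrow> inv\<^bsub>Sn\<^esub> g = inv_into UNIV g"
  by (simp add: inv_BijGroup Bij_def restrict_def)

lemma group_Sn: "group Sn"
  by (rule group_BijGroup)

lemma doubled_perm_nth:
  assumes "bij \<sigma>"
  shows "doubled_perm \<sigma> v $ Inl (\<sigma> i) = v $ Inl i" "doubled_perm \<sigma> v $ Inr (\<sigma> i) = v $ Inr i"
  using bij_is_inj[OF assms]
  by (simp_all add: doubled_perm_def xv_def yv_def axis_def inj_eq delta_times cong: if_cong)

lemma finite_rep_Sn: "finite_rep (Sn :: ('n::finite \<Rightarrow> 'n) monoid) doubled_perm"
proof -
  interpret group "Sn :: ('n \<Rightarrow> 'n) monoid" by (rule group_Sn)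
  show ?thesis
    by (rule finite_rep.intro[OF group_Sn], rule finite_rep_axioms.intro)
       (simp_all add: doubled_perm_linear doubled_perm_comp mult_Sn carrier_Sn one_Sn doubled_perm_id)
qed

lemma vec_expand: "v = (\<Sum>i\<in>UNIV. v $ Inl i *s xv i) + (\<Sum>i\<in>UNIV. v $ Inr i *s yv i)"
  using doubled_perm_id[of v] by (simp add: doubled_perm_def)

lemma basis_nth [simp]:
  "xv i $ Inl l = (if l = i then 1 else 0)" "xv i $ Inr l = 0"
  "yv i $ Inl l = 0" "yv i $ Inr l = (if l = i then 1 else 0)"
  by (simp_all add: xv_def yv_def axis_def)

lemma xsum_ysum_nth [simp]:
  "xsum A $ Inl l = (if l \<in> A then 1 else 0)" "xsum A $ Inr l = 0"
  "ysum A $ Inl l = 0" "ysum A $ Inr l = (if l \<in> A then 1 else 0)"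
  by (simp_all add: xsum_def ysum_def)

lemma vec_eqI_sum:
  assumes "\<And>l. u $ Inl l = v $ Inl l" "\<And>l. u $ Inr l = v $ Inr l"
  shows "u = (v :: complex ^ ('n::finite + 'n))"
proof -
  have "u $ k = v $ k" for k by (cases k) (simp_all add: assms)
  then show ?thesis by (simp add: vec_eq_iff)
qed

subsection \<open>Multilinear maps are determined by basis vectors\<close>

lemma linear_zero_on_basis:
  assumes "\<And>u v. f (u + v) = f u + (f v :: 'c::ab_group_add)" "\<And>c u. f (c *s u) = sc c (f u)"
    and "\<And>c. sc c 0 = 0" "\<And>i. f (xv i) = 0" "\<And>i. f (yv i) = 0"
  shows "f v = 0"
proof -
  have "f 0 = 0" using assms(1)[of 0 0] by simp
  then have s: "f (sum h A) = (\<Sum>a\<in>A. f (h a))" for h and A :: "'n set"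
    by (induction A rule: infinite_finite_induct) (simp_all add: assms(1))
  show ?thesis by (subst vec_expand) (simp add: assms s)
qed

definition trilinear :: "(complex \<Rightarrow> 'c \<Rightarrow> 'c) \<Rightarrow> (complex ^ 'b::finite \<Rightarrow> complex ^ 'b \<Rightarrow> complex ^ 'b \<Rightarrow> 'c::ab_group_add) \<Rightarrow> bool" where
  "trilinear sc F \<longleftrightarrow> vector_space sc \<and>
     (\<forall>u u' v w. F (u + u') v w = F u v w + F u' v w) \<and> (\<forall>c u v w. F (c *s u) v w = sc c (F u v w)) \<and>
     (\<forall>u v v' w. F u (v + v') w = F u v w + F u v' w) \<and> (\<forall>c u v w. F u (c *s v) w = sc c (F u v w)) \<and>
     (\<forall>u v w w'. F u v (w + w') = F u v w + F u v w') \<and> (\<forall>c u v w. F u v (c *s w) = sc c (F u v w))"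

lemma cyc_rotate: "cyc F x y z = cyc F y z x"
  by (simp add: cyc_def add_ac)

text \<open>
  A cyclic sum is invariant under rotation of its arguments, so of the eight types of triples of
  basis vectors four suffice.
\<close>

lemma cyc_zero_on_basis:
  fixes F :: "complex ^ ('n::finite + 'n) \<Rightarrow> complex ^ ('n + 'n) \<Rightarrow> complex ^ ('n + 'n) \<Rightarrow> 'c::ab_group_add"
  assumes F: "trilinear sc F"
    and 0: "\<And>i j k. cyc F (xv i) (xv j) (xv k) = 0" "\<And>i j k. cyc F (xv i) (xv j) (yv k) = 0"
      "\<And>i j k. cyc F (xv i) (yv j) (yv k) = 0" "\<And>i j k. cyc F (yv i) (yv j) (yv k) = 0"
  shows "cyc F u v w = 0"
proof -
  interpret vector_space sc using F by (simp add: trilinear_def)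
  have lin: "cyc F (u + u') v w = cyc F u v w + cyc F u' v w" "cyc F (c *s u) v w = sc c (cyc F u v w)" for u u' v w c
    using F by (simp_all add: cyc_def trilinear_def scale_right_distrib add_ac)
  have step: "cyc F u v w = 0" if "\<And>i. cyc F (xv i) v w = 0" "\<And>i. cyc F (yv i) v w = 0" for u v w
    by (rule linear_zero_on_basis[of "\<lambda>u. cyc F u v w" sc]) (use that in \<open>simp_all add: lin\<close>)
  note rot = cyc_rotate[of F, symmetric]
  have xx: "cyc F (xv i) (xv j) w = 0" for i j w
    by (subst rot, rule step, rule 0, subst cyc_rotate, rule 0)
  have xy: "cyc F (xv i) (yv j) w = 0" for i j w
    by (subst rot, rule step, rule 0, subst cyc_rotate, rule 0)
  have yx: "cyc F (yv i) (xv j) w = 0" for i j w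
    by (subst rot, rule step, subst rot, rule 0, subst rot, rule 0)
  have yy: "cyc F (yv i) (yv j) w = 0" for i j w
    by (subst rot, rule step, rule 0, rule 0)
  show ?thesis
  proof (rule step)
    fix i
    show "cyc F (xv i) v w = 0"
      by (subst cyc_rotate, rule step; subst cyc_rotate, subst cyc_rotate; rule xx xy)
    show "cyc F (yv i) v w = 0"
      by (subst cyc_rotate, rule step; subst cyc_rotate, subst cyc_rotate; rule yx yy)
  qed
qed

lemma vector_space_complex: "vector_space ((*) :: complex \<Rightarrow> complex \<Rightarrow> complex)"
  by unfold_locales (simp_all add: algebra_simps)

lemma vector_space_vec: "vector_space ((*s) :: complex \<Rightarrow> complex ^ 'b \<Rightarrow> complex ^ 'b)"
  by (rule vec.vector_space_axioms)

lemma skew_bilinear_iff: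
  "skew_bilinear sc B \<longleftrightarrow> vector_space sc \<and> (\<forall>u u' v. B (u + u') v = B u v + B u' v) \<and>
     (\<forall>c u v. B (c *s u) v = sc c (B u v)) \<and> (\<forall>u v v'. B u (v + v') = B u v + B u v') \<and>
     (\<forall>c u v. B u (c *s v) = sc c (B u v)) \<and> (\<forall>u v. B u v = - B v u)"
  unfolding skew_bilinear_def Vector_Spaces.linear_iff by (simp add: vector_space_vec) blast

lemma skew_bilinear_eqI:
  fixes B :: "complex ^ ('n::finite + 'n) \<Rightarrow> complex ^ ('n + 'n) \<Rightarrow> 'c::ab_group_add"
  assumes "skew_bilinear sc B" "skew_bilinear sc B'"
    and "\<And>i j. B (xv i) (xv j) = B' (xv i) (xv j)" "\<And>i j. B (xv i) (yv j) = B' (xv i) (yv j)"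
      "\<And>i j. B (yv i) (yv j) = B' (yv i) (yv j)"
  shows "B = B'"
proof (intro ext)
  fix u v
  interpret vector_space sc using assms(1) by (simp add: skew_bilinear_iff)
  have B: "B (u + u') v = B u v + B u' v" "B (c *s u) v = sc c (B u v)" "B u v = - B v u" for u u' v c
    using assms(1) unfolding skew_bilinear_iff by blast+
  have B': "B' (u + u') v = B' u v + B' u' v" "B' (c *s u) v = sc c (B' u v)" "B' u v = - B' v u" for u u' v c
    using assms(2) unfolding skew_bilinear_iff by blast+
  have step: "B u v - B' u v = 0" if "\<And>i. B (xv i) v - B' (xv i) v = 0" "\<And>i. B (yv i) v - B' (yv i) v = 0" for u v
    by (rule linear_zero_on_basis[of "\<lambda>u. B u v - B' u v" sc])
       (use that in \<open>simp_all add: B(1,2) B'(1,2) scale_right_diff_distrib\<close>)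
  have yx: "B (yv i) (xv j) = B' (yv i) (xv j)" for i j
    using B(3)[of "yv i" "xv j"] B'(3)[of "yv i" "xv j"] assms(4)[of j i] by simp
  have x: "B v (xv j) = B' v (xv j)" and y: "B v (yv j) = B' v (yv j)" for v j
    using step[of "xv j" v] step[of "yv j" v] by (simp_all add: assms(3-5) yx)
  have flip: "B (xv j) v = B' (xv j) v" "B (yv j) v = B' (yv j) v" for v j
    using B(3)[of "xv j" v] B'(3)[of "xv j" v] x[of v j] B(3)[of "yv j" v] B'(3)[of "yv j" v] y[of v j] by simp_all
  show "B u v = B' u v" using step[of v u] by (simp add: flip)
qed

lemma skew_bilinear_skew_ext:
  fixes xx :: "'n::finite \<Rightarrow> 'n \<Rightarrow> 'c::ab_group_add"
  assumes "vector_space sc" "\<And>i j. xx i j = - xx j i" "\<And>i j. yy i j = - yy j i"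
  shows "skew_bilinear sc (skew_ext sc xx xy yy)"
proof -
  interpret vector_space sc by fact
  have "skew_ext sc xx xy yy u v = - skew_ext sc xx xy yy v u" for u v
  proof -
    have a: "(\<Sum>i\<in>UNIV. \<Sum>j\<in>UNIV. sc (u $ s i * v $ s j) (zz i j)) = - (\<Sum>i\<in>UNIV. \<Sum>j\<in>UNIV. sc (v $ s i * u $ s j) (zz i j))"
      if "\<And>i j. zz i j = - zz j i" for zz :: "'n \<Rightarrow> 'n \<Rightarrow> 'c" and s
    proof -
      have "(\<Sum>i\<in>UNIV. \<Sum>j\<in>UNIV. sc (u $ s i * v $ s j) (zz i j)) = (\<Sum>j\<in>UNIV. \<Sum>i\<in>UNIV. sc (u $ s i * v $ s j) (zz i j))"
        by (rule sum.swap)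
      also have "\<dots> = (\<Sum>j\<in>UNIV. \<Sum>i\<in>UNIV. - sc (v $ s j * u $ s i) (zz j i))"
        by (intro sum.cong refl) (subst that, simp add: mult.commute)
      finally show ?thesis by (simp add: sum_negf)
    qed
    have "(\<Sum>i\<in>UNIV. \<Sum>j\<in>UNIV. sc (u $ Inl i * v $ Inr j - u $ Inr j * v $ Inl i) (xy i j))
      = - (\<Sum>i\<in>UNIV. \<Sum>j\<in>UNIV. sc (v $ Inl i * u $ Inr j - v $ Inr j * u $ Inl i) (xy i j))"
      unfolding sum_negf[symmetric] by (intro sum.cong refl) (simp flip: scale_minus_left add: mult.commute)
    then show ?thesis
      using a[OF assms(2), of Inl] a[OF assms(3), of Inr] by (simp add: skew_ext_def sum.distrib)
  qed
  moreover have "skew_ext sc xx xy yy (u + u') v = skew_ext sc xx xy yy u v + skew_ext sc xx xy yy u' v" for u u' v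
    by (simp add: skew_ext_def algebra_simps sum.distrib flip: sum.distrib)
  moreover have "skew_ext sc xx xy yy (c *s u) v = sc c (skew_ext sc xx xy yy u v)" for c u v
    by (simp add: skew_ext_def scale_sum_right scale_right_distrib algebra_simps)
  moreover have "skew_ext sc xx xy yy u (v + v') = skew_ext sc xx xy yy u v + skew_ext sc xx xy yy u v'" for u v v'
    by (simp add: skew_ext_def algebra_simps sum.distrib flip: sum.distrib)
  moreover have "skew_ext sc xx xy yy u (c *s v) = sc c (skew_ext sc xx xy yy u v)" for c u v
    by (simp add: skew_ext_def scale_sum_right scale_right_distrib algebra_simps)
  ultimately show ?thesis unfolding skew_bilinear_iff using assms(1) by blast
qed

section \<open>Cochains supported on transpositions\<close>

text \<open>
  The exterior product of the linear forms \<open>x\<^sub>r\<^sup>* - x\<^sub>s\<^sup>*\<close> and \<open>y\<^sub>r\<^sup>* - y\<^sub>s\<^sup>*\<close>, which vanish on the vectors fixed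
  by the transposition \<open>(r s)\<close>.
\<close>

definition omega :: "'n \<Rightarrow> 'n \<Rightarrow> complex ^ ('n::finite + 'n) \<Rightarrow> complex ^ ('n + 'n) \<Rightarrow> complex" where
  "omega r s u v = (u $ Inl r - u $ Inl s) * (v $ Inr r - v $ Inr s)
     - (v $ Inl r - v $ Inl s) * (u $ Inr r - u $ Inr s)"

lemma omega_linear:
  "omega r s (u + u') v = omega r s u v + omega r s u' v" "omega r s (c *s u) v = c * omega r s u v"
  "omega r s u (v + v') = omega r s u v + omega r s u v'" "omega r s u (c *s v) = c * omega r s u v"
  by (simp_all add: omega_def algebra_simps)

lemma skew_bilinear_omega: "skew_bilinear (*) (\<lambda>u v. c * omega r s u v)"
  unfolding skew_bilinear_iff omega_def by (simp add: vector_space_complex algebra_simps)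

lemma skew_bilinear_omega_vec: "skew_bilinear (*s) (\<lambda>u v. omega r s u v *s w)"
  unfolding skew_bilinear_iff omega_def by (simp add: vector_space_vec vec_eq_iff algebra_simps)

lemma omega_basis:
  "omega r s (xv i) (xv j) = 0" "omega r s (yv i) (yv j) = 0"
  "omega r s (xv i) (yv j) = ((if i = r then 1 else 0) - (if i = s then 1 else 0))
     * ((if j = r then 1 else 0) - (if j = s then 1 else 0))"
  by (auto simp: omega_def)

lemma is_transposition_transpose [simp]: "r \<noteq> s \<Longrightarrow> is_transposition (tr r s)"
  unfolding is_transposition_def by blast

lemma kappaCref_transpose:
  assumes "r \<noteq> s"
  shows "kappaCref c (tr r s) = (\<lambda>u v. c * omega r s u v)"
proof (rule skew_bilinear_eqI)
  show "skew_bilinear (*) (kappaCref c (tr r s))"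
    using assms by (simp add: kappaCref_def skew_bilinear_skew_ext vector_space_complex)
  show "skew_bilinear (*) (\<lambda>u v. c * omega r s u v)" by (rule skew_bilinear_omega)
qed (use assms in \<open>auto simp: kappaCref_def skew_ext_const_basis omega_basis moved_transpose doubleton_eq_iff\<close>)

lemma kappaLref_transpose:
  assumes "r \<noteq> s"
  shows "kappaLref a a' b b' (tr r s)
    = (\<lambda>u v. omega r s u v *s u_ref a a' b b' (tr r s))"
proof (rule skew_bilinear_eqI)
  show "skew_bilinear (*s) (kappaLref a a' b b' (tr r s))"
    using assms by (simp add: kappaLref_def skew_bilinear_skew_ext vector_space_vec)
  show "skew_bilinear (*s) (\<lambda>u v. omega r s u v *s u_ref a a' b b' (tr r s))"
    by (rule skew_bilinear_omega_vec)
qed (use assms in \<open>auto simp: kappaLref_def skew_ext_lin_basis omega_basis moved_transpose doubleton_eq_iff\<close>)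

lemma doubled_perm_transpose_diff:
  assumes "r \<noteq> s"
  shows "doubled_perm (tr r s) v - v
     = (v $ Inl s - v $ Inl r) *s (xv r - xv s) + (v $ Inr s - v $ Inr r) *s (yv r - yv s)"
proof -
  let ?t = "tr r s"
  have n: "doubled_perm ?t v $ Inl l = v $ Inl (?t l)" "doubled_perm ?t v $ Inr l = v $ Inr (?t l)" for l
    using doubled_perm_nth[of ?t v "?t l"] by simp_all
  show ?thesis
    by (rule vec_eqI_sum) (use assms in \<open>auto simp: n transpose_def\<close>)
qed

text \<open>
  The coordinates of \<open>\<^sup>gx - x\<close> for \<open>g = (r s)\<close> are, up to sign, the two factors of the exterior product
  \<open>omega r s\<close>, and an exterior product of three linear forms with a repeated factor vanishes.
\<close>

lemma omega_homogeneous: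
  assumes "r \<noteq> s"
  shows "cyc (\<lambda>x y z. omega r s y z *s (doubled_perm (tr r s) x - x)) x y z = 0"
proof -
  have 1: "omega r s y z * (x $ Inl s - x $ Inl r) + omega r s z x * (y $ Inl s - y $ Inl r)
      + omega r s x y * (z $ Inl s - z $ Inl r) = 0"
    and 2: "omega r s y z * (x $ Inr s - x $ Inr r) + omega r s z x * (y $ Inr s - y $ Inr r)
      + omega r s x y * (z $ Inr s - z $ Inr r) = 0"
    by (simp_all add: omega_def algebra_simps)
  have "cyc (\<lambda>x y z. omega r s y z *s (doubled_perm (tr r s) x - x)) x y z
     = (omega r s y z * (x $ Inl s - x $ Inl r) + omega r s z x * (y $ Inl s - y $ Inl r)
        + omega r s x y * (z $ Inl s - z $ Inl r)) *s (xv r - xv s)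
     + (omega r s y z * (x $ Inr s - x $ Inr r) + omega r s z x * (y $ Inr s - y $ Inr r)
        + omega r s x y * (z $ Inr s - z $ Inr r)) *s (yv r - yv s)"
    unfolding cyc_def doubled_perm_transpose_diff[OF assms]
    by (simp only: vec.scale_right_distrib vec.scale_left_distrib vec.scale_scale add_ac)
  then show ?thesis by (simp only: 1 2 vec.scale_zero_left add_0_left)
qed

text \<open>
  If the index \<open>t\<close> is moved by \<open>g\<close> and the basis vectors \<open>p\<close>, \<open>q\<close> do not contribute to the coordinate \<open>t\<close>
  of \<open>\<^sup>gp - p\<close> and \<open>\<^sup>gq - q\<close>, then this coordinate of the equation for \<open>p\<close>, \<open>q\<close>, \<open>t\<close> gives \<open>B(p,q) = 0\<close>. For
  two vectors of the same kind such a \<open>t\<close> is found among the vectors of the other kind. For \<open>x\<^sub>i\<close> and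
  \<open>y\<^sub>j\<close> it exists if one of the indices is fixed or if \<open>g\<close> moves an index other than \<open>i\<close> and \<open>g(i)\<close>,
  that is, unless \<open>g\<close> is a transposition that moves both \<open>i\<close> and \<open>j\<close>.
\<close>

lemma homogeneous_imp_kappaCref:
  fixes g :: "'n::finite \<Rightarrow> 'n"
  assumes B: "skew_bilinear (*) B" and g: "bij g" "g \<noteq> id"
    and H: "\<And>x y z. cyc (\<lambda>x y z. B y z *s (doubled_perm g x - x)) x y z = 0"
  shows "\<exists>c. B = kappaCref c g"
proof -
  define e :: "'n + 'n \<Rightarrow> complex ^ ('n + 'n)" where "e p = axis p 1" for p
  have e: "xv i = e (Inl i)" "yv i = e (Inr i)" for i by (simp_all add: xv_def yv_def e_def)
  define D :: "'n + 'n \<Rightarrow> 'n + 'n \<Rightarrow> complex"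
    where "D p t = (if t = map_sum g g p then 1 else 0) - (if t = p then 1 else 0)" for p t
  have "doubled_perm g (e p) = e (map_sum g g p)" for p
    by (cases p) (simp_all add: doubled_perm_basis flip: e)
  then have De: "(doubled_perm g (e p) - e p) $ t = D p t" for p t
    by (simp add: D_def e_def axis_def)
  have eq: "B (e q) (e r) * D p t + B (e r) (e p) * D q t + B (e p) (e q) * D r t = 0" for p q r t
    using arg_cong[OF H[of "e p" "e q" "e r"], of "\<lambda>v. v $ t"]
    by (simp add: cyc_def De del: vector_minus_component)
  have key: "B (e p) (e q) = 0" if "map_sum g g t \<noteq> t" "D p t = 0" "D q t = 0" for p q t
    using eq[of q t p t] that by (simp add: D_def)
  obtain m where m: "g m \<noteq> m" using g(2) by (metis eq_id_iff)
  have xx: "B (xv i) (xv j) = 0" and yy: "B (yv i) (yv j) = 0" for i j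
    unfolding e using m by (auto intro: key[of "Inr m"] key[of "Inl m"] simp: D_def)
  have fixed: "B (xv i) (yv j) = 0" if "g i = i \<or> g j = j" for i j
    unfolding e using m that by (auto intro: key[of "Inl m"] key[of "Inr m"] simp: D_def)
  have third: "B (xv i) (yv j) = 0" if "g k \<noteq> k" "k \<noteq> i" "k \<noteq> g i" for i j k
    unfolding e by (rule key[of "Inl k"]) (use that in \<open>auto simp: D_def\<close>)
  have skew: "B u v = - B v u" for u v using B unfolding skew_bilinear_iff by blast
  show ?thesis
  proof (cases "is_transposition g")
    case True
    then obtain r s where rs: "r \<noteq> s" "g = tr r s" unfolding is_transposition_def by blast
    have x: "B (xv s) (yv j) = - B (xv r) (yv j)" for j
      using eq[of "Inl s" "Inr j" "Inl r" "Inl r"] rs skew[of "yv j" "xv r"] by (simp add: D_def e algebra_simps)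
    have y: "B (xv i) (yv s) = - B (xv i) (yv r)" for i
      using eq[of "Inr s" "Inl i" "Inr r" "Inr r"] rs skew[of "yv s" "xv i"] by (simp add: D_def e algebra_simps)
    have "B = (\<lambda>u v. B (xv r) (yv r) * omega r s u v)"
    proof (rule skew_bilinear_eqI[OF B])
      show "skew_bilinear (*) (\<lambda>u v. B (xv r) (yv r) * omega r s u v)" by (rule skew_bilinear_omega)
      fix i j
      show "B (xv i) (yv j) = B (xv r) (yv r) * omega r s (xv i) (yv j)"
      proof (cases "i \<in> {r, s} \<and> j \<in> {r, s}")
        case True
        then show ?thesis using rs(1) x y by (auto simp: omega_basis)
      next
        case False
        then have "g i = i \<or> g j = j" using rs(2) by (auto simp: transpose_def)
        from fixed[OF this] show ?thesis using False by (auto simp: omega_basis)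
      qed
    qed (simp_all add: xx yy omega_basis)
    then show ?thesis unfolding rs(2) kappaCref_transpose[OF rs(1)] by blast
  next
    case False
    have xy: "B (xv i) (yv j) = 0" for i j
    proof (cases "g i = i")
      case gi: False
      have "\<exists>k. g k \<noteq> k \<and> k \<noteq> i \<and> k \<noteq> g i"
      proof (rule ccontr)
        assume "\<not> ?thesis"
        then have oth: "\<And>k. k \<noteq> i \<Longrightarrow> k \<noteq> g i \<Longrightarrow> g k = k" by blast
        have inj: "inj g" using g(1) by (rule bij_is_inj)
        have gg: "g (g i) = i" using oth[of "g (g i)"] gi by (metis inj injD)
        have "g = tr i (g i)"
        proof
          fix x show "g x = tr i (g i) x"
            by (cases "x = i"; cases "x = g i") (use oth[of x] gg in simp_all)
        qed
        then show False using False gi unfolding is_transposition_def by metis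
      qed
      then show ?thesis using third by blast
    qed (use fixed in blast)
    have "B = (\<lambda>u v. 0)"
      by (rule skew_bilinear_eqI[OF B]) (simp_all add: skew_bilinear_iff vector_space_complex xx yy xy)
    then show ?thesis using False by (intro exI[of _ 0]) (simp add: kappaCref_def)
  qed
qed

section \<open>Invariant functions of two or three indices\<close>

text \<open>
  Three transpositions put the three points in place one after the other; the later ones do not
  move the points that are already in place.
\<close>

lemma ex_bij_triple:
  fixes a b c a' b' c' :: 'n
  assumes "distinct [a, b, c]" "distinct [a', b', c']"
  shows "\<exists>h. bij h \<and> h a = a' \<and> h b = b' \<and> h c = c'"
proof -
  define h1 where "h1 = tr a a'"
  define h2 where "h2 = tr (h1 b) b'"
  define h3 where "h3 = tr (h2 (h1 c)) c'"
  have inj: "inj h1" "inj h2" "inj h3" and bij: "bij h1" "bij h2" "bij h3"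
    by (simp_all add: h1_def h2_def h3_def)
  have 1: "h1 a = a'" by (simp add: h1_def)
  have "h1 b \<noteq> a'" using 1 inj(1) assms(1) by (metis distinct_length_2_or_more injD)
  then have 2: "h2 a' = a'" "h2 (h1 b) = b'" using assms(2) by (auto simp: h2_def transpose_def)
  have "h2 (h1 c) \<noteq> a'" "h2 (h1 c) \<noteq> b'"
    using 1 2 inj assms(1) by (metis distinct_length_2_or_more injD)+
  then have "h3 a' = a'" "h3 b' = b'" "h3 (h2 (h1 c)) = c'" using assms(2) by (auto simp: h3_def transpose_def)
  then show ?thesis using 1 2 bij by (intro exI[of _ "h3 \<circ> h2 \<circ> h1"]) (simp add: bij_comp)
qed

lemma ex_three_distinct:
  assumes "CARD('n::finite) \<ge> 3"
  obtains a b c :: "'n::finite" where "distinct [a, b, c]"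
proof -
  obtain T :: "'n set" where "card T = 3" using assms obtain_subset_with_card_n by metis
  then show ?thesis using that by (auto simp: card_3_iff)
qed

lemma ex_other:
  assumes "CARD('n::finite) \<ge> 3"
  shows "\<exists>c :: 'n. c \<noteq> a \<and> c \<noteq> b"
proof -
  obtain x y z :: 'n where "distinct [x, y, z]" using ex_three_distinct[OF assms] .
  then show ?thesis by auto metis
qed

lemma ex_bij_pair:
  fixes a b a' b' :: "'n::finite"
  assumes n: "CARD('n) \<ge> 3" and "a \<noteq> b" "a' \<noteq> b'"
  shows "\<exists>h. bij h \<and> h a = a' \<and> h b = b'"
proof -
  obtain c where "c \<noteq> a" "c \<noteq> b" using ex_other[OF n] by blast
  moreover obtain c' where "c' \<noteq> a'" "c' \<noteq> b'" using ex_other[OF n] by blast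
  ultimately have "distinct [a, b, c]" "distinct [a', b', c']" using assms by auto
  from ex_bij_triple[OF this] show ?thesis by blast
qed

lemma invariant_two:
  fixes f :: "'n::finite \<Rightarrow> 'n \<Rightarrow> 'c"
  assumes n: "CARD('n) \<ge> 3" and f: "\<And>h i j. bij h \<Longrightarrow> f (h i) (h j) = f i j"
  shows "\<exists>s p. \<forall>i j. f i j = (if i = j then s else p)"
proof -
  obtain a b c :: 'n where d: "distinct [a, b, c]" using ex_three_distinct[OF n] .
  have "f i j = (if i = j then f a a else f a b)" for i j
  proof (cases "i = j")
    case True
    then show ?thesis using f[of "tr a i" a a] by simp
  next
    case False
    then obtain h where "bij h" "h a = i" "h b = j" using ex_bij_pair[OF n, of a b i j] d by auto
    then show ?thesis using f[of h a b] False by simp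
  qed
  then show ?thesis by blast
qed

lemma invariant_three:
  fixes f :: "'n::finite \<Rightarrow> 'n \<Rightarrow> 'n \<Rightarrow> 'c"
  assumes n: "CARD('n) \<ge> 3" and f: "\<And>h i j l. bij h \<Longrightarrow> f (h i) (h j) (h l) = f i j l"
  shows "\<exists>p q r s t. \<forall>i j l. f i j l = (if i = j then if l = i then s else t
           else if l = i then p else if l = j then q else r)"
proof -
  obtain a b c :: 'n where d: "distinct [a, b, c]" using ex_three_distinct[OF n] .
  have "f i j l = (if i = j then if l = i then f a a a else f a a b
           else if l = i then f a b a else if l = j then f a b b else f a b c)" for i j l
  proof -
    have 1: ?thesis if ij: "i = j" "l = i"
      using f[of "tr a i" a a a] ij by simp
    have 2: ?thesis if ij: "i = j" "l \<noteq> i"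
    proof -
      obtain h where "bij h" "h a = i" "h b = l" using ex_bij_pair[OF n, of a b i l] d ij by auto
      then show ?thesis using f[of h a a b] ij by auto
    qed
    have 3: ?thesis if ij: "i \<noteq> j" "l = i \<or> l = j"
    proof -
      obtain h where "bij h" "h a = i" "h b = j" using ex_bij_pair[OF n, of a b i j] d ij by auto
      then show ?thesis using f[of h a b a] f[of h a b b] ij by auto
    qed
    have 4: ?thesis if ij: "i \<noteq> j" "l \<noteq> i" "l \<noteq> j"
    proof -
      obtain h where "bij h" "h a = i" "h b = j" "h c = l" using ex_bij_triple[OF d, of i j l] ij by auto
      then show ?thesis using f[of h a b c] ij by auto
    qed
    show ?thesis using 1 2 3 4 by argo
  qed
  then show ?thesis by blast
qed

section \<open>The defining conditions for the symmetric group\<close>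

lemma drinfeld_Sn_iff:
  fixes \<kappa>L :: "('n::finite \<Rightarrow> 'n, 'n + 'n) lin_cochain" and \<kappa>C :: "('n \<Rightarrow> 'n, 'n + 'n) const_cochain"
  shows "drinfeld_orbifold_map Sn doubled_perm \<kappa>L \<kappa>C \<longleftrightarrow>
     cochain Sn (*s) \<kappa>L \<and> cochain Sn (*) \<kappa>C \<and>
     (\<forall>g. bij g \<longrightarrow> (\<forall>u v. doubled_perm g (\<kappa>L g u v) = \<kappa>L g u v)) \<and>
     (\<forall>g. bij g \<longrightarrow> (\<forall>h. bij h \<longrightarrow> (\<forall>u v.
        doubled_perm h (\<kappa>L g u v) = \<kappa>L (h \<circ> g \<circ> inv' h) (doubled_perm h u) (doubled_perm h v) \<and>
        \<kappa>C g u v = \<kappa>C (h \<circ> g \<circ> inv' h) (doubled_perm h u) (doubled_perm h v)))) \<and>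
     (\<forall>g. bij g \<longrightarrow> (\<forall>x y z.
        cyc (\<lambda>x y z. sym_emb (\<kappa>L g y z) * sym_emb (doubled_perm g x - x)) x y z = 0 \<and>
        cyc (\<lambda>u v w. \<Sum>y\<in>{y. bij y}. \<kappa>L (g \<circ> inv' y) (u + doubled_perm y u) (\<kappa>L y v w)) x y z
          = 2 *s cyc (\<lambda>x y z. \<kappa>C g y z *s (doubled_perm g x - x)) x y z \<and>
        cyc (\<lambda>u v w. \<Sum>y\<in>{y. bij y}. \<kappa>C (g \<circ> inv' y) (u + doubled_perm y u) (\<kappa>L y v w)) x y z = 0))"
proof -
  interpret group "Sn :: ('n \<Rightarrow> 'n) monoid" by (rule group_Sn)
  have conj: "h \<otimes>\<^bsub>Sn\<^esub> g \<otimes>\<^bsub>Sn\<^esub> inv\<^bsub>Sn\<^esub> h = h \<circ> g \<circ> inv' h" if "bij g" "bij h" for g h :: "'n \<Rightarrow> 'n"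
    using that by (simp add: inv_Sn mult_Sn bij_comp bij_imp_bij_inv)
  have sums: "(\<Sum>(x, y)\<in>{(x, y). x \<in> carrier Sn \<and> y \<in> carrier Sn \<and> x \<otimes>\<^bsub>Sn\<^esub> y = g}. F x y)
     = (\<Sum>y\<in>{y. bij y}. F (g \<circ> inv' y) y)" if "bij g" for g :: "'n \<Rightarrow> 'n" and F :: "('n \<Rightarrow> 'n) \<Rightarrow> ('n \<Rightarrow> 'n) \<Rightarrow> 'c::comm_monoid_add"
  proof -
    have "(\<Sum>(x, y)\<in>{(x, y). x \<in> carrier Sn \<and> y \<in> carrier Sn \<and> x \<otimes>\<^bsub>Sn\<^esub> y = g}. F x y)
        = (\<Sum>y\<in>carrier Sn. F (g \<otimes>\<^bsub>Sn\<^esub> inv\<^bsub>Sn\<^esub> y) y)"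
      by (rule sum_pairs_product[OF group_Sn]) (simp_all add: that carrier_Sn)
    also have "\<dots> = (\<Sum>y\<in>{y. bij y}. F (g \<circ> inv' y) y)"
      unfolding carrier_Sn by (rule sum.cong) (simp_all add: that inv_Sn mult_Sn bij_imp_bij_inv)
    finally show ?thesis .
  qed
  show ?thesis
    unfolding drinfeld_orbifold_map_cyc
    by (simp only: conj sums[unfolded carrier_Sn mem_Collect_eq] Ball_def carrier_Sn[unfolded set_eq_iff mem_Collect_eq] cong: imp_cong)
qed

lemma cochain_Sn_skew:
  "cochain Sn sc \<kappa> \<Longrightarrow> bij g \<Longrightarrow> skew_bilinear sc (\<kappa> g)" "cochain Sn sc \<kappa> \<Longrightarrow> \<not> bij g \<Longrightarrow> \<kappa> g = (\<lambda>u v. 0)"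
  by (simp_all add: cochain_def carrier_Sn)

lemma skew_zero:
  assumes "skew_bilinear sc B" shows "B u 0 = 0" "B 0 u = 0"
proof -
  have B: "\<And>u v v'. B u (v + v') = B u v + B u v'" "\<And>u u' v. B (u + u') v = B u v + B u' v" "\<And>u v. B u v = - B v u"
    using assms unfolding skew_bilinear_iff by blast+
  show "B u 0 = 0" "B 0 u = 0" using B(1)[of u 0 0] B(2)[of 0 0 u] by simp_all
qed

lemma conj_eq_id_iff:
  fixes g h :: "'n \<Rightarrow> 'n"
  assumes "bij h" shows "h \<circ> g \<circ> inv' h = id \<longleftrightarrow> g = id"
proof
  assume *: "h \<circ> g \<circ> inv' h = id"
  have "h (g x) = h x" for x using fun_cong[OF *, of "h x"] assms by (simp add: bij_is_inj)
  then show "g = id" using assms by (metis bij_is_inj eq_id_iff injD)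
qed (use surj_iff[THEN iffD1, OF bij_is_surj[OF assms]] in simp)

text \<open>
  Only the factorisation \<open>g = g \<circ> id\<close> contributes to the sums in (iii) and (iv), and there \<open>u\<close> is added
  to itself. Off the identity the left-hand side of (iii) vanishes; at the identity the right-hand side
  does.
\<close>

lemma lie_Sn_iff:
  fixes \<kappa>L :: "('n::finite \<Rightarrow> 'n, 'n + 'n) lin_cochain" and \<kappa>C :: "('n \<Rightarrow> 'n, 'n + 'n) const_cochain"
  assumes supp: "supported_only_on \<kappa>L {id}"
  shows "drinfeld_orbifold_map Sn doubled_perm \<kappa>L \<kappa>C \<longleftrightarrow>
     skew_bilinear (*s) (\<kappa>L id) \<and> cochain Sn (*) \<kappa>C \<and>
     (\<forall>h u v. bij h \<longrightarrow> doubled_perm h (\<kappa>L id u v) = \<kappa>L id (doubled_perm h u) (doubled_perm h v)) \<and>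
     (\<forall>g h u v. bij g \<longrightarrow> bij h \<longrightarrow> \<kappa>C g u v = \<kappa>C (h \<circ> g \<circ> inv' h) (doubled_perm h u) (doubled_perm h v)) \<and>
     (\<forall>g x y z. bij g \<longrightarrow> g \<noteq> id \<longrightarrow> cyc (\<lambda>x y z. \<kappa>C g y z *s (doubled_perm g x - x)) x y z = 0) \<and>
     (\<forall>x y z. cyc (\<lambda>u v w. \<kappa>L id u (\<kappa>L id v w)) x y z = 0) \<and>
     (\<forall>g x y z. bij g \<longrightarrow> cyc (\<lambda>u v w. \<kappa>C g u (\<kappa>L id v w)) x y z = 0)"
    (is "?A \<longleftrightarrow> ?B")
proof -
  have L0: "\<kappa>L g = (\<lambda>u v. 0)" if "g \<noteq> id" for g using supp that by (auto simp: supported_only_on_def)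
  have coch: "cochain Sn (*s) \<kappa>L \<longleftrightarrow> skew_bilinear (*s) (\<kappa>L id)"
  proof
    assume *: "skew_bilinear (*s) (\<kappa>L id)"
    have "skew_bilinear (*s) (\<lambda>u v :: complex ^ ('n + 'n). 0 :: complex ^ ('n + 'n))"
      by (simp add: skew_bilinear_iff vector_space_vec)
    then have "skew_bilinear (*s) (\<kappa>L g)" for g using * L0[of g] by (cases "g = id") auto
    moreover have "\<kappa>L g = (\<lambda>u v. 0)" if "\<not> bij g" for g using L0[of g] that bij_id by auto
    ultimately show "cochain Sn (*s) \<kappa>L" by (simp add: cochain_def carrier_Sn)
  qed (simp add: cochain_Sn_skew)
  have inv: "(\<forall>g h. bij g \<longrightarrow> bij h \<longrightarrow> (\<forall>u v.
        doubled_perm h (\<kappa>L g u v) = \<kappa>L (h \<circ> g \<circ> inv' h) (doubled_perm h u) (doubled_perm h v)))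
    \<longleftrightarrow> (\<forall>h u v. bij h \<longrightarrow> doubled_perm h (\<kappa>L id u v) = \<kappa>L id (doubled_perm h u) (doubled_perm h v))"
  proof -
    have z: "doubled_perm h 0 = 0" for h :: "'n \<Rightarrow> 'n" by (simp add: doubled_perm_def)
    have i: "h \<circ> id \<circ> inv' h = id" if "bij h" for h :: "'n \<Rightarrow> 'n"
      using conj_eq_id_iff[OF that, of id] by simp
    have n: "h \<circ> g \<circ> inv' h \<noteq> id" if "bij h" "g \<noteq> id" for g h :: "'n \<Rightarrow> 'n"
      using conj_eq_id_iff[OF that(1)] that(2) by simp
    show ?thesis
    proof (intro iffI allI impI)
      fix h :: "'n \<Rightarrow> 'n" and u v assume "\<forall>g h. bij g \<longrightarrow> bij h \<longrightarrow> (\<forall>u v.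
        doubled_perm h (\<kappa>L g u v) = \<kappa>L (h \<circ> g \<circ> inv' h) (doubled_perm h u) (doubled_perm h v))" "bij h"
      then show "doubled_perm h (\<kappa>L id u v) = \<kappa>L id (doubled_perm h u) (doubled_perm h v)"
        using i[of h] by (metis bij_id)
    next
      fix g h :: "'n \<Rightarrow> 'n" and u v assume *: "\<forall>h u v. bij h \<longrightarrow> doubled_perm h (\<kappa>L id u v) = \<kappa>L id (doubled_perm h u) (doubled_perm h v)"
        "bij g" "bij h"
      show "doubled_perm h (\<kappa>L g u v) = \<kappa>L (h \<circ> g \<circ> inv' h) (doubled_perm h u) (doubled_perm h v)"
      proof (cases "g = id")
        case True
        then show ?thesis using * i[of h] by simp
      next
        case False
        then show ?thesis using L0[OF False] L0[OF n[OF *(3) False]] z by simp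
      qed
    qed
  qed
  have S: "(\<Sum>y\<in>{y. bij y}. \<kappa> (g \<circ> inv' y) (u + doubled_perm y u) (\<kappa>L y v w)) = \<kappa> g (u + u) (\<kappa>L id v w)"
    if "\<And>g u. bij g \<Longrightarrow> \<kappa> g u 0 = 0" "bij g" for \<kappa> :: "('n \<Rightarrow> 'n) \<Rightarrow> complex ^ ('n + 'n) \<Rightarrow> complex ^ ('n + 'n) \<Rightarrow> 'c::ab_group_add" and g u v w
  proof -
    have "(\<Sum>y\<in>{y. bij y}. \<kappa> (g \<circ> inv' y) (u + doubled_perm y u) (\<kappa>L y v w))
        = (\<Sum>y\<in>{id}. \<kappa> (g \<circ> inv' y) (u + doubled_perm y u) (\<kappa>L y v w))"
      by (rule sum.mono_neutral_right) (auto simp: L0 that bij_comp bij_imp_bij_inv)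
    then show ?thesis by (simp add: doubled_perm_id)
  qed
  show ?thesis
  proof
    assume A: ?A
    then have cL: "skew_bilinear (*s) (\<kappa>L id)" and cC: "cochain Sn (*) \<kappa>C"
      unfolding drinfeld_Sn_iff by (auto simp: cochain_Sn_skew)
    have zL: "bij g \<Longrightarrow> \<kappa>L g u 0 = 0" for g u using L0[of g] skew_zero[OF cL] by (cases "g = id") auto
    have zC: "bij g \<Longrightarrow> \<kappa>C g u 0 = 0" for g u using skew_zero[OF cochain_Sn_skew(1)[OF cC]] by blast
    have LL: "\<kappa>L id (u + u) w = 2 *s \<kappa>L id u w" for u w
    proof -
      have "\<kappa>L id (u + u) w = \<kappa>L id u w + \<kappa>L id u w" using cL unfolding skew_bilinear_iff by blast
      then show ?thesis by (simp add: vec_eq_iff)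
    qed
    have CC: "\<kappa>C g (u + u) w = 2 * \<kappa>C g u w" if "bij g" for g u w
    proof -
      have "\<kappa>C g (u + u) w = \<kappa>C g u w + \<kappa>C g u w"
        using cochain_Sn_skew(1)[OF cC that] unfolding skew_bilinear_iff by blast
      then show ?thesis by simp
    qed
    have three: "cyc (\<lambda>u v w. \<kappa>L g (u + u) (\<kappa>L id v w)) x y z
          = 2 *s cyc (\<lambda>x y z. \<kappa>C g y z *s (doubled_perm g x - x)) x y z"
      and four: "cyc (\<lambda>u v w. \<kappa>C g (u + u) (\<kappa>L id v w)) x y z = 0" if "bij g" for g x y z
    proof -
      have "cyc (\<lambda>u v w. \<Sum>y\<in>{y. bij y}. \<kappa>L (g \<circ> inv' y) (u + doubled_perm y u) (\<kappa>L y v w)) x y z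
          = 2 *s cyc (\<lambda>x y z. \<kappa>C g y z *s (doubled_perm g x - x)) x y z"
        "cyc (\<lambda>u v w. \<Sum>y\<in>{y. bij y}. \<kappa>C (g \<circ> inv' y) (u + doubled_perm y u) (\<kappa>L y v w)) x y z = 0"
        using A that unfolding drinfeld_Sn_iff by blast+
      then show "cyc (\<lambda>u v w. \<kappa>L g (u + u) (\<kappa>L id v w)) x y z
          = 2 *s cyc (\<lambda>x y z. \<kappa>C g y z *s (doubled_perm g x - x)) x y z"
        "cyc (\<lambda>u v w. \<kappa>C g (u + u) (\<kappa>L id v w)) x y z = 0"
        by (simp_all only: S[of \<kappa>L, OF zL that] S[of \<kappa>C, OF zC that])
    qed
    have c1: "cyc (\<lambda>x y z. \<kappa>C g y z *s (doubled_perm g x - x)) x y z = 0" if "bij g" "g \<noteq> id" for g x y z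
      using three[OF that(1), of x y z] by (simp add: L0[OF that(2)] cyc_def[of "\<lambda>u v w. 0"])
    have c2: "cyc (\<lambda>u v w. \<kappa>L id u (\<kappa>L id v w)) x y z = 0" for x y z
    proof -
      have "cyc (\<lambda>u v w. \<kappa>L id (u + u) (\<kappa>L id v w)) x y z = 2 *s cyc (\<lambda>u v w. \<kappa>L id u (\<kappa>L id v w)) x y z"
        by (simp only: LL cyc_def vec.scale_right_distrib)
      moreover have "cyc (\<lambda>x y z. \<kappa>C id y z *s (doubled_perm id x - x)) x y z = 0"
        by (simp add: cyc_def doubled_perm_id)
      ultimately show ?thesis using three[OF bij_id, of x y z] by simp
    qed
    have c3: "cyc (\<lambda>u v w. \<kappa>C g u (\<kappa>L id v w)) x y z = 0" if "bij g" for g x y z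
      using four[OF that, of x y z] unfolding CC[OF that] cyc_def
      by (simp only: distrib_left[symmetric] mult_eq_0_iff) simp
    have "\<forall>g h. bij g \<longrightarrow> bij h \<longrightarrow> (\<forall>u v.
        doubled_perm h (\<kappa>L g u v) = \<kappa>L (h \<circ> g \<circ> inv' h) (doubled_perm h u) (doubled_perm h v))"
      using A unfolding drinfeld_Sn_iff by blast
    then have invL: "\<forall>h u v. bij h \<longrightarrow> doubled_perm h (\<kappa>L id u v) = \<kappa>L id (doubled_perm h u) (doubled_perm h v)"
      by (simp only: inv)
    have invC: "\<forall>g h u v. bij g \<longrightarrow> bij h \<longrightarrow> \<kappa>C g u v = \<kappa>C (h \<circ> g \<circ> inv' h) (doubled_perm h u) (doubled_perm h v)"
      using A unfolding drinfeld_Sn_iff by blast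
    show ?B by (intro conjI cL cC invL invC allI impI c1 c2 c3)
  next
    assume B: ?B
    then have cL: "skew_bilinear (*s) (\<kappa>L id)" and cC: "cochain Sn (*) \<kappa>C" by blast+
    have zL: "bij g \<Longrightarrow> \<kappa>L g u 0 = 0" for g u using L0[of g] skew_zero[OF cL] by (cases "g = id") auto
    have zC: "bij g \<Longrightarrow> \<kappa>C g u 0 = 0" for g u using skew_zero[OF cochain_Sn_skew(1)[OF cC]] by blast
    have LL: "\<kappa>L id (u + u) w = 2 *s \<kappa>L id u w" for u w
    proof -
      have "\<kappa>L id (u + u) w = \<kappa>L id u w + \<kappa>L id u w" using cL unfolding skew_bilinear_iff by blast
      then show ?thesis by (simp add: vec_eq_iff)
    qed
    have CC: "\<kappa>C g (u + u) w = 2 * \<kappa>C g u w" if "bij g" for g u w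
    proof -
      have "\<kappa>C g (u + u) w = \<kappa>C g u w + \<kappa>C g u w"
        using cochain_Sn_skew(1)[OF cC that] unfolding skew_bilinear_iff by blast
      then show ?thesis by simp
    qed
    have three: "cyc (\<lambda>u v w. \<kappa>L g (u + u) (\<kappa>L id v w)) x y z
          = 2 *s cyc (\<lambda>x y z. \<kappa>C g y z *s (doubled_perm g x - x)) x y z" if g: "bij g" for g x y z
    proof (cases "g = id")
      case True
      have "cyc (\<lambda>u v w. \<kappa>L id (u + u) (\<kappa>L id v w)) x y z = 2 *s cyc (\<lambda>u v w. \<kappa>L id u (\<kappa>L id v w)) x y z"
        by (simp only: LL cyc_def vec.scale_right_distrib)
      also have "cyc (\<lambda>u v w. \<kappa>L id u (\<kappa>L id v w)) x y z = 0" using B by blast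
      finally have eq: "cyc (\<lambda>u v w. \<kappa>L id (u + u) (\<kappa>L id v w)) x y z = 0"
        by (simp only: vec.scale_zero_right)
      have "cyc (\<lambda>x y z. \<kappa>C id y z *s (doubled_perm id x - x)) x y z = 0"
        by (simp add: doubled_perm_id cyc_def)
      then show ?thesis unfolding True eq by simp
    next
      case False
      have "cyc (\<lambda>x y z. \<kappa>C g y z *s (doubled_perm g x - x)) x y z = 0" using B g False by blast
      then show ?thesis using L0[OF False] by (simp add: cyc_def[of "\<lambda>u v w. 0"])
    qed
    have four: "cyc (\<lambda>u v w. \<kappa>C g (u + u) (\<kappa>L id v w)) x y z = 0" if g: "bij g" for g x y z
    proof -
      have "cyc (\<lambda>u v w. \<kappa>C g (u + u) (\<kappa>L id v w)) x y z = 2 * cyc (\<lambda>u v w. \<kappa>C g u (\<kappa>L id v w)) x y z"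
        by (simp only: CC[OF g] cyc_def distrib_left)
      moreover have "cyc (\<lambda>u v w. \<kappa>C g u (\<kappa>L id v w)) x y z = 0" using B g by blast
      ultimately show ?thesis by (simp only: mult_zero_right)
    qed
    have two: "cyc (\<lambda>x y z. sym_emb (\<kappa>L g y z) * sym_emb (doubled_perm g x - x)) x y z = 0" for g x y z
      by (cases "g = id") (simp_all add: L0 doubled_perm_id cyc_def)
    have zero: "doubled_perm g (\<kappa>L g u v) = \<kappa>L g u v" for g u v
    proof (cases "g = id")
      case False
      then show ?thesis using L0[OF False] by (simp add: doubled_perm_def)
    qed (simp add: doubled_perm_id)
    have invL: "doubled_perm h (\<kappa>L g u v) = \<kappa>L (h \<circ> g \<circ> inv' h) (doubled_perm h u) (doubled_perm h v)"
      if gh: "bij g" "bij h" for g h u v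
    proof -
      have "\<forall>h u v. bij h \<longrightarrow> doubled_perm h (\<kappa>L id u v) = \<kappa>L id (doubled_perm h u) (doubled_perm h v)"
        using B by blast
      then show ?thesis using gh unfolding inv[symmetric] by blast
    qed
    have invC: "\<kappa>C g u v = \<kappa>C (h \<circ> g \<circ> inv' h) (doubled_perm h u) (doubled_perm h v)"
      if "bij g" "bij h" for g h u v
      using B that by blast
    have three': "cyc (\<lambda>u v w. \<Sum>y\<in>{y. bij y}. \<kappa>L (g \<circ> inv' y) (u + doubled_perm y u) (\<kappa>L y v w)) x y z
          = 2 *s cyc (\<lambda>x y z. \<kappa>C g y z *s (doubled_perm g x - x)) x y z" if g: "bij g" for g x y z
      by (simp only: S[of \<kappa>L, OF zL g] three[OF g])
    have four': "cyc (\<lambda>u v w. \<Sum>y\<in>{y. bij y}. \<kappa>C (g \<circ> inv' y) (u + doubled_perm y u) (\<kappa>L y v w)) x y z = 0"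
      if g: "bij g" for g x y z
      by (simp only: S[of \<kappa>C, OF zC g] four[OF g])
    show ?A unfolding drinfeld_Sn_iff coch
      by (intro conjI allI impI cL cC zero invL invC two three' four')
  qed
qed

section \<open>The constant part off the identity\<close>

lemma conj_transpose:
  assumes "bij h"
  shows "h \<circ> tr r s \<circ> inv' h = tr (h r) (h s)"
proof
  fix x
  obtain y where x: "x = h y" using assms by (metis bij_pointE)
  have inj: "inj h" using assms by (rule bij_is_inj)
  show "(h \<circ> tr r s \<circ> inv' h) x = tr (h r) (h s) x"
    unfolding x using inj by (auto simp: Transposition.transpose_def inj_eq)
qed

lemma conj_closed_iff:
  fixes g h :: "'a \<Rightarrow> 'a"
  assumes closed: "\<And>g h :: 'a \<Rightarrow> 'a. bij h \<Longrightarrow> P g \<Longrightarrow> P (h \<circ> g \<circ> inv' h)" and h: "bij h"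
  shows "P (h \<circ> g \<circ> inv' h) \<longleftrightarrow> P g"
proof
  assume "P (h \<circ> g \<circ> inv' h)"
  then have "P (inv' h \<circ> (h \<circ> g \<circ> inv' h) \<circ> inv' (inv' h))"
    by (rule closed[OF bij_imp_bij_inv[OF h]])
  moreover have "inv' h \<circ> (h \<circ> g \<circ> inv' h) \<circ> inv' (inv' h) = g"
    using h by (simp add: fun_eq_iff bij_is_inj inv_inv_eq)
  ultimately show "P g" by simp
qed (rule closed[OF h])

lemma is_transposition_conj:
  fixes g h :: "'a \<Rightarrow> 'a"
  assumes h: "bij h"
  shows "is_transposition (h \<circ> g \<circ> inv' h) \<longleftrightarrow> is_transposition g"
proof -
  have "is_transposition (h \<circ> g \<circ> inv' h)" if "bij h" "is_transposition g" for g h :: "'a \<Rightarrow> 'a"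
    using that by (auto simp: is_transposition_def[of g] conj_transpose bij_is_inj inj_eq)
  from conj_closed_iff[of is_transposition, OF this h] show ?thesis .
qed

lemma omega_invariant:
  "bij h \<Longrightarrow> omega (h r) (h s) (doubled_perm h u) (doubled_perm h v) = omega r s u v"
  by (simp add: omega_def doubled_perm_nth)

text \<open>
  The multiples of \<open>omega\<close> at different transpositions agree because all transpositions are conjugate.
\<close>

lemma constant_part_kappaCref:
  fixes \<kappa> :: "('n::finite \<Rightarrow> 'n, 'n + 'n) const_cochain"
  assumes n: "CARD('n) \<ge> 3"
    and skew: "\<And>g. bij g \<Longrightarrow> g \<noteq> id \<Longrightarrow> skew_bilinear (*) (\<kappa> g)"
    and hom: "\<And>g x y z. bij g \<Longrightarrow> g \<noteq> id \<Longrightarrow> cyc (\<lambda>x y z. \<kappa> g y z *s (doubled_perm g x - x)) x y z = 0"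
    and inv: "\<And>g h u v. bij g \<Longrightarrow> bij h \<Longrightarrow> g \<noteq> id \<Longrightarrow>
       \<kappa> g u v = \<kappa> (h \<circ> g \<circ> inv' h) (doubled_perm h u) (doubled_perm h v)"
  shows "\<exists>c. \<forall>g. bij g \<longrightarrow> g \<noteq> id \<longrightarrow> \<kappa> g = kappaCref c g"
proof -
  obtain r0 s0 t0 :: 'n where d: "distinct [r0, s0, t0]" using ex_three_distinct[OF n] .
  have nid: "tr r s \<noteq> id" if "r \<noteq> s" for r s :: 'n
    using that by (metis id_apply transpose_apply_first)
  have ex: "\<exists>c. \<kappa> g = kappaCref c g" if "bij g" "g \<noteq> id" for g
    by (rule homogeneous_imp_kappaCref[OF skew[OF that] that hom[OF that]])
  obtain c where c: "\<kappa> (tr r0 s0) = kappaCref c (tr r0 s0)"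
    using ex[of "tr r0 s0"] nid[of r0 s0] d by auto
  have "\<kappa> g = kappaCref c g" if g: "bij g" "g \<noteq> id" for g
  proof (cases "is_transposition g")
    case True
    then obtain r s where rs: "r \<noteq> s" "g = tr r s" unfolding is_transposition_def by blast
    obtain h where h: "bij h" "h r0 = r" "h s0 = s" using ex_bij_pair[OF n, of r0 s0 r s] d rs(1) by auto
    obtain c' where c': "\<kappa> g = kappaCref c' g" using ex[OF g] by blast
    have "\<kappa> (tr r0 s0) (xv r0) (yv r0) = \<kappa> g (xv r) (yv r)"
      using inv[of "tr r0 s0" h "xv r0" "yv r0"] h d nid[of r0 s0]
      by (simp add: conj_transpose rs(2) doubled_perm_basis)
    then have "c = c'"
      using d rs(1) unfolding c c'[unfolded rs(2)] rs(2) by (simp add: kappaCref_transpose omega_basis)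
    then show ?thesis using c' by simp
  next
    case False
    then show ?thesis using ex[OF g] by (auto simp: kappaCref_def)
  qed
  then show ?thesis by blast
qed

lemma kappaCref_props:
  fixes g h :: "'n::finite \<Rightarrow> 'n"
  shows "skew_bilinear (*) (kappaCref c g)" 
    "bij g \<Longrightarrow> bij h \<Longrightarrow> kappaCref c g u v = kappaCref c (h \<circ> g \<circ> inv' h) (doubled_perm h u) (doubled_perm h v)"
    "cyc (\<lambda>x y z. kappaCref c g y z *s (doubled_perm g x - x)) x y z = 0"
proof -
  consider (t) r s where "r \<noteq> s" "g = tr r s" | (n) "\<not> is_transposition g"
    unfolding is_transposition_def by blast
  then show "skew_bilinear (*) (kappaCref c g)"
  proof cases
    case t
    then show ?thesis by (simp add: kappaCref_transpose skew_bilinear_omega)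
  next
    case n
    then show ?thesis by (simp add: kappaCref_def skew_bilinear_iff vector_space_complex)
  qed
  show "kappaCref c g u v = kappaCref c (h \<circ> g \<circ> inv' h) (doubled_perm h u) (doubled_perm h v)" if "bij g" and h: "bij h"
  proof (cases "is_transposition g")
    case True
    then obtain r s where "r \<noteq> s" "g = tr r s" unfolding is_transposition_def by blast
    then show ?thesis using h by (simp add: conj_transpose bij_is_inj inj_eq kappaCref_transpose omega_invariant)
  next
    case False
    then show ?thesis by (simp add: kappaCref_def is_transposition_conj[OF h])
  qed
  show "cyc (\<lambda>x y z. kappaCref c g y z *s (doubled_perm g x - x)) x y z = 0"
  proof (cases "is_transposition g")
    case True
    then obtain r s where rs: "r \<noteq> s" "g = tr r s" unfolding is_transposition_def by blast
    have "cyc (\<lambda>x y z. kappaCref c g y z *s (doubled_perm g x - x)) x y z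
       = c *s cyc (\<lambda>x y z. omega r s y z *s (doubled_perm g x - x)) x y z"
      by (simp add: rs kappaCref_transpose cyc_def vec.scale_right_distrib)
    then show ?thesis using omega_homogeneous[OF rs(1), of x y z] by (simp add: rs(2))
  next
    case False
    then show ?thesis by (simp add: kappaCref_def cyc_def)
  qed
qed

section \<open>The bracket at the identity in coordinates\<close>

text \<open>
  The Kronecker delta.
\<close>

definition kd :: "'n \<Rightarrow> 'n \<Rightarrow> complex" where
  "kd l i = (if l = i then 1 else 0)"

lemma kd_simps [simp]: "kd i i = 1" "i \<noteq> j \<Longrightarrow> kd i j = 0"
  by (simp_all add: kd_def)

lemma basis_kd: "xv i $ Inl l = kd l i" "yv i $ Inr l = kd l i"
  by (simp_all add: kd_def)

lemma sum_kd: "(\<Sum>l\<in>UNIV. kd l i) = 1" "(\<Sum>l\<in>UNIV. kd i l) = 1" for i :: "'n::finite"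
  by (simp_all add: kd_def)

definition sX :: "complex ^ ('n::finite + 'n) \<Rightarrow> complex" where "sX v = (\<Sum>i\<in>UNIV. v $ Inl i)"
definition sY :: "complex ^ ('n::finite + 'n) \<Rightarrow> complex" where "sY v = (\<Sum>i\<in>UNIV. v $ Inr i)"

lemma sX_simps:
  "sX (u + v) = sX u + sX v" "sX (u - v) = sX u - sX v" "sX (- v) = - sX v" "sX (c *s v) = c * sX v" "sX 0 = 0"
  "sX (xv i) = 1" "sX (yv i) = 0" "sX (xsum UNIV :: complex ^ ('n::finite + 'n)) = of_nat CARD('n)" "sX (ysum A) = 0"
  by (simp_all add: sX_def sum.distrib sum_subtractf sum_negf sum_distrib_left)

lemma sY_simps:
  "sY (u + v) = sY u + sY v" "sY (u - v) = sY u - sY v" "sY (- v) = - sY v" "sY (c *s v) = c * sY v" "sY 0 = 0"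
  "sY (xv i) = 0" "sY (yv i) = 1" "sY (ysum UNIV :: complex ^ ('n::finite + 'n)) = of_nat CARD('n)" "sY (xsum A) = 0"
  by (simp_all add: sY_def sum.distrib sum_subtractf sum_negf sum_distrib_left)

lemma skew_ext_basis_left:
  assumes "vector_space sc"
  shows "skew_ext sc xx xy yy (xv i) v = (\<Sum>j\<in>UNIV. sc (v $ Inl j) (xx i j)) + (\<Sum>j\<in>UNIV. sc (v $ Inr j) (xy i j))"
    and "skew_ext sc xx xy yy (yv i) v = (\<Sum>j\<in>UNIV. sc (v $ Inr j) (yy i j)) - (\<Sum>j\<in>UNIV. sc (v $ Inl j) (xy j i))"
proof -
  interpret vector_space sc by fact
  have d: "sc (if P then x else 0) z = (if P then sc x z else 0)" for P x z by simp
  have "skew_ext sc xx xy yy (xv i) v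
     = (\<Sum>k\<in>UNIV. \<Sum>j\<in>UNIV. if k = i then sc (v $ Inl j) (xx k j) + sc (v $ Inr j) (xy k j) else 0)"
    unfolding skew_ext_def by (intro sum.cong refl) auto
  then show "skew_ext sc xx xy yy (xv i) v = (\<Sum>j\<in>UNIV. sc (v $ Inl j) (xx i j)) + (\<Sum>j\<in>UNIV. sc (v $ Inr j) (xy i j))"
    by (simp add: sum_if_const sum.distrib)
  have "skew_ext sc xx xy yy (yv i) v
     = (\<Sum>k\<in>UNIV. \<Sum>j\<in>UNIV. (if k = i then sc (v $ Inr j) (yy k j) else 0) - (if j = i then sc (v $ Inl k) (xy k j) else 0))"
    unfolding skew_ext_def by (intro sum.cong refl) auto
  then show "skew_ext sc xx xy yy (yv i) v = (\<Sum>j\<in>UNIV. sc (v $ Inr j) (yy i j)) - (\<Sum>j\<in>UNIV. sc (v $ Inl j) (xy j i))"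
    by (simp add: sum_if_const sum_subtractf)
qed

text \<open>
  The bracket of \<open>x\<^sub>i\<close>, or of \<open>y\<^sub>i\<close>, with a vector \<open>z\<close> depends on \<open>z\<close> only through the sums of its
  coordinates and through its coordinates at \<open>i\<close> and \<open>l\<close>, when its coordinate \<open>l\<close> is computed. The same
  expression serves for both kinds of coordinates, with the parameters \<open>a\<close> or \<open>b\<close>.
\<close>

definition brx :: "(nat \<Rightarrow> complex) \<Rightarrow> 'n \<Rightarrow> complex ^ ('n::finite + 'n) \<Rightarrow> 'n \<Rightarrow> complex" where
  "brx a i z l = a 1 * (kd l i * sX z - z $ Inl l) + (a 5 * kd l i + a 7) * sY z + a 6 * z $ Inr l
     + ((a 3 - a 5 - a 6) * kd l i + a 4 - a 7) * z $ Inr i"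

definition bry :: "(nat \<Rightarrow> complex) \<Rightarrow> 'n \<Rightarrow> complex ^ ('n::finite + 'n) \<Rightarrow> 'n \<Rightarrow> complex" where
  "bry a i z l = a 2 * (kd l i * sY z - z $ Inr l) - (a 6 * kd l i + a 7) * sX z - a 5 * z $ Inl l
     - ((a 3 - a 5 - a 6) * kd l i + a 4 - a 7) * z $ Inl i"

lemma sum_times_kd: "(\<Sum>j\<in>UNIV. f j * kd l j) = f l" "(\<Sum>j\<in>UNIV. f j * kd j l) = (f l :: complex)" for l :: "'n::finite"
  by (simp_all add: kd_def if_distrib cong: if_cong)

lemma kappaL1_nth:
  "kappaL1 a b id (xv i) z $ Inl l = brx a i z l" "kappaL1 a b id (xv i) z $ Inr l = brx b i z l"
  "kappaL1 a b id (yv i) z $ Inl l = bry a i z l" "kappaL1 a b id (yv i) z $ Inr l = bry b i z l"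
proof -
  have sx: "(\<Sum>j\<in>UNIV. z $ Inl j * (p * (kd l i - kd l j))) = p * (kd l i * sX z - z $ Inl l)" for p
  proof -
    have "(\<Sum>j\<in>UNIV. z $ Inl j * (p * (kd l i - kd l j))) = (\<Sum>j\<in>UNIV. (p * kd l i) * z $ Inl j - p * (z $ Inl j * kd l j))"
      by (rule sum.cong) (simp_all add: algebra_simps)
    also have "\<dots> = (p * kd l i) * sX z - p * z $ Inl l"
      by (simp only: sum_subtractf sum_distrib_left[symmetric] sum_times_kd sX_def)
    finally show ?thesis by (simp add: algebra_simps)
  qed
  have sy: "(\<Sum>j\<in>UNIV. z $ Inr j * (p * (kd l i - kd l j))) = p * (kd l i * sY z - z $ Inr l)" for p
  proof -
    have "(\<Sum>j\<in>UNIV. z $ Inr j * (p * (kd l i - kd l j))) = (\<Sum>j\<in>UNIV. (p * kd l i) * z $ Inr j - p * (z $ Inr j * kd l j))"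
      by (rule sum.cong) (simp_all add: algebra_simps)
    also have "\<dots> = (p * kd l i) * sY z - p * z $ Inr l"
      by (simp only: sum_subtractf sum_distrib_left[symmetric] sum_times_kd sY_def)
    finally show ?thesis by (simp add: algebra_simps)
  qed
  have mx: "(\<Sum>j\<in>UNIV. z $ Inr j * (if i = j then p3 * kd l j + p4 else p5 * kd l i + p6 * kd l j + p7))
     = (p5 * kd l i + p7) * sY z + p6 * z $ Inr l + ((p3 - p5 - p6) * kd l i + p4 - p7) * z $ Inr i" for p3 p4 p5 p6 p7
  proof -
    have "(\<Sum>j\<in>UNIV. z $ Inr j * (if i = j then p3 * kd l j + p4 else p5 * kd l i + p6 * kd l j + p7))
       = (\<Sum>j\<in>UNIV. (p5 * kd l i + p7) * z $ Inr j + p6 * z $ Inr j * kd l j + ((p3 - p5 - p6) * kd l i + p4 - p7) * z $ Inr j * kd i j)"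
      by (rule sum.cong) (auto simp: kd_def algebra_simps)
    then show ?thesis by (simp add: sum.distrib sum_times_kd sY_def flip: sum_distrib_left)
  qed
  have my: "(\<Sum>j\<in>UNIV. z $ Inl j * (if j = i then p3 * kd l i + p4 else p5 * kd l j + p6 * kd l i + p7))
     = (p6 * kd l i + p7) * sX z + p5 * z $ Inl l + ((p3 - p5 - p6) * kd l i + p4 - p7) * z $ Inl i" for p3 p4 p5 p6 p7
  proof -
    have "(\<Sum>j\<in>UNIV. z $ Inl j * (if j = i then p3 * kd l i + p4 else p5 * kd l j + p6 * kd l i + p7))
       = (\<Sum>j\<in>UNIV. (p6 * kd l i + p7) * z $ Inl j + p5 * z $ Inl j * kd l j + ((p3 - p5 - p6) * kd l i + p4 - p7) * z $ Inl j * kd i j)"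
      by (rule sum.cong) (auto simp: kd_def algebra_simps)
    then show ?thesis by (simp add: sum.distrib sum_times_kd sX_def flip: sum_distrib_left)
  qed
  note [simp] = basis_kd and [simp del] = basis_nth(1,4)
  show "kappaL1 a b id (xv i) z $ Inl l = brx a i z l" "kappaL1 a b id (xv i) z $ Inr l = brx b i z l"
    by (simp_all add: kappaL1_def skew_ext_basis_left[OF vector_space_vec] brx_def sx mx if_distribR if_distrib[of "\<lambda>v. v $ _"] cong: if_cong)
  show "kappaL1 a b id (yv i) z $ Inl l = bry a i z l" "kappaL1 a b id (yv i) z $ Inr l = bry b i z l"
    by (simp_all add: kappaL1_def skew_ext_basis_left[OF vector_space_vec] bry_def sy my if_distribR if_distrib[of "\<lambda>v. v $ _"] cong: if_cong)
qed

lemma kappaL1_skew: "skew_bilinear (*s) (kappaL1 a b id)"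
  unfolding kappaL1_def
  by (simp, rule skew_bilinear_skew_ext[OF vector_space_vec]) (simp_all add: vec_eq_iff algebra_simps)

lemma kappaL1_minus: "kappaL1 a b id u (- v) = - kappaL1 a b id u v"
  using kappaL1_skew[of a b] unfolding skew_bilinear_iff by (metis vec.scale_minus_left vec.scale_one)

lemma kappaL1_basis:
  "kappaL1 a b id (xv i) (xv j) = a 1 *s (xv i - xv j) + b 1 *s (yv i - yv j)"
  "kappaL1 a b id (yv i) (yv j) = a 2 *s (xv i - xv j) + b 2 *s (yv i - yv j)"
  "i \<noteq> j \<Longrightarrow> kappaL1 a b id (xv i) (yv j) = a 5 *s xv i + a 6 *s xv j + a 7 *s xsum UNIV + b 5 *s yv i + b 6 *s yv j + b 7 *s ysum UNIV"
  "kappaL1 a b id (xv i) (yv i) = a 3 *s xv i + a 4 *s xsum UNIV + b 3 *s yv i + b 4 *s ysum UNIV"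
  "i \<noteq> j \<Longrightarrow> kappaL1 a b id (yv j) (xv i) = - (a 5 *s xv i + a 6 *s xv j + a 7 *s xsum UNIV + b 5 *s yv i + b 6 *s yv j + b 7 *s ysum UNIV)"
  "kappaL1 a b id (yv i) (xv i) = - (a 3 *s xv i + a 4 *s xsum UNIV + b 3 *s yv i + b 4 *s ysum UNIV)"
  by (simp_all add: kappaL1_def skew_ext_lin_basis)

abbreviation jac where "jac a b \<equiv> cyc (\<lambda>u v w. kappaL1 a b id u (kappaL1 a b id v w))"

text \<open>
  The values of the Jacobi expression on triples of basis vectors. The sequence \<open>g\<close> numbers the
  quadratic polynomials from 1, whereas positions in a list start with 0.
\<close>

context
  fixes i j k l :: "'n::finite" and a b :: "nat \<Rightarrow> complex" and \<alpha> \<beta> c :: complex and g :: "nat \<Rightarrow> complex"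
  assumes g: "g = (\<lambda>m. gammas (of_nat CARD('n)) a b \<alpha> \<beta> c ! (m - 1))"
    and ij: "i \<noteq> j"
begin

lemmas eval = cyc_def kappaL1_basis kappaL1_minus kappaL1_nth brx_def bry_def sX_simps sY_simps g gammas_def
  ij ij[symmetric] basis_kd

lemma jac_xxx:
  assumes "k \<noteq> i" "k \<noteq> j"
  shows "jac a b (xv i) (xv j) (xv k) $ Inl l = 0" "jac a b (xv i) (xv j) (xv k) $ Inr l = 0"
  using assms by (simp_all add: eval del: basis_nth(1,4)) (simp_all add: algebra_simps)

lemma jac_yyy:
  assumes "k \<noteq> i" "k \<noteq> j"
  shows "jac a b (yv i) (yv j) (yv k) $ Inl l = 0" "jac a b (yv i) (yv j) (yv k) $ Inr l = 0"
  using assms by (simp_all add: eval del: basis_nth(1,4)) (simp_all add: algebra_simps)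

lemma jac_xxy:
  assumes "k \<noteq> i" "k \<noteq> j"
  shows "jac a b (xv i) (xv j) (yv k) $ Inl l = g 1 * (kd l i - kd l j)"
    "jac a b (xv i) (xv j) (yv k) $ Inr l = g 2 * (kd l i - kd l j)"
  using assms assms[symmetric] by (simp_all add: eval del: basis_nth(1,4)) (simp_all add: algebra_simps)

lemma jac_xxy':
  "jac a b (xv i) (xv j) (yv i) $ Inl l = - g 10 * kd l i - g 9 * kd l j - g 8"
  "jac a b (xv i) (xv j) (yv i) $ Inr l = g 13 * kd l i - g 12 * kd l j - g 11"
  by (simp_all add: eval del: basis_nth(1,4)) (simp_all add: algebra_simps)

lemma jac_xyy:
  assumes "k \<noteq> i" "k \<noteq> j"
  shows "jac a b (xv k) (yv i) (yv j) $ Inl l = g 4 * (kd l i - kd l j)"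
    "jac a b (xv k) (yv i) (yv j) $ Inr l = g 5 * (kd l i - kd l j)"
  using assms assms[symmetric] by (simp_all add: eval del: basis_nth(1,4)) (simp_all add: algebra_simps)

lemma jac_xyy':
  "jac a b (xv i) (yv i) (yv j) $ Inl l = - g 18 * kd l i - g 17 * kd l j - g 16"
  "jac a b (xv i) (yv i) (yv j) $ Inr l = - g 21 * kd l i - g 20 * kd l j - g 19"
  by (simp_all add: eval del: basis_nth(1,4)) (simp_all add: algebra_simps)

end

section \<open>Invariant brackets and forms\<close>

lemma doubled_perm_simps:
  "doubled_perm h (u + v) = doubled_perm h u + doubled_perm h v"
  "doubled_perm h (c *s u) = c *s doubled_perm h u"
  "doubled_perm h (- u) = - doubled_perm h u" "doubled_perm h (u - v) = doubled_perm h u - doubled_perm h v"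
  "doubled_perm h 0 = 0" "doubled_perm h (sum f A) = (\<Sum>a\<in>A. doubled_perm h (f a))"
proof -
  interpret L: Vector_Spaces.linear "(*s)" "(*s)" "doubled_perm h" by (rule doubled_perm_linear)
  show "doubled_perm h (u + v) = doubled_perm h u + doubled_perm h v"
    "doubled_perm h (c *s u) = c *s doubled_perm h u"
    "doubled_perm h (- u) = - doubled_perm h u" "doubled_perm h (u - v) = doubled_perm h u - doubled_perm h v"
    "doubled_perm h 0 = 0" "doubled_perm h (sum f A) = (\<Sum>a\<in>A. doubled_perm h (f a))"
    by (rule L.add L.scale L.neg L.diff L.zero L.sum)+
qed

lemma doubled_perm_xsum_ysum:
  assumes "bij h"
  shows "doubled_perm h (xsum A) = xsum (h ` A)" "doubled_perm h (ysum A) = ysum (h ` A)"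
  using bij_is_inj[OF assms]
  by (simp_all add: xsum_def ysum_def doubled_perm_simps doubled_perm_basis sum.reindex inj_on_subset)

lemma skew_bilinearD:
  assumes "skew_bilinear sc B"
  shows "vector_space sc" "B (u + u') v = B u v + B u' v" "B (c *s u) v = sc c (B u v)"
    "B u (v + v') = B u v + B u v'" "B u (c *s v) = sc c (B u v)" "B u v = - B v u"
  using assms unfolding skew_bilinear_iff by blast+

lemma skew_bilinear_twist:
  assumes "skew_bilinear sc B"
  shows "skew_bilinear sc (\<lambda>u v. B (doubled_perm h u) (doubled_perm h v))"
  unfolding skew_bilinear_iff doubled_perm_simps
  using skew_bilinearD[OF assms] by blast

lemma skew_bilinear_push:
  assumes "skew_bilinear (*s) B"
  shows "skew_bilinear (*s) (\<lambda>u v. doubled_perm h (B u v))"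
  unfolding skew_bilinear_iff
proof (intro conjI allI)
  fix u v
  show "doubled_perm h (B u v) = - doubled_perm h (B v u)"
    by (subst skew_bilinearD(6)[OF assms]) (rule doubled_perm_simps)
qed (simp_all add: vector_space_vec skew_bilinearD(2-5)[OF assms] doubled_perm_simps)

lemma skew_bilinear_add:
  assumes "skew_bilinear (*) B" "skew_bilinear (*) B'"
  shows "skew_bilinear (*) (\<lambda>u v. B u v + B' u v)"
proof -
  note B = skew_bilinearD[OF assms(1)] and B' = skew_bilinearD[OF assms(2)]
  show ?thesis unfolding skew_bilinear_iff
  proof (intro conjI allI)
    fix u v
    show "B u v + B' u v = - (B v u + B' v u)"
      by (subst B(6), subst B'(6)) simp
  qed (simp_all add: vector_space_complex B(2-5) B'(2-5) distrib_left)
qed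

lemma skew_bilinear_diff:
  assumes "skew_bilinear (*) B" "skew_bilinear (*) B'"
  shows "skew_bilinear (*) (\<lambda>u v. B u v - B' u v)"
proof -
  have "skew_bilinear (*) (\<lambda>u v. - B' u v)"
    unfolding skew_bilinear_iff
  proof (intro conjI allI)
    fix u v show "- B' u v = - (- B' v u)" by (subst skew_bilinearD(6)[OF assms(2)]) simp
  qed (simp_all add: vector_space_complex skew_bilinearD(2-5)[OF assms(2)])
  from skew_bilinear_add[OF assms(1) this] show ?thesis by simp
qed

lemma kappaL1_equivariant:
  assumes h: "bij h"
  shows "doubled_perm h (kappaL1 a b id u v) = kappaL1 a b id (doubled_perm h u) (doubled_perm h v)"
proof -
  have "(\<lambda>u v. doubled_perm h (kappaL1 a b id u v)) = (\<lambda>u v. kappaL1 a b id (doubled_perm h u) (doubled_perm h v))"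
  proof (rule skew_bilinear_eqI[OF skew_bilinear_push[OF kappaL1_skew] skew_bilinear_twist[OF kappaL1_skew]])
    fix i j
    show "doubled_perm h (kappaL1 a b id (xv i) (yv j)) = kappaL1 a b id (doubled_perm h (xv i)) (doubled_perm h (yv j))"
      using h by (cases "i = j")
        (simp_all add: doubled_perm_basis kappaL1_basis doubled_perm_simps doubled_perm_xsum_ysum bij_is_inj inj_eq bij_is_surj)
  qed (simp_all add: doubled_perm_basis kappaL1_basis doubled_perm_simps)
  then show ?thesis by metis
qed

lemma kappaC1_skew: "skew_bilinear (*) (kappaC1 \<alpha> \<beta> g)"
  unfolding kappaC1_def
  by (simp add: skew_bilinear_skew_ext[OF vector_space_complex]) (simp add: skew_bilinear_iff vector_space_complex)

lemma kappaC1_basis: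
  "kappaC1 \<alpha> \<beta> id (xv i) (xv j) = 0" "kappaC1 \<alpha> \<beta> id (yv i) (yv j) = 0"
  "kappaC1 \<alpha> \<beta> id (xv i) (yv j) = (if i = j then \<alpha> else \<beta>)"
  by (simp_all add: kappaC1_def skew_ext_const_basis)

lemma kappaC1_invariant:
  assumes h: "bij h"
  shows "kappaC1 \<alpha> \<beta> id (doubled_perm h u) (doubled_perm h v) = kappaC1 \<alpha> \<beta> id u v"
proof -
  have "(\<lambda>u v. kappaC1 \<alpha> \<beta> id (doubled_perm h u) (doubled_perm h v)) = kappaC1 \<alpha> \<beta> id"
    by (rule skew_bilinear_eqI[OF skew_bilinear_twist[OF kappaC1_skew] kappaC1_skew])
       (simp_all add: doubled_perm_basis kappaC1_basis inj_eq[OF bij_is_inj[OF h]])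
  then show ?thesis by metis
qed

text \<open>
  A triple of indices \<open>(i, j, l)\<close> belongs to one of five orbits; the values on them are rewritten as the
  coefficients that occur in the bracket of \<open>x\<^sub>i\<close> and \<open>y\<^sub>j\<close>.
\<close>

lemma invariant_coefficients:
  fixes f :: "'n::finite \<Rightarrow> 'n \<Rightarrow> 'n \<Rightarrow> complex"
  assumes n: "CARD('n) \<ge> 3" and f: "\<And>h i j l. bij h \<Longrightarrow> f (h i) (h j) (h l) = f i j l"
  shows "\<exists>p3 p4 p5 p6 p7. \<forall>i j l. f i j l = (if i = j then p3 * kd l i + p4 else p5 * kd l i + p6 * kd l j + p7)"
proof -
  obtain p q r s t where *: "f i j l = (if i = j then if l = i then s else t
           else if l = i then p else if l = j then q else r)" for i j l
    using invariant_three[of f, OF n f] by blast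
  show ?thesis
    by (rule exI[of _ "s - t"], rule exI[of _ t], rule exI[of _ "p - r"], rule exI[of _ "q - r"], rule exI[of _ r])
       (auto simp: * kd_def)
qed

lemma invariant_skew_coefficients:
  fixes f :: "'n::finite \<Rightarrow> 'n \<Rightarrow> 'n \<Rightarrow> complex"
  assumes n: "CARD('n) \<ge> 3" and f: "\<And>h i j l. bij h \<Longrightarrow> f (h i) (h j) (h l) = f i j l"
    and skew: "\<And>i j l. f i j l = - f j i l"
  shows "\<exists>p. \<forall>i j l. f i j l = p * (kd l i - kd l j)"
proof -
  obtain p q r s t where *: "f i j l = (if i = j then if l = i then s else t
           else if l = i then p else if l = j then q else r)" for i j l
    using invariant_three[of f, OF n f] by blast
  obtain x y z :: 'n where d: "distinct [x, y, z]" using ex_three_distinct[OF n] .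
  then have ne: "x \<noteq> y" "x \<noteq> z" "y \<noteq> z" "y \<noteq> x" "z \<noteq> x" "z \<noteq> y" by auto
  have "s = - s" "t = - t" "r = - r" "q = - p"
    using skew[of x x x] skew[of x x y] skew[of x y z] skew[of x y y] unfolding * by (simp_all add: ne)
  then have "s = 0" "t = 0" "r = 0" "q = - p" by simp_all
  then show ?thesis by (intro exI[of _ p]) (auto simp: * kd_def)
qed

text \<open>
  The coordinate \<open>l\<close> of the bracket of two basis vectors with indices \<open>i\<close> and \<open>j\<close> is an invariant
  function of three indices. For two vectors of the same kind it is moreover antisymmetric in \<open>i\<close>
  and \<open>j\<close>, which leaves one coefficient.
\<close>

lemma invariant_bracket:
  fixes L :: "complex ^ ('n::finite + 'n) \<Rightarrow> complex ^ ('n + 'n) \<Rightarrow> complex ^ ('n + 'n)"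
  assumes n: "CARD('n) \<ge> 3" and L: "skew_bilinear (*s) L"
    and eq: "\<And>h u v. bij h \<Longrightarrow> doubled_perm h (L u v) = L (doubled_perm h u) (doubled_perm h v)"
  shows "\<exists>a b. L = kappaL1 a b id"
proof -
  have skew: "L u v = - L v u" for u v using L unfolding skew_bilinear_iff by blast
  have inv: "L (xv (h i)) (xv (h j)) $ Inl (h l) = L (xv i) (xv j) $ Inl l"
    "L (xv (h i)) (xv (h j)) $ Inr (h l) = L (xv i) (xv j) $ Inr l"
    "L (yv (h i)) (yv (h j)) $ Inl (h l) = L (yv i) (yv j) $ Inl l"
    "L (yv (h i)) (yv (h j)) $ Inr (h l) = L (yv i) (yv j) $ Inr l"
    "L (xv (h i)) (yv (h j)) $ Inl (h l) = L (xv i) (yv j) $ Inl l"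
    "L (xv (h i)) (yv (h j)) $ Inr (h l) = L (xv i) (yv j) $ Inr l" if "bij h" for h i j l
  proof -
    have e: "L (doubled_perm h u) (doubled_perm h v) $ Inl (h l) = L u v $ Inl l"
      "L (doubled_perm h u) (doubled_perm h v) $ Inr (h l) = L u v $ Inr l" for u v
      by (simp_all only: eq[OF that, symmetric] doubled_perm_nth[OF that])
    show "L (xv (h i)) (xv (h j)) $ Inl (h l) = L (xv i) (xv j) $ Inl l"
      "L (xv (h i)) (xv (h j)) $ Inr (h l) = L (xv i) (xv j) $ Inr l"
      "L (yv (h i)) (yv (h j)) $ Inl (h l) = L (yv i) (yv j) $ Inl l"
      "L (yv (h i)) (yv (h j)) $ Inr (h l) = L (yv i) (yv j) $ Inr l"
      "L (xv (h i)) (yv (h j)) $ Inl (h l) = L (xv i) (yv j) $ Inl l"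
      "L (xv (h i)) (yv (h j)) $ Inr (h l) = L (xv i) (yv j) $ Inr l"
      using e[of "xv i" "xv j"] e[of "yv i" "yv j"] e[of "xv i" "yv j"] by (simp_all only: doubled_perm_basis)
  qed
  have sk: "L u v $ m = - (L v u $ m)" for u v m
    by (subst skew) simp
  obtain a1 where a1: "L (xv i) (xv j) $ Inl l = a1 * (kd l i - kd l j)" for i j l
    using invariant_skew_coefficients[of "\<lambda>i j l. L (xv i) (xv j) $ Inl l", OF n inv(1) sk] by blast
  obtain b1 where b1: "L (xv i) (xv j) $ Inr l = b1 * (kd l i - kd l j)" for i j l
    using invariant_skew_coefficients[of "\<lambda>i j l. L (xv i) (xv j) $ Inr l", OF n inv(2) sk] by blast
  obtain a2 where a2: "L (yv i) (yv j) $ Inl l = a2 * (kd l i - kd l j)" for i j l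
    using invariant_skew_coefficients[of "\<lambda>i j l. L (yv i) (yv j) $ Inl l", OF n inv(3) sk] by blast
  obtain b2 where b2: "L (yv i) (yv j) $ Inr l = b2 * (kd l i - kd l j)" for i j l
    using invariant_skew_coefficients[of "\<lambda>i j l. L (yv i) (yv j) $ Inr l", OF n inv(4) sk] by blast
  obtain a3 a4 a5 a6 a7 where a: "L (xv i) (yv j) $ Inl l = (if i = j then a3 * kd l i + a4 else a5 * kd l i + a6 * kd l j + a7)" for i j l
    using invariant_coefficients[of "\<lambda>i j l. L (xv i) (yv j) $ Inl l", OF n inv(5)] by blast
  obtain b3 b4 b5 b6 b7 where b: "L (xv i) (yv j) $ Inr l = (if i = j then b3 * kd l i + b4 else b5 * kd l i + b6 * kd l j + b7)" for i j l
    using invariant_coefficients[of "\<lambda>i j l. L (xv i) (yv j) $ Inr l", OF n inv(6)] by blast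
  \<comment> \<open>The parameters are numbered from 1; the entry at position 0 is a dummy.\<close>
  define A where "A = (!) [0, a1, a2, a3, a4, a5, a6, a7]"
  define B where "B = (!) [0, b1, b2, b3, b4, b5, b6, b7]"
  have AB: "A 1 = a1" "A 2 = a2" "A 3 = a3" "A 4 = a4" "A 5 = a5" "A 6 = a6" "A 7 = a7"
    "B 1 = b1" "B 2 = b2" "B 3 = b3" "B 4 = b4" "B 5 = b5" "B 6 = b6" "B 7 = b7"
    by (simp_all add: A_def B_def)
  have "L = kappaL1 A B id"
  proof (rule skew_bilinear_eqI[OF L kappaL1_skew])
    fix i j
    show "L (xv i) (xv j) = kappaL1 A B id (xv i) (xv j)"
      unfolding kappaL1_basis AB by (rule vec_eqI_sum) (simp_all add: a1 b1 basis_kd del: basis_nth(1,4))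
    show "L (yv i) (yv j) = kappaL1 A B id (yv i) (yv j)"
      unfolding kappaL1_basis AB by (rule vec_eqI_sum) (simp_all add: a2 b2 basis_kd del: basis_nth(1,4))
    show "L (xv i) (yv j) = kappaL1 A B id (xv i) (yv j)"
    proof (cases "i = j")
      case True
      show ?thesis unfolding True kappaL1_basis AB
        by (rule vec_eqI_sum) (simp_all add: a b basis_kd del: basis_nth(1,4))
    next
      case False
      show ?thesis unfolding kappaL1_basis(3)[OF False] AB
        by (rule vec_eqI_sum) (simp_all add: a b False basis_kd del: basis_nth(1,4))
    qed
  qed
  then show ?thesis by blast
qed

lemma invariant_form:
  fixes C :: "complex ^ ('n::finite + 'n) \<Rightarrow> complex ^ ('n + 'n) \<Rightarrow> complex"
  assumes n: "CARD('n) \<ge> 3" and C: "skew_bilinear (*) C"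
    and inv: "\<And>h u v. bij h \<Longrightarrow> C u v = C (doubled_perm h u) (doubled_perm h v)"
  shows "\<exists>\<alpha> \<beta>. C = kappaC1 \<alpha> \<beta> id"
proof -
  have skew: "C u v = - C v u" for u v using C unfolding skew_bilinear_iff by blast
  have i1: "C (xv (h i)) (xv (h j)) = C (xv i) (xv j)" "C (yv (h i)) (yv (h j)) = C (yv i) (yv j)"
    "C (xv (h i)) (yv (h j)) = C (xv i) (yv j)" if "bij h" for h i j
    using inv[OF that, of "xv i" "xv j"] inv[OF that, of "yv i" "yv j"] inv[OF that, of "xv i" "yv j"]
    by (simp_all add: doubled_perm_basis)
  have zero: "f i j = 0" if f: "\<And>h i j. bij h \<Longrightarrow> f (h i) (h j) = f i j" and s: "\<And>i j. f i j = - f j i" for f :: "'n \<Rightarrow> 'n \<Rightarrow> complex" and i j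
  proof -
    obtain s p where *: "f i j = (if i = j then s else p)" for i j using invariant_two[of f, OF n f] by blast
    have "f i j = f j i" by (simp add: *)
    then show ?thesis using s[of i j] by simp
  qed
  have xx: "C (xv i) (xv j) = 0" for i j by (rule zero[of "\<lambda>i j. C (xv i) (xv j)", OF i1(1) skew])
  have yy: "C (yv i) (yv j) = 0" for i j by (rule zero[of "\<lambda>i j. C (yv i) (yv j)", OF i1(2) skew])
  obtain \<alpha> \<beta> where xy: "C (xv i) (yv j) = (if i = j then \<alpha> else \<beta>)" for i j
    using invariant_two[of "\<lambda>i j. C (xv i) (yv j)", OF n i1(3)] by blast
  have "C = kappaC1 \<alpha> \<beta> id"
    by (rule skew_bilinear_eqI[OF C kappaC1_skew]) (simp_all add: xx yy xy kappaC1_basis)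
  then show ?thesis by blast
qed

section \<open>Lie orbifold algebra maps\<close>

lemma trilinear_nested:
  assumes "skew_bilinear sc f" "skew_bilinear (*s) L"
  shows "trilinear sc (\<lambda>u v w. f u (L v w))"
  unfolding trilinear_def
  by (simp add: skew_bilinearD(1-5)[OF assms(1)] skew_bilinearD(2-5)[OF assms(2)])

lemma cyc_nested_alternating:
  fixes f :: "complex ^ 'b::finite \<Rightarrow> complex ^ 'b \<Rightarrow> 'c::ab_group_add"
  assumes f: "skew_bilinear sc f" and L: "skew_bilinear (*s) L"
  shows "cyc (\<lambda>u v w. f u (L v w)) y x z = - cyc (\<lambda>u v w. f u (L v w)) x y z"
    "cyc (\<lambda>u v w. f u (L v w)) x x z = 0"
proof -
  have add: "f u (v + v') = f u v + f u v'" for u v v' using f unfolding skew_bilinear_iff by blast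
  have zero: "f u 0 = 0" for u using add[of u 0 0] by simp
  have fm: "f u (- v) = - f u v" for u v using add[of u v "- v"] zero[of u] by (simp add: eq_neg_iff_add_eq_0 add.commute)
  have Ls: "L u v = - L v u" for u v using L unfolding skew_bilinear_iff by blast
  have Lz: "L u u = 0" for u using Ls[of u u] by (simp add: vec_eq_iff)
  have "f y (L x z) = - f y (L z x)" "f x (L z y) = - f x (L y z)" "f z (L y x) = - f z (L x y)"
    by (subst Ls, rule fm)+
  then show "cyc (\<lambda>u v w. f u (L v w)) y x z = - cyc (\<lambda>u v w. f u (L v w)) x y z"
    by (simp add: cyc_def add_ac)
  have "f x (L z x) = - f x (L x z)" by (subst Ls, rule fm)
  then show "cyc (\<lambda>u v w. f u (L v w)) x x z = 0" by (simp add: cyc_def Lz zero)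
qed

text \<open>
  The expression is alternating, so the triples with a repeated vector drop out, and up to order only
  triples with three distinct indices or with one index shared by an \<open>x\<close> and a \<open>y\<close> remain.
\<close>

lemma cyc_nested_zeroI:
  fixes f :: "complex ^ ('n::finite + 'n) \<Rightarrow> complex ^ ('n + 'n) \<Rightarrow> 'c::ab_group_add"
  assumes f: "skew_bilinear sc f" and L: "skew_bilinear (*s) L"
    and xxx: "\<And>i j k. distinct [i, j, k] \<Longrightarrow> cyc (\<lambda>u v w. f u (L v w)) (xv i) (xv j) (xv k) = 0"
    and yyy: "\<And>i j k. distinct [i, j, k] \<Longrightarrow> cyc (\<lambda>u v w. f u (L v w)) (yv i) (yv j) (yv k) = 0"
    and xxy: "\<And>i j k. distinct [i, j, k] \<Longrightarrow> cyc (\<lambda>u v w. f u (L v w)) (xv i) (xv j) (yv k) = 0"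
    and xyy: "\<And>i j k. distinct [i, j, k] \<Longrightarrow> cyc (\<lambda>u v w. f u (L v w)) (xv k) (yv i) (yv j) = 0"
    and xxy': "\<And>i j. i \<noteq> j \<Longrightarrow> cyc (\<lambda>u v w. f u (L v w)) (xv i) (xv j) (yv i) = 0"
    and xyy': "\<And>i j. i \<noteq> j \<Longrightarrow> cyc (\<lambda>u v w. f u (L v w)) (xv i) (yv i) (yv j) = 0"
  shows "cyc (\<lambda>u v w. f u (L v w)) u v w = 0"
proof (rule cyc_zero_on_basis[OF trilinear_nested[OF f L]])
  let ?J = "cyc (\<lambda>u v w. f u (L v w))"
  note alt = cyc_nested_alternating(1)[OF f L] and zero = cyc_nested_alternating(2)[OF f L]
  have rot: "?J x y z = ?J y z x" for x y z by (rule cyc_rotate)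
  have zero2: "?J x y y = 0" for x y by (subst rot, rule zero)
  have zero3: "?J x y x = 0" for x y by (subst rot, rule zero2)
  fix i j k
  show "?J (xv i) (xv j) (xv k) = 0"
    using xxx[of i j k] by (cases "i = j"; cases "j = k"; cases "i = k") (simp_all add: zero zero2 zero3)
  show "?J (yv i) (yv j) (yv k) = 0"
    using yyy[of i j k] by (cases "i = j"; cases "j = k"; cases "i = k") (simp_all add: zero zero2 zero3)
  have "?J (xv i) (xv j) (yv j) = 0" if "i \<noteq> j"
    using alt[of "xv i" "xv j" "yv j"] xxy'[of j i] that by simp
  then show "?J (xv i) (xv j) (yv k) = 0"
    using xxy[of i j k] xxy'[of i j] by (cases "i = j"; cases "j = k"; cases "i = k") (simp_all add: zero)
  have "?J (xv i) (yv j) (yv i) = 0" if "i \<noteq> j"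
    using alt[of "yv j" "yv i" "xv i"] xyy'[of i j] that rot[of "xv i" "yv j" "yv i"] rot[of "xv i" "yv i" "yv j"] by simp
  then show "?J (xv i) (yv j) (yv k) = 0"
    using xyy[of j k i] xyy'[of i k] by (cases "i = j"; cases "j = k"; cases "i = k") (auto simp: zero2)
qed

lemma kappaC1_left:
  "kappaC1 \<alpha> \<beta> id (xv i) z = \<beta> * sY z + (\<alpha> - \<beta>) * z $ Inr i"
  "kappaC1 \<alpha> \<beta> id (yv i) z = - \<beta> * sX z - (\<alpha> - \<beta>) * z $ Inl i"
proof -
  have "(\<Sum>j\<in>UNIV. z $ Inr j * (if i = j then \<alpha> else \<beta>)) = (\<Sum>j\<in>UNIV. \<beta> * z $ Inr j + (\<alpha> - \<beta>) * (z $ Inr j * kd i j))"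
    by (rule sum.cong) (auto simp: kd_def algebra_simps)
  also have "\<dots> = \<beta> * sY z + (\<alpha> - \<beta>) * z $ Inr i"
    by (simp only: sum.distrib sum_distrib_left[symmetric] sum_times_kd sY_def)
  finally show "kappaC1 \<alpha> \<beta> id (xv i) z = \<beta> * sY z + (\<alpha> - \<beta>) * z $ Inr i"
    by (simp add: kappaC1_def skew_ext_basis_left[OF vector_space_complex])
  have "(\<Sum>j\<in>UNIV. z $ Inl j * (if j = i then \<alpha> else \<beta>)) = (\<Sum>j\<in>UNIV. \<beta> * z $ Inl j + (\<alpha> - \<beta>) * (z $ Inl j * kd i j))"
    by (rule sum.cong) (auto simp: kd_def algebra_simps)
  also have "\<dots> = \<beta> * sX z + (\<alpha> - \<beta>) * z $ Inl i"
    by (simp only: sum.distrib sum_distrib_left[symmetric] sum_times_kd sX_def)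
  finally show "kappaC1 \<alpha> \<beta> id (yv i) z = - \<beta> * sX z - (\<alpha> - \<beta>) * z $ Inl i"
    by (simp add: kappaC1_def skew_ext_basis_left[OF vector_space_complex])
qed

lemma omega_left:
  "omega r s (xv i) z = (kd r i - kd s i) * (z $ Inr r - z $ Inr s)"
  "omega r s (yv i) z = - (kd r i - kd s i) * (z $ Inl r - z $ Inl s)"
  by (simp_all add: omega_def basis_kd algebra_simps del: basis_nth(1,4))

text \<open>
  The values of the cocycle conditions on triples of basis vectors, for the component at the identity
  and for the component at a transposition.
\<close>

context
  fixes i j :: "'n::finite" and a b :: "nat \<Rightarrow> complex" and \<alpha> \<beta> c :: complex and g :: "nat \<Rightarrow> complex"
  assumes g: "g = (\<lambda>m. gammas (of_nat CARD('n)) a b \<alpha> \<beta> c ! (m - 1))"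
    and ij: "i \<noteq> j"
begin

lemmas evalC = cyc_def kappaL1_basis kappaL1_minus kappaC1_left omega_left sX_simps sY_simps g gammas_def
  ij ij[symmetric] basis_kd

abbreviation "cycC \<equiv> cyc (\<lambda>u v w. kappaC1 \<alpha> \<beta> id u (kappaL1 a b id v w))"

lemma cycC_values:
  assumes "k \<noteq> i" "k \<noteq> j"
  shows "cycC (xv i) (xv j) (xv k) = 0" "cycC (yv i) (yv j) (yv k) = 0"
    "cycC (xv i) (xv j) (yv k) = 0" "cycC (xv k) (yv i) (yv j) = 0"
  using assms assms[symmetric] by (simp_all add: evalC del: basis_nth(1,4)) (simp_all add: algebra_simps)

lemma cycC_values':
  "cycC (xv i) (xv j) (yv i) = - g 7" "cycC (xv i) (yv i) (yv j) = - g 15"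
  by (simp_all add: evalC del: basis_nth(1,4)) (simp_all add: algebra_simps)

abbreviation "cycO r s \<equiv> cyc (\<lambda>u v w. c * omega r s u (kappaL1 a b id v w))"
abbreviation "dl r s m \<equiv> kd r m - kd s m"

lemma cycO_values:
  assumes "k \<noteq> i" "k \<noteq> j"
  shows "cycO r s (xv i) (xv j) (xv k) = 0" "cycO r s (yv i) (yv j) (yv k) = 0"
    "cycO r s (xv i) (xv j) (yv k) = g 3 * (dl r s i - dl r s j) * dl r s k"
    "cycO r s (xv k) (yv i) (yv j) = g 6 * (dl r s i - dl r s j) * dl r s k"
  using assms assms[symmetric] by (simp_all add: evalC del: basis_nth(1,4)) (simp_all add: algebra_simps)

lemma cycO_values':
  "cycO r s (xv i) (xv j) (yv i) = g 3 * (dl r s i + dl r s j) * dl r s i + g 14 * dl r s i * dl r s j"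
  "cycO r s (xv i) (yv i) (yv j) = g 6 * (dl r s i + dl r s j) * dl r s i - g 22 * dl r s i * dl r s j"
  by (simp_all add: evalC del: basis_nth(1,4)) (simp_all add: algebra_simps)

end

lemma not_transposition_id [simp]: "\<not> is_transposition id"
  unfolding is_transposition_def by (metis id_apply transpose_apply_first)

lemma bij_if_transposition: "is_transposition g \<Longrightarrow> bij g"
  unfolding is_transposition_def by auto

lemma gammas_length [simp]: "length (gammas n a b \<alpha> \<beta> c) = 22"
  by (simp add: gammas_def)

lemma gammas_zero_iff:
  "(\<forall>\<gamma>\<in>set (gammas n a b \<alpha> \<beta> c). \<gamma> = 0) \<longleftrightarrow> (\<forall>m. 1 \<le> m \<longrightarrow> m \<le> 22 \<longrightarrow> gammas n a b \<alpha> \<beta> c ! (m - 1) = 0)"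
proof -
  have "(\<forall>\<gamma>\<in>set (gammas n a b \<alpha> \<beta> c). \<gamma> = 0) \<longleftrightarrow> (\<forall>m<22. gammas n a b \<alpha> \<beta> c ! m = 0)"
    by (simp add: all_set_conv_all_nth)
  also have "\<dots> \<longleftrightarrow> (\<forall>m. 1 \<le> m \<longrightarrow> m \<le> 22 \<longrightarrow> gammas n a b \<alpha> \<beta> c ! (m - 1) = 0)"
  proof (intro iffI allI impI)
    fix m :: nat assume "\<forall>m<22. gammas n a b \<alpha> \<beta> c ! m = 0" "1 \<le> m" "m \<le> 22"
    then show "gammas n a b \<alpha> \<beta> c ! (m - 1) = 0" by auto
  next
    fix m :: nat assume "\<forall>m. 1 \<le> m \<longrightarrow> m \<le> 22 \<longrightarrow> gammas n a b \<alpha> \<beta> c ! (m - 1) = 0" "m < 22"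
    then show "gammas n a b \<alpha> \<beta> c ! m = 0" by (metis Suc_leI diff_Suc_1 le_add1 plus_1_eq_Suc)
  qed
  finally show ?thesis .
qed

text \<open>
  Every value on basis vectors is a combination of the quadratic polynomials. Conversely each
  polynomial is isolated by a suitable choice of the indices and of the coordinate, which needs three
  distinct indices.
\<close>

lemma lie_conditions_iff_gammas:
  fixes a b :: "nat \<Rightarrow> complex"
  assumes n: "CARD('n::finite) \<ge> 3"
  shows "(\<forall>x y z :: complex ^ ('n + 'n). cyc (\<lambda>u v w. kappaL1 a b id u (kappaL1 a b id v w)) x y z = 0) \<and>
     (\<forall>x y z :: complex ^ ('n + 'n). cyc (\<lambda>u v w. kappaC1 \<alpha> \<beta> id u (kappaL1 a b id v w)) x y z = 0) \<and>
     (\<forall>r s :: 'n. r \<noteq> s \<longrightarrow> (\<forall>x y z. cyc (\<lambda>u v w. c * omega r s u (kappaL1 a b id v w)) x y z = 0))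
    \<longleftrightarrow> (\<forall>\<gamma>\<in>set (gammas (of_nat CARD('n)) a b \<alpha> \<beta> c). \<gamma> = 0)" (is "?J \<and> ?C \<and> ?O \<longleftrightarrow> ?G")
proof -
  define g where "g = (\<lambda>m. gammas (of_nat CARD('n)) a b \<alpha> \<beta> c ! (m - 1))"
  note jac = jac_xxx[OF g_def _ not_sym not_sym] jac_yyy[OF g_def _ not_sym not_sym] jac_xxy[OF g_def _ not_sym not_sym]
    jac_xyy[OF g_def _ not_sym not_sym]
  note jac' = jac_xxy'[OF g_def] jac_xyy'[OF g_def]
  note cC = cycC_values[OF g_def _ not_sym not_sym] and cC' = cycC_values'[OF g_def]
  note cO = cycO_values[OF g_def _ not_sym not_sym] and cO' = cycO_values'[OF g_def]
  show ?thesis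
  proof
    assume "?G"
    then have "\<forall>m. 1 \<le> m \<longrightarrow> m \<le> 22 \<longrightarrow> g m = 0" unfolding gammas_zero_iff g_def .
    then have g0: "g 1 = 0" "g 2 = 0" "g 3 = 0" "g 4 = 0" "g 5 = 0" "g 6 = 0" "g 7 = 0" "g 8 = 0" "g 9 = 0" "g 10 = 0"
      "g 11 = 0" "g 12 = 0" "g 13 = 0" "g 14 = 0" "g 15 = 0" "g 16 = 0" "g 17 = 0" "g 18 = 0" "g 19 = 0" "g 20 = 0"
      "g 21 = 0" "g 22 = 0" by auto
    have J: "cyc (\<lambda>u v w. kappaL1 a b id u (kappaL1 a b id v w)) x y z = 0" for x y z :: "complex ^ ('n + 'n)"
      by (rule cyc_nested_zeroI[OF kappaL1_skew kappaL1_skew]; rule vec_eqI_sum)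
         (simp_all add: jac jac' g0 del: One_nat_def)
    have C: "cyc (\<lambda>u v w. kappaC1 \<alpha> \<beta> id u (kappaL1 a b id v w)) x y z = 0" for x y z :: "complex ^ ('n + 'n)"
      by (rule cyc_nested_zeroI[OF kappaC1_skew kappaL1_skew]) (simp_all add: cC cC' g0)
    have O: "cyc (\<lambda>u v w. c * omega r s u (kappaL1 a b id v w)) x y z = 0" if "r \<noteq> s" for r s :: 'n and x y z
    proof (rule cyc_nested_zeroI[OF skew_bilinear_omega[of c r s] kappaL1_skew])
      fix i j :: 'n assume ij: "i \<noteq> j"
      show "cyc (\<lambda>u v w. c * omega r s u (kappaL1 a b id v w)) (xv i) (xv j) (yv i) = 0"
        "cyc (\<lambda>u v w. c * omega r s u (kappaL1 a b id v w)) (xv i) (yv i) (yv j) = 0"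
        by (simp_all add: cO'[OF ij] g0)
    qed (simp_all add: cO g0)
    show "?J \<and> ?C \<and> ?O" using J C O by blast
  next
    assume JCO: "?J \<and> ?C \<and> ?O"
    obtain i j k :: 'n where d: "distinct [i, j, k]" using ex_three_distinct[OF n] .
    then have ij: "i \<noteq> j" "j \<noteq> i" and k: "k \<noteq> i" "k \<noteq> j" "i \<noteq> k" "j \<noteq> k" by auto
    have J: "cyc (\<lambda>u v w. kappaL1 a b id u (kappaL1 a b id v w)) x y z $ m = 0" for x y z :: "complex ^ ('n + 'n)" and m
      using JCO by simp
    have C: "cyc (\<lambda>u v w. kappaC1 \<alpha> \<beta> id u (kappaL1 a b id v w)) x y z = 0" for x y z :: "complex ^ ('n + 'n)"
      using JCO by blast
    have O: "cyc (\<lambda>u v w. c * omega r s u (kappaL1 a b id v w)) x y z = 0" if "r \<noteq> s" for r s :: 'n and x y z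
      using JCO that by blast
    have a: "g 1 = 0" "g 2 = 0" "g 4 = 0" "g 5 = 0"
      using J[of "xv i" "xv j" "yv k" "Inl i"] J[of "xv i" "xv j" "yv k" "Inr i"]
        J[of "xv k" "yv i" "yv j" "Inl i"] J[of "xv k" "yv i" "yv j" "Inr i"]
      by (simp_all add: jac ij k del: One_nat_def)
    have b: "g 8 = 0" "g 11 = 0" "g 16 = 0" "g 19 = 0"
      using J[of "xv i" "xv j" "yv i" "Inl k"] J[of "xv i" "xv j" "yv i" "Inr k"]
        J[of "xv i" "yv i" "yv j" "Inl k"] J[of "xv i" "yv i" "yv j" "Inr k"]
      by (simp_all add: jac' ij k del: One_nat_def)
    have c: "g 10 = 0" "g 13 = 0" "g 18 = 0" "g 21 = 0"
      using J[of "xv i" "xv j" "yv i" "Inl i"] J[of "xv i" "xv j" "yv i" "Inr i"]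
        J[of "xv i" "yv i" "yv j" "Inl i"] J[of "xv i" "yv i" "yv j" "Inr i"]
      by (simp_all add: jac' ij k b del: One_nat_def)
    have d: "g 9 = 0" "g 12 = 0" "g 17 = 0" "g 20 = 0"
      using J[of "xv i" "xv j" "yv i" "Inl j"] J[of "xv i" "xv j" "yv i" "Inr j"]
        J[of "xv i" "yv i" "yv j" "Inl j"] J[of "xv i" "yv i" "yv j" "Inr j"]
      by (simp_all add: jac' ij k b del: One_nat_def)
    have e: "g 7 = 0" "g 15 = 0"
      using C[of "xv i" "xv j" "yv i"] C[of "xv i" "yv i" "yv j"] by (simp_all add: cC'[OF ij(1)])
    have f: "g 3 = 0" "g 6 = 0"
      using O[OF k(3), of "xv i" "xv j" "yv k"] O[OF k(3), of "xv k" "yv i" "yv j"]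
      by (simp_all add: cO[OF ij(1) k(3,4)] ij k del: One_nat_def)
    have h: "g 14 = 0" "g 22 = 0"
      using O[OF ij(1), of "xv i" "xv j" "yv i"] O[OF ij(1), of "xv i" "yv i" "yv j"]
      by (simp_all add: cO'[OF ij(1)] ij f del: One_nat_def)
    have "m \<in> {1,2,3,4,5,6,7,8,9,10,11,12,13,14,15,16,17,18,19,20,21,22}" if "1 \<le> m" "m \<le> 22" for m :: nat
      using that by (simp, presburger)
    then show ?G unfolding gammas_zero_iff g_def[THEN fun_cong, symmetric]
      using a b c d e f h by blast
  qed
qed

lemma skew_bilinear_constant_family:
  "skew_bilinear (*) (\<lambda>u v. kappaC1 \<alpha> \<beta> g u v + kappaCref c g u v)"
  by (rule skew_bilinear_add[OF kappaC1_skew kappaCref_props(1)])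

lemma kappaC1_invariant_all:
  assumes "bij h"
  shows "kappaC1 \<alpha> \<beta> g u v = kappaC1 \<alpha> \<beta> (h \<circ> g \<circ> inv' h) (doubled_perm h u) (doubled_perm h v)"
proof (cases "g = id")
  case True
  then show ?thesis using conj_eq_id_iff[OF assms, of id] kappaC1_invariant[OF assms, of \<alpha> \<beta> u v] by simp
next
  case False
  then show ?thesis using conj_eq_id_iff[OF assms, of g] by (simp add: kappaC1_def)
qed

text \<open>
  Invariance determines both parts at the identity, and the homogeneous equation determines the
  constant part off the identity.
\<close>

theorem lie_orbifold_maps:
  assumes n: "CARD('n::finite) \<ge> 3"
  shows "{(\<kappa>L, \<kappa>C). lie_orbifold_map (Sn :: ('n \<Rightarrow> 'n) monoid) doubled_perm \<kappa>L \<kappa>C} = lie_family"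
proof (intro equalityI subsetI)
  fix p :: "('n \<Rightarrow> 'n, 'n + 'n) lin_cochain \<times> ('n \<Rightarrow> 'n, 'n + 'n) const_cochain"
  assume "p \<in> {(\<kappa>L, \<kappa>C). lie_orbifold_map (Sn :: ('n \<Rightarrow> 'n) monoid) doubled_perm \<kappa>L \<kappa>C}"
  then obtain \<kappa>L :: "('n \<Rightarrow> 'n, 'n + 'n) lin_cochain" and \<kappa>C :: "('n \<Rightarrow> 'n, 'n + 'n) const_cochain" where p: "p = (\<kappa>L, \<kappa>C)" and lie: "lie_orbifold_map Sn doubled_perm \<kappa>L \<kappa>C" by auto
  have supp: "supported_only_on \<kappa>L {id}" and dr: "drinfeld_orbifold_map Sn doubled_perm \<kappa>L \<kappa>C"
    using lie by (auto simp: lie_orbifold_map_def one_Sn)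
  have L: "skew_bilinear (*s) (\<kappa>L id)" and coch: "cochain Sn (*) \<kappa>C"
    and eqL: "\<And>h u v. bij h \<Longrightarrow> doubled_perm h (\<kappa>L id u v) = \<kappa>L id (doubled_perm h u) (doubled_perm h v)"
    and eqC: "\<And>g h u v. bij g \<Longrightarrow> bij h \<Longrightarrow> \<kappa>C g u v = \<kappa>C (h \<circ> g \<circ> inv' h) (doubled_perm h u) (doubled_perm h v)"
    and hom: "\<And>g x y z. bij g \<Longrightarrow> g \<noteq> id \<Longrightarrow> cyc (\<lambda>x y z. \<kappa>C g y z *s (doubled_perm g x - x)) x y z = 0"
    and jac: "\<And>x y z. cyc (\<lambda>u v w. \<kappa>L id u (\<kappa>L id v w)) x y z = 0"
    and coc: "\<And>g x y z. bij g \<Longrightarrow> cyc (\<lambda>u v w. \<kappa>C g u (\<kappa>L id v w)) x y z = 0"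
    using dr unfolding lie_Sn_iff[OF supp] by blast+
  obtain a b where ab: "\<kappa>L id = kappaL1 a b id" using invariant_bracket[OF n L eqL] by blast
  have Leq: "\<kappa>L = kappaL1 a b"
  proof
    fix g show "\<kappa>L g = kappaL1 a b g"
      using supp ab by (cases "g = id") (auto simp: supported_only_on_def kappaL1_def)
  qed
  have "\<kappa>C id u v = \<kappa>C id (doubled_perm h u) (doubled_perm h v)" if "bij h" for h u v
    using eqC[OF bij_id that, of u v] conj_eq_id_iff[OF that, of id] by simp
  then obtain \<alpha> \<beta> where C1: "\<kappa>C id = kappaC1 \<alpha> \<beta> id"
    using invariant_form[OF n cochain_Sn_skew(1)[OF coch bij_id]] by blast
  obtain c where c: "\<And>g. bij g \<Longrightarrow> g \<noteq> id \<Longrightarrow> \<kappa>C g = kappaCref c g"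
    using constant_part_kappaCref[of \<kappa>C, OF n cochain_Sn_skew(1)[OF coch] hom eqC] by blast
  have Ceq: "\<kappa>C = (\<lambda>g u v. kappaC1 \<alpha> \<beta> g u v + kappaCref c g u v)"
  proof (intro ext)
    fix g :: "'n \<Rightarrow> 'n" and u v
    consider "g = id" | "bij g" "g \<noteq> id" | "\<not> bij g" by blast
    then show "\<kappa>C g u v = kappaC1 \<alpha> \<beta> g u v + kappaCref c g u v"
    proof cases
      case 1
      then show ?thesis using C1 by (simp add: kappaCref_def)
    next
      case 2
      then show ?thesis using c by (simp add: kappaC1_def)
    next
      case 3
      then have "g \<noteq> id" "\<not> is_transposition g" using bij_if_transposition bij_id by blast+
      then show ?thesis using cochain_Sn_skew(2)[OF coch 3] by (simp add: kappaC1_def kappaCref_def)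
    qed
  qed
  have "\<forall>\<gamma>\<in>set (gammas (of_nat CARD('n)) a b \<alpha> \<beta> c). \<gamma> = 0"
    unfolding lie_conditions_iff_gammas[OF n, symmetric]
  proof (intro conjI allI impI)
    fix x y z :: "complex ^ ('n + 'n)" show "cyc (\<lambda>u v w. kappaL1 a b id u (kappaL1 a b id v w)) x y z = 0"
      using jac[of x y z] by (simp only: ab)
    show "cyc (\<lambda>u v w. kappaC1 \<alpha> \<beta> id u (kappaL1 a b id v w)) x y z = 0"
      using coc[OF bij_id, of x y z] by (simp only: ab C1)
  next
    fix r s :: 'n and x y z :: "complex ^ ('n + 'n)" assume rs: "r \<noteq> s"
    have "\<kappa>C (tr r s) = (\<lambda>u v. c * omega r s u v)"
      using c[of "tr r s"] rs not_transposition_id is_transposition_transpose[OF rs]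
      by (metis bij_if_transposition kappaCref_transpose)
    then show "cyc (\<lambda>u v w. c * omega r s u (kappaL1 a b id v w)) x y z = 0"
      using coc[OF bij_if_transposition[OF is_transposition_transpose[OF rs]], of x y z] by (simp only: ab)
  qed
  then show "p \<in> lie_family" unfolding p Leq Ceq lie_family_def by blast
next
  fix p :: "('n \<Rightarrow> 'n, 'n + 'n) lin_cochain \<times> ('n \<Rightarrow> 'n, 'n + 'n) const_cochain"
  assume "p \<in> lie_family"
  then obtain a b \<alpha> \<beta> c where p: "p = (kappaL1 a b, \<lambda>g u v. kappaC1 \<alpha> \<beta> g u v + kappaCref c g u v)"
    and G: "\<forall>\<gamma>\<in>set (gammas (of_nat CARD('n)) a b \<alpha> \<beta> c). \<gamma> = 0"
    unfolding lie_family_def by blast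
  let ?C = "\<lambda>(g :: 'n \<Rightarrow> 'n) u v. kappaC1 \<alpha> \<beta> g u v + kappaCref c g u v :: complex"
  note eqs = lie_conditions_iff_gammas[OF n, of a b \<alpha> \<beta> c, THEN iffD2, OF G]
  have supp: "supported_only_on (kappaL1 a b) {id :: 'n \<Rightarrow> 'n}" by (auto simp: supported_only_on_def kappaL1_def)
  have coch: "cochain Sn (*) ?C"
    unfolding cochain_def
  proof (intro conjI ballI allI impI)
    fix g :: "'n \<Rightarrow> 'n" assume "g \<notin> carrier Sn"
    then have "g \<noteq> id" "\<not> is_transposition g" using bij_if_transposition bij_id by (auto simp: carrier_Sn)
    then show "?C g = (\<lambda>u v. 0)" by (simp add: kappaC1_def kappaCref_def)
  qed (rule skew_bilinear_constant_family)
  have "drinfeld_orbifold_map Sn doubled_perm (kappaL1 a b) ?C"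
    unfolding lie_Sn_iff[OF supp]
  proof (intro conjI allI impI)
    fix g h :: "'n \<Rightarrow> 'n" and u v assume "bij g" "bij h"
    then show "?C g u v = ?C (h \<circ> g \<circ> inv' h) (doubled_perm h u) (doubled_perm h v)"
      using kappaC1_invariant_all[of h \<alpha> \<beta> g u v] kappaCref_props(2)[of g h c u v] by simp
  next
    fix g :: "'n \<Rightarrow> 'n" and x y z :: "complex ^ ('n + 'n)" assume "bij g" "g \<noteq> id"
    then show "cyc (\<lambda>x y z. ?C g y z *s (doubled_perm g x - x)) x y z = 0"
      using kappaCref_props(3)[of c g x y z] by (simp add: kappaC1_def)
  next
    fix g :: "'n \<Rightarrow> 'n" and x y z :: "complex ^ ('n + 'n)" assume "bij g"
    consider "g = id" | r s where "r \<noteq> s" "g = tr r s" | "g \<noteq> id" "\<not> is_transposition g"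
      unfolding is_transposition_def by blast
    then show "cyc (\<lambda>u v w. ?C g u (kappaL1 a b id v w)) x y z = 0"
    proof cases
      case 1
      have "cyc (\<lambda>u v w. kappaC1 \<alpha> \<beta> id u (kappaL1 a b id v w)) x y z = 0" using eqs by blast
      then show ?thesis unfolding 1 by (simp add: kappaCref_def)
    next
      case 2
      have "cyc (\<lambda>u v w. c * omega r s u (kappaL1 a b id v w)) x y z = 0" using eqs 2(1) by blast
      moreover have "tr r s \<noteq> id" using 2(1) by (metis is_transposition_transpose not_transposition_id)
      ultimately show ?thesis unfolding 2(2) by (simp add: kappaC1_def kappaCref_transpose[OF 2(1)])
    next
      case 3
      then show ?thesis by (simp add: kappaC1_def kappaCref_def cyc_def)
    qed
  qed (use eqs in \<open>simp_all add: coch kappaL1_skew kappaL1_equivariant\<close>)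
  then show "p \<in> {(\<kappa>L, \<kappa>C). lie_orbifold_map (Sn :: ('n \<Rightarrow> 'n) monoid) doubled_perm \<kappa>L \<kappa>C}"
    using supp by (simp add: p lie_orbifold_map_def one_Sn)
qed

section \<open>Products of two transpositions\<close>

text \<open>
  Two transpositions move the same two points, disjoint pairs of points, or exactly one common point.
\<close>

lemma two_transpositions_cases:
  assumes "i \<noteq> j" "r \<noteq> s"
  obtains "{i, j} = {r, s}" | "i \<notin> {r, s}" "j \<notin> {r, s}"
    | p q t where "distinct [p, q, t]" "tr i j = tr p q" "tr r s = tr q t"
proof (cases "i \<in> {r, s}"; cases "j \<in> {r, s}")
  assume "i \<in> {r, s}" "j \<in> {r, s}"
  then show ?thesis using assms that(1) by auto
next
  assume i: "i \<in> {r, s}" and j: "j \<notin> {r, s}"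
  show ?thesis
    by (rule that(3)[of j i "if i = r then s else r"]) (use i j assms in \<open>auto simp: transpose_commute\<close>)
next
  assume i: "i \<notin> {r, s}" and j: "j \<in> {r, s}"
  show ?thesis
    by (rule that(3)[of i j "if j = r then s else r"]) (use i j assms in \<open>auto simp: transpose_commute\<close>)
qed (use that(2) in blast)

lemma tr_comp_rotate: "distinct [p, q, t] \<Longrightarrow> tr p q \<circ> tr q t = tr q t \<circ> tr t p"
  by (auto simp: fun_eq_iff Transposition.transpose_def)

lemma tr_comp_values:
  assumes "distinct [p, q, t]"
  shows "(tr p q \<circ> tr q t) p = q" "(tr p q \<circ> tr q t) q = t" "(tr p q \<circ> tr q t) t = p"
    "x \<notin> {p, q, t} \<Longrightarrow> (tr p q \<circ> tr q t) x = x"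
  using assms by (auto simp: Transposition.transpose_def)

lemma is_3cycle_iff: "is_3cycle g \<longleftrightarrow> (\<exists>p q t. distinct [p, q, t] \<and> g = tr p q \<circ> tr q t)"
  by (simp add: is_3cycle_def)

lemma inv_tr [simp]: "inv' (tr r s) = tr r s"
  by (simp add: inv_unique_comp)

text \<open>
  The linear form \<open>B x\<^sub>i\<^sup>* - A y\<^sub>i\<^sup>*\<close>. On the 3-cycle \<open>(p q t)\<close> the constant cochain \<open>kappaC3cyc\<close>, with
  \<open>A = a\<^sup>\<bottom> - a\<close> and \<open>B = b\<^sup>\<bottom> - b\<close>, is the cyclic sum of the exterior products of these forms, which is
  \<open>tri_form\<close>.
\<close>

definition tri :: "complex \<Rightarrow> complex \<Rightarrow> 'n::finite \<Rightarrow> complex ^ ('n + 'n) \<Rightarrow> complex" where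
  "tri A B i u = B * u $ Inl i - A * u $ Inr i"

lemma u_ref_nth:
  assumes "r \<noteq> s"
  shows "u_ref a a' b b' (tr r s) $ Inl i = (if i = r \<or> i = s then a else a')"
    "u_ref a a' b b' (tr r s) $ Inr i = (if i = r \<or> i = s then b else b')"
  by (auto simp: u_ref_def moved_transpose[OF assms])

text \<open>
  The vector \<open>u + \<^sup>gu\<close> is fixed by \<open>g = (r s)\<close>. Hence a transposition composed with itself contributes
  nothing to (iii) and (iv).
\<close>

lemma omega_fixed: "omega r s (u + doubled_perm (tr r s) u) v = 0"
proof (cases "r = s")
  case False
  have n: "doubled_perm (tr r s) v $ Inl l = v $ Inl (tr r s l)" "doubled_perm (tr r s) v $ Inr l = v $ Inr (tr r s l)" for l v
    using doubled_perm_nth[of "tr r s" v "tr r s l"] by simp_all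
  show ?thesis by (simp add: omega_def n)
qed (simp add: omega_def)

lemma omega_u_ref:
  assumes "distinct [p, q, t]"
  shows "omega p q (u + doubled_perm (tr q t) u) (u_ref a a' b b' (tr q t))
    = 2 * tri (a' - a) (b' - b) p u - tri (a' - a) (b' - b) q u - tri (a' - a) (b' - b) t u"
proof -
  have n: "doubled_perm (tr q t) v $ Inl l = v $ Inl (tr q t l)" "doubled_perm (tr q t) v $ Inr l = v $ Inr (tr q t l)" for l v
    using doubled_perm_nth[of "tr q t" v "tr q t l"] by simp_all
  show ?thesis using assms by (simp add: omega_def n u_ref_nth tri_def algebra_simps)
qed

lemma omega_u_ref_disjoint:
  assumes "r \<noteq> s" "i \<notin> {r, s}" "j \<notin> {r, s}"
  shows "omega i j u (u_ref a a' b b' (tr r s)) = 0"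
  using assms by (simp add: omega_def u_ref_nth)

lemma omega_doubleton: "{i, j} = {r, s} \<Longrightarrow> omega i j = omega r s"
  by (auto simp: doubleton_eq_iff omega_def fun_eq_iff algebra_simps)

text \<open>
  The common shape of the linear and of the constant reflection cochain. It allows the left-hand
  sides of (iii) and (iv) to be computed together.
\<close>

locale transposition_cochain =
  fixes \<kappa> :: "('n::finite \<Rightarrow> 'n) \<Rightarrow> complex ^ ('n + 'n) \<Rightarrow> complex ^ ('n + 'n) \<Rightarrow> 'c::ab_group_add"
    and \<Phi> :: "('n \<Rightarrow> 'n) \<Rightarrow> complex \<Rightarrow> 'c"
  assumes \<kappa>_tr: "r \<noteq> s \<Longrightarrow> \<kappa> (tr r s) u v = \<Phi> (tr r s) (omega r s u v)"
    and \<kappa>_other: "\<not> is_transposition x \<Longrightarrow> \<kappa> x u v = 0"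
    and \<Phi>_zero: "\<Phi> x 0 = 0"
begin

abbreviation "pair_term a a' b b' g y u v w \<equiv> \<kappa> (g \<circ> inv' y) (u + doubled_perm y u) (kappaLref a a' b b' y v w)"

lemma \<kappa>_zero: "\<kappa> x u 0 = 0"
  by (cases "is_transposition x") (auto simp: is_transposition_def \<kappa>_tr \<kappa>_other omega_def \<Phi>_zero)

lemma pair_term_cases:
  assumes "pair_term a a' b b' g y u v w \<noteq> 0"
  obtains p q t where "distinct [p, q, t]" "y = tr q t" "g = tr p q \<circ> tr q t"
proof -
  have "is_transposition y"
  proof (rule ccontr)
    assume "\<not> is_transposition y"
    then have "kappaLref a a' b b' y = (\<lambda>u v. 0)" by (simp add: kappaLref_def)
    then show False using assms by (simp add: \<kappa>_zero)
  qed
  then obtain r s where y: "r \<noteq> s" "y = tr r s" unfolding is_transposition_def by blast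
  have "is_transposition (g \<circ> tr r s)" using assms \<kappa>_other by (auto simp: y)
  then obtain i j where x: "i \<noteq> j" "g \<circ> tr r s = tr i j" unfolding is_transposition_def by blast
  have g: "g = tr i j \<circ> tr r s"
    unfolding x(2)[symmetric] by (simp add: comp_assoc)
  have val: "pair_term a a' b b' g y u v w = \<Phi> (tr i j) (omega r s v w * omega i j (u + doubled_perm (tr r s) u) (u_ref a a' b b' (tr r s)))"
    by (simp add: y x \<kappa>_tr[OF x(1)] kappaLref_transpose[OF y(1)] omega_linear)
  show ?thesis
  proof (rule two_transpositions_cases[OF x(1) y(1)])
    assume "{i, j} = {r, s}"
    then have o: "omega i j = omega r s" by (rule omega_doubleton)
    show ?thesis using assms unfolding val o by (simp add: omega_fixed \<Phi>_zero)
  next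
    assume "i \<notin> {r, s}" "j \<notin> {r, s}"
    then show ?thesis using assms unfolding val by (simp add: omega_u_ref_disjoint y \<Phi>_zero)
  next
    fix p q t assume "distinct [p, q, t]" "tr i j = tr p q" "tr r s = tr q t"
    then show ?thesis using that[of p q t] y(2) g by simp
  qed
qed

lemma pair_sum_not_3cycle:
  "\<not> is_3cycle g \<Longrightarrow> (\<Sum>y\<in>{y. bij y}. pair_term a a' b b' g y u v w) = 0"
  using pair_term_cases unfolding is_3cycle_iff by (intro sum.neutral ballI) metis

lemma pair_term_value:
  assumes "distinct [p, q, t]" "g = tr p q \<circ> tr q t"
  shows "pair_term a a' b b' g (tr q t) u v w
    = \<Phi> (tr p q) ((2 * tri (a' - a) (b' - b) p u - tri (a' - a) (b' - b) q u - tri (a' - a) (b' - b) t u) * omega q t v w)"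
proof -
  have "g \<circ> tr q t = tr p q" using assms(2) by (simp add: comp_assoc)
  moreover have "p \<noteq> q" "q \<noteq> t" using assms(1) by auto
  ultimately show ?thesis
    using omega_u_ref[OF assms(1), of u a a' b b']
    by (simp add: \<kappa>_tr kappaLref_transpose omega_linear mult.commute)
qed

text \<open>
  A 3-cycle is a product of two transpositions in exactly three ways.
\<close>

lemma pair_sum_3cycle:
  assumes d: "distinct [p, q, t]" and g: "g = tr p q \<circ> tr q t"
  shows "(\<Sum>y\<in>{y. bij y}. pair_term a a' b b' g y u v w)
    = \<Phi> (tr p q) ((2 * tri (a' - a) (b' - b) p u - tri (a' - a) (b' - b) q u - tri (a' - a) (b' - b) t u) * omega q t v w)
    + \<Phi> (tr q t) ((2 * tri (a' - a) (b' - b) q u - tri (a' - a) (b' - b) t u - tri (a' - a) (b' - b) p u) * omega t p v w)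
    + \<Phi> (tr t p) ((2 * tri (a' - a) (b' - b) t u - tri (a' - a) (b' - b) p u - tri (a' - a) (b' - b) q u) * omega p q v w)"
proof -
  have d2: "distinct [q, t, p]" and d3: "distinct [t, p, q]" using d by auto
  have g2: "g = tr q t \<circ> tr t p" and g3: "g = tr t p \<circ> tr p q"
    using g tr_comp_rotate[OF d] tr_comp_rotate[OF d2] by simp_all
  have "(\<Sum>y\<in>{y. bij y}. pair_term a a' b b' g y u v w) = (\<Sum>y\<in>{tr q t, tr t p, tr p q}. pair_term a a' b b' g y u v w)"
  proof (rule sum.mono_neutral_right)
    show "\<forall>y\<in>{y. bij y} - {tr q t, tr t p, tr p q}. pair_term a a' b b' g y u v w = 0"
    proof (rule ballI, rule ccontr)
      fix y assume y: "y \<in> {y. bij y} - {tr q t, tr t p, tr p q}" and "pair_term a a' b b' g y u v w \<noteq> 0"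
      then obtain p' q' t' where *: "distinct [p', q', t']" "y = tr q' t'" "g = tr p' q' \<circ> tr q' t'"
        using pair_term_cases by metis
      have v: "g p' = q'" "g q' = t'" using tr_comp_values[OF *(1)] *(3) by simp_all
      have "g p' \<noteq> p'" using v(1) *(1) by auto
      have "p' \<in> {p, q, t}"
      proof (rule ccontr)
        assume "p' \<notin> {p, q, t}"
        then have "(tr p q \<circ> tr q t) p' = p'" by (rule tr_comp_values(4)[OF d])
        then show False using \<open>g p' \<noteq> p'\<close> unfolding g by simp
      qed
      then have "(q', t') \<in> {(q, t), (t, p), (p, q)}"
        using v tr_comp_values(1-3)[OF d] g by auto
      then show False using y *(2) by auto
    qed
  qed auto
  moreover have "tr q t \<noteq> tr t p" "tr q t \<noteq> tr p q" "tr t p \<noteq> tr p q"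
  proof -
    have v: "tr q t p = p" "tr t p p = t" "tr p q p = q" using d by (simp_all add: Transposition.transpose_def)
    have ne: "p \<noteq> q" "q \<noteq> t" "p \<noteq> t" using d by auto
    show "tr q t \<noteq> tr t p" "tr q t \<noteq> tr p q" "tr t p \<noteq> tr p q" using v ne by metis+
  qed
  ultimately show ?thesis
    using pair_term_value[OF d g, of u a a' b b' v w] pair_term_value[OF d2 g2, of u a a' b b' v w]
      pair_term_value[OF d3 g3, of u a a' b b' v w]
    by (simp add: add_ac)
qed

end

section \<open>The constant part on 3-cycles\<close>

definition tri_form :: "complex \<Rightarrow> complex \<Rightarrow> 'n::finite \<Rightarrow> 'n \<Rightarrow> 'n \<Rightarrow> complex ^ ('n + 'n) \<Rightarrow> complex ^ ('n + 'n) \<Rightarrow> complex" where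
  "tri_form A B p q t u v = (tri A B p u * tri A B q v - tri A B q u * tri A B p v)
     + (tri A B q u * tri A B t v - tri A B t u * tri A B q v)
     + (tri A B t u * tri A B p v - tri A B p u * tri A B t v)"

lemma tri_form_skew: "skew_bilinear (*) (tri_form A B p q t)"
  unfolding skew_bilinear_iff tri_form_def tri_def
  by (simp add: vector_space_complex algebra_simps)

lemma cyc_sign_kd:
  assumes "distinct [p, q, t]" "g = tr p q \<circ> tr q t"
  shows "cyc_sign g i j = (kd p i * kd q j - kd q i * kd p j) + (kd q i * kd t j - kd t i * kd q j)
     + (kd t i * kd p j - kd p i * kd t j)"
proof -
  have v: "g p = q" "g q = t" "g t = p" "\<And>x. x \<notin> {p, q, t} \<Longrightarrow> g x = x"
    using tr_comp_values[OF assms(1)] assms(2) by auto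
  have ne: "p \<noteq> q" "q \<noteq> t" "p \<noteq> t" "q \<noteq> p" "t \<noteq> q" "t \<noteq> p" using assms(1) by auto
  have fixed: "g x = x" if "x \<noteq> p" "x \<noteq> q" "x \<noteq> t" for x using v(4)[of x] that by simp
  have out: "cyc_sign g i j = 0" if "g i = i \<or> g j = j" for i j
  proof -
    have inj: "inj g" unfolding assms(2) by (simp add: inj_compose)
    have "g j = i \<Longrightarrow> g i = i \<Longrightarrow> j = i" "g i = j \<Longrightarrow> g j = j \<Longrightarrow> i = j"
      using injD[OF inj, of j i] injD[OF inj, of i j] by simp_all
    then show ?thesis using that by (auto simp: cyc_sign_def)
  qed
  consider "i = p" | "i = q" | "i = t" | "i \<noteq> p" "i \<noteq> q" "i \<noteq> t" by blast
  then show ?thesis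
  proof cases
    case 4
    then show ?thesis using out[of i j] fixed[of i] by (simp add: kd_def)
  next
    case 1
    consider "j = p" | "j = q" | "j = t" | "j \<noteq> p" "j \<noteq> q" "j \<noteq> t" by blast
    then show ?thesis
      by cases (simp_all add: 1 v(1-3) ne out fixed kd_def cyc_sign_def[of g p p] cyc_sign_def[of g p q] cyc_sign_def[of g p t])
  next
    case 2
    consider "j = p" | "j = q" | "j = t" | "j \<noteq> p" "j \<noteq> q" "j \<noteq> t" by blast
    then show ?thesis
      by cases (simp_all add: 2 v(1-3) ne out fixed kd_def cyc_sign_def[of g q p] cyc_sign_def[of g q q] cyc_sign_def[of g q t])
  next
    case 3
    consider "j = p" | "j = q" | "j = t" | "j \<noteq> p" "j \<noteq> q" "j \<noteq> t" by blast
    then show ?thesis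
      by cases (simp_all add: 3 v(1-3) ne out fixed kd_def cyc_sign_def[of g t p] cyc_sign_def[of g t q] cyc_sign_def[of g t t])
  qed
qed

lemma tri_basis: "tri A B p (xv i) = B * kd p i" "tri A B p (yv i) = - A * kd p i"
  by (simp_all add: tri_def basis_kd del: basis_nth(1,4))

lemma kappaC3cyc_eq_tri_form:
  assumes "distinct [p, q, t]" "g = tr p q \<circ> tr q t"
  shows "kappaC3cyc a a' b b' g = tri_form (a' - a) (b' - b) p q t"
proof (rule skew_bilinear_eqI[OF _ tri_form_skew])
  have c3: "is_3cycle g" using assms is_3cycle_iff by blast
  note cs = cyc_sign_kd[OF assms]
  show "skew_bilinear (*) (kappaC3cyc a a' b b' g)"
    using c3 by (simp add: kappaC3cyc_def) (rule skew_bilinear_skew_ext[OF vector_space_complex]; simp add: cs algebra_simps)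
  fix i j
  show "kappaC3cyc a a' b b' g (xv i) (xv j) = tri_form (a' - a) (b' - b) p q t (xv i) (xv j)"
    "kappaC3cyc a a' b b' g (xv i) (yv j) = tri_form (a' - a) (b' - b) p q t (xv i) (yv j)"
    "kappaC3cyc a a' b b' g (yv i) (yv j) = tri_form (a' - a) (b' - b) p q t (yv i) (yv j)"
    using c3 by (simp_all add: kappaC3cyc_def skew_ext_const_basis cs tri_form_def tri_basis power2_eq_square)
      (simp_all add: algebra_simps)
qed

lemma tri_u_ref:
  assumes "r \<noteq> s"
  shows "tri (a' - a) (b' - b) i (u_ref a a' b b' (tr r s)) = b' * a - b * a'"
  by (simp add: tri_def u_ref_nth[OF assms] algebra_simps)

text \<open>
  On \<open>u_ref\<close> the form \<open>tri\<close> has the same value for all indices, and \<open>tri_form\<close> is a combination of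
  differences of such values.
\<close>

lemma kappaC3cyc_u_ref:
  fixes x y :: "'n::finite \<Rightarrow> 'n"
  shows "kappaC3cyc a a' b b' x u (kappaLref a a' b b' y v w) = 0"
proof (cases "is_3cycle x \<and> is_transposition y")
  case True
  then obtain p q t r s where x: "distinct [p, q, t]" "x = tr p q \<circ> tr q t" and y: "r \<noteq> s" "y = tr r s"
    unfolding is_3cycle_iff is_transposition_def by blast
  have "tri A B i (c *s v) = c * tri A B i v" for A B i c and v :: "complex ^ ('n + 'n)"
    by (simp add: tri_def algebra_simps)
  then have tu: "tri (a' - a) (b' - b) i (c *s u_ref a a' b b' (tr r s)) = c * (b' * a - b * a')" for i c
    by (simp only: tri_u_ref[OF y(1)])
  show ?thesis
    unfolding kappaC3cyc_eq_tri_form[OF x] y(2) kappaLref_transpose[OF y(1)] tri_form_def tu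
    by (simp add: algebra_simps)
next
  case False
  then show ?thesis by (auto simp: kappaC3cyc_def kappaLref_def skew_ext_def)
qed

context
  fixes p q t :: "'n::finite" and A B :: complex
begin

definition "ex1 u = u $ Inl p - u $ Inl q"
definition "ex2 u = u $ Inl q - u $ Inl t"
definition "ey1 u = u $ Inr p - u $ Inr q"
definition "ey2 u = u $ Inr q - u $ Inr t"

text \<open>
  Everything below depends only on the differences of coordinates, and only two differences of each
  kind are independent. In terms of these, the identities for cyclic sums are polynomial identities.
\<close>

lemma differences:
  "2 * tri A B p u - tri A B q u - tri A B t u = B * (2 * ex1 u + ex2 u) - A * (2 * ey1 u + ey2 u)"
  "2 * tri A B q u - tri A B t u - tri A B p u = B * (ex2 u - ex1 u) - A * (ey2 u - ey1 u)"
  "2 * tri A B t u - tri A B p u - tri A B q u = - B * (ex1 u + 2 * ex2 u) + A * (ey1 u + 2 * ey2 u)"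
  "omega p q v w = ex1 v * ey1 w - ex1 w * ey1 v" "omega q t v w = ex2 v * ey2 w - ex2 w * ey2 v"
  "omega t p v w = (ex1 v + ex2 v) * (ey1 w + ey2 w) - (ex1 w + ex2 w) * (ey1 v + ey2 v)"
  "tri_form A B p q t v w = (B * ex1 v - A * ey1 v) * (B * ex2 w - A * ey2 w)
     - (B * ex2 v - A * ey2 v) * (B * ex1 w - A * ey1 w)"
  "u $ Inl q - u $ Inl t = ex2 u" "u $ Inr q - u $ Inr t = ey2 u"
  unfolding ex1_def ex2_def ey1_def ey2_def tri_form_def tri_def omega_def
  by (simp_all add: algebra_simps)

lemma cyc3_identity_const:
  "cyc (\<lambda>u v w. (2 * tri A B p u - tri A B q u - tri A B t u) * omega q t v w
    + (2 * tri A B q u - tri A B t u - tri A B p u) * omega t p v w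
    + (2 * tri A B t u - tri A B p u - tri A B q u) * omega p q v w) u v w = 0"
  unfolding cyc_def differences by (simp add: algebra_simps)

lemma cyc3_identity_x:
  "A * cyc (\<lambda>u v w. (2 * tri A B p u - tri A B q u - tri A B t u) * omega q t v w) u v w
    = 2 * cyc (\<lambda>u v w. tri_form A B p q t v w * (u $ Inl q - u $ Inl t)) u v w"
  unfolding cyc_def differences by (simp add: algebra_simps)

lemma cyc3_identity_y:
  "B * cyc (\<lambda>u v w. (2 * tri A B p u - tri A B q u - tri A B t u) * omega q t v w) u v w
    = 2 * cyc (\<lambda>u v w. tri_form A B p q t v w * (u $ Inr q - u $ Inr t)) u v w"
  unfolding cyc_def differences by (simp add: algebra_simps)

end

lemma cyc_add: "cyc (\<lambda>u v w. f u v w + g u v w) x y z = cyc f x y z + cyc g x y z"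
  by (simp add: cyc_def add_ac)

lemma cyc_mult: "cyc (\<lambda>u v w. c * f u v w) x y z = c * (cyc f x y z :: complex)"
  by (simp add: cyc_def algebra_simps)

lemma cyc_nth: "cyc f x y z $ m = cyc (\<lambda>u v w. f u v w $ m) x y z"
  by (simp add: cyc_def)

interpretation lin_ref: transposition_cochain "kappaLref a a' b b'" "\<lambda>x z. z *s u_ref a a' b b' x"
  for a a' b b' :: complex
  by unfold_locales (simp_all add: kappaLref_transpose, simp_all add: kappaLref_def)

interpretation const_ref: transposition_cochain "kappaCref c" "\<lambda>x z. c * z" for c :: complex
  by unfold_locales (simp_all add: kappaCref_transpose, simp_all add: kappaCref_def)

text \<open>
  At the coordinate \<open>l\<close>, each of the three products of transpositions carries the coefficient \<open>a\<close>
  or \<open>a\<^sup>\<bottom>\<close>, depending on whether its first factor moves \<open>l\<close>. A common coefficient contributes 0 by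
  \<open>cyc3_identity_const\<close>. If \<open>l = t\<close>, the coefficients differ by \<open>a\<^sup>\<bottom> - a\<close> for the one factor \<open>(p q)\<close> that
  fixes \<open>t\<close>.
\<close>

lemma pair_sum_coordinate:
  fixes g :: "'n::finite \<Rightarrow> 'n"
  assumes d: "distinct [p, q, t]" and g: "g = tr p q \<circ> tr q t" and l: "l \<noteq> p" "l \<noteq> q"
  shows "cyc (\<lambda>u v w. \<Sum>y\<in>{y. bij y}. kappaLref a a' b b' (g \<circ> inv' y) (u + doubled_perm y u) (kappaLref a a' b b' y v w)) x y z $ Inl l
      = 2 * cyc (\<lambda>x y z. kappaC3cyc a a' b b' g y z * (doubled_perm g x - x) $ Inl l) x y z" (is ?X)
    and "cyc (\<lambda>u v w. \<Sum>y\<in>{y. bij y}. kappaLref a a' b b' (g \<circ> inv' y) (u + doubled_perm y u) (kappaLref a a' b b' y v w)) x y z $ Inr l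
      = 2 * cyc (\<lambda>x y z. kappaC3cyc a a' b b' g y z * (doubled_perm g x - x) $ Inr l) x y z" (is ?Y)
proof -
  define A B where AB: "A = a' - a" "B = b' - b"
  define f1 where "f1 = (\<lambda>u v w :: complex ^ ('n + 'n). (2 * tri A B p u - tri A B q u - tri A B t u) * omega q t v w)"
  define f2 where "f2 = (\<lambda>u v w :: complex ^ ('n + 'n). (2 * tri A B q u - tri A B t u - tri A B p u) * omega t p v w)"
  define f3 where "f3 = (\<lambda>u v w :: complex ^ ('n + 'n). (2 * tri A B t u - tri A B p u - tri A B q u) * omega p q v w)"
  have const: "cyc (\<lambda>u v w. f1 u v w + f2 u v w + f3 u v w) x y z = 0"
    unfolding f1_def f2_def f3_def by (rule cyc3_identity_const)
  then have const': "cyc f1 x y z + cyc f2 x y z + cyc f3 x y z = 0" by (simp only: cyc_add)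
  have sum: "(\<Sum>y\<in>{y. bij y}. kappaLref a a' b b' (g \<circ> inv' y) (u + doubled_perm y u) (kappaLref a a' b b' y v w))
     = f1 u v w *s u_ref a a' b b' (tr p q) + f2 u v w *s u_ref a a' b b' (tr q t) + f3 u v w *s u_ref a a' b b' (tr t p)" for u v w
    unfolding f1_def f2_def f3_def AB by (rule lin_ref.pair_sum_3cycle[OF d g])
  have ne: "p \<noteq> q" "q \<noteq> t" "t \<noteq> p" using d by auto
  have inj: "bij g" unfolding g by (simp add: bij_comp)
  show ?X
  proof (cases "l = t")
    case True
    have n: "doubled_perm g u $ Inl t = u $ Inl q" for u
      using doubled_perm_nth(1)[OF inj, of u q] tr_comp_values(2)[OF d] g by simp
    have "cyc (\<lambda>u v w. \<Sum>y\<in>{y. bij y}. kappaLref a a' b b' (g \<circ> inv' y) (u + doubled_perm y u) (kappaLref a a' b b' y v w)) x y z $ Inl l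
       = cyc (\<lambda>u v w. a * (f1 u v w + f2 u v w + f3 u v w) + A * f1 u v w) x y z"
      unfolding sum cyc_nth True
      by (simp add: u_ref_nth ne ne[symmetric] AB algebra_simps)
    also have "\<dots> = A * cyc f1 x y z" by (simp only: cyc_add cyc_mult const') simp
    also have "\<dots> = 2 * cyc (\<lambda>u v w. tri_form A B p q t v w * (u $ Inl q - u $ Inl t)) x y z"
      unfolding f1_def by (rule cyc3_identity_x)
    finally show ?thesis
      unfolding kappaC3cyc_eq_tri_form[OF d g] AB[symmetric] True by (simp add: n)
  next
    case False
    have n: "doubled_perm g u $ Inl l = u $ Inl l" for u
      using doubled_perm_nth(1)[OF inj, of u l] tr_comp_values(4)[OF d, of l] g l False by simp
    have "cyc (\<lambda>u v w. \<Sum>y\<in>{y. bij y}. kappaLref a a' b b' (g \<circ> inv' y) (u + doubled_perm y u) (kappaLref a a' b b' y v w)) x y z $ Inl l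
       = cyc (\<lambda>u v w. a' * (f1 u v w + f2 u v w + f3 u v w)) x y z"
      unfolding sum cyc_nth by (simp add: u_ref_nth ne l False algebra_simps)
    also have "\<dots> = 0" by (simp only: cyc_mult const mult_zero_right)
    finally show ?thesis by (simp add: n cyc_def)
  qed
  show ?Y
  proof (cases "l = t")
    case True
    have n: "doubled_perm g u $ Inr t = u $ Inr q" for u
      using doubled_perm_nth(2)[OF inj, of u q] tr_comp_values(2)[OF d] g by simp
    have "cyc (\<lambda>u v w. \<Sum>y\<in>{y. bij y}. kappaLref a a' b b' (g \<circ> inv' y) (u + doubled_perm y u) (kappaLref a a' b b' y v w)) x y z $ Inr l
       = cyc (\<lambda>u v w. b * (f1 u v w + f2 u v w + f3 u v w) + B * f1 u v w) x y z"
      unfolding sum cyc_nth True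
      by (simp add: u_ref_nth ne ne[symmetric] AB algebra_simps)
    also have "\<dots> = B * cyc f1 x y z" by (simp only: cyc_add cyc_mult const') simp
    also have "\<dots> = 2 * cyc (\<lambda>u v w. tri_form A B p q t v w * (u $ Inr q - u $ Inr t)) x y z"
      unfolding f1_def by (rule cyc3_identity_y)
    finally show ?thesis
      unfolding kappaC3cyc_eq_tri_form[OF d g] AB[symmetric] True by (simp add: n)
  next
    case False
    have n: "doubled_perm g u $ Inr l = u $ Inr l" for u
      using doubled_perm_nth(2)[OF inj, of u l] tr_comp_values(4)[OF d, of l] g l False by simp
    have "cyc (\<lambda>u v w. \<Sum>y\<in>{y. bij y}. kappaLref a a' b b' (g \<circ> inv' y) (u + doubled_perm y u) (kappaLref a a' b b' y v w)) x y z $ Inr l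
       = cyc (\<lambda>u v w. b' * (f1 u v w + f2 u v w + f3 u v w)) x y z"
      unfolding sum cyc_nth by (simp add: u_ref_nth ne l False algebra_simps)
    also have "\<dots> = 0" by (simp only: cyc_mult const mult_zero_right)
    finally show ?thesis by (simp add: n cyc_def)
  qed
qed

text \<open>
  For a 3-cycle \<open>(p q t)\<close>, every coordinate is covered by one of the three rotations of \<open>p\<close>, \<open>q\<close>, \<open>t\<close>.
\<close>

lemma kappaLref_quadratic:
  fixes g :: "'n::finite \<Rightarrow> 'n"
  shows "cyc (\<lambda>u v w. \<Sum>y\<in>{y. bij y}. kappaLref a a' b b' (g \<circ> inv' y) (u + doubled_perm y u) (kappaLref a a' b b' y v w)) x y z
      = 2 *s cyc (\<lambda>x y z. kappaC3cyc a a' b b' g y z *s (doubled_perm g x - x)) x y z"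
proof (cases "is_3cycle g")
  case True
  then obtain p q t where d: "distinct [p, q, t]" and g: "g = tr p q \<circ> tr q t"
    unfolding is_3cycle_iff by blast
  have d2: "distinct [q, t, p]" and d3: "distinct [t, p, q]" using d by auto
  have g2: "g = tr q t \<circ> tr t p" and g3: "g = tr t p \<circ> tr p q"
    using g tr_comp_rotate[OF d] tr_comp_rotate[OF d2] by simp_all
  show ?thesis
  proof (rule vec_eqI_sum)
    fix l
    consider "l \<noteq> p" "l \<noteq> q" | "l \<noteq> q" "l \<noteq> t" | "l \<noteq> t" "l \<noteq> p" using d by auto
    note cases = this
    have s: "(2 *s cyc (\<lambda>x y z. kappaC3cyc a a' b b' g y z *s (doubled_perm g x - x)) x y z) $ m
       = 2 * cyc (\<lambda>x y z. kappaC3cyc a a' b b' g y z * (doubled_perm g x - x) $ m) x y z" for m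
      by (simp only: vector_smult_component cyc_nth)
    show "cyc (\<lambda>u v w. \<Sum>y\<in>{y. bij y}. kappaLref a a' b b' (g \<circ> inv' y) (u + doubled_perm y u) (kappaLref a a' b b' y v w)) x y z $ Inl l
      = (2 *s cyc (\<lambda>x y z. kappaC3cyc a a' b b' g y z *s (doubled_perm g x - x)) x y z) $ Inl l"
      unfolding s
      by (rule cases) (rule pair_sum_coordinate(1)[OF d g] pair_sum_coordinate(1)[OF d2 g2] pair_sum_coordinate(1)[OF d3 g3]; assumption)+
    show "cyc (\<lambda>u v w. \<Sum>y\<in>{y. bij y}. kappaLref a a' b b' (g \<circ> inv' y) (u + doubled_perm y u) (kappaLref a a' b b' y v w)) x y z $ Inr l
      = (2 *s cyc (\<lambda>x y z. kappaC3cyc a a' b b' g y z *s (doubled_perm g x - x)) x y z) $ Inr l"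
      unfolding s
      by (rule cases) (rule pair_sum_coordinate(2)[OF d g] pair_sum_coordinate(2)[OF d2 g2] pair_sum_coordinate(2)[OF d3 g3]; assumption)+
  qed
next
  case False
  then show ?thesis
    by (simp add: lin_ref.pair_sum_not_3cycle) (simp add: kappaC3cyc_def cyc_def)
qed

lemma kappaCref_quadratic:
  fixes g :: "'n::finite \<Rightarrow> 'n"
  shows "cyc (\<lambda>u v w. \<Sum>y\<in>{y. bij y}. kappaCref c (g \<circ> inv' y) (u + doubled_perm y u) (kappaLref a a' b b' y v w)) x y z = 0"
proof (cases "is_3cycle g")
  case True
  then obtain p q t where d: "distinct [p, q, t]" and g: "g = tr p q \<circ> tr q t"
    unfolding is_3cycle_iff by blast
  show ?thesis
    unfolding const_ref.pair_sum_3cycle[OF d g] distrib_left[symmetric] cyc_mult cyc3_identity_const by simp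
next
  case False
  then show ?thesis by (simp add: const_ref.pair_sum_not_3cycle cyc_def)
qed

section \<open>The linear part off the identity\<close>

lemma lookup_tens_emb_mult:
  "Poly_Mapping.lookup (tens_emb u * tens_emb v) (Word [p, q]) = u $ p * v $ q"
proof -
  have w: "Word [b] + Word [c] = Word [b, c]" for b c :: 'b by (simp add: plus_free_mon_def)
  have "Poly_Mapping.lookup (tens_emb u * tens_emb v) (Word [p, q])
      = (\<Sum>b\<in>UNIV. \<Sum>c\<in>UNIV. if b = p then if c = q then u $ b * v $ c else 0 else 0)"
    unfolding tens_emb_def sum_product lookup_sum mult_single w lookup_single
    by (intro sum.cong refl) (auto simp: when_def)
  also have "\<dots> = u $ p * v $ q" by (simp add: sum_if_const)
  finally show ?thesis .
qed

lemma surj_map_sum: "surj f \<Longrightarrow> surj g \<Longrightarrow> surj (map_sum f g)"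
  by (auto simp: surj_def split: sum.split) (metis map_sum.simps sum.exhaust)

text \<open>
  The standard Hermitian product is invariant under \<open>g\<close>, so a fixed vector is orthogonal to all
  vectors of the form \<open>\<^sup>gX - X\<close>. If \<open>\<^sup>gX - X\<close> is itself fixed, it is orthogonal to itself.
\<close>

lemma cyclic_image_invariant_zero:
  fixes X :: "complex ^ ('n::finite + 'n)"
  assumes g: "bij g" and w: "doubled_perm g (doubled_perm g X - X) = doubled_perm g X - X"
  shows "doubled_perm g X = X"
proof -
  define w where "w = doubled_perm g X - X"
  have n: "doubled_perm g v $ map_sum g g m = v $ m" for v :: "complex ^ ('n + 'n)" and m
    by (cases m) (simp_all add: doubled_perm_nth[OF g])
  have bij: "bij (map_sum g g)" using g by (simp add: bij_def sum.inj_map surj_map_sum)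
  have inv: "w $ map_sum g g m = w $ m" for m using n[of w m] assms(2) by (simp add: w_def)
  have "(\<Sum>m\<in>UNIV. cnj (w $ m) * w $ m) = (\<Sum>m\<in>UNIV. cnj (w $ map_sum g g m) * w $ map_sum g g m)"
    by (simp add: inv)
  also have "\<dots> = (\<Sum>m\<in>UNIV. cnj (w $ m) * X $ m - cnj (w $ map_sum g g m) * X $ map_sum g g m)"
  proof (rule sum.cong)
    fix m
    have "w $ map_sum g g m = X $ m - X $ map_sum g g m" by (simp add: w_def n)
    then show "cnj (w $ map_sum g g m) * w $ map_sum g g m = cnj (w $ m) * X $ m - cnj (w $ map_sum g g m) * X $ map_sum g g m"
      using inv[of m] by (metis right_diff_distrib)
  qed simp
  also have "\<dots> = 0"
    using sum.reindex_bij_betw[OF bij, of "\<lambda>m. cnj (w $ m) * X $ m"] by (simp add: sum_subtractf)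
  finally have "(\<Sum>m\<in>UNIV. of_real ((cmod (w $ m))\<^sup>2) :: complex) = 0"
    by (simp only: complex_norm_square mult.commute)
  then have "(\<Sum>m\<in>UNIV. (cmod (w $ m))\<^sup>2) = 0" by (simp only: of_real_sum[symmetric] of_real_eq_0_iff)
  then have "w $ m = 0" for m by (subst (asm) sum_nonneg_eq_0_iff) auto
  then show ?thesis by (simp add: w_def vec_eq_iff)
qed

text \<open>
  Let \<open>T p q\<close> be the cyclic sum of the products of coordinate \<open>p\<close> of \<open>B(y,z)\<close> and coordinate \<open>q\<close> of
  \<open>\<^sup>gx - x\<close>. Condition (ii) makes \<open>T\<close> antisymmetric, and (0) makes it invariant under \<open>g\<close> in the first
  argument, hence in the second. So for fixed \<open>p\<close> it is a \<open>g\<close>-invariant vector of the form \<open>\<^sup>gX - X\<close>.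
\<close>

lemma symmetric_condition_coordinates:
  fixes g :: "'n::finite \<Rightarrow> 'n"
  assumes g: "bij g" and fxd: "\<And>u v. doubled_perm g (B u v) = B u v"
    and sym: "cyc (\<lambda>x y z. sym_emb (B y z) * sym_emb (doubled_perm g x - x)) x y z = 0"
  shows "cyc (\<lambda>x y z. B y z $ m *s (doubled_perm g x - x)) x y z = 0"
proof -
  define T where "T p q = cyc (\<lambda>x y z. B y z $ p * (doubled_perm g x - x) $ q) x y z" for p q
  obtain S :: "('n + 'n) sym_alg \<Rightarrow> ('n + 'n) tensor_alg" where S: "S 0 = 0" "\<And>p q. S (p + q) = S p + S q"
    "\<And>u v. S (sym_emb u * sym_emb v) = tens_emb u * tens_emb v + tens_emb v * tens_emb u"
    using symmetric_square_embedding by metis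
  have anti: "T p q + T q p = 0" for p q
  proof -
    have "0 = Poly_Mapping.lookup (S (cyc (\<lambda>x y z. sym_emb (B y z) * sym_emb (doubled_perm g x - x)) x y z)) (Word [p, q])"
      by (simp only: sym S(1) lookup_zero)
    also have "\<dots> = T p q + T q p"
      unfolding cyc_def S(2,3) lookup_add lookup_tens_emb_mult T_def by (simp add: algebra_simps)
    finally show ?thesis by simp
  qed
  have n: "doubled_perm g v $ map_sum g g m = v $ m" for v :: "complex ^ ('n + 'n)" and m
    by (cases m) (simp_all add: doubled_perm_nth[OF g])
  have "B u v $ map_sum g g p = B u v $ p" for u v p using n[of "B u v" p] fxd[of u v] by simp
  then have left: "T (map_sum g g p) q = T p q" for p q by (simp add: T_def cyc_def)
  have right: "T p (map_sum g g q) = T p q" for p q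
    using anti[of p q] anti[of p "map_sum g g q"] left[of q p] by (simp add: add_eq_0_iff2)
  define X where "X = cyc (\<lambda>x y z. B y z $ m *s x) x y z"
  have X: "cyc (\<lambda>x y z. B y z $ m *s (doubled_perm g x - x)) x y z = doubled_perm g X - X"
    by (simp add: X_def cyc_def doubled_perm_simps vec.scale_right_diff_distrib)
  have T: "(doubled_perm g X - X) $ q = T m q" for q
    unfolding X[symmetric] T_def by (simp add: cyc_nth)
  have "doubled_perm g (doubled_perm g X - X) = doubled_perm g X - X"
  proof -
    have "doubled_perm g (doubled_perm g X - X) $ map_sum g g q = (doubled_perm g X - X) $ map_sum g g q" for q
      unfolding n T right ..
    moreover have "\<exists>q. m = map_sum g g q" for m
      using g by (metis bij_is_surj surj_map_sum surjD)
    ultimately show ?thesis unfolding vec_eq_iff by metis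
  qed
  from cyclic_image_invariant_zero[OF g this] show ?thesis unfolding X by simp
qed

text \<open>
  Each coordinate of \<open>B\<close> solves the homogeneous equation.
\<close>

lemma linear_part_off_identity:
  fixes g :: "'n::finite \<Rightarrow> 'n"
  assumes B: "skew_bilinear (*s) B" and g: "bij g" "g \<noteq> id"
    and fxd: "\<And>u v. doubled_perm g (B u v) = B u v"
    and sym: "\<And>x y z. cyc (\<lambda>x y z. sym_emb (B y z) * sym_emb (doubled_perm g x - x)) x y z = 0"
  shows "\<not> is_transposition g \<Longrightarrow> B = (\<lambda>u v. 0)"
    and "r \<noteq> s \<Longrightarrow> g = tr r s \<Longrightarrow> B = (\<lambda>u v. omega r s u v *s B (xv r) (yv r))"
proof -
  have "skew_bilinear (*) (\<lambda>u v. B u v $ m)" for m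
    unfolding skew_bilinear_iff
  proof (intro conjI allI)
    fix u v show "B u v $ m = - (B v u $ m)" by (subst skew_bilinearD(6)[OF B]) simp
  qed (simp_all add: vector_space_complex skew_bilinearD(2-5)[OF B])
  then have "\<exists>c. (\<lambda>u v. B u v $ m) = kappaCref c g" for m
    by (rule homogeneous_imp_kappaCref[OF _ g symmetric_condition_coordinates[of g B, OF g(1) fxd sym]])
  then have ex: "\<exists>c. \<forall>u v. B u v $ m = kappaCref c g u v" for m by (metis (mono_tags))
  show "B = (\<lambda>u v. 0)" if "\<not> is_transposition g"
    using ex that by (intro ext) (simp add: kappaCref_def vec_eq_iff)
  show "B = (\<lambda>u v. omega r s u v *s B (xv r) (yv r))" if rs: "r \<noteq> s" "g = tr r s"
  proof (intro ext)
    fix u v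
    have "B u v $ m = (omega r s u v *s B (xv r) (yv r)) $ m" for m
    proof -
      obtain c where c: "\<And>u v. B u v $ m = c * omega r s u v"
        using ex[of m] unfolding rs(2) kappaCref_transpose[OF rs(1)] by blast
      show ?thesis using rs(1) by (simp add: c omega_basis)
    qed
    then show "B u v = omega r s u v *s B (xv r) (yv r)" by (simp add: vec_eq_iff)
  qed
qed

section \<open>Drinfeld orbifold algebra maps supported off the identity\<close>

lemma bij_tr: "bij (tr r s)"
  by simp

lemma conj_3cycle:
  assumes "bij h"
  shows "h \<circ> (tr p q \<circ> tr q t) \<circ> inv' h = tr (h p) (h q) \<circ> tr (h q) (h t)"
proof -
  have "h \<circ> (tr p q \<circ> tr q t) \<circ> inv' h = (h \<circ> tr p q \<circ> inv' h) \<circ> (h \<circ> tr q t \<circ> inv' h)"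
    using assms by (simp add: fun_eq_iff bij_is_inj)
  then show ?thesis by (simp only: conj_transpose[OF assms])
qed

lemma is_3cycle_conj:
  fixes g h :: "'a \<Rightarrow> 'a"
  assumes h: "bij h"
  shows "is_3cycle (h \<circ> g \<circ> inv' h) \<longleftrightarrow> is_3cycle g"
proof -
  have "is_3cycle (h \<circ> g \<circ> inv' h)" if h: "bij h" and g: "is_3cycle g" for g h :: "'a \<Rightarrow> 'a"
  proof -
    obtain p q t where g: "distinct [p, q, t]" "g = tr p q \<circ> tr q t" using g unfolding is_3cycle_iff by blast
    have "distinct [h p, h q, h t]" using g(1) h by (simp add: bij_is_inj inj_eq)
    then show ?thesis unfolding is_3cycle_iff g(2) conj_3cycle[OF h] by blast
  qed
  from conj_closed_iff[of is_3cycle, OF this h] show ?thesis .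
qed

lemma not_3cycle_id [simp]: "\<not> is_3cycle id"
  unfolding is_3cycle_iff by (metis distinct_length_2_or_more id_apply tr_comp_values(1))

lemma bij_if_3cycle: "is_3cycle g \<Longrightarrow> bij g"
  unfolding is_3cycle_iff by (auto simp: bij_comp)

lemma kappaC3cyc_skew: "skew_bilinear (*) (kappaC3cyc a a' b b' g)"
proof (cases "is_3cycle g")
  case True
  then obtain p q t where "distinct [p, q, t]" "g = tr p q \<circ> tr q t" unfolding is_3cycle_iff by blast
  then show ?thesis by (simp only: kappaC3cyc_eq_tri_form tri_form_skew)
qed (simp add: kappaC3cyc_def skew_bilinear_iff vector_space_complex)

lemma kappaC3cyc_invariant:
  assumes h: "bij h"
  shows "kappaC3cyc a a' b b' g u v = kappaC3cyc a a' b b' (h \<circ> g \<circ> inv' h) (doubled_perm h u) (doubled_perm h v)"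
proof (cases "is_3cycle g")
  case True
  then obtain p q t where g: "distinct [p, q, t]" "g = tr p q \<circ> tr q t" unfolding is_3cycle_iff by blast
  have hg: "distinct [h p, h q, h t]" "h \<circ> g \<circ> inv' h = tr (h p) (h q) \<circ> tr (h q) (h t)"
    using g h by (simp_all only: conj_3cycle) (simp add: bij_is_inj inj_eq)
  have "tri A B (h i) (doubled_perm h u) = tri A B i u" for A B i u
    by (simp add: tri_def doubled_perm_nth[OF h])
  then show ?thesis
    unfolding kappaC3cyc_eq_tri_form[OF g] kappaC3cyc_eq_tri_form[OF hg] by (simp add: tri_form_def)
next
  case False
  then show ?thesis by (simp add: kappaC3cyc_def is_3cycle_conj[OF h])
qed

lemma u_ref_equivariant:
  assumes h: "bij h" and rs: "r \<noteq> s"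
  shows "doubled_perm h (u_ref a a' b b' (tr r s)) = u_ref a a' b b' (tr (h r) (h s))"
proof -
  have "h r \<noteq> h s" using h rs by (simp add: bij_is_inj inj_eq)
  then show ?thesis
    unfolding u_ref_def doubled_perm_simps doubled_perm_xsum_ysum[OF h] moved_transpose[OF rs]
    using h by (simp add: moved_transpose bij_is_surj)
qed

lemma kappaLref_skew: "skew_bilinear (*s) (kappaLref a a' b b' g)"
proof (cases "is_transposition g")
  case True
  then obtain r s where "r \<noteq> s" "g = tr r s" unfolding is_transposition_def by blast
  then show ?thesis using skew_bilinear_omega_vec by (simp add: kappaLref_transpose)
qed (simp add: kappaLref_def skew_bilinear_iff vector_space_vec)

lemma kappaLref_equivariant:
  assumes h: "bij h"
  shows "doubled_perm h (kappaLref a a' b b' g u v)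
    = kappaLref a a' b b' (h \<circ> g \<circ> inv' h) (doubled_perm h u) (doubled_perm h v)"
proof (cases "is_transposition g")
  case True
  then obtain r s where g: "r \<noteq> s" "g = tr r s" unfolding is_transposition_def by blast
  have "h r \<noteq> h s" using h g(1) by (simp add: bij_is_inj inj_eq)
  then show ?thesis
    unfolding g(2) conj_transpose[OF h] kappaLref_transpose[OF g(1)]
    by (simp add: kappaLref_transpose doubled_perm_simps u_ref_equivariant[OF h g(1)] omega_invariant[OF h])
next
  case False
  then show ?thesis by (simp add: kappaLref_def is_transposition_conj[OF h] doubled_perm_simps)
qed

lemma kappaLref_fixed: "doubled_perm g (kappaLref a a' b b' g u v) = kappaLref a a' b b' g u v"
proof (cases "is_transposition g")
  case True
  then obtain r s where g: "r \<noteq> s" "g = tr r s" unfolding is_transposition_def by blast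
  have "doubled_perm (tr r s) (u_ref a a' b b' (tr r s)) = u_ref a a' b b' (tr r s)"
    using u_ref_equivariant[OF bij_tr g(1), of r s] by (simp add: transpose_commute)
  then show ?thesis by (simp add: g kappaLref_transpose doubled_perm_simps)
qed (simp add: kappaLref_def doubled_perm_simps)

lemma kappaLref_symmetric_condition:
  "cyc (\<lambda>x y z. sym_emb (kappaLref a a' b b' g y z) * sym_emb (doubled_perm g x - x)) x y z = 0"
proof (cases "is_transposition g")
  case True
  then obtain r s where g: "r \<noteq> s" "g = tr r s" unfolding is_transposition_def by blast
  have "cyc (\<lambda>x y z. sym_emb (kappaLref a a' b b' g y z) * sym_emb (doubled_perm g x - x)) x y z
     = sym_emb (u_ref a a' b b' g) * sym_emb (cyc (\<lambda>x y z. omega r s y z *s (doubled_perm g x - x)) x y z)"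
    unfolding cyc_def g(2) kappaLref_transpose[OF g(1)]
    by (simp only: sym_emb_linear distrib_left mult_ac)
  then show ?thesis by (simp only: g(2) omega_homogeneous[OF g(1)] sym_emb_linear mult_zero_right)
qed (simp add: kappaLref_def cyc_def)

text \<open>
  The contribution of \<open>kappaCref\<close> has cyclic sum 0, that of \<open>kappaC3cyc\<close> vanishes term by term, and
  \<open>kappaC1\<close> contributes only for \<open>y = g\<close>.
\<close>

lemma constant_condition_reduction:
  fixes g :: "'n::finite \<Rightarrow> 'n"
  assumes g: "bij g"
  shows "cyc (\<lambda>u v w. \<Sum>y\<in>{y. bij y}.
        kappaC1 \<alpha> \<beta> (g \<circ> inv' y) (u + doubled_perm y u) (kappaLref a a' b b' y v w)
      + kappaCref c (g \<circ> inv' y) (u + doubled_perm y u) (kappaLref a a' b b' y v w)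
      + kappaC3cyc a a' b b' (g \<circ> inv' y) (u + doubled_perm y u) (kappaLref a a' b b' y v w)) x y z
    = cyc (\<lambda>u v w. kappaC1 \<alpha> \<beta> id (u + doubled_perm g u) (kappaLref a a' b b' g v w)) x y z"
proof -
  have eq: "g \<circ> inv' y = id \<longleftrightarrow> y = g" if "bij y" for y
    using that g by (metis bij_betw_def comp_id inj_iff o_assoc surj_iff id_comp)
  have "(\<Sum>y\<in>{y. bij y}. kappaC1 \<alpha> \<beta> (g \<circ> inv' y) (u + doubled_perm y u) (kappaLref a a' b b' y v w))
      = (\<Sum>y\<in>{g}. kappaC1 \<alpha> \<beta> (g \<circ> inv' y) (u + doubled_perm y u) (kappaLref a a' b b' y v w))" for u v w
    by (rule sum.mono_neutral_right) (use g eq in \<open>auto simp: kappaC1_def\<close>)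
  moreover have "g \<circ> inv' g = id" using eq[OF g] by simp
  ultimately have 1: "(\<Sum>y\<in>{y. bij y}. kappaC1 \<alpha> \<beta> (g \<circ> inv' y) (u + doubled_perm y u) (kappaLref a a' b b' y v w))
      = kappaC1 \<alpha> \<beta> id (u + doubled_perm g u) (kappaLref a a' b b' g v w)" for u v w
    by simp
  show ?thesis
    unfolding kappaC3cyc_u_ref add_0_right sum.distrib 1 cyc_add kappaCref_quadratic ..
qed

lemma sum_u_ref:
  fixes r s :: "'n::finite"
  assumes "r \<noteq> s"
  shows "sX (u_ref a a' b b' (tr r s)) = 2 * a + (of_nat CARD('n) - 2) * a'"
    "sY (u_ref a a' b b' (tr r s)) = 2 * b + (of_nat CARD('n) - 2) * b'"
proof -
  have "(\<Sum>i\<in>UNIV. if i = r \<or> i = s then x else x') = 2 * x + (of_nat CARD('n) - 2) * x'" for x x' :: complex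
  proof -
    have "(\<Sum>i\<in>UNIV. if i = r \<or> i = s then x else x') = (\<Sum>i\<in>UNIV. x' + (x - x') * kd i r + (x - x') * kd i s)"
      by (rule sum.cong) (use assms in \<open>auto simp: kd_def\<close>)
    also have "\<dots> = 2 * x + (of_nat CARD('n) - 2) * x'"
      by (simp only: sum.distrib sum_distrib_left[symmetric] sum_kd) (simp add: algebra_simps)
    finally show ?thesis .
  qed
  then show "sX (u_ref a a' b b' (tr r s)) = 2 * a + (of_nat CARD('n) - 2) * a'"
    "sY (u_ref a a' b b' (tr r s)) = 2 * b + (of_nat CARD('n) - 2) * b'"
    by (simp_all add: sX_def sY_def u_ref_nth[OF assms])
qed

definition off_equations :: "complex \<Rightarrow> complex \<Rightarrow> complex \<Rightarrow> complex \<Rightarrow> complex \<Rightarrow> complex \<Rightarrow> complex \<Rightarrow> bool" where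
  "off_equations n a a' b b' \<alpha> \<beta> \<longleftrightarrow>
     \<alpha> * a + \<beta> * (a + (n - 2) * a') = 0 \<and> \<alpha> * a' + \<beta> * (2 * a + (n - 3) * a') = 0 \<and>
     \<alpha> * b + \<beta> * (b + (n - 2) * b') = 0 \<and> \<alpha> * b' + \<beta> * (2 * b + (n - 3) * b') = 0"

text \<open>
  With \<open>\<phi>\<close> the linear form \<open>u \<mapsto> kappaC1(u + \<^sup>gu, u_ref g)\<close> the condition at \<open>g = (r s)\<close> is that the
  cyclic sum of \<open>omega r s v w * \<phi> u\<close> vanishes. On \<open>(u, x\<^sub>r, y\<^sub>r)\<close>, where \<open>u\<close> is a basis vector with
  index \<open>s\<close> or with an index other than \<open>r\<close> and \<open>s\<close>, it is determined by the values of \<open>\<phi>\<close> on basis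
  vectors, and these are, up to factors, the left-hand sides of the four equations.
\<close>

lemma constant_condition_iff:
  assumes n: "CARD('n::finite) \<ge> 3"
  shows "(\<forall>g :: 'n \<Rightarrow> 'n. bij g \<longrightarrow> (\<forall>x y z.
      cyc (\<lambda>u v w. kappaC1 \<alpha> \<beta> id (u + doubled_perm g u) (kappaLref a a' b b' g v w)) x y z = 0))
    \<longleftrightarrow> off_equations (of_nat CARD('n)) a a' b b' \<alpha> \<beta>" (is "?C \<longleftrightarrow> ?E")
proof -
  let ?n = "of_nat CARD('n) :: complex"
  define e1 e2 e3 e4 where e: "e1 = \<alpha> * a + \<beta> * (a + (?n - 2) * a')" "e2 = \<alpha> * a' + \<beta> * (2 * a + (?n - 3) * a')"
    "e3 = \<alpha> * b + \<beta> * (b + (?n - 2) * b')" "e4 = \<alpha> * b' + \<beta> * (2 * b + (?n - 3) * b')"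
  have E: "?E \<longleftrightarrow> e1 = 0 \<and> e2 = 0 \<and> e3 = 0 \<and> e4 = 0" by (simp add: off_equations_def e)
  define \<phi> where "\<phi> r s u = kappaC1 \<alpha> \<beta> id (u + doubled_perm (tr r s) u) (u_ref a a' b b' (tr r s))" for r s :: 'n and u
  have add: "\<phi> r s (u + v) = \<phi> r s u + \<phi> r s v" and scale: "\<phi> r s (k *s u) = k * \<phi> r s u" for r s u v k
    unfolding \<phi>_def doubled_perm_simps
    by (simp_all add: skew_bilinearD(2,3)[OF kappaC1_skew] distrib_left)
  have val: "\<phi> r s (xv i) = (if i \<in> {r, s} then 2 * e3 else 2 * e4)"
    "\<phi> r s (yv i) = - (if i \<in> {r, s} then 2 * e1 else 2 * e2)"
    if "r \<noteq> s" for r s i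
  proof -
    have l: "kappaC1 \<alpha> \<beta> id (xv i) (u_ref a a' b b' (tr r s)) = (if i \<in> {r, s} then e3 else e4)"
      "kappaC1 \<alpha> \<beta> id (yv i) (u_ref a a' b b' (tr r s)) = - (if i \<in> {r, s} then e1 else e2)" for i
      by (simp_all add: kappaC1_left sum_u_ref[OF that] u_ref_nth[OF that] e algebra_simps)
    have "tr r s i \<in> {r, s} \<longleftrightarrow> i \<in> {r, s}" by (auto simp: Transposition.transpose_def)
    then show "\<phi> r s (xv i) = (if i \<in> {r, s} then 2 * e3 else 2 * e4)"
      "\<phi> r s (yv i) = - (if i \<in> {r, s} then 2 * e1 else 2 * e2)"
      unfolding \<phi>_def by (simp_all only: doubled_perm_basis skew_bilinearD(2)[OF kappaC1_skew] l) (simp_all split: if_split)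
  qed
  have summand: "cyc (\<lambda>u v w. kappaC1 \<alpha> \<beta> id (u + doubled_perm (tr r s) u) (kappaLref a a' b b' (tr r s) v w)) x y z
     = cyc (\<lambda>u v w. omega r s v w * \<phi> r s u) x y z" if "r \<noteq> s" for r s :: 'n and x y z
    unfolding kappaLref_transpose[OF that] \<phi>_def by (simp only: skew_bilinearD(5)[OF kappaC1_skew])
  show ?thesis
  proof
    assume C: ?C
    obtain r s t :: 'n where "distinct [r, s, t]" using ex_three_distinct[OF n] .
    then have ne: "r \<noteq> s" "s \<noteq> t" "r \<noteq> t" "s \<noteq> r" "t \<noteq> s" "t \<noteq> r" by auto
    have "cyc (\<lambda>u v w. omega r s v w * \<phi> r s u) x y z = 0" for x y z
      unfolding summand[OF ne(1), symmetric] using C bij_tr[of r s] by blast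
    from this[of "xv t" "xv r" "yv r"] this[of "yv t" "xv r" "yv r"] this[of "xv s" "xv r" "yv r"] this[of "yv s" "xv r" "yv r"]
    have "\<phi> r s (xv t) = 0" "\<phi> r s (yv t) = 0" "\<phi> r s (xv s) + \<phi> r s (xv r) = 0" "\<phi> r s (yv s) + \<phi> r s (yv r) = 0"
      by (simp_all add: cyc_def omega_def ne)
    then show ?E unfolding E by (simp add: val ne)
  next
    assume ?E
    have "\<phi> r s u = 0" if "r \<noteq> s" for r s :: 'n and u
      by (rule linear_zero_on_basis[of "\<phi> r s" "(*)"])
         (use \<open>?E\<close> E in \<open>simp_all add: add scale val[OF that]\<close>)
    then have moves: "cyc (\<lambda>u v w. kappaC1 \<alpha> \<beta> id (u + doubled_perm (tr r s) u) (kappaLref a a' b b' (tr r s) v w)) x y z = 0"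
      if "r \<noteq> s" for r s :: 'n and x y z
      unfolding summand[OF that] using that by (simp add: cyc_def)
    show ?C
    proof (intro allI impI)
      fix g :: "'n \<Rightarrow> 'n" and x y z
      show "cyc (\<lambda>u v w. kappaC1 \<alpha> \<beta> id (u + doubled_perm g u) (kappaLref a a' b b' g v w)) x y z = 0"
      proof (cases "is_transposition g")
        case True
        then show ?thesis using moves unfolding is_transposition_def by blast
      next
        case False
        then show ?thesis by (simp add: kappaLref_def cyc_def skew_zero(1)[OF kappaC1_skew])
      qed
    qed
  qed
qed

text \<open>
  The vectors \<open>U r s\<close> that describe the components at the transpositions form an invariant family,
  symmetric in \<open>r\<close> and \<open>s\<close>. Hence a coordinate \<open>l\<close> of \<open>U r s\<close> depends only on whether \<open>l\<close> is one of \<open>r\<close>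
  and \<open>s\<close>.
\<close>

lemma linear_part_kappaLref:
  fixes \<kappa>L :: "('n::finite \<Rightarrow> 'n, 'n + 'n) lin_cochain"
  assumes n: "CARD('n) \<ge> 3"
    and eqv: "\<And>g h u v. bij g \<Longrightarrow> bij h \<Longrightarrow> doubled_perm h (\<kappa>L g u v) = \<kappa>L (h \<circ> g \<circ> inv' h) (doubled_perm h u) (doubled_perm h v)"
    and tr: "\<And>r s. r \<noteq> s \<Longrightarrow> \<kappa>L (tr r s) = (\<lambda>u v. omega r s u v *s \<kappa>L (tr r s) (xv r) (yv r))"
    and other: "\<And>g. \<not> is_transposition g \<Longrightarrow> \<kappa>L g = (\<lambda>u v. 0)"
  shows "\<exists>a a' b b'. \<kappa>L = kappaLref a a' b b'"
proof -
  define U where "U r s = (if r = s then 0 else \<kappa>L (tr r s) (xv r) (yv r))" for r s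
  have U: "doubled_perm h (U r s) = U (h r) (h s)" if "bij h" for h r s
    using eqv[OF bij_tr that, of r s "xv r" "yv r"] that
    by (auto simp: U_def conj_transpose doubled_perm_basis bij_is_inj inj_eq doubled_perm_simps)
  have sym: "U r s = U s r" for r s
  proof (cases "r = s")
    case False
    have "\<kappa>L (tr r s) (xv s) (yv s) = \<kappa>L (tr r s) (xv r) (yv r)"
      using False by (subst tr[OF False]) (simp add: omega_basis)
    then show ?thesis using False by (simp add: U_def transpose_commute)
  qed simp
  have shape: "\<exists>x x'. \<forall>r s l. r \<noteq> s \<longrightarrow> f r s l = (if l = r \<or> l = s then x else x')"
    if f: "\<And>h r s l. bij h \<Longrightarrow> f (h r) (h s) (h l) = f r s l" and s: "\<And>r s l. f r s l = f s r l"
    for f :: "'n \<Rightarrow> 'n \<Rightarrow> 'n \<Rightarrow> complex"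
  proof -
    obtain p q r s t where *: "f i j l = (if i = j then if l = i then s else t
           else if l = i then p else if l = j then q else r)" for i j l
      using invariant_three[of f, OF n f] by blast
    have "f i j l = (if l = i \<or> l = j then p else r)" if "i \<noteq> j" for i j l
      using *[of i j l] *[of j i l] s[of i j l] that by auto
    then show ?thesis by blast
  qed
  obtain a a' where a: "\<And>r s l. r \<noteq> s \<Longrightarrow> U r s $ Inl l = (if l = r \<or> l = s then a else a')"
    using shape[of "\<lambda>r s l. U r s $ Inl l"] sym U by (metis doubled_perm_nth(1))
  obtain b b' where b: "\<And>r s l. r \<noteq> s \<Longrightarrow> U r s $ Inr l = (if l = r \<or> l = s then b else b')"
    using shape[of "\<lambda>r s l. U r s $ Inr l"] sym U by (metis doubled_perm_nth(2))
  have "\<kappa>L g = kappaLref a a' b b' g" for g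
  proof (cases "is_transposition g")
    case True
    then obtain r s where g: "r \<noteq> s" "g = tr r s" unfolding is_transposition_def by blast
    have "U r s = u_ref a a' b b' (tr r s)"
      by (rule vec_eqI_sum) (simp_all add: a[OF g(1)] b[OF g(1)] u_ref_nth[OF g(1)])
    then show ?thesis using tr[OF g(1)] g by (simp add: kappaLref_transpose U_def)
  next
    case False
    then show ?thesis by (simp add: other kappaLref_def)
  qed
  then show ?thesis by blast
qed

text \<open>
  Off the identity, \<open>\<kappa>\<^sup>C\<close> and \<open>kappaC3cyc\<close> have the same right-hand side in (iii), so their difference
  \<open>\<kappa>D\<close> solves the homogeneous equation.
\<close>

theorem off_identity_maps:
  assumes n: "CARD('n::finite) \<ge> 3"
  shows "{(\<kappa>L, \<kappa>C). drinfeld_orbifold_map (Sn :: ('n \<Rightarrow> 'n) monoid) doubled_perm \<kappa>L \<kappa>C \<and> supported_only_off \<kappa>L {id}} = off_family"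
proof (intro equalityI subsetI)
  fix p :: "('n \<Rightarrow> 'n, 'n + 'n) lin_cochain \<times> ('n \<Rightarrow> 'n, 'n + 'n) const_cochain"
  assume "p \<in> {(\<kappa>L, \<kappa>C). drinfeld_orbifold_map (Sn :: ('n \<Rightarrow> 'n) monoid) doubled_perm \<kappa>L \<kappa>C \<and> supported_only_off \<kappa>L {id}}"
  then obtain \<kappa>L :: "('n \<Rightarrow> 'n, 'n + 'n) lin_cochain" and \<kappa>C :: "('n \<Rightarrow> 'n, 'n + 'n) const_cochain"
    where p: "p = (\<kappa>L, \<kappa>C)" and dr: "drinfeld_orbifold_map Sn doubled_perm \<kappa>L \<kappa>C" and off: "\<kappa>L id = (\<lambda>u v. 0)"
    by (auto simp: supported_only_off_def)
  have cL: "cochain Sn (*s) \<kappa>L" and cC: "cochain Sn (*) \<kappa>C"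
    and fxd: "\<And>g u v. bij g \<Longrightarrow> doubled_perm g (\<kappa>L g u v) = \<kappa>L g u v"
    and eqL: "\<And>g h u v. bij g \<Longrightarrow> bij h \<Longrightarrow> doubled_perm h (\<kappa>L g u v) = \<kappa>L (h \<circ> g \<circ> inv' h) (doubled_perm h u) (doubled_perm h v)"
    and eqC: "\<And>g h u v. bij g \<Longrightarrow> bij h \<Longrightarrow> \<kappa>C g u v = \<kappa>C (h \<circ> g \<circ> inv' h) (doubled_perm h u) (doubled_perm h v)"
    and two: "\<And>g x y z. bij g \<Longrightarrow> cyc (\<lambda>x y z. sym_emb (\<kappa>L g y z) * sym_emb (doubled_perm g x - x)) x y z = 0"
    and three: "\<And>g x y z. bij g \<Longrightarrow> cyc (\<lambda>u v w. \<Sum>y\<in>{y. bij y}. \<kappa>L (g \<circ> inv' y) (u + doubled_perm y u) (\<kappa>L y v w)) x y z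
          = 2 *s cyc (\<lambda>x y z. \<kappa>C g y z *s (doubled_perm g x - x)) x y z"
    and four: "\<And>g x y z. bij g \<Longrightarrow> cyc (\<lambda>u v w. \<Sum>y\<in>{y. bij y}. \<kappa>C (g \<circ> inv' y) (u + doubled_perm y u) (\<kappa>L y v w)) x y z = 0"
    using dr unfolding drinfeld_Sn_iff by blast+
  have "\<kappa>L g = (\<lambda>u v. 0)" if "\<not> is_transposition g" for g
  proof -
    consider "g = id" | "bij g" "g \<noteq> id" | "\<not> bij g" by blast
    then show ?thesis
    proof cases
      case 2
      then show ?thesis using linear_part_off_identity(1)[OF cochain_Sn_skew(1)[OF cL] _ _ fxd two] that by blast
    qed (use off cochain_Sn_skew(2)[OF cL] in auto)
  qed
  moreover have "\<kappa>L (tr r s) = (\<lambda>u v. omega r s u v *s \<kappa>L (tr r s) (xv r) (yv r))" if "r \<noteq> s" for r s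
  proof -
    have "tr r s \<noteq> id" using that by (metis is_transposition_transpose not_transposition_id)
    then show ?thesis
      by (rule linear_part_off_identity(2)[OF cochain_Sn_skew(1)[OF cL bij_tr] bij_tr _ fxd[OF bij_tr] two[OF bij_tr] that refl])
  qed
  ultimately obtain a a' b b' where L: "\<kappa>L = kappaLref a a' b b'"
    using linear_part_kappaLref[of \<kappa>L, OF n eqL] by blast
  define \<kappa>D where "\<kappa>D = (\<lambda>g u v. \<kappa>C g u v - kappaC3cyc a a' b b' g u v)"
  have "\<kappa>C id u v = \<kappa>C id (doubled_perm h u) (doubled_perm h v)" if "bij h" for h u v
    using eqC[OF bij_id that, of u v] conj_eq_id_iff[OF that, of id] by simp
  then obtain \<alpha> \<beta> where C1: "\<kappa>C id = kappaC1 \<alpha> \<beta> id"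
    using invariant_form[OF n cochain_Sn_skew(1)[OF cC bij_id]] by blast
  have "\<exists>c. \<forall>g. bij g \<longrightarrow> g \<noteq> id \<longrightarrow> \<kappa>D g = kappaCref c g"
  proof (rule constant_part_kappaCref[OF n])
    fix g :: "'n \<Rightarrow> 'n" assume g: "bij g"
    show "skew_bilinear (*) (\<kappa>D g)"
      unfolding \<kappa>D_def by (rule skew_bilinear_diff[OF cochain_Sn_skew(1)[OF cC g] kappaC3cyc_skew])
    fix x y z
    have "2 *s cyc (\<lambda>x y z. \<kappa>C g y z *s (doubled_perm g x - x)) x y z
        = 2 *s cyc (\<lambda>x y z. kappaC3cyc a a' b b' g y z *s (doubled_perm g x - x)) x y z"
      using three[OF g, of x y z] unfolding L kappaLref_quadratic by (rule sym)
    then have "cyc (\<lambda>x y z. \<kappa>C g y z *s (doubled_perm g x - x)) x y z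
        = cyc (\<lambda>x y z. kappaC3cyc a a' b b' g y z *s (doubled_perm g x - x)) x y z"
      by (simp only: vec.scale_cancel_left) simp
    then show "cyc (\<lambda>x y z. \<kappa>D g y z *s (doubled_perm g x - x)) x y z = 0"
      unfolding \<kappa>D_def vec.scale_left_diff_distrib by (simp add: cyc_def algebra_simps)
  next
    fix g h :: "'n \<Rightarrow> 'n" and u v assume gh: "bij g" "bij h"
    show "\<kappa>D g u v = \<kappa>D (h \<circ> g \<circ> inv' h) (doubled_perm h u) (doubled_perm h v)"
      unfolding \<kappa>D_def using eqC[OF gh, of u v] kappaC3cyc_invariant[OF gh(2), of a a' b b' g u v] by simp
  qed
  then obtain c where c: "\<And>g. bij g \<Longrightarrow> g \<noteq> id \<Longrightarrow> \<kappa>D g = kappaCref c g" by blast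
  have C: "\<kappa>C = (\<lambda>g u v. kappaC1 \<alpha> \<beta> g u v + kappaCref c g u v + kappaC3cyc a a' b b' g u v)"
  proof (intro ext)
    fix g :: "'n \<Rightarrow> 'n" and u v
    consider "g = id" | "bij g" "g \<noteq> id" | "\<not> bij g" by blast
    then show "\<kappa>C g u v = kappaC1 \<alpha> \<beta> g u v + kappaCref c g u v + kappaC3cyc a a' b b' g u v"
    proof cases
      case 1
      then show ?thesis using C1 by (simp add: kappaCref_def kappaC3cyc_def)
    next
      case 2
      then have "\<kappa>D g u v = kappaCref c g u v" using c by simp
      then show ?thesis using 2 by (simp add: \<kappa>D_def kappaC1_def algebra_simps)
    next
      case 3
      then have "g \<noteq> id" "\<not> is_transposition g" "\<not> is_3cycle g"
        using bij_if_transposition bij_if_3cycle bij_id by blast+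
      then show ?thesis using cochain_Sn_skew(2)[OF cC 3] by (simp add: kappaC1_def kappaCref_def kappaC3cyc_def)
    qed
  qed
  have "off_equations (of_nat CARD('n)) a a' b b' \<alpha> \<beta>"
    unfolding constant_condition_iff[OF n, symmetric]
  proof (intro allI impI)
    fix g :: "'n \<Rightarrow> 'n" and x y z assume g: "bij g"
    show "cyc (\<lambda>u v w. kappaC1 \<alpha> \<beta> id (u + doubled_perm g u) (kappaLref a a' b b' g v w)) x y z = 0"
      using four[OF g, of x y z] unfolding C L constant_condition_reduction[OF g] .
  qed
  then show "p \<in> off_family" unfolding p C L off_family_def off_equations_def by blast
next
  fix p :: "('n \<Rightarrow> 'n, 'n + 'n) lin_cochain \<times> ('n \<Rightarrow> 'n, 'n + 'n) const_cochain"
  assume "p \<in> off_family"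
  then obtain a a' b b' \<alpha> \<beta> c where
    p: "p = (kappaLref a a' b b', \<lambda>g u v. kappaC1 \<alpha> \<beta> g u v + kappaCref c g u v + kappaC3cyc a a' b b' g u v)"
    and E: "off_equations (of_nat CARD('n)) a a' b b' \<alpha> \<beta>"
    unfolding off_family_def off_equations_def by blast
  let ?C = "\<lambda>(g :: 'n \<Rightarrow> 'n) u v. kappaC1 \<alpha> \<beta> g u v + kappaCref c g u v + kappaC3cyc a a' b b' g u v :: complex"
  have nbij: "g \<noteq> id" "\<not> is_transposition g" "\<not> is_3cycle g" if "\<not> bij g" for g :: "'n \<Rightarrow> 'n"
    using that bij_if_transposition bij_if_3cycle bij_id by blast+
  have cL: "cochain Sn (*s) (kappaLref a a' b b' :: ('n \<Rightarrow> 'n, 'n + 'n) lin_cochain)"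
    using nbij(2) by (simp add: cochain_def carrier_Sn kappaLref_skew) (simp add: kappaLref_def)
  have skew: "skew_bilinear (*) (?C g)" for g :: "'n \<Rightarrow> 'n"
    by (intro skew_bilinear_add kappaC1_skew kappaCref_props(1) kappaC3cyc_skew)
  have cC: "cochain Sn (*) ?C"
    unfolding cochain_def carrier_Sn
    using skew nbij by (simp add: kappaC1_def kappaCref_def kappaC3cyc_def)
  have inv: "?C g u v = ?C (h \<circ> g \<circ> inv' h) (doubled_perm h u) (doubled_perm h v)" if "bij g" "bij h" for g h u v
    using kappaC1_invariant_all[OF that(2), of \<alpha> \<beta> g u v] kappaCref_props(2)[OF that, of c u v]
      kappaC3cyc_invariant[OF that(2), of a a' b b' g u v] by simp
  have three: "cyc (\<lambda>x y z. ?C g y z *s (doubled_perm g x - x)) x y z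
     = cyc (\<lambda>x y z. kappaC3cyc a a' b b' g y z *s (doubled_perm g x - x)) x y z" for g :: "'n \<Rightarrow> 'n" and x y z
  proof -
    have "cyc (\<lambda>x y z. kappaC1 \<alpha> \<beta> g y z *s (doubled_perm g x - x)) x y z = 0"
      by (cases "g = id") (simp_all add: doubled_perm_id kappaC1_def cyc_def)
    then show ?thesis
      by (simp only: vec.scale_left_distrib cyc_add kappaCref_props(3)) simp
  qed
  have four: "cyc (\<lambda>u v w. \<Sum>y\<in>{y. bij y}. ?C (g \<circ> inv' y) (u + doubled_perm y u) (kappaLref a a' b b' y v w)) x y z = 0"
    if "bij g" for g :: "'n \<Rightarrow> 'n" and x y z
    using constant_condition_iff[OF n, THEN iffD2, OF E] that unfolding constant_condition_reduction[OF that] by blast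
  have "drinfeld_orbifold_map Sn doubled_perm (kappaLref a a' b b') ?C"
    unfolding drinfeld_Sn_iff three
    by (intro conjI allI impI cL cC kappaLref_fixed kappaLref_equivariant inv kappaLref_symmetric_condition kappaLref_quadratic four)
  moreover have "supported_only_off (kappaLref a a' b b') {id :: 'n \<Rightarrow> 'n}"
    by (simp add: supported_only_off_def kappaLref_def)
  ultimately show "p \<in> {(\<kappa>L, \<kappa>C). drinfeld_orbifold_map (Sn :: ('n \<Rightarrow> 'n) monoid) doubled_perm \<kappa>L \<kappa>C \<and> supported_only_off \<kappa>L {id}}"
    by (simp add: p)
qed

text \<open>
  A degree-one deformation is the same as a Drinfeld orbifold algebra map with nonzero linear part,
  since every such map yields an algebra of Poincare-Birkhoff-Witt type.
\<close>

theorem theorem1p1: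
  assumes "CARD('n::finite) \<ge> 3"
  shows
    "{(\<kappa>L, \<kappa>C). lie_orbifold_map (Sn :: ('n \<Rightarrow> 'n) monoid) doubled_perm \<kappa>L \<kappa>C} = lie_family
     \<and> (\<forall>(\<kappa>L, \<kappa>C) \<in> lie_family.
          lie_orbifold_algebra (Sn :: ('n \<Rightarrow> 'n) monoid) doubled_perm \<kappa>L \<kappa>C)
     \<and> {(\<kappa>L, \<kappa>C). drinfeld_orbifold_map (Sn :: ('n \<Rightarrow> 'n) monoid) doubled_perm \<kappa>L \<kappa>C
            \<and> supported_only_off \<kappa>L {\<one>\<^bsub>Sn\<^esub>}} = off_family
     \<and> (\<forall>(\<kappa>L, \<kappa>C) \<in> off_family.
          drinfeld_orbifold_algebra (Sn :: ('n \<Rightarrow> 'n) monoid) doubled_perm \<kappa>L \<kappa>C)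
     \<and> {(\<kappa>L, \<kappa>C). degree_one_deformation (Sn :: ('n \<Rightarrow> 'n) monoid) doubled_perm \<kappa>L \<kappa>C
            \<and> (supported_only_on \<kappa>L {\<one>\<^bsub>Sn\<^esub>} \<or> supported_only_off \<kappa>L {\<one>\<^bsub>Sn\<^esub>})}
       = {(\<kappa>L, \<kappa>C) \<in> lie_family \<union> off_family. \<kappa>L \<noteq> (\<lambda>g u v. 0)}"
proof -
  note lie = lie_orbifold_maps[OF assms] and off = off_identity_maps[OF assms]
  have pbw: "drinfeld_orbifold_algebra Sn doubled_perm \<kappa>L \<kappa>C"
    if "drinfeld_orbifold_map Sn doubled_perm \<kappa>L \<kappa>C"
    for \<kappa>L :: "('n \<Rightarrow> 'n, 'n + 'n) lin_cochain" and \<kappa>C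
    by (rule drinfeld_data.drinfeld_orbifold_algebra[OF drinfeld_data.intro[OF finite_rep_Sn drinfeld_data_axioms.intro[OF that]]])
  have deg: "degree_one_deformation Sn doubled_perm \<kappa>L \<kappa>C \<longleftrightarrow>
      drinfeld_orbifold_map Sn doubled_perm \<kappa>L \<kappa>C \<and> \<kappa>L \<noteq> (\<lambda>g u v. 0)"
    for \<kappa>L :: "('n \<Rightarrow> 'n, 'n + 'n) lin_cochain" and \<kappa>C
    unfolding degree_one_deformation_def using pbw by blast
  have in_lie: "(\<kappa>L, \<kappa>C) \<in> lie_family \<longleftrightarrow> lie_orbifold_map (Sn :: ('n \<Rightarrow> 'n) monoid) doubled_perm \<kappa>L \<kappa>C" for \<kappa>L \<kappa>C
    unfolding lie[symmetric] by simp
  have in_off: "(\<kappa>L, \<kappa>C) \<in> off_family \<longleftrightarrow>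
      drinfeld_orbifold_map (Sn :: ('n \<Rightarrow> 'n) monoid) doubled_perm \<kappa>L \<kappa>C \<and> supported_only_off \<kappa>L {\<one>\<^bsub>Sn\<^esub>}" for \<kappa>L \<kappa>C
    unfolding off[symmetric] by (simp add: one_Sn)
  have map_if_lie: "lie_orbifold_map (Sn :: ('n \<Rightarrow> 'n) monoid) doubled_perm \<kappa>L \<kappa>C \<longleftrightarrow>
      drinfeld_orbifold_map Sn doubled_perm \<kappa>L \<kappa>C \<and> supported_only_on \<kappa>L {\<one>\<^bsub>Sn\<^esub>}" for \<kappa>L \<kappa>C
    by (rule lie_orbifold_map_def)
  show ?thesis
  proof (intro conjI lie)
    show "\<forall>(\<kappa>L, \<kappa>C) \<in> lie_family. lie_orbifold_algebra (Sn :: ('n \<Rightarrow> 'n) monoid) doubled_perm \<kappa>L \<kappa>C"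
      using pbw by (auto simp: in_lie lie_orbifold_algebra_def map_if_lie)
    show "{(\<kappa>L, \<kappa>C). drinfeld_orbifold_map (Sn :: ('n \<Rightarrow> 'n) monoid) doubled_perm \<kappa>L \<kappa>C
        \<and> supported_only_off \<kappa>L {\<one>\<^bsub>Sn\<^esub>}} = off_family"
      by (auto simp: in_off)
    show "\<forall>(\<kappa>L, \<kappa>C) \<in> off_family. drinfeld_orbifold_algebra (Sn :: ('n \<Rightarrow> 'n) monoid) doubled_perm \<kappa>L \<kappa>C"
      using pbw by (auto simp: in_off)
    show "{(\<kappa>L, \<kappa>C). degree_one_deformation (Sn :: ('n \<Rightarrow> 'n) monoid) doubled_perm \<kappa>L \<kappa>C
            \<and> (supported_only_on \<kappa>L {\<one>\<^bsub>Sn\<^esub>} \<or> supported_only_off \<kappa>L {\<one>\<^bsub>Sn\<^esub>})}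
       = {(\<kappa>L, \<kappa>C) \<in> lie_family \<union> off_family. \<kappa>L \<noteq> (\<lambda>g u v. 0)}"
      unfolding deg by (auto simp: in_lie in_off map_if_lie)
  qed
qed

end
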